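(* Let $\mathcal{C}$ be a graph class of structurally bounded expansion. Then $\mathcal{C}$ is strongly flip-flat if and only if there exist a graph class $\mathcal{D}$ of bounded expansion that is uniformly almost-wide and a transduction $\tau$ such that $\mathcal{C}\subseteq\tau(\mathcal{D})$.
   Context: Graphs are finite simple undirected. A graph $H$ is a depth-$r$ shallow minor of $G$ if there are pairwise disjoint connected subgraphs $C_v$ ($v\in V(H)$) of $G$, each of radius at most $r$, such that $uv\in E(H)$ only if some edge of $G$ joins $C_u$ and $C_v$. A class $\mathcal{D}$ has bounded expansion if there is $f:\mathbb{N}\to\mathbb{N}$ such that for every $r$ and every depth-$r$ shallow minor $H$ of a graph in $\mathcal{D}$, $|E(H)|/|V(H)|\le f(r)$. Transductions: for $c\in\mathbb{N}$ and first-order formulas $\delta(x),\varphi(x,y)$ over the signature $\{E,C_1,\dots,C_c\}$ ($E$ the edge relation, $C_i$ unary predicates), the transduction $T_{\delta,\varphi}$ maps a graph $G$ to the set of graphs $H$ for which there is an expansion $G^+$ of $G$ (an arbitrary interpretation of $C_1,\dots,C_c$ on $V(G)$) with $V(H)=\{v: G^+\models\delta(v)\}$ and $E(H)=\{uv: u\ne v\in V(H),\ G^+\models\varphi(u,v)\vee\varphi(v,u)\}$; $T_{\delta,\varphi}(\mathcal{D})=\bigcup_{G\in\mathcal{D}}T_{\delta,\varphi}(G)$. A class $\mathcal{C}$ is of structurally bounded expansion if $\mathcal{C}\subseteq T(\mathcal{D})$ for some transduction $T$ and some class $\mathcal{D}$ of bounded expansion. $B\subseteq V(G)$ is $r$-independent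 in $G$ if its distinct vertices are pairwise at distance $>r$. A flip is a pair $(A,B)$ of vertex subsets; $G\oplus(A,B)$ has edge set $E(G)\,\Delta\,((A\times B)\cup(B\times A))$, and $G\oplus\{F_1,\dots,F_k\}=G\oplus F_1\oplus\cdots\oplus F_k$. $\mathcal{C}$ is strongly flip-flat if there is an integer $s$ such that for every $r\in\mathbb{N}$ there is $N_r:\mathbb{N}\to\mathbb{N}$ such that for all $m$, all $G\in\mathcal{C}$ and all $A\subseteq V(G)$ with $|A|\ge N_r(m)$ there are a set of at most $s$ flips $\mathcal{F}$ and $B\subseteq A$, $|B|\ge m$, $r$-independent in $G\oplus\mathcal{F}$. $\mathcal{D}$ is uniformly almost-wide if there is an integer $s$ such that for every $r$ there is $N_r:\mathbb{N}\to\mathbb{N}$ such that for all $m$, all $G\in\mathcal{D}$ and all $A\subseteq V(G)$ with $|A|\ge N_r(m)$ there are $S\subseteq V(G)$, $|S|\le s$, and $B\subseteq A\setminus S$, $|B|>m$, $r$-independent in $G\setminus S$ (the subgraph induced by $V(G)\setminus S$). *)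

theory Defs
  imports "Graph_Theory.Graph_Theory" "HOL-Library.Infinite_Typeclass"
begin

text \<open>
  A finite simple undirected graph is a \<^const>\<open>pair_graph\<close>: finitely many vertices and a
  symmetric irreflexive set of arcs, so each undirected edge is present as two arcs.
  A graph class is a set of such graphs over one vertex type; when that type is infinite, it
  contains a copy of every finite graph.
\<close>

definition graph_class :: "'a pair_pre_digraph set \<Rightarrow> bool" where
  "graph_class \<C> \<longleftrightarrow> (\<forall>G\<in>\<C>. pair_graph G)"

definition edges :: "'a pair_pre_digraph \<Rightarrow> 'a set set" where
  "edges G = (\<lambda>(u, v). {u, v}) ` parcs G"

text \<open>The distance is \<open>\<infinity>\<close> between vertices in different components.\<close>

definition gdist :: "('a, 'b) pre_digraph \<Rightarrow> 'a \<Rightarrow> 'a \<Rightarrow> ereal" where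
  "gdist G = wf_digraph.\<mu> G (\<lambda>_. 1)"

definition radius :: "('a, 'b) pre_digraph \<Rightarrow> ereal" where
  "radius G = (INF c\<in>verts G. SUP v\<in>verts G. gdist G c v)"

definition r_independent :: "nat \<Rightarrow> ('a, 'b) pre_digraph \<Rightarrow> 'a set \<Rightarrow> bool" where
  "r_independent r G B \<longleftrightarrow>
     B \<subseteq> verts G \<and> (\<forall>u\<in>B. \<forall>v\<in>B. u \<noteq> v \<longrightarrow> ereal (real r) < gdist G u v)"


subsection \<open>Bounded expansion\<close>

text \<open>
  The branch sets are nonempty and disjoint, so a minor of \<open>G\<close> has at most as many vertices
  as \<open>G\<close>; taking \<open>H\<close> over the same vertex type therefore loses nothing up to isomorphism.
  Note that \<^const>\<open>connected\<close> includes nonemptiness.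
\<close>

definition shallow_minor ::
  "nat \<Rightarrow> 'a pair_pre_digraph \<Rightarrow> 'a pair_pre_digraph \<Rightarrow> bool" where
  "shallow_minor r H G \<longleftrightarrow> pair_graph H \<and>
     (\<exists>C :: 'a \<Rightarrow> 'a pair_pre_digraph.
        (\<forall>v\<in>pverts H. pair_graph (C v) \<and> subgraph (C v) G \<and> connected (C v) \<and>
           radius (C v) \<le> ereal (real r)) \<and>
        (\<forall>u\<in>pverts H. \<forall>v\<in>pverts H. u \<noteq> v \<longrightarrow> pverts (C u) \<inter> pverts (C v) = {}) \<and>
        (\<forall>(u, v)\<in>parcs H. \<exists>x\<in>pverts (C u). \<exists>y\<in>pverts (C v). (x, y) \<in> parcs G))"

definition bounded_expansion :: "'a pair_pre_digraph set \<Rightarrow> bool" where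
  "bounded_expansion \<D> \<longleftrightarrow>
     (\<exists>f :: nat \<Rightarrow> nat. \<forall>r. \<forall>G\<in>\<D>. \<forall>H. shallow_minor r H G \<longrightarrow>
        real (card (edges H)) / real (card (pverts H)) \<le> real (f r))"


subsection \<open>First-order transductions\<close>

text \<open>Variables are natural numbers; \<open>Col i x\<close> is the atom $C_i(x)$.\<close>

datatype fo =
    Eq nat nat
  | Adj nat nat
  | Col nat nat
  | Neg fo
  | Conj fo fo
  | Disj fo fo
  | Ex nat fo
  | All nat fo

primrec fvars :: "fo \<Rightarrow> nat set" where
  "fvars (Eq x y) = {x, y}"
| "fvars (Adj x y) = {x, y}"
| "fvars (Col i x) = {x}"
| "fvars (Neg \<phi>) = fvars \<phi>"
| "fvars (Conj \<phi> \<psi>) = fvars \<phi> \<union> fvars \<psi>"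
| "fvars (Disj \<phi> \<psi>) = fvars \<phi> \<union> fvars \<psi>"
| "fvars (Ex x \<phi>) = fvars \<phi> - {x}"
| "fvars (All x \<phi>) = fvars \<phi> - {x}"

primrec colours :: "fo \<Rightarrow> nat set" where
  "colours (Eq x y) = {}"
| "colours (Adj x y) = {}"
| "colours (Col i x) = {i}"
| "colours (Neg \<phi>) = colours \<phi>"
| "colours (Conj \<phi> \<psi>) = colours \<phi> \<union> colours \<psi>"
| "colours (Disj \<phi> \<psi>) = colours \<phi> \<union> colours \<psi>"
| "colours (Ex x \<phi>) = colours \<phi>"
| "colours (All x \<phi>) = colours \<phi>"

primrec sat :: "'a pair_pre_digraph \<Rightarrow> (nat \<Rightarrow> 'a set) \<Rightarrow> (nat \<Rightarrow> 'a) \<Rightarrow> fo \<Rightarrow> bool" where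
  "sat G P \<sigma> (Eq x y) \<longleftrightarrow> \<sigma> x = \<sigma> y"
| "sat G P \<sigma> (Adj x y) \<longleftrightarrow> (\<sigma> x, \<sigma> y) \<in> parcs G"
| "sat G P \<sigma> (Col i x) \<longleftrightarrow> \<sigma> x \<in> P i"
| "sat G P \<sigma> (Neg \<phi>) \<longleftrightarrow> \<not> sat G P \<sigma> \<phi>"
| "sat G P \<sigma> (Conj \<phi> \<psi>) \<longleftrightarrow> sat G P \<sigma> \<phi> \<and> sat G P \<sigma> \<psi>"
| "sat G P \<sigma> (Disj \<phi> \<psi>) \<longleftrightarrow> sat G P \<sigma> \<phi> \<or> sat G P \<sigma> \<psi>"
| "sat G P \<sigma> (Ex x \<phi>) \<longleftrightarrow> (\<exists>a\<in>pverts G. sat G P (\<sigma>(x := a)) \<phi>)"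
| "sat G P \<sigma> (All x \<phi>) \<longleftrightarrow> (\<forall>a\<in>pverts G. sat G P (\<sigma>(x := a)) \<phi>)"

text \<open>
  In $\delta(x)$ the variable $x$ is 0; in $\varphi(x,y)$ the variables $x$, $y$ are 0 and 1.
\<close>

definition sat1 :: "'a pair_pre_digraph \<Rightarrow> (nat \<Rightarrow> 'a set) \<Rightarrow> fo \<Rightarrow> 'a \<Rightarrow> bool" where
  "sat1 G P \<delta> v \<longleftrightarrow> sat G P (\<lambda>_. v) \<delta>"

definition sat2 :: "'a pair_pre_digraph \<Rightarrow> (nat \<Rightarrow> 'a set) \<Rightarrow> fo \<Rightarrow> 'a \<Rightarrow> 'a \<Rightarrow> bool" where
  "sat2 G P \<phi> u v \<longleftrightarrow> sat G P ((\<lambda>_. v)(0 := u)) \<phi>"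

datatype transduction =
  Transduction (ncolours: nat) (vertex_formula: fo) (edge_formula: fo)

definition is_transduction :: "transduction \<Rightarrow> bool" where
  "is_transduction \<tau> \<longleftrightarrow>
     fvars (vertex_formula \<tau>) \<subseteq> {0} \<and> fvars (edge_formula \<tau>) \<subseteq> {0, 1} \<and>
     colours (vertex_formula \<tau>) \<subseteq> {1..ncolours \<tau>} \<and>
     colours (edge_formula \<tau>) \<subseteq> {1..ncolours \<tau>}"

definition interpreted_graph ::
  "transduction \<Rightarrow> 'a pair_pre_digraph \<Rightarrow> (nat \<Rightarrow> 'a set) \<Rightarrow> 'a pair_pre_digraph" where
  "interpreted_graph \<tau> G P =
     (let V = {v \<in> pverts G. sat1 G P (vertex_formula \<tau>) v} in
      \<lparr> pverts = V,
        parcs = {(u, v). u \<in> V \<and> v \<in> V \<and> u \<noteq> v \<and>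
                   (sat2 G P (edge_formula \<tau>) u v \<or> sat2 G P (edge_formula \<tau>) v u)} \<rparr>)"

definition transduce :: "transduction \<Rightarrow> 'a pair_pre_digraph \<Rightarrow> 'a pair_pre_digraph set" where
  "transduce \<tau> G =
     {interpreted_graph \<tau> G P | P. \<forall>i\<in>{1..ncolours \<tau>}. P i \<subseteq> pverts G}"

definition transduce_class ::
  "transduction \<Rightarrow> 'a pair_pre_digraph set \<Rightarrow> 'a pair_pre_digraph set" where
  "transduce_class \<tau> \<D> = (\<Union>G\<in>\<D>. transduce \<tau> G)"

definition structurally_bounded_expansion :: "'a pair_pre_digraph set \<Rightarrow> bool" where
  "structurally_bounded_expansion \<C> \<longleftrightarrow>
     (\<exists>\<tau> \<D>. is_transduction \<tau> \<and> graph_class \<D> \<and> bounded_expansion \<D> \<and>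
        \<C> \<subseteq> transduce_class \<tau> \<D>)"


subsection \<open>Flips, strong flip-flatness and uniform almost-wideness\<close>

text \<open>
  When \<open>A\<close> and \<open>B\<close> overlap, the symmetric difference creates loops at the vertices of
  \<open>A \<inter> B\<close>; these are dropped so that the result is again a simple graph.
\<close>

definition flip :: "'a set \<times> 'a set \<Rightarrow> 'a pair_pre_digraph \<Rightarrow> 'a pair_pre_digraph" where
  "flip F G = (case F of (A, B) \<Rightarrow>
     G\<lparr> parcs := sym_diff (parcs G) (A \<times> B \<union> B \<times> A) - Id \<rparr>)"

definition flips :: "('a set \<times> 'a set) set \<Rightarrow> 'a pair_pre_digraph \<Rightarrow> 'a pair_pre_digraph" where
  "flips \<F> G = Finite_Set.fold flip G \<F>"

text \<open>Flips commute, so the fold does not depend on the order.\<close>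

lemma comp_fun_commute_flip: "comp_fun_commute flip"
  by standard (auto simp: flip_def fun_eq_iff split: prod.splits intro!: pair_pre_digraph.equality)

lemma flips_empty: "flips {} G = G"
  by (simp add: flips_def)

lemma flips_insert:
  "finite \<F> \<Longrightarrow> F \<notin> \<F> \<Longrightarrow> flips (insert F \<F>) G = flip F (flips \<F> G)"
  using comp_fun_commute_on.fold_insert[OF comp_fun_commute_flip[unfolded comp_fun_commute_def'], of F \<F> G]
  by (simp add: flips_def)

definition strongly_flip_flat :: "'a pair_pre_digraph set \<Rightarrow> bool" where
  "strongly_flip_flat \<C> \<longleftrightarrow>
     (\<exists>s :: nat. \<forall>r :: nat. \<exists>N :: nat \<Rightarrow> nat. \<forall>m. \<forall>G\<in>\<C>. \<forall>A \<subseteq> pverts G. N m \<le> card A \<longrightarrow>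
        (\<exists>\<F> B. \<F> \<subseteq> Pow (pverts G) \<times> Pow (pverts G) \<and> card \<F> \<le> s \<and>
           B \<subseteq> A \<and> m \<le> card B \<and> r_independent r (flips \<F> G) B))"

definition uniformly_almost_wide :: "'a pair_pre_digraph set \<Rightarrow> bool" where
  "uniformly_almost_wide \<D> \<longleftrightarrow>
     (\<exists>s :: nat. \<forall>r :: nat. \<exists>N :: nat \<Rightarrow> nat. \<forall>m. \<forall>G\<in>\<D>. \<forall>A \<subseteq> pverts G. N m \<le> card A \<longrightarrow>
        (\<exists>S B. S \<subseteq> pverts G \<and> card S \<le> s \<and>
           B \<subseteq> A - S \<and> m < card B \<and> r_independent r (with_proj G \<restriction> (pverts G - S)) B))"

end

theory Submission
  imports Defs
begin

text \<open>
  In a class of bounded expansion the vertices of each graph can be ordered so that the sets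
  \<open>W x\<close> of vertices weakly reachable from \<open>x\<close> within a fixed distance (the hubs of \<open>x\<close>) have
  bounded size, and coloured so that each \<open>W x\<close> is rainbow. By a semantic quantifier elimination,
  the truth of a first-order formula depends only on bounded labels of the vertices and on the
  colours of the hubs that they share.

  If \<open>\<C>\<close> is transduced from an almost-wide class, apply this after isolating the separator \<open>S\<close>, whose
  edges are absorbed into the labels. Flipping the pairs of labels that are adjacent without a shared
  hub leaves only edges between vertices at bounded distance in \<open>G - S\<close>, so sets scattered in
  \<open>G - S\<close> remain scattered.

  Conversely, for \<open>H\<close> in \<open>\<C>\<close> and each pair of labels, the shared hubs are organised in a forest of
  bounded height, and adjacency becomes a function of the depth of a meet. Complementing such a graph
  inside its connected components, it becomes edgeless after boundedly many rounds. Adding to \<open>V(H)\<close> a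
  vertex for every component of every round, adjacent to the members of the component, gives a
  graph \<open>G'\<close> that encodes \<open>H\<close>. Its adjacencies are local in the original sparse graph up to
  boundedly many apices, so the graphs \<open>G'\<close> have bounded expansion. If few flips scatter a set in
  \<open>H\<close>, all but boundedly many components have bounded diameter in the flipped graph, so deleting the
  vertices of the exceptional ones scatters the set in \<open>G'\<close>.
\<close>

section \<open>Walks and weak reachability\<close>

text \<open>The obstacle in the converse is that flip-flatness speaks about distances in
  \<open>H\<close> only. Adding the shared hubs themselves to \<open>H\<close> would be a sparse
  encoding too, but a hub need not leave a trace in \<open>H\<close>, so scattering a set there says
  nothing about walks through the hub. A component of a round is visible in \<open>H\<close>: its
  vertices are joined by at most five edges of the round, and by parity these are either all edges
  or all non-edges of \<open>H\<close>. Flips can leave the ends of such an edge more than three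
  steps apart in at most two sibling components per pair of flip classes, which is where the
  exceptional components and the constant 15 = 5 * 3 come from. The rounds end because each one
  pushes the meets of the components strictly deeper into the forest. The meet of a component is a
  forest node, which gives the added vertex its place in the sparse graph; a component whose members
  share no node becomes an apex. The constants are fixed in the order formula, range, number of
  hubs, number of labels: the range of the hubs must not depend on the order of the vertices, which
  is chosen for that range.\<close>

definition near :: "('b \<times> 'b) set \<Rightarrow> nat \<Rightarrow> ('b \<times> 'b) set" where
  "near R n = (\<Union>m\<le>n. R ^^ m)"

lemma near_iff: "(x, y) \<in> near R n \<longleftrightarrow> (\<exists>m\<le>n. (x, y) \<in> R ^^ m)"
  by (auto simp: near_def)

lemma near_refl [simp]: "(x, x) \<in> near R n"
  by (auto simp: near_iff intro!: exI[of _ 0])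

lemma near_0 [simp]: "near R 0 = Id"
  by (auto simp: near_def)

lemma near_1: "(x, y) \<in> R \<Longrightarrow> 1 \<le> n \<Longrightarrow> (x, y) \<in> near R n"
  by (auto simp: near_iff intro!: exI[of _ 1])

lemma near_trans: "(x, y) \<in> near R m \<Longrightarrow> (y, z) \<in> near R n \<Longrightarrow> (x, z) \<in> near R (m + n)"
  unfolding near_iff by (metis add_mono relcompI relpow_add)

lemma relpow_mono':
  fixes R R' :: "('b \<times> 'b) set"
  shows "R \<subseteq> R' \<Longrightarrow> R ^^ n \<subseteq> R' ^^ n"
  by (induction n) auto

lemma near_mono: "(x, y) \<in> near R m \<Longrightarrow> R \<subseteq> R' \<Longrightarrow> m \<le> n \<Longrightarrow> (x, y) \<in> near R' n"
  unfolding near_iff by (meson order_trans relpow_mono' subsetD)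

lemma relpow_sym: "sym R \<Longrightarrow> (x, y) \<in> R ^^ n \<Longrightarrow> (y, x) \<in> R ^^ n"
proof (induction n arbitrary: y)
  case (Suc n)
  then obtain z where "(x, z) \<in> R ^^ n" "(z, y) \<in> R" by auto
  with Suc show ?case by (meson relpow_Suc_I2 symD)
qed simp

lemma near_sym: "sym R \<Longrightarrow> (x, y) \<in> near R n \<Longrightarrow> (y, x) \<in> near R n"
  unfolding near_iff by (meson relpow_sym)

lemma near_Suc_iff:
  "(x, y) \<in> near R (Suc n) \<longleftrightarrow> x = y \<or> (\<exists>z. (x, z) \<in> R \<and> (z, y) \<in> near R n)"
proof
  assume "(x, y) \<in> near R (Suc n)"
  then obtain m where m: "m \<le> Suc n" "(x, y) \<in> R ^^ m" by (auto simp: near_iff)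
  then show "x = y \<or> (\<exists>z. (x, z) \<in> R \<and> (z, y) \<in> near R n)"
    by (cases m) (auto simp: near_iff simp del: relpow.simps(2) dest!: relpow_Suc_D2)
next
  assume "x = y \<or> (\<exists>z. (x, z) \<in> R \<and> (z, y) \<in> near R n)"
  then show "(x, y) \<in> near R (Suc n)"
    using near_trans[OF near_1[of x _ R 1]] by auto
qed

lemma near_Suc_iff2:
  "(x, y) \<in> near R (Suc n) \<longleftrightarrow> x = y \<or> (\<exists>z. (x, z) \<in> near R n \<and> (z, y) \<in> R)"
proof
  assume "(x, y) \<in> near R (Suc n)"
  then obtain m where m: "m \<le> Suc n" "(x, y) \<in> R ^^ m" by (auto simp: near_iff)
  then show "x = y \<or> (\<exists>z. (x, z) \<in> near R n \<and> (z, y) \<in> R)"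
    by (cases m) (auto simp: near_iff)
next
  assume "x = y \<or> (\<exists>z. (x, z) \<in> near R n \<and> (z, y) \<in> R)"
  then show "(x, y) \<in> near R (Suc n)"
    using near_trans[OF _ near_1[of _ y R 1]] by fastforce
qed

lemma near_le_mult:
  assumes "(x, y) \<in> near R n" and step: "\<And>a b. (a, b) \<in> R \<Longrightarrow> (a, b) \<in> near R' c"
  shows "(x, y) \<in> near R' (n * c)"
  using assms(1)
proof (induction n arbitrary: y)
  case (Suc n)
  then show ?case
    using near_trans[OF Suc.IH step] by (fastforce simp: near_Suc_iff2 add.commute)
qed simp

lemma near_in: "(x, y) \<in> near R n \<Longrightarrow> R \<subseteq> X \<times> X \<Longrightarrow> x \<in> X \<Longrightarrow> y \<in> X"
  by (cases n) (auto simp: near_Suc_iff2)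

abbreviation restr :: "('b \<times> 'b) set \<Rightarrow> 'b set \<Rightarrow> ('b \<times> 'b) set" where
  "restr R X \<equiv> R \<inter> X \<times> X"

lemma sym_restr: "sym R \<Longrightarrow> sym (restr R X)"
  by (auto simp: sym_def)

text \<open>These are the weak reachability sets of the generalised colouring numbers:
  \<open>u\<close> is a \<open>\<rho>\<close>-least vertex of a walk of length at most
  \<open>n\<close> that starts at \<open>x\<close>. Restricting the relation, instead of quantifying
  over walks, lets \<open>near\<close> carry all arguments about walks.\<close>

definition wreach :: "('b \<times> 'b) set \<Rightarrow> ('b \<Rightarrow> nat) \<Rightarrow> nat \<Rightarrow> 'b \<Rightarrow> 'b set" where
  "wreach R \<rho> n x = {u. (x, u) \<in> near (restr R {a. \<rho> u \<le> \<rho> a}) n}"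

lemma wreach_self [simp]: "x \<in> wreach R \<rho> n x"
  by (simp add: wreach_def)

lemma wreach_0 [simp]: "wreach R \<rho> 0 x = {x}"
  by (auto simp: wreach_def)

lemma wreach_le: "u \<in> wreach R \<rho> n x \<Longrightarrow> \<rho> u \<le> \<rho> x"
  by (cases n) (auto simp: wreach_def near_Suc_iff)

lemma wreach_mono: "R \<subseteq> R' \<Longrightarrow> m \<le> n \<Longrightarrow> wreach R \<rho> m x \<subseteq> wreach R' \<rho> n x"
  unfolding wreach_def by (auto elim!: near_mono[of _ _ "restr R X" for X])

lemma wreach_subset: "R \<subseteq> V \<times> V \<Longrightarrow> x \<in> V \<Longrightarrow> wreach R \<rho> n x \<subseteq> V"
  unfolding wreach_def by (auto elim!: near_in)

lemma wreach_near: "u \<in> wreach R \<rho> n x \<Longrightarrow> (x, u) \<in> near R n"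
  unfolding wreach_def using near_mono[OF _ Int_lower1 order_refl] by fastforce

lemma restr_up_mono:
  fixes \<rho> :: "'b \<Rightarrow> nat"
  shows "\<rho> w \<le> \<rho> u \<Longrightarrow> restr R {a. \<rho> u \<le> \<rho> a} \<subseteq> restr R {a. \<rho> w \<le> \<rho> a}"
  by auto

lemma wreach_trans:
  assumes "u \<in> wreach R \<rho> m x" "w \<in> wreach R \<rho> n u"
  shows "w \<in> wreach R \<rho> (m + n) x"
proof -
  have "(x, u) \<in> near (restr R {a. \<rho> w \<le> \<rho> a}) m"
    using assms(1) near_mono[OF _ restr_up_mono[where \<rho> = \<rho>, OF wreach_le[OF assms(2)]] order_refl]
    by (auto simp: wreach_def)
  with assms(2) show ?thesis by (auto simp: wreach_def intro: near_trans)
qed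

text \<open>Walk back from \<open>u\<close> to \<open>x\<close> and on to \<open>w\<close>: the
  first half stays above \<open>u\<close>, hence above \<open>w\<close>. So among the hubs of one
  vertex the lower is always a hub of the higher.\<close>

lemma wreach_common:
  assumes "sym R" "u \<in> wreach R \<rho> m x" "w \<in> wreach R \<rho> n x" "\<rho> w \<le> \<rho> u"
  shows "w \<in> wreach R \<rho> (m + n) u"
proof -
  have "(x, u) \<in> near (restr R {a. \<rho> w \<le> \<rho> a}) m"
    using assms(2) near_mono[OF _ restr_up_mono[where \<rho> = \<rho>, OF assms(4)] order_refl]
    by (auto simp: wreach_def)
  then have "(u, x) \<in> near (restr R {a. \<rho> w \<le> \<rho> a}) m"
    by (rule near_sym[OF sym_restr[OF assms(1)]])
  with assms(3) show ?thesis by (auto simp: wreach_def intro: near_trans)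
qed

lemma wreach_edge: "(x, y) \<in> R \<Longrightarrow> \<rho> y \<le> \<rho> x \<Longrightarrow> 1 \<le> n \<Longrightarrow> y \<in> wreach R \<rho> n x"
  by (auto simp: wreach_def intro: near_1)

text \<open>Every suffix of a walk that witnesses \<open>u\<close> as a hub is again such a witness,
  so the walk never leaves the cluster of \<open>u\<close>. Clusters are thus connected with radius
  at most \<open>n\<close>, which lets them serve as pieces of branch sets.\<close>

lemma wreach_cluster:
  assumes "u \<in> wreach R \<rho> n w"
  shows "(w, u) \<in> near (restr R {w. u \<in> wreach R \<rho> n w}) n"
proof -
  let ?X = "{w. u \<in> wreach R \<rho> n w}" and ?U = "restr R {a. \<rho> u \<le> \<rho> a}"
  have "(w, u) \<in> near (restr R ?X) m" if "(w, u) \<in> near ?U m" "m \<le> n" for m w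
    using that
  proof (induction m arbitrary: w)
    case (Suc m)
    show ?case
    proof (cases "w = u")
      case False
      then obtain z where z: "(w, z) \<in> ?U" "(z, u) \<in> near ?U m"
        using Suc.prems(1) by (auto simp: near_Suc_iff)
      have "w \<in> ?X" "z \<in> ?X"
        using Suc.prems near_mono[OF z(2) order_refl, of n] near_mono[OF Suc.prems(1) order_refl, of n]
        by (auto simp: wreach_def)
      then show ?thesis using Suc z by (auto simp: near_Suc_iff)
    qed simp
  qed simp
  then show ?thesis using assms by (auto simp: wreach_def)
qed

text \<open>Greedy colouring upwards along \<open>\<rho>\<close>. The highest vertex is coloured
  last: no lower vertex weakly reaches it, and it has fewer than \<open>k\<close> hubs besides
  itself whose colours it must avoid.\<close>

lemma ex_colouring:
  assumes "finite V" "inj_on \<rho> V" "R \<subseteq> V \<times> V" "\<And>x. x \<in> V \<Longrightarrow> card (wreach R \<rho> n x) \<le> k"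
  shows "\<exists>\<chi>. (\<forall>x\<in>V. \<chi> x < k) \<and> (\<forall>x\<in>V. \<forall>u\<in>wreach R \<rho> n x. u \<noteq> x \<longrightarrow> \<chi> u \<noteq> \<chi> x)"
proof -
  have "\<exists>\<chi>. (\<forall>x\<in>X. \<chi> x < k) \<and> (\<forall>x\<in>X. \<forall>u\<in>wreach R \<rho> n x \<inter> X. u \<noteq> x \<longrightarrow> \<chi> u \<noteq> \<chi> x)"
    if "X \<subseteq> V" "card X = m" for m X
    using that
  proof (induction m arbitrary: X)
    case 0
    then have "X = {}" using assms(1) finite_subset by fastforce
    then show ?case by auto
  next
    case (Suc m)
    have fX: "finite X" and ne: "X \<noteq> {}" using Suc.prems assms(1) finite_subset by fastforce+
    have "Max (\<rho> ` X) \<in> \<rho> ` X" using fX ne by (intro Max_in) auto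
    then obtain y where y: "y \<in> X" "\<rho> y = Max (\<rho> ` X)" by auto
    then have y: "y \<in> X" "\<forall>x\<in>X. \<rho> x \<le> \<rho> y" using fX by auto
    obtain \<chi> where \<chi>: "\<forall>x\<in>X - {y}. \<chi> x < k"
      "\<forall>x\<in>X - {y}. \<forall>u\<in>wreach R \<rho> n x \<inter> (X - {y}). u \<noteq> x \<longrightarrow> \<chi> u \<noteq> \<chi> x"
      using Suc.IH[of "X - {y}"] Suc.prems y fX by (auto simp: card_Diff_singleton)
    have fw: "finite (wreach R \<rho> n y)"
      using wreach_subset[OF assms(3), of y \<rho> n] y Suc.prems by (meson finite_subset assms(1) subsetD)
    have "card (\<chi> ` (wreach R \<rho> n y - {y})) < k"
    proof -
      have "card (\<chi> ` (wreach R \<rho> n y - {y})) \<le> card (wreach R \<rho> n y - {y})"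
        using fw by (intro card_image_le) auto
      also have "\<dots> < card (wreach R \<rho> n y)" by (rule card_Diff1_less[OF fw wreach_self])
      also have "\<dots> \<le> k" using assms(4) y Suc.prems by auto
      finally show ?thesis .
    qed
    then have "\<not> {..<k} \<subseteq> \<chi> ` (wreach R \<rho> n y - {y})"
      using card_mono[of "\<chi> ` (wreach R \<rho> n y - {y})" "{..<k}"] fw by auto
    then obtain c where c: "c < k" "c \<notin> \<chi> ` (wreach R \<rho> n y - {y})" by auto
    have "\<rho> x < \<rho> y" if "x \<in> X" "x \<noteq> y" for x
      using that y assms(2) Suc.prems by (metis inj_onD le_neq_implies_less subsetD)
    then have "y \<notin> wreach R \<rho> n x" if "x \<in> X" "x \<noteq> y" for x
      using that wreach_le by (metis leD)
    then show ?case using \<chi> c y(1) by (intro exI[of _ "\<chi>(y := c)"]) auto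
  qed
  from this[of V] show ?thesis using wreach_subset[OF assms(3)] by (metis Int_absorb2 order_refl)
qed

text \<open>The range is doubled because, by \<open>wreach_common\<close>, one of two hubs at range
  \<open>n\<close> of the same vertex is a hub of the other at range \<open>2 * n\<close>.\<close>

lemma ex_wreach_colouring:
  assumes "finite V" "inj_on \<rho> V" "R \<subseteq> V \<times> V" "sym R"
    and "\<And>x. x \<in> V \<Longrightarrow> card (wreach R \<rho> (2 * n) x) \<le> k"
  shows "\<exists>\<chi>. (\<forall>x\<in>V. \<chi> x < k) \<and> (\<forall>x\<in>V. inj_on \<chi> (wreach R \<rho> n x))"
proof -
  obtain \<chi> where \<chi>: "\<forall>x\<in>V. \<chi> x < k"
      "\<forall>x\<in>V. \<forall>u\<in>wreach R \<rho> (2 * n) x. u \<noteq> x \<longrightarrow> \<chi> u \<noteq> \<chi> x"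
    using ex_colouring[OF assms(1-3,5)] by blast
  have "inj_on \<chi> (wreach R \<rho> n x)" if "x \<in> V" for x
  proof (rule inj_onI)
    fix u w assume u: "u \<in> wreach R \<rho> n x" "w \<in> wreach R \<rho> n x" "\<chi> u = \<chi> w"
    have "u \<in> V" "w \<in> V" using u wreach_subset[OF assms(3) that] by auto
    moreover have "u \<in> wreach R \<rho> (2 * n) w \<or> w \<in> wreach R \<rho> (2 * n) u"
      using u wreach_common[OF assms(4)] by (metis linear mult_2)
    ultimately show "u = w" using \<chi>(2) u(3) by metis
  qed
  with \<chi>(1) show ?thesis by blast
qed

text \<open>Labels are assembled below as tuples of finite data. This turns them into natural
  numbers whose bound depends on the set of possible tuples and not on the graph.\<close>

lemma ex_recode: "finite \<Lambda> \<Longrightarrow> \<exists>e :: 'b \<Rightarrow> nat. inj_on e \<Lambda> \<and> e ` \<Lambda> \<subseteq> {..<card \<Lambda>}"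
  by (metis ex_bij_betw_finite_nat bij_betw_def atLeast0LessThan order_refl)

lemma card_le_if_fibres_le:
  assumes "finite A" "f ` A \<subseteq> B" "finite B" "\<And>b. b \<in> B \<Longrightarrow> card {a \<in> A. f a = b} \<le> k"
  shows "card A \<le> k * card B"
proof -
  have "card A \<le> card (\<Union>b\<in>B. {a \<in> A. f a = b})"
    using assms(1-3) by (intro card_mono) auto
  also have "\<dots> \<le> (\<Sum>b\<in>B. card {a \<in> A. f a = b})" using assms(3) by (rule card_UN_le)
  also have "\<dots> \<le> (\<Sum>b\<in>B. k)" using assms(4) by (rule sum_mono)
  finally show ?thesis by (simp add: mult.commute)
qed

section \<open>Distances, minors and bounded expansion in terms of walks\<close>

lemma pair_graph_iff:
  "pair_graph G \<longleftrightarrow> finite (pverts G) \<and> parcs G \<subseteq> pverts G \<times> pverts G \<and> sym (parcs G) \<and> irrefl (parcs G)"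
proof
  assume "pair_graph G"
  then interpret pair_graph G .
  have "symmetric (with_proj G)" by (rule pair_sym_arcs)
  then have "sym (parcs G)" by (simp add: symmetric_def)
  moreover have "irrefl (parcs G)" using pair_no_loops by (force simp: irrefl_def)
  ultimately show "finite (pverts G) \<and> parcs G \<subseteq> pverts G \<times> pverts G \<and> sym (parcs G) \<and> irrefl (parcs G)"
    using pair_finite_verts arc_fst_in_verts arc_snd_in_verts by force
next
  assume a: "finite (pverts G) \<and> parcs G \<subseteq> pverts G \<times> pverts G \<and> sym (parcs G) \<and> irrefl (parcs G)"
  then have "finite (parcs G)" by (meson finite_SigmaI finite_subset)
  then show "pair_graph G"
    using a by unfold_locales (auto simp: symmetric_def irrefl_def)
qed

lemma less_gdist_iff:
  assumes wf: "parcs G \<subseteq> pverts G \<times> pverts G" and x: "x \<in> pverts G"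
  shows "ereal (real n) < gdist (with_proj G) x y \<longleftrightarrow> (x, y) \<notin> near (parcs G) n"
proof -
  interpret pair_wf_digraph G using wf by unfold_locales auto
  have len: "awalk_cost (\<lambda>_. 1) p = real (length p)" for p :: "('a \<times> 'a) list"
    by (induction p) auto
  have pow: "(\<exists>p. length p = m \<and> awalk x p y) \<longleftrightarrow> (x, y) \<in> parcs G ^^ m" if "x \<in> pverts G" for m x
    using that
  proof (induction m arbitrary: x)
    case 0
    then show ?case by (auto simp: awalk_def)
  next
    case (Suc m)
    show ?case
    proof
      assume "\<exists>p. length p = Suc m \<and> awalk x p y"
      then obtain e p where ep: "length p = m" "awalk x (e # p) y" by (metis length_Suc_conv)
      then have "(x, snd e) \<in> parcs G" "awalk (snd e) p y" "snd e \<in> pverts G"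
        using wf by (auto simp: awalk_Cons_iff)
      then show "(x, y) \<in> parcs G ^^ Suc m" using Suc.IH ep(1) by (blast intro: relpow_Suc_I2)
    next
      assume "(x, y) \<in> parcs G ^^ Suc m"
      then obtain z where z: "(x, z) \<in> parcs G" "(z, y) \<in> parcs G ^^ m" by (meson relpow_Suc_D2)
      then have "z \<in> pverts G" using wf by auto
      then obtain p where "length p = m" "awalk z p y" using Suc.IH z by blast
      then show "\<exists>p. length p = Suc m \<and> awalk x p y"
        using z Suc.prems by (intro exI[of _ "(x, z) # p"]) (auto simp: awalk_Cons_iff)
    qed
  qed
  have g: "gdist (with_proj G) x y = (INF p\<in>{p. awalk x p y}. ereal (real (length p)))"
    unfolding gdist_def \<mu>_def len ..
  show ?thesis
  proof
    assume l: "ereal (real n) < gdist (with_proj G) x y"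
    show "(x, y) \<notin> near (parcs G) n"
    proof
      assume "(x, y) \<in> near (parcs G) n"
      then obtain m where "m \<le> n" "(x, y) \<in> parcs G ^^ m" by (auto simp: near_iff)
      moreover from this obtain p where "length p = m" "awalk x p y" using pow[OF x, of m] by blast
      ultimately have "gdist (with_proj G) x y \<le> ereal (real n)"
        unfolding g by (intro INF_lower2[of p]) auto
      then show False using l by auto
    qed
  next
    assume nn: "(x, y) \<notin> near (parcs G) n"
    have "ereal (real (Suc n)) \<le> gdist (with_proj G) x y"
      unfolding g
    proof (rule INF_greatest)
      fix p assume "p \<in> {p. awalk x p y}"
      then have "(x, y) \<in> parcs G ^^ length p" using pow[OF x] by blast
      then have "\<not> length p \<le> n" using nn by (auto simp: near_iff)
      then show "ereal (real (Suc n)) \<le> ereal (real (length p))" by simp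
    qed
    then show "ereal (real n) < gdist (with_proj G) x y"
      by (rule less_le_trans[rotated]) simp
  qed
qed

lemma r_independent_iff:
  assumes "parcs G \<subseteq> pverts G \<times> pverts G"
  shows "r_independent r (with_proj G) B \<longleftrightarrow>
    B \<subseteq> pverts G \<and> (\<forall>u\<in>B. \<forall>v\<in>B. u \<noteq> v \<longrightarrow> (u, v) \<notin> near (parcs G) r)"
proof -
  have "ereal (real r) < gdist (with_proj G) u v \<longleftrightarrow> (u, v) \<notin> near (parcs G) r"
    if "B \<subseteq> pverts G" "u \<in> B" for u v
    using less_gdist_iff[OF assms] that by blast
  then show ?thesis unfolding r_independent_def by auto
qed

lemma induce_subgraph_with_proj:
  "with_proj G \<restriction> X = with_proj \<lparr>pverts = X, parcs = restr (parcs G) X\<rparr>"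
  by (auto simp: induce_subgraph_def with_proj_def)

lemma radius_le_iff:
  assumes G: "pair_graph G" and ne: "pverts G \<noteq> {}"
  shows "radius (with_proj G) \<le> ereal (real q) \<longleftrightarrow>
    (\<exists>c\<in>pverts G. \<forall>v\<in>pverts G. (c, v) \<in> near (parcs G) q)"
proof -
  have wf: "parcs G \<subseteq> pverts G \<times> pverts G" and fin: "finite (pverts G)" using G by (auto simp: pair_graph_iff)
  let ?e = "\<lambda>c. SUP v\<in>pverts G. gdist (with_proj G) c v"
  have e: "?e c \<le> ereal (real q) \<longleftrightarrow> (\<forall>v\<in>pverts G. (c, v) \<in> near (parcs G) q)" if "c \<in> pverts G" for c
    unfolding SUP_le_iff using less_gdist_iff[OF wf that, of q] not_less by metis
  have "radius (with_proj G) = Min (?e ` pverts G)"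
    unfolding radius_def using fin ne by (simp add: Min_Inf)
  also have "\<dots> \<le> ereal (real q) \<longleftrightarrow> (\<exists>c\<in>pverts G. ?e c \<le> ereal (real q))"
    using fin ne by (subst Min_le_iff) auto
  finally show ?thesis using e by auto
qed

text \<open>A model of a shallow minor in which every branch set is named by its own centre, so that
  the minor lives on a subset of \<open>V\<close>.\<close>

definition ball_system :: "('b \<times> 'b) set \<Rightarrow> 'b set \<Rightarrow> nat \<Rightarrow> 'b set \<Rightarrow> ('b \<Rightarrow> 'b set) \<Rightarrow> bool" where
  "ball_system R V q I B \<longleftrightarrow> I \<subseteq> V \<and>
     (\<forall>v\<in>I. v \<in> B v \<and> B v \<subseteq> V \<and> (\<forall>w\<in>B v. (v, w) \<in> near (restr R (B v)) q)) \<and>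
     (\<forall>u\<in>I. \<forall>v\<in>I. u \<noteq> v \<longrightarrow> B u \<inter> B v = {})"

definition minor_arcs :: "('b \<times> 'b) set \<Rightarrow> 'b set \<Rightarrow> ('b \<Rightarrow> 'b set) \<Rightarrow> ('b \<times> 'b) set" where
  "minor_arcs R I B = {(u, v). u \<in> I \<and> v \<in> I \<and> u \<noteq> v \<and> (\<exists>x\<in>B u. \<exists>y\<in>B v. (x, y) \<in> R)}"

text \<open>Arcs are counted, so every edge of the minor counts twice.\<close>

definition shallow_density :: "('b \<times> 'b) set \<Rightarrow> 'b set \<Rightarrow> nat \<Rightarrow> nat \<Rightarrow> bool" where
  "shallow_density R V q d \<longleftrightarrow>
     (\<forall>I B. ball_system R V q I B \<longrightarrow> card (minor_arcs R I B) \<le> d * card I)"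

lemma card_arcs_le:
  assumes "pair_graph H"
  shows "card (parcs H) \<le> 2 * card (edges H)"
proof -
  have fin: "finite (parcs H)"
    using assms finite_subset[of "parcs H" "pverts H \<times> pverts H"] by (simp add: pair_graph_iff)
  let ?f = "\<lambda>(u, v). {u, v}"
  have "card {a \<in> parcs H. ?f a = b} \<le> 2" if b: "b \<in> edges H" for b
  proof -
    obtain u v where "b = {u, v}" using b by (auto simp: edges_def)
    have "(x, y) \<in> {(u, v), (v, u)}" if "{x, y} = {u, v}" for x y
      using that by (auto simp: doubleton_eq_iff)
    then have "{a \<in> parcs H. ?f a = b} \<subseteq> {(u, v), (v, u)}"
      unfolding \<open>b = {u, v}\<close> by (intro subsetI) (simp add: split_beta prod_eq_iff)
    then have "card {a \<in> parcs H. ?f a = b} \<le> card {(u, v), (v, u)}" by (intro card_mono finite.intros)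
    also have "{(u, v), (v, u)} = set [(u, v), (v, u)]" by simp
    also have "card \<dots> \<le> 2" by (rule order_trans[OF card_length]) simp
    finally show ?thesis .
  qed
  then show ?thesis
    using fin by (intro card_le_if_fibres_le[of _ ?f]) (auto simp: edges_def)
qed

lemma bounded_expansion_density:
  assumes BE: "bounded_expansion \<D>" and gc: "graph_class \<D>"
  shows "\<exists>d. \<forall>G\<in>\<D>. shallow_density (parcs G) (pverts G) q d"
proof -
  obtain f :: "nat \<Rightarrow> nat" where f: "\<And>r G H. G \<in> \<D> \<Longrightarrow> shallow_minor r H G \<Longrightarrow>
      real (card (edges H)) / real (card (pverts H)) \<le> real (f r)"
    using BE unfolding bounded_expansion_def by blast
  show ?thesis
  \<comment> \<open>The factor 2 converts the edges counted by \<open>bounded_expansion\<close> into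
    arcs.\<close>
  proof (intro exI[of _ "2 * f q"] ballI)
    fix G assume GD: "G \<in> \<D>"
    then have G: "pair_graph G" using gc by (auto simp: graph_class_def)
    note G' = G[unfolded pair_graph_iff]
    show "shallow_density (parcs G) (pverts G) q (2 * f q)"
      unfolding shallow_density_def
    proof (intro allI impI)
      fix I B assume bs: "ball_system (parcs G) (pverts G) q I B"
      define H where "H = \<lparr>pverts = I, parcs = minor_arcs (parcs G) I B\<rparr>"
      define C where "C v = \<lparr>pverts = B v, parcs = restr (parcs G) (B v)\<rparr>" for v
      have finI: "finite I" using bs G' finite_subset by (auto simp: ball_system_def)
      have symG: "sym (parcs G)" using G' by blast
      have H: "pair_graph H"
        unfolding pair_graph_iff H_def using finI symG
        by (auto simp: minor_arcs_def sym_def irrefl_def)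
      have Cg: "pair_graph (C v)" if "v \<in> I" for v
      proof -
        have "finite (B v)" using bs that G' finite_subset unfolding ball_system_def by blast
        then show ?thesis using G' by (auto simp: pair_graph_iff C_def sym_def irrefl_def)
      qed
      have sm: "shallow_minor q H G"
        unfolding shallow_minor_def
      proof (intro conjI exI[of _ C] H)
        show "\<forall>v\<in>pverts H. pair_graph (C v) \<and> subgraph (with_proj (C v)) (with_proj G) \<and>
            connected (with_proj (C v)) \<and> radius (with_proj (C v)) \<le> ereal (real q)"
        proof (intro ballI conjI)
          fix v assume "v \<in> pverts H"
          then have v: "v \<in> I" by (simp add: H_def)
          show cg: "pair_graph (C v)" by (rule Cg[OF v])
          have Bv: "v \<in> B v" "B v \<subseteq> pverts G" "\<And>w. w \<in> B v \<Longrightarrow> (v, w) \<in> near (restr (parcs G) (B v)) q"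
            using bs v by (auto simp: ball_system_def)
          interpret Cv: pair_graph "C v" by (rule cg)
          interpret Gg: pair_graph G by (rule G)
          show "subgraph (with_proj (C v)) (with_proj G)"
            unfolding subgraph_def compatible_def
            using Bv(2) Cv.wf_digraph Gg.wf_digraph by (auto simp: C_def)
          show "radius (with_proj (C v)) \<le> ereal (real q)"
            using radius_le_iff[OF cg] Bv by (auto simp: C_def)
          have reach: "w \<rightarrow>\<^sup>*\<^bsub>with_proj (C v)\<^esub> w'" if "(w, w') \<in> near (restr (parcs G) (B v)) n" "w \<in> B v" for w w' n
            using that
          proof (induction n arbitrary: w')
            case 0
            then have "w \<in> verts (with_proj (C v))" by (simp add: C_def)
            then show ?case using 0 by simp
          next
            case (Suc n)
            show ?case
            proof (cases "w = w'")
              case False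
              then obtain z where z: "(w, z) \<in> near (restr (parcs G) (B v)) n" "(z, w') \<in> restr (parcs G) (B v)"
                using Suc.prems by (auto simp: near_Suc_iff2)
              have "w \<rightarrow>\<^sup>*\<^bsub>with_proj (C v)\<^esub> z" using Suc z by blast
              moreover have "z \<rightarrow>\<^bsub>with_proj (C v)\<^esub> w'" using z(2) by (simp add: C_def)
              ultimately show ?thesis by (rule wf_digraph.reachable_adj_trans[OF Cv.wf_digraph])
            next
              case True
              have "w \<in> verts (with_proj (C v))" using Suc.prems by (simp add: C_def)
              then show ?thesis using True by simp
            qed
          qed
          have "w \<rightarrow>\<^sup>*\<^bsub>with_proj (C v)\<^esub> w'" if "w \<in> B v" "w' \<in> B v" for w w'
          proof -
            have "(w, v) \<in> near (restr (parcs G) (B v)) q"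
              by (rule near_sym[OF sym_restr[OF symG] Bv(3)[OF that(1)]])
            then have "(w, w') \<in> near (restr (parcs G) (B v)) (q + q)"
              using Bv(3)[OF that(2)] by (rule near_trans)
            then show ?thesis using reach that by blast
          qed
          moreover have "(parcs (C v))\<^sup>s = parcs (C v)"
            using cg by (auto simp: symcl_def pair_graph_iff sym_def)
          ultimately show "connected (with_proj (C v))"
            using Bv(1) unfolding connected_conv reachable_def by (auto simp: C_def)
        qed
        show "\<forall>u\<in>pverts H. \<forall>v\<in>pverts H. u \<noteq> v \<longrightarrow> pverts (C u) \<inter> pverts (C v) = {}"
          using bs by (auto simp: H_def C_def ball_system_def)
        show "\<forall>(u, v)\<in>parcs H. \<exists>x\<in>pverts (C u). \<exists>y\<in>pverts (C v). (x, y) \<in> parcs G"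
          by (auto simp: H_def C_def minor_arcs_def)
      qed
      have "real (card (edges H)) / real (card I) \<le> real (f q)" using f[OF GD sm] by (simp add: H_def)
      \<comment> \<open>Division by zero yields zero, so the density bound says nothing for empty
        \<open>I\<close>; there are no arcs in that case.\<close>
      then have "real (card (edges H)) \<le> real (f q) * real (card I) \<or> card I = 0"
        by (cases "card I = 0") (auto simp: divide_le_eq)
      moreover have "minor_arcs (parcs G) I B = {}" if "card I = 0"
        using that finI by (auto simp: minor_arcs_def)
      ultimately have "card (edges H) \<le> f q * card I \<or> minor_arcs (parcs G) I B = {}"
        by (metis of_nat_le_iff of_nat_mult)
      then show "card (minor_arcs (parcs G) I B) \<le> 2 * f q * card I"
        using card_arcs_le[OF H] by (auto simp: H_def)
    qed
  qed
qed

lemma shallow_minor_balls: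
  assumes "shallow_minor q H G" "pair_graph G"
  obtains B z where "\<And>v. v \<in> pverts H \<Longrightarrow> z v \<in> B v \<and> B v \<subseteq> pverts G \<and> (\<forall>w\<in>B v. (z v, w) \<in> near (restr (parcs G) (B v)) q)"
    "\<And>u v. u \<in> pverts H \<Longrightarrow> v \<in> pverts H \<Longrightarrow> u \<noteq> v \<Longrightarrow> B u \<inter> B v = {}"
    "\<And>u v. (u, v) \<in> parcs H \<Longrightarrow> \<exists>x\<in>B u. \<exists>y\<in>B v. (x, y) \<in> parcs G"
proof -
  obtain C where C: "\<And>v. v \<in> pverts H \<Longrightarrow> pair_graph (C v)" "\<And>v. v \<in> pverts H \<Longrightarrow> subgraph (with_proj (C v)) (with_proj G)"
    "\<And>v. v \<in> pverts H \<Longrightarrow> connected (with_proj (C v))"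
    "\<And>v. v \<in> pverts H \<Longrightarrow> radius (with_proj (C v)) \<le> ereal (real q)"
    and C2: "\<forall>u\<in>pverts H. \<forall>v\<in>pverts H. u \<noteq> v \<longrightarrow> pverts (C u) \<inter> pverts (C v) = {}"
    "\<forall>(u, v)\<in>parcs H. \<exists>x\<in>pverts (C u). \<exists>y\<in>pverts (C v). (x, y) \<in> parcs G"
    using assms(1) unfolding shallow_minor_def by blast
  have "\<exists>c\<in>pverts (C v). \<forall>w\<in>pverts (C v). (c, w) \<in> near (parcs (C v)) q" if "v \<in> pverts H" for v
  proof -
    have "pverts (C v) \<noteq> {}" using C(3)[OF that] unfolding connected_conv by simp
    then show ?thesis using C(4)[OF that] radius_le_iff[OF C(1)[OF that]] by blast
  qed
  then obtain z where z: "\<And>v. v \<in> pverts H \<Longrightarrow> z v \<in> pverts (C v) \<and> (\<forall>w\<in>pverts (C v). (z v, w) \<in> near (parcs (C v)) q)"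
    by metis
  have sub: "pverts (C v) \<subseteq> pverts G" "parcs (C v) \<subseteq> restr (parcs G) (pverts (C v))" if "v \<in> pverts H" for v
    using C(1,2)[OF that] by (auto simp: subgraph_def pair_graph_iff)
  show ?thesis
  proof (rule that[of z "\<lambda>v. pverts (C v)"])
    fix v assume v: "v \<in> pverts H"
    show "z v \<in> pverts (C v) \<and> pverts (C v) \<subseteq> pverts G \<and>
      (\<forall>w\<in>pverts (C v). (z v, w) \<in> near (restr (parcs G) (pverts (C v))) q)"
      using z[OF v] sub[OF v] near_mono[OF _ sub(2)[OF v] order_refl] by blast
  qed (use C2 in auto)
qed

section \<open>Orders with small weak reachability sets\<close>

abbreviation walk :: "('b \<times> 'b) set \<Rightarrow> 'b list \<Rightarrow> bool" where
  "walk R \<equiv> successively (\<lambda>a b. (a, b) \<in> R)"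

lemma walk_near:
  assumes "walk R (v # ys)" "set (v # ys) \<subseteq> X" "w \<in> set (v # ys)"
  shows "(v, w) \<in> near (restr R X) (length ys)"
  using assms
proof (induction ys arbitrary: v)
  case (Cons y ys)
  show ?case
  proof (cases "w = v")
    case False
    then have "(y, w) \<in> near (restr R X) (length ys)" using Cons by auto
    moreover have "(v, y) \<in> restr R X" using Cons.prems by auto
    ultimately show ?thesis by (auto simp: near_Suc_iff)
  qed simp
qed simp

lemma walk_edge: "walk R (v # ys @ [w]) \<Longrightarrow> \<exists>x\<in>insert v (set ys). (x, w) \<in> R"
  by (cases ys rule: rev_cases) (auto simp: successively_append_iff successively_Cons split: if_splits)

text \<open>The walks counted by \<open>r\<close>-admissibility, meeting only in \<open>v\<close>.
  The lists omit \<open>v\<close> itself, which makes their disjointness literal.\<close>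

definition fan :: "('b \<times> 'b) set \<Rightarrow> 'b set \<Rightarrow> nat \<Rightarrow> 'b \<Rightarrow> 'b list set \<Rightarrow> bool" where
  "fan R S r v F \<longleftrightarrow> finite F \<and>
     (\<forall>zs\<in>F. zs \<noteq> [] \<and> walk R (v # zs) \<and> last zs \<in> S \<and> v \<notin> set zs \<and> length zs \<le> r) \<and>
     (\<forall>zs\<in>F. \<forall>zs'\<in>F. zs \<noteq> zs' \<longrightarrow> set zs \<inter> set zs' = {})"

text \<open>Greedy: a vertex with few neighbours joins \<open>I\<close> and is discarded together
  with them, so each member of \<open>I\<close> costs at most \<open>d + 1\<close> vertices of
  \<open>S\<close>.\<close>

lemma ex_independent_set:
  assumes "finite S" "\<And>S'. S' \<subseteq> S \<Longrightarrow> S' \<noteq> {} \<Longrightarrow> \<exists>v\<in>S'. card {u \<in> S'. L v u} \<le> d"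
    and sym: "\<And>u v. L u v \<Longrightarrow> L v u"
  shows "\<exists>I\<subseteq>S. (\<forall>u\<in>I. \<forall>v\<in>I. u \<noteq> v \<longrightarrow> \<not> L u v) \<and> card S \<le> (d + 1) * card I"
  using assms(1,2)
proof (induction "card S" arbitrary: S rule: less_induct)
  case less
  show ?case
  proof (cases "S = {}")
    case False
    then obtain v where v: "v \<in> S" "card {u \<in> S. L v u} \<le> d" using less.prems(2)[of S] by blast
    define S' where "S' = S - {v} - {u \<in> S. L v u}"
    have fS: "finite S" by (rule less.prems(1))
    have S': "S' \<subseteq> S" "v \<notin> S'" by (auto simp: S'_def)
    then have "card S' < card S" using v fS by (intro psubset_card_mono) auto
    moreover have "finite S'" using fS by (simp add: S'_def)
    moreover have "\<exists>v\<in>T. card {u \<in> T. L v u} \<le> d" if "T \<subseteq> S'" "T \<noteq> {}" for T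
      using less.prems(2)[of T] that S' by blast
    ultimately have "\<exists>I\<subseteq>S'. (\<forall>u\<in>I. \<forall>v\<in>I. u \<noteq> v \<longrightarrow> \<not> L u v) \<and> card S' \<le> (d + 1) * card I"
      by (rule less.hyps)
    then obtain I where I: "I \<subseteq> S'" "\<forall>u\<in>I. \<forall>v\<in>I. u \<noteq> v \<longrightarrow> \<not> L u v" "card S' \<le> (d + 1) * card I"
      by blast
    have fI: "finite I" "v \<notin> I" using I(1) S' fS by (auto intro: finite_subset[of I S])
    have "S \<subseteq> S' \<union> insert v {u \<in> S. L v u}" by (auto simp: S'_def)
    then have "card S \<le> card (S' \<union> insert v {u \<in> S. L v u})" using fS by (intro card_mono) (auto simp: S'_def)
    also have "\<dots> \<le> card S' + card (insert v {u \<in> S. L v u})" by (rule card_Un_le)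
    also have "card (insert v {u \<in> S. L v u}) \<le> Suc d" using v(2) by (simp add: card_insert_if fS)
    finally have "card S \<le> (d + 1) * card (insert v I)" using I(3) fI by simp
    moreover have "\<not> L v u" "\<not> L u v" if "u \<in> I" for u
      using that I(1) sym by (auto simp: S'_def)
    ultimately show ?thesis
      using I v S' by (intro exI[of _ "insert v I"]) auto
  qed simp
qed

text \<open>If every vertex of \<open>S\<close> had a larger fan, the fans would yield a shallow
  minor that is too dense. Walks of different fans may cross, so first a maximal family
  \<open>P\<close> of disjoint short connections between vertices of \<open>S\<close> is fixed; then
  the fans at an independent set \<open>I\<close> of the resulting link graph are cut at their first
  vertex in \<open>S\<close> or on \<open>P\<close>. A crossing of two cut walks would enlarge
  \<open>P\<close>. The factors of \<open>p\<close> are the density of the final minor, the size of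
  its vertex set \<open>Z\<close> relative to \<open>S\<close>, and the loss from \<open>S\<close>
  to \<open>I\<close>.\<close>

lemma ex_small_fan_vertex:
  fixes R :: "('b \<times> 'b) set"
  assumes finV: "finite V" and RV: "R \<subseteq> V \<times> V" and symR: "sym R"
    and dens: "shallow_density R V (2 * r) d"
    and S: "S \<subseteq> V" "S \<noteq> {}" and p: "p = d * (1 + 2 * r * d) * (d + 1)"
  shows "\<exists>v\<in>S. \<forall>F. fan R S r v F \<longrightarrow> card F \<le> p"
proof (rule ccontr)
  assume "\<not> ?thesis"
  then have "\<forall>v\<in>S. \<exists>F. fan R S r v F \<and> p < card F" by (metis not_le)
  then obtain F where F: "\<And>v. v \<in> S \<Longrightarrow> fan R S r v (F v)" "\<And>v. v \<in> S \<Longrightarrow> p < card (F v)" by metis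
  have finS: "finite S" using S finV finite_subset by blast
  have symE: "(a, b) \<in> R \<Longrightarrow> (b, a) \<in> R" for a b using symR by (meson symD)
  \<comment> \<open>The length \<open>2 * r\<close> leaves room for two initial pieces of fan walks
    glued at a crossing.\<close>
  define conn where "conn c \<longleftrightarrow> (case c of (u, v, xs) \<Rightarrow> u \<in> S \<and> v \<in> S \<and> u \<noteq> v \<and>
      walk R (u # xs @ [v]) \<and> set xs \<inter> S = {} \<and> length xs \<le> 2 * r)" for c
  define good where "good P \<longleftrightarrow> (\<forall>c\<in>P. conn c) \<and> (\<forall>c\<in>P. \<forall>c'\<in>P. c \<noteq> c' \<longrightarrow>
      set (snd (snd c)) \<inter> set (snd (snd c')) = {} \<and> {fst c, fst (snd c)} \<noteq> {fst c', fst (snd c')})" for P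
  have card_good: "card P \<le> card (S \<times> S)" if "good P" for P
  proof (rule card_inj_on_le)
    show "inj_on (\<lambda>c. (fst c, fst (snd c))) P" using that by (fastforce simp: inj_on_def good_def)
    show "(\<lambda>c. (fst c, fst (snd c))) ` P \<subseteq> S \<times> S" using that by (auto simp: good_def conn_def)
  qed (use finS in auto)
  have "good {}" by (simp add: good_def)
  then obtain P where P: "good P" and P_max: "\<And>P'. good P' \<Longrightarrow> card P' \<le> card P"
    using ex_has_greatest_nat[of good "{}" card "Suc (card (S \<times> S))"] card_good by (metis less_Suc_eq_le)
  have finP: "finite P"
  proof (rule inj_on_finite)
    show "inj_on (\<lambda>c. (fst c, fst (snd c))) P" using P by (fastforce simp: inj_on_def good_def)
    show "(\<lambda>c. (fst c, fst (snd c))) ` P \<subseteq> S \<times> S" using P by (auto simp: good_def conn_def)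
  qed (use finS in auto)
  have Pc: "u \<in> S" "v \<in> S" "u \<noteq> v" "walk R (u # xs @ [v])" "set xs \<inter> S = {}" "length xs \<le> 2 * r"
    if "(u, v, xs) \<in> P" for u v xs using that P by (auto simp: good_def conn_def)
  have walkV: "set xs \<subseteq> V" if "walk R (u # xs @ [v])" for u v xs
  proof
    fix x assume "x \<in> set xs"
    then obtain as bs where "xs = as @ x # bs" by (meson split_list)
    then have "walk R ((u # as) @ [x] @ (bs @ [v]))" using that by simp
    then have "(x, hd (bs @ [v])) \<in> R" by (simp add: successively_append_iff successively_Cons)
    then show "x \<in> V" using RV by auto
  qed
  define Vp where "Vp = (\<Union>c\<in>P. set (snd (snd c)))"
  define link where "link u v \<longleftrightarrow> (\<exists>xs. (u, v, xs) \<in> P \<or> (v, u, xs) \<in> P)" for u v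
  \<comment> \<open>The interior of a connection is assigned to its first end. So the balls are
    disjoint and each connection becomes an arc of the minor, which bounds
    \<open>card P\<close>.\<close>
  define B where "B u = insert u (\<Union>c\<in>{c \<in> P. fst c = u}. set (snd (snd c)))" for u
  have link_sym: "link v u" if "link u v" for u v using that by (auto simp: link_def)
  have bs: "ball_system R V (2 * r) S' B" if S': "S' \<subseteq> S" for S'
    unfolding ball_system_def
  proof (intro conjI ballI impI)
    show "S' \<subseteq> V" using S S' by blast
    fix v assume "v \<in> S'"
    show "v \<in> B v" by (simp add: B_def)
    show "B v \<subseteq> V" using walkV Pc(4) \<open>v \<in> S'\<close> S' S by (force simp: B_def)
    show "(v, w) \<in> near (restr R (B v)) (2 * r)" if w: "w \<in> B v" for w
    proof (cases "w = v")
      case False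
      then obtain u xs where c: "(v, u, xs) \<in> P" "w \<in> set xs" using w by (auto simp: B_def)
      have "walk R (v # xs)" using Pc(4)[OF c(1)] by (simp add: successively_Cons successively_append_iff) (metis hd_append2 self_append_conv2)
      moreover have "set (v # xs) \<subseteq> B v" using c(1) by (force simp: B_def)
      ultimately have "(v, w) \<in> near (restr R (B v)) (length xs)" using c(2) by (intro walk_near) auto
      then show ?thesis by (rule near_mono[OF _ order_refl Pc(6)[OF c(1)]])
    qed simp
    fix u assume u: "u \<in> S'" "v \<noteq> u"
    show "B v \<inter> B u = {}"
    proof -
      have "set (snd (snd c)) \<inter> set (snd (snd c')) = {}" if "c \<in> P" "c' \<in> P" "fst c = v" "fst c' = u" for c c'
      proof -
        have "c \<noteq> c'" using that u(2) by auto
        then show ?thesis using that(1,2) P unfolding good_def by blast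
      qed
      moreover have "set (snd (snd c)) \<inter> S = {}" if "c \<in> P" for c
        using that Pc(5)[of "fst c" "fst (snd c)" "snd (snd c)"] by simp
      moreover have "u \<in> S" "v \<in> S" using u \<open>v \<in> S'\<close> S' by auto
      ultimately show ?thesis using u(2) by (fastforce simp: B_def)
    qed
  qed
  have linkB: "(u, v) \<in> minor_arcs R S' B" if "u \<in> S'" "v \<in> S'" "link u v" for u v S'
  proof -
    have *: "\<exists>x\<in>B a. (x, b) \<in> R" if c: "(a, b, xs) \<in> P" for a b xs
    proof -
      have "insert a (set xs) \<subseteq> B a" using c by (force simp: B_def)
      then show ?thesis using walk_edge[OF Pc(4)[OF c]] by blast
    qed
    have ne: "u \<noteq> v" using that(3) Pc(3) by (auto simp: link_def)
    have self: "v \<in> B v" "u \<in> B u" by (auto simp: B_def)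
    obtain xs where "(u, v, xs) \<in> P \<or> (v, u, xs) \<in> P" using \<open>link u v\<close> by (auto simp: link_def)
    then have "(\<exists>x\<in>B u. (x, v) \<in> R) \<or> (\<exists>x\<in>B v. (x, u) \<in> R)"
      using *[of u v xs] *[of v u xs] by (elim disjE) simp_all
    then have "\<exists>x\<in>B u. \<exists>y\<in>B v. (x, y) \<in> R" using self symE by metis
    then show ?thesis using that ne by (auto simp: minor_arcs_def)
  qed
  have fin_arcs: "finite (minor_arcs R S' B')" if "S' \<subseteq> V" for S' B'
  proof (rule finite_subset)
    show "minor_arcs R S' B' \<subseteq> V \<times> V" using that by (auto simp: minor_arcs_def)
  qed (use finV in simp)
  \<comment> \<open>The same balls give a minor on every subset of \<open>S\<close>, so the link
    graph is degenerate.\<close>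
  have deg: "\<exists>v\<in>S'. card {u \<in> S'. link v u} \<le> d" if S': "S' \<subseteq> S" "S' \<noteq> {}" for S'
  proof (rule ccontr)
    assume "\<not> ?thesis"
    then have gt: "d < card {u \<in> S'. link v u}" if "v \<in> S'" for v using that by (meson not_le)
    have finS': "finite S'" using S' finS finite_subset by blast
    have "d * card S' < (\<Sum>v\<in>S'. card {u \<in> S'. link v u})"
      using sum_strict_mono[OF finS' S'(2) gt] by (simp add: mult.commute)
    also have "\<dots> = card (SIGMA v:S'. {u \<in> S'. link v u})" using finS' by simp
    also have "\<dots> \<le> card (minor_arcs R S' B)"
      using linkB S' S by (intro card_mono fin_arcs) auto
    also have "\<dots> \<le> d * card S'" using dens bs[OF S'(1)] by (auto simp: shallow_density_def)
    finally show False by simp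
  qed
  have "card P \<le> card (minor_arcs R S B)"
  proof (rule card_inj_on_le)
    show "inj_on (\<lambda>c. (fst c, fst (snd c))) P" using P by (fastforce simp: inj_on_def good_def)
    show "(\<lambda>c. (fst c, fst (snd c))) ` P \<subseteq> minor_arcs R S B"
    proof
      fix a assume "a \<in> (\<lambda>c. (fst c, fst (snd c))) ` P"
      then obtain u v xs where "(u, v, xs) \<in> P" "a = (u, v)" by auto
      then show "a \<in> minor_arcs R S B" using linkB[of u S v] Pc(1,2) by (auto simp: link_def)
    qed
  qed (rule fin_arcs[OF S(1)])
  also have "\<dots> \<le> d * card S" using dens bs[of S] by (auto simp: shallow_density_def)
  finally have cardP: "card P \<le> d * card S" .
  have "card Vp \<le> (\<Sum>c\<in>P. card (set (snd (snd c))))" unfolding Vp_def by (rule card_UN_le[OF finP])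
  also have "\<dots> \<le> (\<Sum>c\<in>P. 2 * r)" proof (rule sum_mono)
    fix c assume "c \<in> P"
    then have "length (snd (snd c)) \<le> 2 * r" using Pc(6)[of "fst c" "fst (snd c)" "snd (snd c)"] by simp
    then show "card (set (snd (snd c))) \<le> 2 * r" using card_length[of "snd (snd c)"] by linarith
  qed
  also have "\<dots> \<le> 2 * r * (d * card S)" using cardP by (simp add: mult.commute)
  finally have cardVp: "card Vp \<le> 2 * r * (d * card S)" .
  obtain I where I: "I \<subseteq> S" "\<forall>u\<in>I. \<forall>v\<in>I. u \<noteq> v \<longrightarrow> \<not> link u v" "card S \<le> (d + 1) * card I"
    using ex_independent_set[OF finS deg] link_sym by blast
  define Z where "Z = S \<union> Vp"
  have trunc: "\<exists>t. (\<exists>us. zs = fst t @ snd t # us) \<and> snd t \<in> Z \<and> set (fst t) \<inter> Z = {}"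
    if zs: "zs \<in> F v" "v \<in> S" for v zs
  proof -
    have "zs \<noteq> [] \<and> last zs \<in> S" using F(1)[OF zs(2)] zs(1) by (auto simp: fan_def)
    then have "\<exists>x\<in>set zs. x \<in> Z" by (auto simp: Z_def intro: bexI[of _ "last zs"])
    from split_list_first_prop[OF this] obtain ys w us
      where "zs = ys @ w # us" "w \<in> Z" "\<forall>y\<in>set ys. y \<notin> Z" by blast
    then show ?thesis by (intro exI[of _ "(ys, w)"]) auto
  qed
  define tr where "tr zs = (SOME t. (\<exists>us. zs = fst t @ snd t # us) \<and> snd t \<in> Z \<and> set (fst t) \<inter> Z = {})" for zs
  define ys where "ys v zs = fst (tr zs)" for v :: 'b and zs
  define w where "w v zs = snd (tr zs)" for v :: 'b and zs
  have yw: "(\<exists>us. zs = ys v zs @ w v zs # us) \<and> w v zs \<in> Z \<and> set (ys v zs) \<inter> Z = {}"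
    if "zs \<in> F v" "v \<in> S" for v zs
    using someI_ex[OF trunc[OF that]] unfolding ys_def w_def tr_def .
  have fanF: "walk R (v # zs)" "v \<notin> set zs" "length zs \<le> r" if "zs \<in> F v" "v \<in> S" for v zs
    using F(1)[OF that(2)] that(1) by (auto simp: fan_def)
  have yw': "walk R (v # ys v zs @ [w v zs])" "w v zs \<noteq> v" "w v zs \<in> set zs" "set (ys v zs) \<subseteq> set zs"
    "length (ys v zs) < r" if zs: "zs \<in> F v" "v \<in> S" for v zs
  proof -
    obtain us where us: "zs = ys v zs @ w v zs # us" using yw zs by blast
    have "walk R ((v # ys v zs @ [w v zs]) @ us)" using fanF(1)[OF zs] us by simp
    then show "walk R (v # ys v zs @ [w v zs])" by (simp only: successively_append_iff)
    have "w v zs \<in> set (ys v zs @ w v zs # us)" by simp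
    then show w: "w v zs \<in> set zs" using us by simp
    then show "w v zs \<noteq> v" using fanF(2)[OF zs] by metis
    show "set (ys v zs) \<subseteq> set zs" by (subst us) auto
    have "length zs = length (ys v zs) + Suc (length us)" by (subst us) simp
    then show "length (ys v zs) < r" using fanF(3)[OF zs] by simp
  qed
  define A where "A v = (if v \<in> I then insert v (\<Union>zs\<in>F v. set (ys v zs)) else {v})" for v
  \<comment> \<open>Gluing the two pieces at a common vertex connects \<open>v\<close> to
    \<open>v'\<close> outside \<open>Z\<close>. As \<open>v\<close> and \<open>v'\<close> are not
    linked, this connection could be added to \<open>P\<close>, against its maximality.\<close>
  have disjI: "set (ys v zs) \<inter> set (ys v' zs') = {}"
    if v: "v \<in> I" "v' \<in> I" "v \<noteq> v'" and zs: "zs \<in> F v" "zs' \<in> F v'" for v v' zs zs'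
  proof (rule ccontr)
    assume "set (ys v zs) \<inter> set (ys v' zs') \<noteq> {}"
    then obtain x where x: "x \<in> set (ys v zs)" "x \<in> set (ys v' zs')" by blast
    have vS: "v \<in> S" "v' \<in> S" using v I by auto
    obtain as bs where ab: "ys v zs = as @ x # bs" using x(1) by (meson split_list)
    obtain cs ds where cd: "ys v' zs' = cs @ x # ds" using x(2) by (meson split_list)
    have "walk R ((v # as @ [x]) @ (bs @ [w v zs]))" using yw'(1)[OF zs(1) vS(1)] ab by simp
    then have w1: "walk R (v # as @ [x])" by (simp only: successively_append_iff)
    have "walk R ((v' # cs @ [x]) @ (ds @ [w v' zs']))" using yw'(1)[OF zs(2) vS(2)] cd by simp
    then have "walk R (v' # cs @ [x])" by (simp only: successively_append_iff)
    then have "walk R (rev (v' # cs @ [x]))"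
      unfolding successively_rev by (rule successively_mono) (rule symE)
    then have w2: "walk R (x # rev cs @ [v'])" by simp
    define xs where "xs = as @ x # rev cs"
    have "walk R ([x] @ (rev cs @ [v']))" using w2 by simp
    then have "walk R ((v # as @ [x]) @ (rev cs @ [v']))"
      using w1 by (simp only: successively_append_iff) simp
    then have "walk R (v # xs @ [v'])" by (simp add: xs_def)
    moreover have xsZ: "set xs \<inter> Z = {}" using yw[OF zs(1) vS(1)] yw[OF zs(2) vS(2)] ab cd by (auto simp: xs_def)
    moreover have "length xs \<le> 2 * r"
      using yw'(5)[OF zs(1) vS(1)] yw'(5)[OF zs(2) vS(2)] ab cd by (simp add: xs_def)
    ultimately have c: "conn (v, v', xs)" using vS v(3) by (auto simp: conn_def Z_def)
    have nl: "\<not> link v v'" using I(2) v by blast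
    have new1: "{v, v'} \<noteq> {fst c, fst (snd c)}" if "c \<in> P" for c
      using that nl by (cases c) (auto simp: link_def doubleton_eq_iff)
    have new2: "set xs \<inter> set (snd (snd c)) = {}" if "c \<in> P" for c
      using that xsZ by (auto simp: Z_def Vp_def)
    have old: "set (snd (snd c1)) \<inter> set (snd (snd c2)) = {} \<and> {fst c1, fst (snd c1)} \<noteq> {fst c2, fst (snd c2)}"
      if "c1 \<in> P" "c2 \<in> P" "c1 \<noteq> c2" for c1 c2
      using P that unfolding good_def by blast
    have "set (snd (snd c1)) \<inter> set (snd (snd c2)) = {} \<and> {fst c1, fst (snd c1)} \<noteq> {fst c2, fst (snd c2)}"
      if cc: "c1 \<in> insert (v, v', xs) P" "c2 \<in> insert (v, v', xs) P" "c1 \<noteq> c2" for c1 c2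
    proof -
      consider "c1 \<in> P" "c2 \<in> P" | "c1 = (v, v', xs)" "c2 \<in> P" | "c1 \<in> P" "c2 = (v, v', xs)"
        using cc by blast
      then show ?thesis
      proof cases
        case 1
        then show ?thesis using old cc(3) by blast
      next
        case 2
        then show ?thesis using new1[of c2] new2[of c2] by simp
      next
        case 3
        then show ?thesis using new1[of c1] new2[of c1] by (simp add: Int_commute eq_commute)
      qed
    qed
    moreover have "conn c1" if "c1 \<in> insert (v, v', xs) P" for c1
      using that c P unfolding good_def by blast
    ultimately have "good (insert (v, v', xs) P)" unfolding good_def by blast
    moreover have "(v, v', xs) \<notin> P" using nl by (auto simp: link_def)
    ultimately show False using P_max[of "insert (v, v', xs) P"] finP by simp
  qed
  have ZV: "Z \<subseteq> V"
  proof -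
    have "set (snd (snd c)) \<subseteq> V" if "c \<in> P" for c using walkV Pc(4) that by (metis prod.collapse)
    then show ?thesis using S by (auto simp: Z_def Vp_def)
  qed
  have ysV: "set (ys v zs) \<subseteq> V" if "zs \<in> F v" "v \<in> S" for v zs
    by (rule walkV[OF yw'(1)[OF that]])
  have IZ: "I \<subseteq> Z" using I by (auto simp: Z_def)
  \<comment> \<open>In this minor the members of \<open>I\<close> absorb their cut walks; the end of
    each cut walk is an element of \<open>Z\<close> and so a vertex of the minor of its own.\<close>
  have bsA: "ball_system R V (2 * r) Z A"
    unfolding ball_system_def
  proof (intro conjI ballI impI)
    show "Z \<subseteq> V" by (rule ZV)
    fix v assume v: "v \<in> Z"
    show "v \<in> A v" by (simp add: A_def)
    show "A v \<subseteq> V" using v ZV ysV I(1) by (auto simp: A_def)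
    show "(v, x) \<in> near (restr R (A v)) (2 * r)" if x: "x \<in> A v" for x
    proof (cases "x = v")
      case False
      then obtain zs where zs: "v \<in> I" "zs \<in> F v" "x \<in> set (ys v zs)"
        using x by (auto simp: A_def split: if_splits)
      have vS: "v \<in> S" using zs I by blast
      have "walk R ((v # ys v zs) @ [w v zs])" using yw'(1)[OF zs(2) vS] by simp
      then have "walk R (v # ys v zs)" by (simp only: successively_append_iff)
      moreover have "set (v # ys v zs) \<subseteq> A v" using zs by (auto simp: A_def)
      ultimately have "(v, x) \<in> near (restr R (A v)) (length (ys v zs))"
        using zs(3) by (intro walk_near) auto
      then show ?thesis by (rule near_mono) (use yw'(5)[OF zs(2) vS] in auto)
    qed simp
    fix u assume u: "u \<in> Z" "v \<noteq> u"
    have avoid: "set (ys a zs) \<inter> Z = {}" if "a \<in> I" "zs \<in> F a" for a zs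
      using yw[OF that(2)] that(1) I(1) by blast
    show "A v \<inter> A u = {}"
      using u v avoid disjI IZ unfolding A_def by (auto split: if_splits) blast+
  qed
  \<comment> \<open>The walks of one fan are disjoint, so each of the more than \<open>p\<close>
    walks at \<open>v\<close> contributes a separate arc.\<close>
  have inj: "inj_on (w v) (F v)" if v: "v \<in> S" for v
  proof (rule inj_onI, rule ccontr)
    fix zs zs' assume zs: "zs \<in> F v" "zs' \<in> F v" "w v zs = w v zs'" "zs \<noteq> zs'"
    then have "set zs \<inter> set zs' = {}" using F(1)[OF v] by (auto simp: fan_def)
    then show False using yw'(3)[OF zs(1) v] yw'(3)[OF zs(2) v] zs(3) by auto
  qed
  have "finite I" using I finS finite_subset by blast
  have "(p + 1) * card I \<le> (\<Sum>v\<in>I. card (w v ` F v))"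
  proof -
    have "p + 1 \<le> card (w v ` F v)" if "v \<in> I" for v
      using inj[of v] F(2)[of v] that I(1) by (auto simp: card_image)
    then have "(\<Sum>v\<in>I. p + 1) \<le> (\<Sum>v\<in>I. card (w v ` F v))" by (rule sum_mono)
    then show ?thesis by (simp add: mult.commute)
  qed
  also have "\<dots> = card (SIGMA v:I. w v ` F v)"
  proof -
    have "finite (F v)" if "v \<in> I" for v using F(1)[of v] that I(1) by (auto simp: fan_def)
    then show ?thesis using \<open>finite I\<close> by (subst card_SigmaI) auto
  qed
  also have "\<dots> \<le> card (minor_arcs R Z A)"
  proof (intro card_mono fin_arcs ZV subsetI)
    fix a assume "a \<in> (SIGMA v:I. w v ` F v)"
    then obtain v zs where a: "a = (v, w v zs)" "v \<in> I" "zs \<in> F v" by auto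
    have vS: "v \<in> S" using a I by blast
    have "insert v (set (ys v zs)) \<subseteq> A v" using a by (auto simp: A_def)
    then obtain x where "x \<in> A v" "(x, w v zs) \<in> R" using walk_edge[OF yw'(1)[OF a(3) vS]] by blast
    moreover have "w v zs \<in> A (w v zs)" by (simp add: A_def)
    moreover have "w v zs \<in> Z" "v \<in> Z" "v \<noteq> w v zs"
      using yw[OF a(3) vS] a(2) IZ yw'(2)[OF a(3) vS] by auto
    ultimately show "a \<in> minor_arcs R Z A" unfolding a(1) minor_arcs_def by blast
  qed
  also have "\<dots> \<le> d * card Z" using dens bsA by (auto simp: shallow_density_def)
  also have "card Z \<le> card S + card Vp" unfolding Z_def by (rule card_Un_le)
  also have "\<dots> \<le> (1 + 2 * r * d) * card S" using cardVp by (simp add: algebra_simps)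
  also have "\<dots> \<le> (1 + 2 * r * d) * ((d + 1) * card I)" using I(3) by (rule mult_le_mono2)
  finally have "(p + 1) * card I \<le> p * card I" by (simp add: p algebra_simps)
  moreover have "card I > 0" using I(3) S(2) finS by (metis card_gt_0_iff gr0I le_zero_eq mult_0_right)
  ultimately show False by simp
qed

text \<open>The vertex with small fans receives the highest rank: then the set of vertices ranked at
  most as high is the set it was chosen from, and its removal leaves the corresponding sets of all
  other vertices unchanged.\<close>

lemma ex_admissible_order:
  assumes finV: "finite V" and RV: "R \<subseteq> V \<times> V" and symR: "sym R"
    and dens: "shallow_density R V (2 * r) d" and p: "p = d * (1 + 2 * r * d) * (d + 1)"
  shows "\<exists>\<rho> :: 'b \<Rightarrow> nat. inj_on \<rho> V \<and> (\<forall>v\<in>V. \<forall>F. fan R {u \<in> V. \<rho> u \<le> \<rho> v} r v F \<longrightarrow> card F \<le> p)"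
proof -
  have "\<exists>\<rho> :: 'b \<Rightarrow> nat. inj_on \<rho> S \<and> \<rho> ` S \<subseteq> {..<card S} \<and>
      (\<forall>v\<in>S. \<forall>F. fan R {u \<in> S. \<rho> u \<le> \<rho> v} r v F \<longrightarrow> card F \<le> p)" if "S \<subseteq> V" "card S = n" for S n
    using that
  proof (induction n arbitrary: S)
    case 0
    then have "S = {}" using finV finite_subset by fastforce
    then show ?case by simp
  next
    case (Suc n)
    have finS: "finite S" using Suc.prems finV finite_subset by blast
    have "S \<noteq> {}" using Suc.prems by auto
    then obtain v where v: "v \<in> S" "\<forall>F. fan R S r v F \<longrightarrow> card F \<le> p"
      using ex_small_fan_vertex[OF finV RV symR dens Suc.prems(1) _ p] by blast
    have cS: "card (S - {v}) = n" using v Suc.prems finS by simp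
    have sub: "S - {v} \<subseteq> V" using Suc.prems(1) by blast
    obtain \<rho> :: "'b \<Rightarrow> nat" where \<rho>: "inj_on \<rho> (S - {v})" "\<rho> ` (S - {v}) \<subseteq> {..<card (S - {v})}"
      "\<forall>x\<in>S - {v}. \<forall>F. fan R {u \<in> S - {v}. \<rho> u \<le> \<rho> x} r x F \<longrightarrow> card F \<le> p"
      using Suc.IH[OF sub cS] by (elim exE conjE) (rule that)
    define \<rho>' where "\<rho>' = \<rho>(v := n)"
    have less: "\<rho>' x < n" if "x \<in> S" "x \<noteq> v" for x using that \<rho>(2) cS by (auto simp: \<rho>'_def)
    have v': "\<rho>' v = n" by (simp add: \<rho>'_def)
    have top: "{u \<in> S. \<rho>' u \<le> \<rho>' v} = S" using less v' by fastforce
    have rest: "{u \<in> S. \<rho>' u \<le> \<rho>' x} = {u \<in> S - {v}. \<rho> u \<le> \<rho> x}" if "x \<in> S - {v}" for x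
      using that less[of x] by (auto simp: \<rho>'_def)
    have "inj_on \<rho>' S"
    proof (rule inj_onI)
      fix x y assume xy: "x \<in> S" "y \<in> S" "\<rho>' x = \<rho>' y"
      show "x = y"
      proof (cases "x = v \<or> y = v")
        case True
        then show ?thesis using less[OF xy(1)] less[OF xy(2)] v' xy(3) by (metis less_irrefl)
      next
        case False
        then show ?thesis using xy inj_onD[OF \<rho>(1), of x y] by (auto simp: \<rho>'_def)
      qed
    qed
    moreover have "\<rho>' x < card S" if "x \<in> S" for x
      using less[OF that] v' Suc.prems(2) by (cases "x = v") auto
    moreover have "card F \<le> p" if "x \<in> S" "fan R {u \<in> S. \<rho>' u \<le> \<rho>' x} r x F" for x F
    proof (cases "x = v")
      case True
      then show ?thesis using that v(2) top by simp
    next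
      case False
      then show ?thesis using that \<rho>(3) rest[of x] by simp
    qed
    ultimately show ?case by (intro exI[of _ \<rho>']) auto
  qed
  from this[OF order_refl refl] show ?thesis by blast
qed

section \<open>From admissibility to strong and weak reachability\<close>

definition sreach :: "('b \<times> 'b) set \<Rightarrow> ('b \<Rightarrow> nat) \<Rightarrow> nat \<Rightarrow> 'b \<Rightarrow> 'b set" where
  "sreach R \<rho> r v = {u. \<rho> u < \<rho> v \<and> (\<exists>w. (v, w) \<in> near (restr R {a. \<rho> v \<le> \<rho> a}) r \<and> (w, u) \<in> R)}"

text \<open>
  In a breadth-first tree whose leaves are the strongly reachable vertices, the subtrees below a
  vertex \<open>w\<close> that contain leaves form a fan at \<open>w\<close>.
\<close>

lemma card_leaves:
  fixes \<rho> :: "'b \<Rightarrow> nat" and L :: "'b set"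
  assumes finL: "finite L" and RV: "R \<subseteq> V \<times> V" and inj: "inj_on \<rho> V"
    and fans: "\<And>v F. v \<in> V \<Longrightarrow> fan R {u \<in> V. \<rho> u \<le> \<rho> v} r v F \<Longrightarrow> card F \<le> p" and p: "1 \<le> p"
    and root: "dp v = 0" "v \<in> V" "v \<notin> L"
    and T: "L \<subseteq> T" "\<And>t. t \<in> T \<Longrightarrow> t \<noteq> v \<Longrightarrow> \<pi> t \<in> T - L \<and> dp t = Suc (dp (\<pi> t)) \<and> (\<pi> t, t) \<in> R"
    and dp: "\<And>t. t \<in> T \<Longrightarrow> dp t \<le> r"
    and \<rho>L: "\<And>t. t \<in> L \<Longrightarrow> \<rho> t < \<rho> v" and \<rho>T: "\<And>t. t \<in> T - L \<Longrightarrow> \<rho> v \<le> \<rho> t"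
    and w: "w \<in> T - L" "w \<in> V"
  shows "card {u \<in> L. dp w \<le> dp u \<and> (\<pi> ^^ (dp u - dp w)) u = w} \<le> p ^ (r - dp w)"
  using w
proof (induction "r - dp w" arbitrary: w rule: less_induct)
  case less
  let ?Lf = "\<lambda>w. {u \<in> L. dp w \<le> dp u \<and> (\<pi> ^^ (dp u - dp w)) u = w}"
  have anc: "(\<pi> ^^ i) t \<in> T \<and> dp ((\<pi> ^^ i) t) = dp t - i \<and> (0 < i \<longrightarrow> (\<pi> ^^ i) t \<notin> L)"
    if "t \<in> T" "i \<le> dp t" for t i
    using that(2)
  proof (induction i)
    case (Suc i)
    then have IH: "(\<pi> ^^ i) t \<in> T" "dp ((\<pi> ^^ i) t) = dp t - i" by auto
    then have "(\<pi> ^^ i) t \<noteq> v" using root(1) Suc.prems by auto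
    from T(2)[OF IH(1) this] show ?case using IH(2) by auto
  qed (use that in auto)
  have anc_edge: "((\<pi> ^^ Suc i) t, (\<pi> ^^ i) t) \<in> R" if "t \<in> T" "i < dp t" for t i
  proof -
    have *: "(\<pi> ^^ i) t \<in> T" "dp ((\<pi> ^^ i) t) = dp t - i" using anc[OF that(1), of i] that(2) by auto
    then have "(\<pi> ^^ i) t \<noteq> v" using root(1) that(2) by auto
    from T(2)[OF *(1) this] show ?thesis by simp
  qed
  have gt: "dp w < dp u" if "u \<in> ?Lf w" for u
  proof -
    have "u \<noteq> w" using that less.prems by auto
    then show ?thesis using that by (cases "dp u = dp w") auto
  qed
  \<comment> \<open>\<open>ch u\<close> is the child of \<open>w\<close> on the tree path to the
    leaf \<open>u\<close>; it remains to count the children and the leaves below each of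
    them.\<close>
  define ch where "ch u = (\<pi> ^^ (dp u - Suc (dp w))) u" for u
  have ch: "ch u \<in> T" "dp (ch u) = Suc (dp w)" if "u \<in> ?Lf w" for u
    using anc[of u "dp u - Suc (dp w)"] gt[OF that] that T(1) by (auto simp: ch_def)
  have "card {u \<in> ?Lf w. ch u = c} \<le> p ^ (r - Suc (dp w))" if c: "c \<in> ch ` ?Lf w" for c
  proof -
    obtain u0 where u0: "u0 \<in> ?Lf w" "c = ch u0" using c by blast
    have cT: "c \<in> T" "dp c = Suc (dp w)" using ch[OF u0(1)] u0(2) by auto
    show ?thesis
    proof (cases "c \<in> L")
      case True
      have "u = c" if "u \<in> ?Lf w" "ch u = c" for u
      proof (cases "dp u = Suc (dp w)")
        case False
        then have "0 < dp u - Suc (dp w)" using gt[OF that(1)] by simp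
        then have "ch u \<notin> L" using anc[of u "dp u - Suc (dp w)"] that T(1) by (auto simp: ch_def)
        then show ?thesis using True that by simp
      qed (use that in \<open>simp add: ch_def\<close>)
      then have "{u \<in> ?Lf w. ch u = c} \<subseteq> {c}" by blast
      then have "card {u \<in> ?Lf w. ch u = c} \<le> 1" using card_mono[of "{c}"] by fastforce
      then show ?thesis using p by (meson le_trans one_le_power)
    next
      case False
      have "c \<noteq> v" using cT(2) root(1) by auto
      then have "c \<in> V" using T(2)[OF cT(1)] RV by blast
      moreover have "r - dp c < r - dp w" using dp[OF cT(1)] cT(2) by simp
      ultimately have "card (?Lf c) \<le> p ^ (r - dp c)" using less.hyps[of c] cT(1) False by blast
      moreover have "{u \<in> ?Lf w. ch u = c} \<subseteq> ?Lf c"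
      proof
        fix x assume x: "x \<in> {u \<in> ?Lf w. ch u = c}"
        then have "dp w < dp x" using gt[of x] by blast
        then show "x \<in> ?Lf c" using x unfolding cT(2) ch_def by simp
      qed
      moreover have "finite (?Lf c)" using finL by simp
      ultimately show ?thesis unfolding cT(2) by (meson card_mono le_trans)
    qed
  qed
  then have "card (?Lf w) \<le> p ^ (r - Suc (dp w)) * card (ch ` ?Lf w)"
    using finL by (intro card_le_if_fibres_le[of _ ch]) auto
  also have "card (ch ` ?Lf w) \<le> p"
  proof -
    define u where "u c = (SOME u. u \<in> ?Lf w \<and> ch u = c)" for c
    have u: "u c \<in> ?Lf w" "ch (u c) = c" if "c \<in> ch ` ?Lf w" for c
      using someI_ex[of "\<lambda>u. u \<in> ?Lf w \<and> ch u = c"] that unfolding u_def by blast+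
    define m where "m c = dp (u c) - dp w" for c
    define f where "f c i = (\<pi> ^^ (m c - i)) (u c)" for c i
    \<comment> \<open>The path to the leaf is cut at its first vertex below \<open>w\<close>, not
      below \<open>v\<close>: inner vertices of the tree are only known to be at least as high as
      \<open>v\<close>, and a fan at \<open>w\<close> may end anywhere below \<open>w\<close>. The
      cut exists because the leaf itself is below \<open>v\<close>.\<close>
    define j where "j c = (LEAST i. \<rho> (f c i) < \<rho> w)" for c
    define zs where "zs c = map (f c) [1..<Suc (j c)]" for c
    let ?Ch = "ch ` ?Lf w"
    have uT: "u c \<in> T" and m_pos: "0 < m c" and m_le: "m c \<le> dp (u c)" and dpu: "dp (u c) = dp w + m c"
      if "c \<in> ?Ch" for c
      using u(1)[OF that] gt[OF u(1)[OF that]] T(1) by (auto simp: m_def)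
    have \<rho>w: "\<rho> v \<le> \<rho> w" by (rule \<rho>T[OF less.prems(1)])
    have f0: "f c 0 = w" and fm: "f c (m c) = u c" if "c \<in> ?Ch" for c
      using u(1)[OF that] by (auto simp: f_def m_def)
    have fT: "f c i \<in> T" "dp (f c i) = dp w + i" if "c \<in> ?Ch" "i \<le> m c" for c i
      using anc[OF uT[OF that(1)], of "m c - i"] m_le[OF that(1)] dpu[OF that(1)] that(2)
      by (auto simp: f_def)
    have fE: "(f c i, f c (Suc i)) \<in> R" if "c \<in> ?Ch" "i < m c" for c i
    proof -
      have "m c - i = Suc (m c - Suc i)" using that(2) by simp
      then show ?thesis
        using anc_edge[OF uT[OF that(1)], of "m c - Suc i"] dpu[OF that(1)] that(2) m_pos[OF that(1)]
        unfolding f_def by simp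
    qed
    have fch: "(\<pi> ^^ (i - 1)) (f c i) = c" if "c \<in> ?Ch" "1 \<le> i" "i \<le> m c" for c i
    proof -
      have "(\<pi> ^^ (i - 1)) (f c i) = (\<pi> ^^ (i - 1 + (m c - i))) (u c)" by (simp add: f_def funpow_add)
      also have "i - 1 + (m c - i) = dp (u c) - Suc (dp w)" using that dpu[OF that(1)] by simp
      finally show ?thesis using u(2)[OF that(1)] by (simp add: ch_def)
    qed
    have jm: "\<rho> (f c (j c)) < \<rho> w" "j c \<le> m c" "0 < j c" if "c \<in> ?Ch" for c
    proof -
      have "\<rho> (f c (m c)) < \<rho> w" using \<rho>L[of "u c"] u(1)[OF that] fm[OF that] \<rho>w by simp
      then show "\<rho> (f c (j c)) < \<rho> w" "j c \<le> m c" unfolding j_def by (rule LeastI, rule Least_le)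
      then show "0 < j c" using f0[OF that] by (cases "j c") auto
    qed
    have zs_mem: "\<exists>i. 1 \<le> i \<and> i \<le> m c \<and> x = f c i" if "c \<in> ?Ch" "x \<in> set (zs c)" for c x
      using that(2) jm(2)[OF that(1)] by (auto simp: zs_def)
    have zs_ch: "(\<pi> ^^ (dp x - Suc (dp w))) x = c" "x \<noteq> w" if c: "c \<in> ?Ch" "x \<in> set (zs c)" for c x
    proof -
      obtain i where i: "1 \<le> i" "i \<le> m c" "x = f c i" using zs_mem[OF c] by blast
      then show "(\<pi> ^^ (dp x - Suc (dp w))) x = c" using fch[OF c(1)] fT(2)[OF c(1) i(2)] by simp
      show "x \<noteq> w" using fT(2)[OF c(1) i(2)] i by auto
    qed
    have walk_map: "walk R (map g [a..<b])" if "\<And>i. a \<le> i \<Longrightarrow> Suc i < b \<Longrightarrow> (g i, g (Suc i)) \<in> R" for g a b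
      using that
    proof (induction b)
      case (Suc b)
      show ?case
      proof (cases "a < b")
        case True
        then obtain b' where b': "b = Suc b'" "a \<le> b'" by (cases b) auto
        have "walk R (map g [a..<b])" using Suc by simp
        moreover have "(g b', g b) \<in> R" using Suc.prems[of b'] b' by simp
        moreover have "last (map g [a..<b]) = g b'" using b' by simp
        ultimately show ?thesis using True by (auto simp: successively_append_iff)
      qed (cases "a = b"; simp)
    qed simp
    have fan: "fan R {u \<in> V. \<rho> u \<le> \<rho> w} r w (zs ` ?Ch)"
      unfolding fan_def
    proof (intro conjI ballI impI)
      show "finite (zs ` ?Ch)" using finL by simp
      fix z assume "z \<in> zs ` ?Ch"
      then obtain c where c: "c \<in> ?Ch" "z = zs c" by blast
      show "z \<noteq> []" using jm(3)[OF c(1)] c(2) by (simp add: zs_def)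
      have "walk R (map (f c) [0..<Suc (j c)])"
        using fE[OF c(1)] jm(2)[OF c(1)] by (intro walk_map) auto
      moreover have "map (f c) [0..<Suc (j c)] = w # zs c"
        using f0[OF c(1)] unfolding zs_def by (subst upt_conv_Cons) auto
      ultimately show "walk R (w # z)" using c(2) by simp
      have lst: "last z = f c (j c)" using c(2) jm(3)[OF c(1)] by (simp add: zs_def)
      have "(f c (j c - 1), f c (Suc (j c - 1))) \<in> R"
        using fE[OF c(1), of "j c - 1"] jm[OF c(1)] by simp
      then have "f c (j c) \<in> V" using RV jm(3)[OF c(1)] by auto
      then show "last z \<in> {u \<in> V. \<rho> u \<le> \<rho> w}" using lst jm(1)[OF c(1)] by simp
      show "w \<notin> set z" using zs_ch(2)[OF c(1)] c(2) by blast
      have "dp (f c (m c)) \<le> r" using fT(1)[OF c(1), of "m c"] dp by simp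
      then show "length z \<le> r" using fT(2)[OF c(1), of "m c"] jm(2)[OF c(1)] c(2) by (simp add: zs_def)
      fix z' assume "z' \<in> zs ` ?Ch" and ne: "z \<noteq> z'"
      then obtain c' where c': "c' \<in> ?Ch" "z' = zs c'" by blast
      show "set z \<inter> set z' = {}"
      proof (rule ccontr)
        assume "set z \<inter> set z' \<noteq> {}"
        then obtain x where "x \<in> set z" "x \<in> set z'" by blast
        then have "c = c'" using zs_ch(1)[OF c(1), of x] zs_ch(1)[OF c'(1), of x] c(2) c'(2) by simp
        then show False using ne c c' by simp
      qed
    qed
    have "inj_on zs ?Ch"
    proof (rule inj_onI)
      fix c c' assume c: "c \<in> ?Ch" "c' \<in> ?Ch" "zs c = zs c'"
      have "zs c \<noteq> []" using jm(3)[OF c(1)] by (simp add: zs_def)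
      then have "hd (zs c) \<in> set (zs c)" by simp
      then show "c = c'" using zs_ch(1)[OF c(1)] zs_ch(1)[OF c(2)] c(3) by metis
    qed
    then show ?thesis using fans[OF less.prems(2) fan] by (simp add: card_image)
  qed
  finally have le: "card (?Lf w) \<le> p ^ (r - Suc (dp w)) * p" by simp
  show ?case
  proof (cases "dp w < r")
    case True
    then have "r - dp w = Suc (r - Suc (dp w))" by simp
    then show ?thesis using le by (simp add: mult.commute)
  next
    case False
    have "?Lf w = {}" using gt dp T(1) False by fastforce
    then show ?thesis by (simp only: card.empty)
  qed
qed

text \<open>The inner vertices of the tree are those reached without going below \<open>v\<close>,
  at breadth-first depth at most \<open>r\<close>. The strongly reachable vertices hang off them one
  step deeper, hence \<open>Suc r\<close> levels with one factor \<open>p\<close> each.\<close>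

lemma card_sreach:
  assumes finV: "finite V" and RV: "R \<subseteq> V \<times> V" and inj: "inj_on \<rho> V"
    and fans: "\<And>v F. v \<in> V \<Longrightarrow> fan R {u \<in> V. \<rho> u \<le> \<rho> v} (Suc r) v F \<Longrightarrow> card F \<le> p" and p: "1 \<le> p"
    and v: "v \<in> V"
  shows "card (sreach R \<rho> r v) \<le> p ^ Suc r"
proof -
  let ?R = "restr R {a. \<rho> v \<le> \<rho> a}"
  define L where "L = sreach R \<rho> r v"
  define D where "D = {w. (v, w) \<in> near ?R r}"
  define \<delta> where "\<delta> w = (LEAST m. (v, w) \<in> ?R ^^ m)" for w
  have LV: "L \<subseteq> V" using RV by (auto simp: L_def sreach_def)
  have finL: "finite L" using LV finV finite_subset by blast
  have D\<rho>: "\<rho> v \<le> \<rho> w" if "w \<in> D" for w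
    using that by (cases r) (auto simp: D_def near_Suc_iff2)
  have \<delta>: "(v, w) \<in> ?R ^^ \<delta> w" "\<delta> w \<le> r" if w: "w \<in> D" for w
  proof -
    obtain m where m: "m \<le> r" "(v, w) \<in> ?R ^^ m" using w by (auto simp: D_def near_iff)
    show "(v, w) \<in> ?R ^^ \<delta> w" unfolding \<delta>_def using m(2) by (rule LeastI)
    show "\<delta> w \<le> r" unfolding \<delta>_def using Least_le[of "\<lambda>m. (v, w) \<in> ?R ^^ m", OF m(2)] m(1) by simp
  qed
  have par: "\<exists>w'. w' \<in> D \<and> (w', w) \<in> R \<and> \<delta> w = Suc (\<delta> w')" if w: "w \<in> D" "w \<noteq> v" for w
  proof -
    obtain m where m: "\<delta> w = Suc m" using \<delta>(1)[OF w(1)] w(2) by (cases "\<delta> w") auto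
    then obtain w' where w': "(v, w') \<in> ?R ^^ m" "(w', w) \<in> ?R" using \<delta>(1)[OF w(1)] by auto
    have wD: "w' \<in> D"
      using w'(1) \<delta>(2)[OF w(1)] m unfolding D_def near_iff by (auto intro!: exI[of _ m])
    have "\<delta> w' \<le> m" unfolding \<delta>_def using w'(1) by (rule Least_le)
    moreover have "(v, w) \<in> ?R ^^ Suc (\<delta> w')" using \<delta>(1)[OF wD] w'(2) by auto
    then have "\<delta> w \<le> Suc (\<delta> w')" unfolding \<delta>_def[of w] by (rule Least_le)
    ultimately have "\<delta> w = Suc (\<delta> w')" using m by simp
    then show ?thesis using wD w'(2) by blast
  qed
  have parL: "\<exists>w'. w' \<in> D \<and> (w', u) \<in> R" if "u \<in> L" for u
    using that by (auto simp: L_def sreach_def D_def)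
  \<comment> \<open>A leaf may hang at any inner neighbour: for leaves only the bound on the depth
    matters, not that it is least possible.\<close>
  define \<pi> where "\<pi> t = (if t \<in> L then SOME w'. w' \<in> D \<and> (w', t) \<in> R
     else SOME w'. w' \<in> D \<and> (w', t) \<in> R \<and> \<delta> t = Suc (\<delta> w'))" for t
  define dp where "dp t = (if t \<in> L then Suc (\<delta> (\<pi> t)) else \<delta> t)" for t
  have LD: "L \<inter> D = {}" using D\<rho> by (force simp: L_def sreach_def)
  have \<pi>L: "\<pi> t \<in> D" "(\<pi> t, t) \<in> R" if "t \<in> L" for t
    using someI_ex[OF parL[OF that]] that by (auto simp: \<pi>_def)
  have \<pi>D: "\<pi> t \<in> D" "(\<pi> t, t) \<in> R" "\<delta> t = Suc (\<delta> (\<pi> t))" if "t \<in> D" "t \<noteq> v" for t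
    using someI_ex[OF par[OF that]] LD that by (auto simp: \<pi>_def)
  have vD: "v \<in> D" by (simp add: D_def)
  have \<delta>v: "\<delta> v = 0" unfolding \<delta>_def by (rule Least_eq_0) simp
  have "card {u \<in> L. dp v \<le> dp u \<and> (\<pi> ^^ (dp u - dp v)) u = v} \<le> p ^ (Suc r - dp v)"
  proof (rule card_leaves[where T = "L \<union> D" and V = V and R = R and \<rho> = \<rho>])
    show "\<pi> t \<in> L \<union> D - L \<and> dp t = Suc (dp (\<pi> t)) \<and> (\<pi> t, t) \<in> R" if "t \<in> L \<union> D" "t \<noteq> v" for t
      using that \<pi>L[of t] \<pi>D[of t] LD by (auto simp: dp_def)
    show "dp t \<le> Suc r" if "t \<in> L \<union> D" for t
      using that \<delta>(2)[of t] \<delta>(2)[OF \<pi>L(1)[of t]] by (auto simp: dp_def)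
  qed (use finL RV inj fans p v vD LD D\<rho> \<delta>v in \<open>auto simp: dp_def L_def sreach_def\<close>)
  moreover have "(\<pi> ^^ (dp u)) u = v" if "u \<in> L" for u
  proof -
    have *: "(\<pi> ^^ (\<delta> t)) t = v" if "t \<in> D" for t
      using that
    proof (induction "\<delta> t" arbitrary: t)
      case 0
      then show ?case using \<delta>(1)[OF 0(2)] by auto
    next
      case (Suc n)
      then have "t \<noteq> v" using \<delta>v by auto
      then show ?case using Suc \<pi>D[OF Suc.prems] by (metis comp_apply funpow_Suc_right nat.inject)
    qed
    show ?thesis using *[OF \<pi>L(1)[OF that]] that by (simp add: dp_def funpow_swap1)
  qed
  moreover have dpv: "dp v = 0" using LD vD \<delta>v by (auto simp: dp_def)
  ultimately have "card {u \<in> L. True} \<le> p ^ Suc r" by (simp cong: conj_cong)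
  then show ?thesis by (simp add: L_def)
qed

text \<open>The first vertex below \<open>x\<close> on a walk to \<open>u\<close> is strongly
  reachable from \<open>x\<close>, and the rest of the walk is shorter and shows \<open>u\<close> as
  a hub of that vertex. With a(n) for the largest size at range n, this is the recursion a(n+1)
  \<le> 1 + s a(n).\<close>

lemma card_wreach:
  assumes finV: "finite V" and RV: "R \<subseteq> V \<times> V" and sreach: "\<And>v. v \<in> V \<Longrightarrow> card (sreach R \<rho> r v) \<le> s"
    and inj: "inj_on \<rho> V" and "n \<le> Suc r" "x \<in> V"
  shows "card (wreach R \<rho> n x) \<le> (s + 1) ^ n"
  using assms(5,6)
proof (induction n arbitrary: x)
  case (Suc n)
  have sV: "sreach R \<rho> r x \<subseteq> V" using RV by (auto simp: sreach_def)
  then have finS: "finite (sreach R \<rho> r x)" using finV finite_subset by blast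
  have "wreach R \<rho> (Suc n) x \<subseteq> insert x (\<Union>y\<in>sreach R \<rho> r x. wreach R \<rho> n y)"
  proof
    fix u assume u: "u \<in> wreach R \<rho> (Suc n) x"
    show "u \<in> insert x (\<Union>y\<in>sreach R \<rho> r x. wreach R \<rho> n y)"
    proof (cases "u = x")
      case False
      let ?R = "restr R {a. \<rho> u \<le> \<rho> a}"
      obtain m where m: "m \<le> Suc n" "(x, u) \<in> ?R ^^ m" using u by (auto simp: wreach_def near_iff)
      then obtain f where f: "f 0 = x" "f m = u" "\<And>i. i < m \<Longrightarrow> (f i, f (Suc i)) \<in> ?R"
        unfolding relpow_fun_conv by blast
      have "u \<in> V" using u wreach_subset[OF RV Suc.prems(2)] by blast
      then have "\<rho> u < \<rho> x"
        using wreach_le[OF u] False inj Suc.prems(2) by (metis inj_onD le_neq_implies_less)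
      then have fm: "\<rho> (f m) < \<rho> x" using f by simp
      define j where "j = (LEAST i. \<rho> (f i) < \<rho> x)"
      have j: "\<rho> (f j) < \<rho> x" "j \<le> m" unfolding j_def using fm by (rule LeastI, rule Least_le)
      have j_min: "\<rho> x \<le> \<rho> (f i)" if "i < j" for i using not_less_Least[of i] that unfolding j_def by (meson not_le)
      obtain j' where j': "j = Suc j'" using j(1) f(1) by (cases j) auto
      have "(x, f j') \<in> restr R {a. \<rho> x \<le> \<rho> a} ^^ j'"
        unfolding relpow_fun_conv using f j_min j j' by (intro exI[of _ f]) auto
      then have "(x, f j') \<in> near (restr R {a. \<rho> x \<le> \<rho> a}) r"
        unfolding near_iff using j j' m Suc.prems by (intro exI[of _ j']) auto
      moreover have "(f j', f j) \<in> R" using f(3)[of j'] j j' by simp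
      ultimately have s: "f j \<in> sreach R \<rho> r x" using j(1) by (auto simp: sreach_def)
      have "(f j, u) \<in> ?R ^^ (m - j)"
        unfolding relpow_fun_conv using f j by (intro exI[of _ "\<lambda>i. f (j + i)"]) auto
      then have "u \<in> wreach R \<rho> n (f j)"
        unfolding wreach_def near_iff using j j' m(1) by (auto intro!: exI[of _ "m - j"])
      then show ?thesis using s by blast
    qed simp
  qed
  moreover have finW: "finite (wreach R \<rho> n y)" if "y \<in> V" for y
    by (rule finite_subset[OF wreach_subset[OF RV that] finV])
  ultimately have "card (wreach R \<rho> (Suc n) x) \<le> card (insert x (\<Union>y\<in>sreach R \<rho> r x. wreach R \<rho> n y))"
    using finS sV by (intro card_mono) auto
  also have "\<dots> \<le> Suc (card (\<Union>y\<in>sreach R \<rho> r x. wreach R \<rho> n y))" by (rule card_insert_le_m1) simp_all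
  also have "card (\<Union>y\<in>sreach R \<rho> r x. wreach R \<rho> n y) \<le> (\<Sum>y\<in>sreach R \<rho> r x. card (wreach R \<rho> n y))"
    by (rule card_UN_le[OF finS])
  also have "\<dots> \<le> (\<Sum>y\<in>sreach R \<rho> r x. (s + 1) ^ n)" using Suc sV by (intro sum_mono) auto
  also have "\<dots> \<le> s * (s + 1) ^ n" using sreach[OF Suc.prems(2)] by simp
  finally show ?case by (simp add: le_trans Suc_le_eq less_Suc_eq_le)
qed simp

lemma ex_wreach_order:
  assumes finV: "finite V" and RV: "R \<subseteq> V \<times> V" and symR: "sym R"
    and dens: "shallow_density R V (2 * Suc r) d"
  shows "\<exists>\<rho> :: 'b \<Rightarrow> nat. inj_on \<rho> V \<and>
    (\<forall>x\<in>V. card (wreach R \<rho> r x) \<le> ((d * (1 + 2 * Suc r * d) * (d + 1) + 1) ^ Suc r + 1) ^ r)"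
proof -
  define p where "p = d * (1 + 2 * Suc r * d) * (d + 1)"
  obtain \<rho> :: "'b \<Rightarrow> nat" where \<rho>: "inj_on \<rho> V"
    "\<And>v F. v \<in> V \<Longrightarrow> fan R {u \<in> V. \<rho> u \<le> \<rho> v} (Suc r) v F \<Longrightarrow> card F \<le> p"
    using ex_admissible_order[OF finV RV symR dens p_def] by blast
  \<comment> \<open>\<open>card_sreach\<close> asks for a positive bound on the fans, hence
    \<open>p + 1\<close>.\<close>
  have "card (sreach R \<rho> r v) \<le> (p + 1) ^ Suc r" if "v \<in> V" for v
  proof (rule card_sreach[OF finV RV \<rho>(1) _ _ that])
    fix v F assume "v \<in> V" "fan R {u \<in> V. \<rho> u \<le> \<rho> v} (Suc r) v F"
    from \<rho>(2)[OF this] show "card F \<le> p + 1" by simp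
  qed simp
  then have "card (wreach R \<rho> r x) \<le> ((p + 1) ^ Suc r + 1) ^ r" if "x \<in> V" for x
    using card_wreach[OF finV RV _ \<rho>(1) _ that, where n = r and r = r] by simp
  then show ?thesis using \<rho>(1) unfolding p_def by blast
qed

lemma bounded_expansion_order:
  fixes \<D> :: "'a pair_pre_digraph set"
  assumes "bounded_expansion \<D>" "graph_class \<D>"
  shows "\<exists>k. \<forall>G\<in>\<D>. \<exists>\<rho> :: 'a \<Rightarrow> nat. inj_on \<rho> (pverts G) \<and>
    (\<forall>x\<in>pverts G. card (wreach (parcs G) \<rho> r x) \<le> k)"
proof -
  obtain d where d: "\<And>G. G \<in> \<D> \<Longrightarrow> shallow_density (parcs G) (pverts G) (2 * Suc r) d"
    using bounded_expansion_density[OF assms] by blast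
  have "\<exists>\<rho> :: 'a \<Rightarrow> nat. inj_on \<rho> (pverts G) \<and>
      (\<forall>x\<in>pverts G. card (wreach (parcs G) \<rho> r x) \<le> ((d * (1 + 2 * Suc r * d) * (d + 1) + 1) ^ Suc r + 1) ^ r)"
    if G: "G \<in> \<D>" for G
  proof -
    have "pair_graph G" using assms(2) G by (auto simp: graph_class_def)
    then show ?thesis using ex_wreach_order[OF _ _ _ d[OF G]] by (auto simp: pair_graph_iff)
  qed
  then show ?thesis by blast
qed

section \<open>Bounded expansion from clusters\<close>

lemma near_map:
  assumes "(x, y) \<in> near R n" and step: "\<And>a b. (a, b) \<in> R \<Longrightarrow> (c a, c b) \<in> near R' m"
  shows "(c x, c y) \<in> near R' (n * m)"
  using assms(1)
proof (induction n arbitrary: y)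
  case (Suc n)
  show ?case
  proof (cases "x = y")
    case False
    then obtain z where z: "(x, z) \<in> near R n" "(z, y) \<in> R" using Suc.prems by (auto simp: near_Suc_iff2)
    show ?thesis using near_trans[OF Suc.IH[OF z(1)] step[OF z(2)]] by (simp add: add.commute)
  qed simp
qed simp

text \<open>
  Every vertex \<open>g\<close> of \<open>G'\<close> outside \<open>Z\<close> has a centre \<open>c g\<close> in \<open>G\<close>, and the clusters
  \<open>{w. c g \<in> wreach R \<rho> n w}\<close> of adjacent vertices intersect.
\<close>

definition clustered ::
  "nat \<Rightarrow> nat \<Rightarrow> nat \<Rightarrow> 'a pair_pre_digraph \<Rightarrow> 'a pair_pre_digraph \<Rightarrow> bool" where
  "clustered n k T G G' \<longleftrightarrow> (\<exists>(\<rho> :: 'a \<Rightarrow> nat) c Z.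
     (\<forall>w\<in>pverts G. card (wreach (parcs G) \<rho> n w) \<le> k) \<and> Z \<subseteq> pverts G' \<and> card Z \<le> T \<and>
     c ` (pverts G' - Z) \<subseteq> pverts G \<and> (\<forall>u\<in>pverts G. card {g \<in> pverts G' - Z. c g = u} \<le> T) \<and>
     (\<forall>(g, g')\<in>parcs G'. g \<notin> Z \<longrightarrow> g' \<notin> Z \<longrightarrow>
        (\<exists>w\<in>pverts G. c g \<in> wreach (parcs G) \<rho> n w \<and> c g' \<in> wreach (parcs G) \<rho> n w)))"

text \<open>A branch set avoiding \<open>Z\<close> is replaced by the union \<open>Y v\<close> of
  the clusters of its vertices. This set is connected in \<open>G\<close> with radius at most
  \<open>e\<close>: each step of \<open>G'\<close> moves the centre by at most \<open>2 * n\<close>,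
  and a last \<open>n\<close> reaches any vertex of a cluster. If two branch sets are adjacent,
  their sets \<open>Y\<close> intersect, and the lower of their \<open>\<rho>'\<close>-least
  vertices \<open>m\<close> is a hub of the other at range \<open>4 * e\<close>. The order
  \<open>\<rho>\<close> of the clusters and the order \<open>\<rho>'\<close> that counts serve
  different ranges.\<close>

lemma card_minor_le:
  fixes G G' H :: "'a pair_pre_digraph" and \<rho>' :: "'a \<Rightarrow> nat"
  assumes G: "pair_graph G" and G': "pair_graph G'" and cl: "clustered n k T G G'"
    and sm: "shallow_minor q H G'"
    and e: "e = q * (2 * n) + n"
    and \<rho>': "\<And>x. x \<in> pverts G \<Longrightarrow> card (wreach (parcs G) \<rho>' (4 * e) x) \<le> k'"
  shows "card (edges H) \<le> (2 * (T * k * k') + 2 * T) * card (pverts H)"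
proof -
  let ?V = "pverts G" and ?R = "parcs G" and ?V' = "pverts G'" and ?R' = "parcs G'" and ?I = "pverts H"
  note Gf = G[unfolded pair_graph_iff] and G'f = G'[unfolded pair_graph_iff]
  have symR: "sym ?R" and RV: "?R \<subseteq> ?V \<times> ?V" and finV: "finite ?V" and finV': "finite ?V'" using Gf G'f by auto
  have H: "pair_graph H" using sm by (simp add: shallow_minor_def)
  note Hf = H[unfolded pair_graph_iff]
  have finI: "finite ?I" using Hf by blast
  obtain \<rho> c Z where \<rho>0: "\<forall>w\<in>?V. card (wreach ?R \<rho> n w) \<le> k" and Z: "Z \<subseteq> ?V'" "card Z \<le> T"
    and c0: "c ` (?V' - Z) \<subseteq> ?V" "\<forall>u\<in>?V. card {g \<in> ?V' - Z. c g = u} \<le> T"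
    and adj0: "\<forall>(g, g')\<in>?R'. g \<notin> Z \<longrightarrow> g' \<notin> Z \<longrightarrow>
        (\<exists>w\<in>?V. c g \<in> wreach ?R \<rho> n w \<and> c g' \<in> wreach ?R \<rho> n w)"
    using cl unfolding clustered_def by (elim exE conjE) (rule that)
  have \<rho>: "card (wreach ?R \<rho> n w) \<le> k" if "w \<in> ?V" for w using \<rho>0 that by blast
  have c: "c g \<in> ?V" if "g \<in> ?V' - Z" for g using c0(1) that by blast
  have c2: "card {g \<in> ?V' - Z. c g = u} \<le> T" if "u \<in> ?V" for u using c0(2) that by blast
  have adj: "\<exists>w\<in>?V. c g \<in> wreach ?R \<rho> n w \<and> c g' \<in> wreach ?R \<rho> n w"
    if "(g, g') \<in> ?R'" "g \<notin> Z" "g' \<notin> Z" for g g'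
    using adj0 that by blast
  obtain B z where B: "\<And>v. v \<in> ?I \<Longrightarrow> z v \<in> B v \<and> B v \<subseteq> ?V' \<and> (\<forall>w\<in>B v. (z v, w) \<in> near (restr ?R' (B v)) q)"
    and Bd: "\<And>u v. u \<in> ?I \<Longrightarrow> v \<in> ?I \<Longrightarrow> u \<noteq> v \<Longrightarrow> B u \<inter> B v = {}"
    and Be: "\<And>u v. (u, v) \<in> parcs H \<Longrightarrow> \<exists>x\<in>B u. \<exists>y\<in>B v. (x, y) \<in> ?R'"
    by (rule shallow_minor_balls[OF sm G'], rule that)
  define X where "X g = {w \<in> ?V. c g \<in> wreach ?R \<rho> n w}" for g
  define I0 where "I0 = {v \<in> ?I. B v \<inter> Z = {}}"
  define Y where "Y v = (\<Union>g\<in>B v. X g)" for v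
  have XV: "X g \<subseteq> ?V" for g by (auto simp: X_def)
  have YV: "Y v \<subseteq> ?V" for v using XV by (auto simp: Y_def)
  have Xc: "(w, c g) \<in> near (restr ?R (X g)) n" if "w \<in> X g" for g w
  proof -
    have "(w, c g) \<in> near (restr ?R {w. c g \<in> wreach ?R \<rho> n w}) n"
      using that by (intro wreach_cluster) (simp add: X_def)
    then show ?thesis by (rule near_mono) (use RV in \<open>auto simp: X_def\<close>)
  qed
  have XY: "(w, c g) \<in> near (restr ?R (Y v)) n" "(c g, w) \<in> near (restr ?R (Y v)) n" if "g \<in> B v" "w \<in> X g" for g v w
  proof -
    show "(w, c g) \<in> near (restr ?R (Y v)) n"
      by (rule near_mono[OF Xc[OF that(2)]]) (use that(1) in \<open>auto simp: Y_def\<close>)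
    then show "(c g, w) \<in> near (restr ?R (Y v)) n" by (rule near_sym[OF sym_restr[OF symR]])
  qed
  have B0: "g \<in> ?V' - Z" if "v \<in> I0" "g \<in> B v" for v g using that B by (auto simp: I0_def)
  have centre: "(c (z v), w) \<in> near (restr ?R (Y v)) e" if v: "v \<in> I0" and w: "w \<in> Y v" for v w
  proof -
    have vI: "v \<in> ?I" using v by (simp add: I0_def)
    obtain g where g: "g \<in> B v" "w \<in> X g" using w by (auto simp: Y_def)
    have "(z v, g) \<in> near (restr ?R' (B v)) q" using B[OF vI] g(1) by blast
    then have "(c (z v), c g) \<in> near (restr ?R (Y v)) (q * (2 * n))"
    proof (rule near_map)
      fix a b assume ab: "(a, b) \<in> restr ?R' (B v)"
      then have ab': "(a, b) \<in> ?R'" "a \<in> B v" "b \<in> B v" by auto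
      then obtain w where "w \<in> X a" "w \<in> X b" using adj[of a b] B0[OF v] by (auto simp: X_def)
      then show "(c a, c b) \<in> near (restr ?R (Y v)) (2 * n)"
        using near_trans[OF XY(2)[OF ab'(2)] XY(1)[OF ab'(3)]] by (simp add: mult_2)
    qed
    then show ?thesis unfolding e using XY(2)[OF g] by (rule near_trans)
  qed
  have pair: "(w, w') \<in> near (restr ?R (Y v)) (2 * e)" if "v \<in> I0" "w \<in> Y v" "w' \<in> Y v" for v w w'
    using near_trans[OF near_sym[OF sym_restr[OF symR] centre[OF that(1,2)]] centre[OF that(1,3)]]
    by (simp add: mult_2)
  have Yne: "Y v \<noteq> {}" if "v \<in> I0" for v
  proof -
    have "z v \<in> B v" using that B by (auto simp: I0_def)
    moreover have "c (z v) \<in> X (z v)" using c[OF B0[OF that \<open>z v \<in> B v\<close>]] by (simp add: X_def)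
    ultimately show ?thesis by (auto simp: Y_def)
  qed
  have "\<exists>x\<in>Y v. \<forall>y\<in>Y v. \<rho>' x \<le> \<rho>' y" if "v \<in> I0" for v
  proof -
    have "finite (Y v)" using YV finV finite_subset by blast
    then have "Min (\<rho>' ` Y v) \<in> \<rho>' ` Y v" using Yne[OF that] by (intro Min_in) auto
    then show ?thesis using \<open>finite (Y v)\<close> by (metis (no_types, lifting) Min_le finite_imageI imageE imageI)
  qed
  then obtain m where m: "\<And>v. v \<in> I0 \<Longrightarrow> m v \<in> Y v" "\<And>v y. v \<in> I0 \<Longrightarrow> y \<in> Y v \<Longrightarrow> \<rho>' (m v) \<le> \<rho>' y"
    by metis
  have mV: "m v \<in> ?V" if "v \<in> I0" for v using m(1)[OF that] YV by blast
  have finW: "finite (wreach ?R r j x)" if "x \<in> ?V" for r j x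
    by (rule finite_subset[OF wreach_subset[OF RV that] finV])
  have finI0: "finite I0" using finI by (simp add: I0_def)
  \<comment> \<open>Each such \<open>v\<close> contributes a vertex of \<open>B v\<close> whose
    cluster contains \<open>x\<close>. These vertices are distinct, their centres are among the at
    most \<open>k\<close> hubs of \<open>x\<close>, and at most \<open>T\<close> of them share a
    centre.\<close>
  have fib: "card {v \<in> I0. m v = x} \<le> T * k" if x: "x \<in> ?V" for x
  proof -
    have "\<exists>g\<in>B v. x \<in> X g" if "v \<in> I0" "m v = x" for v using m(1)[OF that(1)] that(2) by (auto simp: Y_def)
    then obtain h where h: "\<And>v. v \<in> I0 \<Longrightarrow> m v = x \<Longrightarrow> h v \<in> B v \<and> x \<in> X (h v)" by metis
    let ?S = "{g \<in> ?V' - Z. c g \<in> wreach ?R \<rho> n x}"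
    have "card {v \<in> I0. m v = x} \<le> card ?S"
    proof (rule card_inj_on_le)
      show "inj_on h {v \<in> I0. m v = x}"
      proof (rule inj_onI)
        fix u v assume uv: "u \<in> {v \<in> I0. m v = x}" "v \<in> {v \<in> I0. m v = x}" "h u = h v"
        then have "h u \<in> B u \<inter> B v" using h[of u] h[of v] by auto
        then show "u = v" using Bd[of u v] uv by (auto simp: I0_def)
      qed
      show "h ` {v \<in> I0. m v = x} \<subseteq> ?S"
        using h B0 by (fastforce simp: X_def)
    qed (use finV' in simp)
    also have "card ?S \<le> T * card (wreach ?R \<rho> n x)"
    proof (rule card_le_if_fibres_le[where f = c])
      fix b assume "b \<in> wreach ?R \<rho> n x"
      then have "b \<in> ?V" using wreach_subset[OF RV x] by blast
      then have "card {g \<in> ?V' - Z. c g = b} \<le> T" by (rule c2)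
      moreover have "{a \<in> ?S. c a = b} \<subseteq> {g \<in> ?V' - Z. c g = b}" by auto
      moreover have "finite {g \<in> ?V' - Z. c g = b}" using finV' by simp
      ultimately show "card {a \<in> ?S. c a = b} \<le> T" by (meson card_mono le_trans)
    qed (use finV' finW[OF x] in auto)
    also have "\<dots> \<le> T * k" using \<rho>[OF x] by simp
    finally show ?thesis .
  qed
  define A1 where "A1 = {(v, u). v \<in> I0 \<and> u \<in> I0 \<and> m u \<in> wreach ?R \<rho>' (4 * e) (m v)}"
  have "A1 = (SIGMA v:I0. {u \<in> I0. m u \<in> wreach ?R \<rho>' (4 * e) (m v)})" by (auto simp: A1_def)
  then have "card A1 = (\<Sum>v\<in>I0. card {u \<in> I0. m u \<in> wreach ?R \<rho>' (4 * e) (m v)})"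
    using finI0 by simp
  also have "\<dots> \<le> (\<Sum>v\<in>I0. T * k * k')"
  proof (rule sum_mono)
    fix v assume v: "v \<in> I0"
    have "card {u \<in> I0. m u \<in> wreach ?R \<rho>' (4 * e) (m v)} \<le> T * k * card (wreach ?R \<rho>' (4 * e) (m v))"
    proof (rule card_le_if_fibres_le[where f = m])
      fix b assume "b \<in> wreach ?R \<rho>' (4 * e) (m v)"
      then have "b \<in> ?V" using wreach_subset[OF RV mV[OF v]] by blast
      have "{a \<in> {u \<in> I0. m u \<in> wreach ?R \<rho>' (4 * e) (m v)}. m a = b} \<subseteq> {v \<in> I0. m v = b}" by auto
      moreover have "finite {v \<in> I0. m v = b}" using finI0 by simp
      ultimately show "card {a \<in> {u \<in> I0. m u \<in> wreach ?R \<rho>' (4 * e) (m v)}. m a = b} \<le> T * k"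
        using fib[OF \<open>b \<in> ?V\<close>] by (meson card_mono le_trans)
    qed (use finI0 finW[OF mV[OF v]] in auto)
    also have "\<dots> \<le> T * k * k'" using \<rho>'[OF mV[OF v]] by simp
    finally show "card {u \<in> I0. m u \<in> wreach ?R \<rho>' (4 * e) (m v)} \<le> T * k * k'" .
  qed
  also have "\<dots> \<le> T * k * k' * card ?I"
    using card_mono[OF finI, of I0] by (simp add: I0_def mult.commute)
  finally have A1: "card A1 \<le> T * k * k' * card ?I" .
  \<comment> \<open>Branch sets are disjoint, so at most \<open>T\<close> of them meet
    \<open>Z\<close>; these are charged with all their possible arcs in both directions.\<close>
  define Bad where "Bad = ?I - I0"
  have Bad: "card Bad \<le> T"
  proof -
    have "\<exists>g. g \<in> B v \<inter> Z" if "v \<in> Bad" for v using that by (auto simp: Bad_def I0_def)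
    then obtain h where h: "\<And>v. v \<in> Bad \<Longrightarrow> h v \<in> B v \<inter> Z" by metis
    have "card Bad \<le> card Z"
    proof (rule card_inj_on_le)
      show "inj_on h Bad"
      proof (rule inj_onI)
        fix u v assume uv: "u \<in> Bad" "v \<in> Bad" "h u = h v"
        then have "h u \<in> B u \<inter> B v" using h[of u] h[of v] by auto
        then show "u = v" using Bd[of u v] uv by (auto simp: Bad_def)
      qed
      show "h ` Bad \<subseteq> Z" using h by auto
      show "finite Z" using Z(1) finV' finite_subset by blast
    qed
    then show ?thesis using Z(2) by simp
  qed
  have "parcs H \<subseteq> (A1 \<union> A1\<inverse>) \<union> (Bad \<times> ?I \<union> ?I \<times> Bad)"
  proof
    fix a assume a: "a \<in> parcs H"
    obtain u v where uv: "a = (u, v)" by (cases a)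
    have I: "u \<in> ?I" "v \<in> ?I" using a uv Hf by auto
    show "a \<in> (A1 \<union> A1\<inverse>) \<union> (Bad \<times> ?I \<union> ?I \<times> Bad)"
    proof (cases "u \<in> I0 \<and> v \<in> I0")
      case True
      obtain x y where xy: "x \<in> B u" "y \<in> B v" "(x, y) \<in> ?R'" using Be a uv by blast
      obtain w where "w \<in> X x" "w \<in> X y" using adj[OF xy(3)] B0[of u x] B0[of v y] True xy by (auto simp: X_def)
      then have w: "w \<in> Y u" "w \<in> Y v" using xy by (auto simp: Y_def)
      \<comment> \<open>From \<open>m v\<close> walk inside \<open>Y v\<close> to the shared vertex
        \<open>w\<close>, then inside \<open>Y u\<close> to \<open>m u\<close>: everything on the
        way lies above the lower of the two minima.\<close>
      have *: "m u \<in> wreach ?R \<rho>' (4 * e) (m v)" if uv: "u \<in> I0" "v \<in> I0" "w \<in> Y u" "w \<in> Y v" "\<rho>' (m u) \<le> \<rho>' (m v)" for u v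
      proof -
        let ?Q = "restr ?R {a. \<rho>' (m u) \<le> \<rho>' a}"
        have "(m v, w) \<in> near (restr ?R (Y v)) (2 * e)" by (rule pair[OF uv(2) m(1)[OF uv(2)] uv(4)])
        then have "(m v, w) \<in> near ?Q (2 * e)"
          by (rule near_mono) (use m(2)[OF uv(2)] uv(5) in \<open>fastforce\<close>)+
        moreover have "(w, m u) \<in> near (restr ?R (Y u)) (2 * e)" by (rule pair[OF uv(1,3) m(1)[OF uv(1)]])
        then have "(w, m u) \<in> near ?Q (2 * e)"
          by (rule near_mono) (use m(2)[OF uv(1)] in \<open>auto\<close>)
        ultimately have "(m v, m u) \<in> near ?Q (2 * e + 2 * e)" by (rule near_trans)
        then show ?thesis by (simp add: wreach_def)
      qed
      have "m u \<in> wreach ?R \<rho>' (4 * e) (m v) \<or> m v \<in> wreach ?R \<rho>' (4 * e) (m u)"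
        using *[of u v] *[of v u] True w by (meson linear)
      then show ?thesis using True uv by (auto simp: A1_def)
    next
      case False
      then show ?thesis using I uv by (auto simp: Bad_def)
    qed
  qed
  moreover have "finite A1" using finI0 by (auto simp: A1_def intro: finite_subset[of _ "I0 \<times> I0"])
  moreover have finB: "finite Bad" using finI by (simp add: Bad_def)
  ultimately have "card (parcs H) \<le> card ((A1 \<union> A1\<inverse>) \<union> (Bad \<times> ?I \<union> ?I \<times> Bad))"
    using finI by (intro card_mono) auto
  also have "\<dots> \<le> (card A1 + card (A1\<inverse>)) + (card (Bad \<times> ?I) + card (?I \<times> Bad))"
    by (meson add_mono card_Un_le le_trans)
  also have "\<dots> \<le> 2 * (T * k * k' * card ?I) + 2 * (T * card ?I)"
  proof -
    have "card Bad * card ?I \<le> T * card ?I" by (rule mult_le_mono1[OF Bad])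
    moreover have "card (Bad \<times> ?I) = card Bad * card ?I" "card (?I \<times> Bad) = card Bad * card ?I"
      by (simp_all add: card_cartesian_product)
    moreover have "card (A1\<inverse>) = card A1" by simp
    ultimately show ?thesis using A1 by linarith
  qed
  finally have "card (parcs H) \<le> (2 * (T * k * k') + 2 * T) * card ?I" by (simp add: algebra_simps)
  moreover have "card (edges H) \<le> card (parcs H)"
  proof -
    have "finite (parcs H)" using Hf finite_subset[of "parcs H" "?I \<times> ?I"] by simp
    then show ?thesis unfolding edges_def by (rule card_image_le)
  qed
  ultimately show ?thesis by linarith
qed

text \<open>The clusters come with one order that is good for range \<open>n\<close>, whereas depth
  \<open>q\<close> needs range \<open>4 * e\<close>; a second order of \<open>G\<close> is therefore
  taken for each \<open>q\<close>.\<close>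

theorem clustered_bounded_expansion:
  fixes \<D> \<D>' :: "'a pair_pre_digraph set"
  assumes BE: "bounded_expansion \<D>" "graph_class \<D>" and gc: "graph_class \<D>'"
    and cl: "\<And>G'. G' \<in> \<D>' \<Longrightarrow> \<exists>G\<in>\<D>. clustered n k T G G'"
  shows "bounded_expansion \<D>'"
proof -
  define bd where "bd q b \<longleftrightarrow> (\<forall>G'\<in>\<D>'. \<forall>H. shallow_minor q H G' \<longrightarrow> card (edges H) \<le> b * card (pverts H))"
    for q b
  have "\<exists>b. bd q b" for q
  proof -
    define e where "e = q * (2 * n) + n"
    obtain k' where k': "\<forall>G\<in>\<D>. \<exists>\<rho> :: 'a \<Rightarrow> nat. inj_on \<rho> (pverts G) \<and>
        (\<forall>x\<in>pverts G. card (wreach (parcs G) \<rho> (4 * e) x) \<le> k')"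
      using bounded_expansion_order[OF BE, of "4 * e"] by (rule exE)
    have "card (edges H) \<le> (2 * (T * k * k') + 2 * T) * card (pverts H)"
      if G': "G' \<in> \<D>'" and H: "shallow_minor q H G'" for G' H
    proof -
      obtain G where G: "G \<in> \<D>" "clustered n k T G G'" using cl[OF G'] by blast
      obtain \<rho> :: "'a \<Rightarrow> nat" where \<rho>: "\<forall>x\<in>pverts G. card (wreach (parcs G) \<rho> (4 * e) x) \<le> k'"
        using k' G(1) by blast
      have "pair_graph G" "pair_graph G'" using BE(2) gc G(1) G' by (auto simp: graph_class_def)
      then show ?thesis by (rule card_minor_le[OF _ _ G(2) H e_def]) (use \<rho> in blast)
    qed
    then show ?thesis unfolding bd_def by blast
  qed
  then obtain b where "\<And>q. bd q (b q)" by metis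
  then have b: "card (edges H) \<le> b q * card (pverts H)" if "G' \<in> \<D>'" "shallow_minor q H G'" for q G' H
    using that unfolding bd_def by blast
  have "real (card (edges H)) / real (card (pverts H)) \<le> real (b q)"
    if "G' \<in> \<D>'" "shallow_minor q H G'" for q G' H
  proof (cases "card (pverts H) = 0")
    case False
    have "real (card (edges H)) \<le> real (b q) * real (card (pverts H))"
      using b[OF that] by (metis of_nat_le_iff of_nat_mult)
    then show ?thesis using False by (simp add: divide_le_eq)
  qed simp
  then show ?thesis unfolding bounded_expansion_def by blast
qed

section \<open>Semantic quantifier elimination\<close>

text \<open>Branch on one set \<open>T z0\<close>. Either it misses \<open>M\<close>, or
  \<open>M\<close> contains some \<open>t\<close> of it; then only sets without \<open>t\<close>
  compete, and \<open>M\<close> without \<open>t\<close> is smaller. There are at most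
  \<open>k\<close> choices of \<open>t\<close>, so the length obeys 1 + k (k+1)^q \<le>
  (k+1)^(q+1).\<close>

lemma representative_family:
  fixes T :: "'z \<Rightarrow> 'b set"
  assumes "\<And>z. z \<in> Z \<Longrightarrow> finite (T z) \<and> card (T z) \<le> k"
  shows "\<exists>zs. length zs \<le> (k + 1) ^ q \<and> set zs \<subseteq> Z \<and>
    (\<forall>M. finite M \<and> card M \<le> q \<and> (\<exists>z\<in>Z. T z \<inter> M = {}) \<longrightarrow> (\<exists>z\<in>set zs. T z \<inter> M = {}))"
  using assms
proof (induction q arbitrary: Z)
  case 0
  show ?case
  proof (cases "Z = {}")
    case False
    then obtain z where "z \<in> Z" by blast
    then show ?thesis by (intro exI[of _ "[z]"]) auto
  qed (auto intro: exI[of _ "[]"])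
next
  case (Suc q)
  show ?case
  proof (cases "Z = {}")
    case False
    then obtain z0 where z0: "z0 \<in> Z" by blast
    define good where "good t zs \<longleftrightarrow> length zs \<le> (k + 1) ^ q \<and> set zs \<subseteq> {z \<in> Z. t \<notin> T z} \<and>
      (\<forall>M. finite M \<and> card M \<le> q \<and> (\<exists>z\<in>{z \<in> Z. t \<notin> T z}. T z \<inter> M = {}) \<longrightarrow>
        (\<exists>z\<in>set zs. T z \<inter> M = {}))" for t zs
    have "\<exists>zs. good t zs" for t
      unfolding good_def using Suc.prems by (intro Suc.IH) auto
    then obtain h where good: "\<And>t. good t (h t)" by metis
    have h: "length (h t) \<le> (k + 1) ^ q" "set (h t) \<subseteq> {z \<in> Z. t \<notin> T z}" for t
      using good[of t] by (simp_all add: good_def)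
    have h3: "\<exists>z\<in>set (h t). T z \<inter> M = {}"
      if "finite M" "card M \<le> q" "\<exists>z\<in>{z \<in> Z. t \<notin> T z}. T z \<inter> M = {}" for t M
      using good[of t] that unfolding good_def by blast
    obtain ts where ts: "set ts = T z0" "distinct ts"
      using Suc.prems[OF z0] finite_distinct_list by metis
    define zs where "zs = z0 # concat (map h ts)"
    have lts: "length ts \<le> k" using Suc.prems[OF z0] ts by (metis distinct_card)
    have "length (concat (map h ts)) \<le> length ts * (k + 1) ^ q"
      using h(1) by (induction ts) (auto intro: add_mono)
    also have "\<dots> \<le> k * (k + 1) ^ q" using lts by simp
    finally have "length zs \<le> (k + 1) ^ Suc q" by (simp add: zs_def Suc_le_eq le_less_trans)
    moreover have "set zs \<subseteq> Z" using z0 h(2) by (auto simp: zs_def)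
    moreover have "\<exists>z\<in>set zs. T z \<inter> M = {}"
      if M: "finite M" "card M \<le> Suc q" "z \<in> Z" "T z \<inter> M = {}" for M z
    proof (cases "T z0 \<inter> M = {}")
      case False
      then obtain t where t: "t \<in> T z0" "t \<in> M" by blast
      have "card (M - {t}) \<le> q" using M t by auto
      then obtain z' where z': "z' \<in> set (h t)" "T z' \<inter> (M - {t}) = {}"
        using h3[of "M - {t}" t] M t by blast
      then have "T z' \<inter> M = {}" using h(2)[of t] by blast
      then show ?thesis using z' t ts by (auto simp: zs_def)
    qed (auto simp: zs_def)
    ultimately show ?thesis by blast
  qed (auto intro: exI[of _ "[]"])
qed

section \<open>Types of tuples in terms of coloured hubs\<close>

locale hub_system =
  fixes V :: "'b set" and R :: "('b \<times> 'b) set" and \<rho> :: "'b \<Rightarrow> nat" and \<chi> :: "'b \<Rightarrow> nat"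
    and N k :: nat
  assumes finite_V: "finite V" and R_V: "R \<subseteq> V \<times> V" and sym_R: "sym R" and inj_\<rho>: "inj_on \<rho> V"
    and \<chi>_less: "x \<in> V \<Longrightarrow> \<chi> x < k"
    and inj_\<chi>: "x \<in> V \<Longrightarrow> inj_on \<chi> (wreach R \<rho> N x)"
begin

abbreviation W :: "nat \<Rightarrow> 'b \<Rightarrow> 'b set" where "W \<equiv> wreach R \<rho>"

text \<open>Among the hubs of one vertex a colour names at most one hub, up to range
  \<open>N\<close>. So this set of colours tells which hubs are shared, in bounded space and without
  mentioning vertices.\<close>

definition pat :: "nat \<Rightarrow> 'b \<Rightarrow> 'b \<Rightarrow> nat set" where
  "pat r x y = \<chi> ` (W r x \<inter> W r y)"

text \<open>Only labels and pairwise patterns are compared, no larger subtuples. The case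
  \<open>i = j\<close> compares the colours of all hubs of a single vertex.\<close>

definition eqtype :: "nat set \<Rightarrow> ('b \<Rightarrow> nat) \<Rightarrow> nat \<Rightarrow> (nat \<Rightarrow> 'b) \<Rightarrow> (nat \<Rightarrow> 'b) \<Rightarrow> bool" where
  "eqtype X l r \<sigma> \<sigma>' \<longleftrightarrow> (\<forall>i\<in>X. l (\<sigma> i) = l (\<sigma>' i)) \<and>
     (\<forall>i\<in>X. \<forall>j\<in>X. pat r (\<sigma> i) (\<sigma> j) = pat r (\<sigma>' i) (\<sigma>' j))"

lemma W_V: "x \<in> V \<Longrightarrow> W r x \<subseteq> V"
  by (rule wreach_subset[OF R_V])

lemma finite_W: "x \<in> V \<Longrightarrow> finite (W r x)"
  by (rule finite_subset[OF W_V finite_V])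

lemma W_mono: "r \<le> s \<Longrightarrow> W r x \<subseteq> W s x"
  by (rule wreach_mono) auto

lemma inj_\<chi>': "x \<in> V \<Longrightarrow> r \<le> N \<Longrightarrow> inj_on \<chi> (W r x)"
  by (rule inj_on_subset[OF inj_\<chi> W_mono])

lemma card_W: "x \<in> V \<Longrightarrow> r \<le> N \<Longrightarrow> card (W r x) \<le> k"
proof -
  assume x: "x \<in> V" "r \<le> N"
  have "card (W r x) = card (\<chi> ` W r x)" using inj_\<chi>'[OF x] by (simp add: card_image)
  also have "\<dots> \<le> card {..<k}" using W_V[OF x(1)] \<chi>_less by (intro card_mono) auto
  finally show ?thesis by simp
qed

lemma \<chi>_eqD: "x \<in> V \<Longrightarrow> r \<le> N \<Longrightarrow> u \<in> W r x \<Longrightarrow> v \<in> W r x \<Longrightarrow> \<chi> u = \<chi> v \<Longrightarrow> u = v"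
  using inj_\<chi>' by (meson inj_onD)

lemma pat_sym: "pat r x y = pat r y x"
  by (auto simp: pat_def)

lemma pat_self: "pat r x x = \<chi> ` W r x"
  by (simp add: pat_def)

text \<open>A colour in the pattern at range \<open>s\<close> names one vertex for both sides; if
  the colour also occurs at range \<open>r\<close> on a side, it is this vertex that occurs there.
  So once hub colours are stored in labels, patterns at a large range determine those at smaller
  ranges.\<close>

lemma pat_restrict:
  assumes "x \<in> V" "y \<in> V" "r \<le> s" "s \<le> N"
  shows "pat r x y = pat s x y \<inter> \<chi> ` W r x \<inter> \<chi> ` W r y"
proof -
  have *: "a \<in> pat r x y" if "a \<in> pat s x y" "a \<in> \<chi> ` W r x" "a \<in> \<chi> ` W r y" for a
  proof -
    obtain u where u1: "u \<in> W r x" "\<chi> u = a" using \<open>a \<in> \<chi> ` W r x\<close> by auto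
    obtain v where v1: "v \<in> W r y" "\<chi> v = a" using \<open>a \<in> \<chi> ` W r y\<close> by auto
    obtain w where w1: "w \<in> W s x" "w \<in> W s y" "\<chi> w = a"
      using \<open>a \<in> pat s x y\<close> by (auto simp: pat_def)
    note u = u1(1) v1(1) w1(1,2) u1(2) v1(2) w1(3)
    have "u \<in> W s x" "v \<in> W s y" using u W_mono[OF assms(3)] by blast+
    then have "u = w" "v = w"
      using \<chi>_eqD[OF assms(1,4), of u w] \<chi>_eqD[OF assms(2,4), of v w] u by simp_all
    then show ?thesis using u by (auto simp: pat_def)
  qed
  have "pat r x y \<subseteq> pat s x y" unfolding pat_def
    using W_mono[OF assms(3)] by (intro image_mono Int_mono)
  moreover have "pat r x y \<subseteq> \<chi> ` W r x" "pat r x y \<subseteq> \<chi> ` W r y" unfolding pat_def by auto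
  ultimately show ?thesis using * by blast
qed

lemma eqtype_sym: "eqtype X l r \<sigma> \<sigma>' \<Longrightarrow> eqtype X l r \<sigma>' \<sigma>"
  by (auto simp: eqtype_def)

lemma eqtype_weaken:
  assumes "eqtype X l s \<sigma> \<sigma>'" "Y \<subseteq> X" "r \<le> s" "s \<le> N"
    and "\<And>x y. x \<in> V \<Longrightarrow> y \<in> V \<Longrightarrow> l x = l y \<Longrightarrow> l' x = l' y \<and> \<chi> ` W r x = \<chi> ` W r y"
    and "\<And>i. i \<in> X \<Longrightarrow> \<sigma> i \<in> V \<and> \<sigma>' i \<in> V"
  shows "eqtype Y l' r \<sigma> \<sigma>'"
  unfolding eqtype_def
proof (intro conjI ballI)
  fix i assume i: "i \<in> Y"
  then have iV: "\<sigma> i \<in> V" "\<sigma>' i \<in> V" "l (\<sigma> i) = l (\<sigma>' i)" using assms by (auto simp: eqtype_def)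
  then show "l' (\<sigma> i) = l' (\<sigma>' i)" using assms(5) by blast
  fix j assume j: "j \<in> Y"
  then have jV: "\<sigma> j \<in> V" "\<sigma>' j \<in> V" "l (\<sigma> j) = l (\<sigma>' j)" using assms by (auto simp: eqtype_def)
  have "pat s (\<sigma> i) (\<sigma> j) = pat s (\<sigma>' i) (\<sigma>' j)" using i j assms(1,2) unfolding eqtype_def by blast
  then show "pat r (\<sigma> i) (\<sigma> j) = pat r (\<sigma>' i) (\<sigma>' j)"
    using pat_restrict[OF iV(1) jV(1) assms(3,4)] pat_restrict[OF iV(2) jV(2) assms(3,4)]
      assms(5)[OF iV] assms(5)[OF jV] by simp
qed

text \<open>
  For the transfer of an existential quantifier, a witness \<open>z\<close> is described over the highest
  vertex \<open>b\<close> that it shares with the parameters: below \<open>b\<close> everything is determined by \<open>b\<close>, and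
  above \<open>b\<close> it has to avoid the parameters, for which it suffices to try a bounded list
  \<open>zs l b\<close> of representatives.
\<close>

definition above :: "'b option \<Rightarrow> nat \<Rightarrow> 'b \<Rightarrow> 'b set" where
  "above b r z = (case b of None \<Rightarrow> W r z | Some b \<Rightarrow> {h \<in> W r z. \<rho> b < \<rho> h})"

definition candidates :: "('b \<Rightarrow> nat) \<Rightarrow> nat \<Rightarrow> nat \<Rightarrow> 'b option \<Rightarrow> 'b set" where
  "candidates l r e b = {z \<in> V. l z = e \<and> (case b of None \<Rightarrow> True | Some b \<Rightarrow> b \<in> W r z)}"

text \<open>What a hub \<open>h\<close> must remember about the representatives: how many there are
  over it, and in which lists and positions it occurs above the anchor \<open>b\<close>. The anchor
  is recorded by its colour only, which keeps the information bounded. Two hubs at range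
  \<open>r\<close> of one vertex, \<open>b\<close> lower than \<open>h\<close>, are related at range
  \<open>2 * r\<close>, which explains that range.\<close>

definition local_info ::
  "(nat \<Rightarrow> 'b option \<Rightarrow> 'b list) \<Rightarrow> nat \<Rightarrow> nat \<Rightarrow> 'b \<Rightarrow>
     (nat \<times> nat) set \<times> (nat \<times> nat \<times> nat) set \<times> (nat \<times> nat) set" where
  "local_info zs K r h =
     ({(e, length (zs e (Some h))) | e. e < K},
      {(e, j, \<chi> b) | e j b. e < K \<and> b \<in> W (2 * r) h \<and> j < length (zs e (Some b)) \<and>
          h \<in> above (Some b) r (zs e (Some b) ! j)},
      {(e, j). e < K \<and> j < length (zs e None) \<and> h \<in> above None r (zs e None ! j)})"

text \<open>A hub \<open>u\<close> of \<open>z\<close> below \<open>b\<close> is reached from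
  \<open>b\<close> at range \<open>2 * r\<close>, hence from \<open>y\<close> at range
  \<open>3 * r\<close>. Whether \<open>x\<close> shares it is then visible in the pattern of
  \<open>x\<close> and \<open>y\<close>. This is why a quantifier triples the range.\<close>

lemma shared_below:
  assumes V: "x \<in> V" "y \<in> V" "x' \<in> V" "y' \<in> V" "z \<in> V" "z' \<in> V" and r: "3 * r \<le> N"
    and b: "b \<in> W r z" "b \<in> W r y" "b' \<in> W r z'" "b' \<in> W r y'" "\<chi> b = \<chi> b'"
    and ord: "{(\<chi> u, \<chi> v) | u v. u \<in> W r z \<and> v \<in> W r z \<and> \<rho> u \<le> \<rho> v} =
       {(\<chi> u, \<chi> v) | u v. u \<in> W r z' \<and> v \<in> W r z' \<and> \<rho> u \<le> \<rho> v}"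
    and col: "\<chi> ` W r x = \<chi> ` W r x'"
    and p: "pat (3 * r) x y = pat (3 * r) x' y'"
    and u: "u \<in> W r z" "u \<in> W r x" "\<rho> u \<le> \<rho> b"
  shows "\<chi> u \<in> pat r z' x'"
proof -
  have "(\<chi> u, \<chi> b) \<in> {(\<chi> u, \<chi> v) | u v. u \<in> W r z \<and> v \<in> W r z \<and> \<rho> u \<le> \<rho> v}"
    using u b by blast
  then obtain u' b2 where u': "u' \<in> W r z'" "b2 \<in> W r z'" "\<rho> u' \<le> \<rho> b2" "\<chi> u' = \<chi> u" "\<chi> b2 = \<chi> b"
    unfolding ord by auto
  have "b2 = b'" using \<chi>_eqD[OF V(6), of r b2 b'] u' b r by auto
  have 2: "u \<in> W (2 * r) b" using wreach_common[OF sym_R b(1) u(1,3)] by (simp add: mult_2)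
  have u3: "u \<in> W (3 * r) y" using wreach_trans[OF b(2) 2] by (simp add: algebra_simps)
  have 2: "u' \<in> W (2 * r) b'"
    using wreach_common[OF sym_R b(3) u'(1)] u' \<open>b2 = b'\<close> by (simp add: mult_2)
  have u3': "u' \<in> W (3 * r) y'" using wreach_trans[OF b(4) 2] by (simp add: algebra_simps)
  have "u \<in> W (3 * r) x" using u(2) W_mono[of r "3 * r" x] by auto
  then have "\<chi> u \<in> pat (3 * r) x y" using u3 by (auto simp: pat_def)
  then obtain e where e: "e \<in> W (3 * r) x'" "e \<in> W (3 * r) y'" "\<chi> e = \<chi> u"
    unfolding p by (auto simp: pat_def)
  have "e = u'" using \<chi>_eqD[OF V(4) r e(2) u3'] e(3) u'(4) by simp
  obtain u2 where u2: "u2 \<in> W r x'" "\<chi> u2 = \<chi> u" using col u(2) by (metis imageE imageI)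
  have "u2 \<in> W (3 * r) x'" using u2(1) W_mono[of r "3 * r" x'] by auto
  then have "u2 = e" using \<chi>_eqD[OF V(3) r _ e(1), of u2] u2 e by simp
  then have "u' \<in> W r z' \<inter> W r x'" using \<open>e = u'\<close> u2 u' by simp
  then show ?thesis unfolding pat_def using u'(4) by (metis imageI)
qed

text \<open>The copy of \<open>z\<close> is the representative with the same label and the same list
  position over the corresponding anchor. The hubs of the parameters carry the marks of
  \<open>local_info\<close>, which agree on both sides, so an unwanted hub shared by the copy would
  be matched by one shared by the original representative.\<close>

lemma exists_transfer:
  assumes X: "finite X" "card X \<le> n" "x0 \<notin> X" and r: "3 * r \<le> N"
    and l: "\<And>x. x \<in> V \<Longrightarrow> l x < K"
    and l_col: "\<And>x y. x \<in> V \<Longrightarrow> y \<in> V \<Longrightarrow> l x = l y \<Longrightarrow> \<chi> ` W r x = \<chi> ` W r y"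
    and l_ord: "\<And>x y. x \<in> V \<Longrightarrow> y \<in> V \<Longrightarrow> l x = l y \<Longrightarrow>
       {(\<chi> u, \<chi> v) | u v. u \<in> W r x \<and> v \<in> W r x \<and> \<rho> u \<le> \<rho> v} =
       {(\<chi> u, \<chi> v) | u v. u \<in> W r y \<and> v \<in> W r y \<and> \<rho> u \<le> \<rho> v}"
    and zs: "\<And>e b. set (zs e b) \<subseteq> candidates l r e b"
      "\<And>e b M. finite M \<Longrightarrow> card M \<le> n * k \<Longrightarrow> (\<exists>z\<in>candidates l r e b. above b r z \<inter> M = {}) \<Longrightarrow>
         (\<exists>z\<in>set (zs e b). above b r z \<inter> M = {})"
    and l': "\<And>x y. x \<in> V \<Longrightarrow> y \<in> V \<Longrightarrow> l' x = l' y \<Longrightarrow> l x = l y \<and>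
       {(\<chi> u, local_info zs K r u) | u. u \<in> W r x} = {(\<chi> u, local_info zs K r u) | u. u \<in> W r y}"
    and \<sigma>: "\<And>i. i \<in> X \<Longrightarrow> \<sigma> i \<in> V \<and> \<sigma>' i \<in> V" and eq: "eqtype X l' (3 * r) \<sigma> \<sigma>'"
    and z: "z \<in> V"
  shows "\<exists>z'\<in>V. eqtype (insert x0 X) l r (\<sigma>(x0 := z)) (\<sigma>'(x0 := z'))"
proof -
  have lab: "l (\<sigma> i) = l (\<sigma>' i)" "\<chi> ` W r (\<sigma> i) = \<chi> ` W r (\<sigma>' i)" if "i \<in> X" for i
    using that eq \<sigma>[OF that] l' l_col unfolding eqtype_def by blast+
  have info: "{(\<chi> u, local_info zs K r u) | u. u \<in> W r (\<sigma> i)} = {(\<chi> u, local_info zs K r u) | u. u \<in> W r (\<sigma>' i)}"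
    if "i \<in> X" for i
    using that eq \<sigma>[OF that] l' unfolding eqtype_def by blast
  have pats: "pat (3 * r) (\<sigma> i) (\<sigma> j) = pat (3 * r) (\<sigma>' i) (\<sigma>' j)" if "i \<in> X" "j \<in> X" for i j
    using that eq unfolding eqtype_def by blast
  have eqX: "eqtype X l r \<sigma> \<sigma>'"
  proof (rule eqtype_weaken[OF eq order_refl _ r])
    show "l x = l y \<and> \<chi> ` W r x = \<chi> ` W r y" if "x \<in> V" "y \<in> V" "l' x = l' y" for x y
      using l'[OF that] l_col[OF that(1,2)] by simp
  qed (use \<sigma> in auto)
  define M where "M = (\<Union>i\<in>X. W r (\<sigma> i))"
  define M' where "M' = (\<Union>i\<in>X. W r (\<sigma>' i))"
  have rN: "r \<le> N" using r by simp
  have MV: "M \<subseteq> V" using \<sigma> W_V by (fastforce simp: M_def)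
  have fM: "finite M" using MV finite_V finite_subset by blast
  have "card M \<le> (\<Sum>i\<in>X. card (W r (\<sigma> i)))" unfolding M_def by (rule card_UN_le[OF X(1)])
  also have "\<dots> \<le> (\<Sum>i\<in>X. k)" using card_W[OF _ rN] \<sigma> by (intro sum_mono) auto
  also have "\<dots> \<le> n * k" using X by simp
  finally have cM: "card M \<le> n * k" .
  have goal: ?thesis if z': "z' \<in> V" "l z' = l z" "\<And>i. i \<in> X \<Longrightarrow> pat r z (\<sigma> i) = pat r z' (\<sigma>' i)" for z'
  proof -
    have "pat r z z = pat r z' z'" using l_col[OF z'(1) z z'(2)] by (simp add: pat_self)
    then have "eqtype (insert x0 X) l r (\<sigma>(x0 := z)) (\<sigma>'(x0 := z'))"
      using eqX X(3) z' unfolding eqtype_def by (auto simp: pat_sym[of r "\<sigma> i" z for i] pat_sym[of r "\<sigma>' i" z' for i])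
    then show ?thesis using z' by blast
  qed
  show ?thesis
  \<comment> \<open>A witness that shares no hub has no anchor; its representatives come from the
    lists for \<open>None\<close>.\<close>
  proof (cases "W r z \<inter> M = {}")
    case True
    have "\<exists>z\<in>candidates l r (l z) None. above None r z \<inter> M = {}"
      using True z by (auto simp: candidates_def above_def)
    then obtain z' where z': "z' \<in> set (zs (l z) None)" "above None r z' \<inter> M = {}"
      using zs(2)[OF fM cM] by blast
    then obtain j where j: "j < length (zs (l z) None)" "zs (l z) None ! j = z'" by (metis in_set_conv_nth)
    have cand: "z' \<in> V" "l z' = l z" using zs(1) z' by (auto simp: candidates_def)
    have "W r z' \<inter> M' = {}"
    proof (rule ccontr)
      assume "W r z' \<inter> M' \<noteq> {}"
      then obtain h' i where h': "h' \<in> W r z'" "i \<in> X" "h' \<in> W r (\<sigma>' i)" by (auto simp: M'_def)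
      have mk: "(l z, j) \<in> snd (snd (local_info zs K r h'))"
        using h' j l[OF z] by (auto simp: local_info_def above_def)
      have "(\<chi> h', local_info zs K r h') \<in> {(\<chi> u, local_info zs K r u) | u. u \<in> W r (\<sigma>' i)}"
        using h' by blast
      then obtain h where h: "h \<in> W r (\<sigma> i)" "local_info zs K r h = local_info zs K r h'"
        unfolding info[OF h'(2), symmetric] by auto
      then have "h \<in> W r z'" using mk j by (auto simp: local_info_def above_def)
      then show False using z' h h'(2) by (auto simp: above_def M_def)
    qed
    then have "pat r z (\<sigma> i) = {}" "pat r z' (\<sigma>' i) = {}" if "i \<in> X" for i
      using that True by (auto simp: pat_def M_def M'_def)
    then show ?thesis using goal[OF cand] by blast
  next
    case False
    let ?B = "W r z \<inter> M"
    have "finite ?B" using fM by simp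
    then have "Max (\<rho> ` ?B) \<in> \<rho> ` ?B" using False by (intro Max_in) auto
    then obtain b where "b \<in> ?B" "\<rho> b = Max (\<rho> ` ?B)" by auto
    then have b: "b \<in> W r z" "b \<in> M" and b_max: "\<And>u. u \<in> ?B \<Longrightarrow> \<rho> u \<le> \<rho> b"
      using \<open>finite ?B\<close> by auto
    obtain i0 where i0: "i0 \<in> X" "b \<in> W r (\<sigma> i0)" using b(2) by (auto simp: M_def)
    have "\<exists>z\<in>candidates l r (l z) (Some b). above (Some b) r z \<inter> M = {}"
      using b b_max z by (intro bexI[of _ z]) (fastforce simp: candidates_def above_def)+
    then obtain y where y: "y \<in> set (zs (l z) (Some b))" "above (Some b) r y \<inter> M = {}"
      using zs(2)[OF fM cM] by blast
    then obtain j where j: "j < length (zs (l z) (Some b))" "zs (l z) (Some b) ! j = y"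
      by (metis in_set_conv_nth)
    have "(\<chi> b, local_info zs K r b) \<in> {(\<chi> u, local_info zs K r u) | u. u \<in> W r (\<sigma> i0)}"
      using i0 by blast
    \<comment> \<open>The hub with the same colour and marks as \<open>b\<close> on the other side.
      Its list of representatives has the same length, so position \<open>j\<close> exists
      there.\<close>
    then obtain b' where b': "b' \<in> W r (\<sigma>' i0)" "\<chi> b' = \<chi> b" "local_info zs K r b' = local_info zs K r b"
      unfolding info[OF i0(1)] by auto
    have "(l z, length (zs (l z) (Some b))) \<in> fst (local_info zs K r b')"
      unfolding b'(3) using l[OF z] by (auto simp: local_info_def)
    then have len: "length (zs (l z) (Some b')) = length (zs (l z) (Some b))"
      by (auto simp: local_info_def)
    define z' where "z' = zs (l z) (Some b') ! j"
    have "z' \<in> set (zs (l z) (Some b'))" using j len by (auto simp: z'_def)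
    then have "z' \<in> candidates l r (l z) (Some b')" using zs(1) by blast
    then have z': "z' \<in> V" "l z' = l z" "b' \<in> W r z'" by (auto simp: candidates_def)
    have avoid: "above (Some b') r z' \<inter> M' = {}"
    proof (rule ccontr)
      assume "above (Some b') r z' \<inter> M' \<noteq> {}"
      then obtain h' i where h': "h' \<in> above (Some b') r z'" "i \<in> X" "h' \<in> W r (\<sigma>' i)"
        by (auto simp: M'_def)
      then have h'W: "h' \<in> W r z'" "\<rho> b' < \<rho> h'" by (auto simp: above_def)
      have b'h': "b' \<in> W (2 * r) h'"
        using wreach_common[OF sym_R h'W(1) z'(3)] h'W by (simp add: mult_2)
      have mk: "(l z, j, \<chi> b) \<in> fst (snd (local_info zs K r h'))"
        using h'(1) j l[OF z] b'h' b'(2)[symmetric] len unfolding local_info_def z'_def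
        by (auto intro!: exI[of _ b'])
      have "(\<chi> h', local_info zs K r h') \<in> {(\<chi> u, local_info zs K r u) | u. u \<in> W r (\<sigma>' i)}"
        using h' by blast
      then obtain h where h: "h \<in> W r (\<sigma> i)" "local_info zs K r h = local_info zs K r h'"
        unfolding info[OF h'(2), symmetric] by auto
      \<comment> \<open>The mark gives the anchor \<open>b2\<close> of \<open>h\<close> by its
        colour only. That \<open>b2\<close> is \<open>b\<close> follows from the pattern of
        \<open>\<sigma> i\<close> and \<open>\<sigma> i0\<close> at range \<open>3 * r\<close>,
        which contains this colour.\<close>
      have mk': "(l z, j, \<chi> b) \<in> fst (snd (local_info zs K r h))" using mk h(2) by simp
      obtain b2 where b2: "b2 \<in> W (2 * r) h" "\<chi> b2 = \<chi> b" "h \<in> above (Some b2) r (zs (l z) (Some b2) ! j)"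
        using mk' unfolding local_info_def by auto
      have "b2 \<in> W (3 * r) (\<sigma> i)" using wreach_trans[OF h(1) b2(1)] by (simp add: algebra_simps)
      moreover have "b' \<in> W (3 * r) (\<sigma>' i)" using wreach_trans[OF h'(3) b'h'] by (simp add: algebra_simps)
      moreover have "b' \<in> W (3 * r) (\<sigma>' i0)" "b \<in> W (3 * r) (\<sigma> i0)"
        using b'(1) i0(2) W_mono[of r "3 * r"] by auto
      ultimately have "\<chi> b' \<in> pat (3 * r) (\<sigma>' i) (\<sigma>' i0)"
        unfolding pat_def by (intro imageI IntI)
      then have "\<chi> b \<in> pat (3 * r) (\<sigma> i) (\<sigma> i0)" using pats[OF h'(2) i0(1)] b'(2) by simp
      then obtain e where e: "e \<in> W (3 * r) (\<sigma> i)" "e \<in> W (3 * r) (\<sigma> i0)" "\<chi> e = \<chi> b"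
        by (auto simp: pat_def)
      have "e = b2" using \<chi>_eqD[OF _ r e(1) \<open>b2 \<in> W (3 * r) (\<sigma> i)\<close>] e b2 \<sigma>[OF h'(2)] by auto
      moreover have "e = b" using \<chi>_eqD[OF _ r e(2) \<open>b \<in> W (3 * r) (\<sigma> i0)\<close>] e \<sigma>[OF i0(1)] by auto
      ultimately have "h \<in> above (Some b) r y" using b2 j by simp
      then show False using y h h'(2) by (auto simp: M_def)
    qed
    \<comment> \<open>Above the anchors neither side shares a hub with the parameters; below them
      \<open>shared_below\<close> transfers shared hubs in both directions.\<close>
    have "pat r z (\<sigma> i) = pat r z' (\<sigma>' i)" if i: "i \<in> X" for i
    proof
      show "pat r z (\<sigma> i) \<subseteq> pat r z' (\<sigma>' i)"
      proof
        fix a assume "a \<in> pat r z (\<sigma> i)"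
        then obtain u where u: "u \<in> W r z" "u \<in> W r (\<sigma> i)" "a = \<chi> u" by (auto simp: pat_def)
        have "\<rho> u \<le> \<rho> b" using b_max u i by (auto simp: M_def)
        then show "a \<in> pat r z' (\<sigma>' i)"
          using shared_below[of "\<sigma> i" "\<sigma> i0" "\<sigma>' i" "\<sigma>' i0" z z' r b b' u] \<sigma>[OF i] \<sigma>[OF i0(1)] z z' r b i0 b'
            l_ord[OF z z'(1)] lab[OF i] pats[OF i i0(1)] u by simp
      qed
      show "pat r z' (\<sigma>' i) \<subseteq> pat r z (\<sigma> i)"
      proof
        fix a assume "a \<in> pat r z' (\<sigma>' i)"
        then obtain u where u: "u \<in> W r z'" "u \<in> W r (\<sigma>' i)" "a = \<chi> u" by (auto simp: pat_def)
        have "\<rho> u \<le> \<rho> b'" using avoid u i by (auto simp: M'_def above_def not_less)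
        then show "a \<in> pat r z (\<sigma> i)"
          using shared_below[of "\<sigma>' i" "\<sigma>' i0" "\<sigma> i" "\<sigma> i0" z' z r b' b u] \<sigma>[OF i] \<sigma>[OF i0(1)] z z' r b i0 b'
            l_ord[OF z'(1) z z'(2)] lab[OF i] pats[OF i i0(1)] u by simp
      qed
    qed
    then show ?thesis using goal[OF z'(1,2)] by blast
  qed
qed

end

section \<open>Elimination by induction on the formula\<close>

definition determined ::
  "'b pair_pre_digraph \<Rightarrow> (nat \<Rightarrow> 'b set) \<Rightarrow> ('b \<times> 'b) set \<Rightarrow> ('b \<Rightarrow> nat) \<Rightarrow> ('b \<Rightarrow> nat) \<Rightarrow>
     fo \<Rightarrow> ('b \<Rightarrow> nat) \<Rightarrow> nat \<Rightarrow> bool" where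
  "determined G P R \<rho> \<chi> \<phi> l r \<longleftrightarrow> (\<forall>\<sigma> \<sigma>'. (\<forall>i\<in>fvars \<phi>. \<sigma> i \<in> pverts G \<and> \<sigma>' i \<in> pverts G) \<longrightarrow>
     hub_system.eqtype R \<rho> \<chi> (fvars \<phi>) l r \<sigma> \<sigma>' \<longrightarrow> sat G P \<sigma> \<phi> = sat G P \<sigma>' \<phi>)"

text \<open>This is what makes atomic formulas determined. Adjacency is that of \<open>G\<close>,
  while patterns are taken in \<open>R\<close>, which may lack edges of \<open>G\<close>; the labels
  have to account for the missing ones.\<close>

definition base_labelling ::
  "'b pair_pre_digraph \<Rightarrow> (nat \<Rightarrow> 'b set) \<Rightarrow> ('b \<times> 'b) set \<Rightarrow> ('b \<Rightarrow> nat) \<Rightarrow> ('b \<Rightarrow> nat) \<Rightarrow>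
     nat set \<Rightarrow> ('b \<Rightarrow> nat) \<Rightarrow> bool" where
  "base_labelling G P R \<rho> \<chi> C l \<longleftrightarrow>
     (\<forall>x\<in>pverts G. \<forall>x'\<in>pverts G. l x = l x' \<longrightarrow> \<chi> x = \<chi> x' \<and> (\<forall>i\<in>C. x \<in> P i \<longleftrightarrow> x' \<in> P i)) \<and>
     (\<forall>x\<in>pverts G. \<forall>y\<in>pverts G. \<forall>x'\<in>pverts G. \<forall>y'\<in>pverts G.
        l x = l x' \<longrightarrow> l y = l y' \<longrightarrow> hub_system.pat R \<rho> \<chi> 1 x y = hub_system.pat R \<rho> \<chi> 1 x' y' \<longrightarrow>
        (x, y) \<in> parcs G \<longleftrightarrow> (x', y') \<in> parcs G)"

lemma finite_fvars: "finite (fvars \<phi>)"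
  by (induction \<phi>) auto

lemma hub_system_mono: "hub_system V R \<rho> \<chi> N k \<Longrightarrow> M \<le> N \<Longrightarrow> hub_system V R \<rho> \<chi> M k"
  unfolding hub_system_def by (meson inj_on_subset order_refl wreach_mono)

text \<open>The order of quantifiers is essential: the range \<open>N\<close> depends on the formula
  only, since the bound \<open>k\<close> on the hubs is known only once the range is fixed. The
  number \<open>K\<close> of labels may then depend on \<open>k\<close>.\<close>

definition eliminable :: "'b itself \<Rightarrow> fo \<Rightarrow> bool" where
  "eliminable _ \<phi> \<longleftrightarrow> (\<exists>N\<ge>1. \<forall>k K0. \<exists>K. \<forall>(G :: 'b pair_pre_digraph) P R \<rho> \<chi> l0.
     hub_system (pverts G) R \<rho> \<chi> N k \<longrightarrow> (\<forall>x\<in>pverts G. l0 x < K0) \<longrightarrow>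
     base_labelling G P R \<rho> \<chi> (colours \<phi>) l0 \<longrightarrow>
     (\<exists>l. (\<forall>x\<in>pverts G. l x < K) \<and> determined G P R \<rho> \<chi> \<phi> l N))"

lemma eliminable_cong:
  assumes "eliminable TYPE('b) \<phi>" "fvars \<psi> = fvars \<phi>" "colours \<psi> = colours \<phi>"
    and "\<And>G P \<sigma>. sat (G :: 'b pair_pre_digraph) P \<sigma> \<psi> \<longleftrightarrow> f (sat G P \<sigma> \<phi>)"
  shows "eliminable TYPE('b) \<psi>"
proof -
  have "determined G P R \<rho> \<chi> \<psi> l r" if "determined G P R \<rho> \<chi> \<phi> l r"
    for G :: "'b pair_pre_digraph" and P R \<rho> \<chi> l r
    unfolding determined_def assms(2) assms(4)
  proof (intro allI impI)
    fix \<sigma> \<sigma>' assume "\<forall>i\<in>fvars \<phi>. \<sigma> i \<in> pverts G \<and> \<sigma>' i \<in> pverts G"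
      "hub_system.eqtype R \<rho> \<chi> (fvars \<phi>) l r \<sigma> \<sigma>'"
    then have "sat G P \<sigma> \<phi> = sat G P \<sigma>' \<phi>" using that unfolding determined_def by blast
    then show "f (sat G P \<sigma> \<phi>) = f (sat G P \<sigma>' \<phi>)" by simp
  qed
  note det = this
  obtain N where N: "N \<ge> 1" "\<And>k K0. \<exists>K. \<forall>(G :: 'b pair_pre_digraph) P R \<rho> \<chi> l0.
     hub_system (pverts G) R \<rho> \<chi> N k \<longrightarrow> (\<forall>x\<in>pverts G. l0 x < K0) \<longrightarrow>
     base_labelling G P R \<rho> \<chi> (colours \<phi>) l0 \<longrightarrow>
     (\<exists>l. (\<forall>x\<in>pverts G. l x < K) \<and> determined G P R \<rho> \<chi> \<phi> l N)"
    using assms(1) unfolding eliminable_def by blast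
  show ?thesis unfolding eliminable_def assms(3)
  proof (rule exI[of _ N], intro conjI allI N(1))
    fix k K0
    obtain K where K: "\<forall>(G :: 'b pair_pre_digraph) P R \<rho> \<chi> l0.
       hub_system (pverts G) R \<rho> \<chi> N k \<longrightarrow> (\<forall>x\<in>pverts G. l0 x < K0) \<longrightarrow>
       base_labelling G P R \<rho> \<chi> (colours \<phi>) l0 \<longrightarrow>
       (\<exists>l. (\<forall>x\<in>pverts G. l x < K) \<and> determined G P R \<rho> \<chi> \<phi> l N)" using N(2)[of k K0] by (rule exE)
    show "\<exists>K. \<forall>(G :: 'b pair_pre_digraph) P R \<rho> \<chi> l0.
       hub_system (pverts G) R \<rho> \<chi> N k \<longrightarrow> (\<forall>x\<in>pverts G. l0 x < K0) \<longrightarrow>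
       base_labelling G P R \<rho> \<chi> (colours \<phi>) l0 \<longrightarrow>
       (\<exists>l. (\<forall>x\<in>pverts G. l x < K) \<and> determined G P R \<rho> \<chi> \<psi> l N)"
      by (rule exI[of _ K]) (use K det in blast)
  qed
qed

lemma eliminable_atom:
  assumes "\<And>(G :: 'b pair_pre_digraph) P R \<rho> \<chi> l k. hub_system (pverts G) R \<rho> \<chi> 1 k \<Longrightarrow>
    base_labelling G P R \<rho> \<chi> (colours \<phi>) l \<Longrightarrow> determined G P R \<rho> \<chi> \<phi> l 1"
  shows "eliminable TYPE('b) \<phi>"
  unfolding eliminable_def using assms by (intro exI[of _ 1]) blast

text \<open>Every vertex is its own hub. So two vertices are equal exactly if they have the same
  colour and this colour lies in their pattern.\<close>

lemma eliminable_Eq: "eliminable TYPE('b) (Eq x y)"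
proof (rule eliminable_atom)
  fix G :: "'b pair_pre_digraph" and P R \<rho> \<chi> l k
  assume "hub_system (pverts G) R \<rho> \<chi> 1 k" and l: "base_labelling G P R \<rho> \<chi> (colours (Eq x y)) l"
  then interpret hub_system "pverts G" R \<rho> \<chi> 1 k by simp
  have *: "\<sigma>' x = \<sigma>' y"
    if V: "\<forall>i\<in>{x, y}. \<sigma> i \<in> pverts G \<and> \<sigma>' i \<in> pverts G" and e: "eqtype {x, y} l 1 \<sigma> \<sigma>'" "\<sigma> x = \<sigma> y" for \<sigma> \<sigma>'
  proof -
    have \<chi>: "\<chi> (\<sigma> x) = \<chi> (\<sigma>' x)" "\<chi> (\<sigma> y) = \<chi> (\<sigma>' y)"
      using l V e(1) unfolding base_labelling_def eqtype_def by blast+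
    have "\<chi> (\<sigma> x) \<in> pat 1 (\<sigma> x) (\<sigma> y)" using e(2) by (auto simp: pat_def)
    then have "\<chi> (\<sigma> x) \<in> pat 1 (\<sigma>' x) (\<sigma>' y)" using e(1) by (simp add: eqtype_def)
    then obtain w where w: "w \<in> W 1 (\<sigma>' x)" "w \<in> W 1 (\<sigma>' y)" "\<chi> w = \<chi> (\<sigma> x)" by (auto simp: pat_def)
    have "w = \<sigma>' x" using \<chi>_eqD[of "\<sigma>' x" 1 w "\<sigma>' x"] V w \<chi> by simp
    moreover have "w = \<sigma>' y" using \<chi>_eqD[of "\<sigma>' y" 1 w "\<sigma>' y"] V w \<chi> e(2) by simp
    ultimately show ?thesis by simp
  qed
  show "determined G P R \<rho> \<chi> (Eq x y) l 1"
    unfolding determined_def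
  proof (intro allI impI)
    fix \<sigma> \<sigma>' assume V: "\<forall>i\<in>fvars (Eq x y). \<sigma> i \<in> pverts G \<and> \<sigma>' i \<in> pverts G"
      and e: "eqtype (fvars (Eq x y)) l 1 \<sigma> \<sigma>'"
    have "\<sigma> x = \<sigma> y \<longleftrightarrow> \<sigma>' x = \<sigma>' y"
      using *[of \<sigma> \<sigma>'] *[of \<sigma>' \<sigma>] eqtype_sym[OF e] V e unfolding fvars.simps by blast
    then show "sat G P \<sigma> (Eq x y) = sat G P \<sigma>' (Eq x y)" by simp
  qed
qed

lemma eliminable_Adj: "eliminable TYPE('b) (Adj x y)"
proof (rule eliminable_atom)
  fix G :: "'b pair_pre_digraph" and P R \<rho> \<chi> l k
  assume "hub_system (pverts G) R \<rho> \<chi> 1 k" and l: "base_labelling G P R \<rho> \<chi> (colours (Adj x y)) l"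
  then interpret hub_system "pverts G" R \<rho> \<chi> 1 k by simp
  show "determined G P R \<rho> \<chi> (Adj x y) l 1"
    using l unfolding determined_def base_labelling_def eqtype_def by auto
qed

lemma eliminable_Col: "eliminable TYPE('b) (Col i x)"
proof (rule eliminable_atom)
  fix G :: "'b pair_pre_digraph" and P R \<rho> \<chi> l k
  assume "hub_system (pverts G) R \<rho> \<chi> 1 k" and l: "base_labelling G P R \<rho> \<chi> (colours (Col i x)) l"
  then interpret hub_system "pverts G" R \<rho> \<chi> 1 k by simp
  show "determined G P R \<rho> \<chi> (Col i x) l 1"
    using l unfolding determined_def base_labelling_def eqtype_def by auto
qed

text \<open>The two labels come with ranges \<open>N1\<close> and \<open>N2\<close>. The hub colours
  at both ranges are stored as well, so that \<open>eqtype_weaken\<close> can pass from the common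
  range to each of them.\<close>

lemma eliminable_binary:
  assumes "eliminable TYPE('b) \<phi>" "eliminable TYPE('b) \<psi>"
    and "fvars \<theta> = fvars \<phi> \<union> fvars \<psi>" "colours \<theta> = colours \<phi> \<union> colours \<psi>"
    and f: "\<And>G P \<sigma>. sat (G :: 'b pair_pre_digraph) P \<sigma> \<theta> \<longleftrightarrow> f (sat G P \<sigma> \<phi>) (sat G P \<sigma> \<psi>)"
  shows "eliminable TYPE('b) \<theta>"
proof -
  obtain N1 where N1: "N1 \<ge> 1" "\<And>k K0. \<exists>K. \<forall>(G :: 'b pair_pre_digraph) P R \<rho> \<chi> l0.
     hub_system (pverts G) R \<rho> \<chi> N1 k \<longrightarrow> (\<forall>x\<in>pverts G. l0 x < K0) \<longrightarrow>
     base_labelling G P R \<rho> \<chi> (colours \<phi>) l0 \<longrightarrow>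
     (\<exists>l. (\<forall>x\<in>pverts G. l x < K) \<and> determined G P R \<rho> \<chi> \<phi> l N1)"
    using assms(1) unfolding eliminable_def by blast
  obtain N2 where N2: "N2 \<ge> 1" "\<And>k K0. \<exists>K. \<forall>(G :: 'b pair_pre_digraph) P R \<rho> \<chi> l0.
     hub_system (pverts G) R \<rho> \<chi> N2 k \<longrightarrow> (\<forall>x\<in>pverts G. l0 x < K0) \<longrightarrow>
     base_labelling G P R \<rho> \<chi> (colours \<psi>) l0 \<longrightarrow>
     (\<exists>l. (\<forall>x\<in>pverts G. l x < K) \<and> determined G P R \<rho> \<chi> \<psi> l N2)"
    using assms(2) unfolding eliminable_def by blast
  define N where "N = max N1 N2"
  have NN: "N1 \<le> N" "N2 \<le> N" by (auto simp: N_def)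
  show ?thesis unfolding eliminable_def
  proof (rule exI[of _ N], intro conjI allI)
    show "1 \<le> N" using N1(1) NN by simp
    fix k K0
    obtain K1 where K1: "\<And>(G :: 'b pair_pre_digraph) P R \<rho> \<chi> l0.
      hub_system (pverts G) R \<rho> \<chi> N1 k \<Longrightarrow> (\<forall>x\<in>pverts G. l0 x < K0) \<Longrightarrow>
      base_labelling G P R \<rho> \<chi> (colours \<phi>) l0 \<Longrightarrow>
      (\<exists>l. (\<forall>x\<in>pverts G. l x < K1) \<and> determined G P R \<rho> \<chi> \<phi> l N1)" using N1(2) by metis
    obtain K2 where K2: "\<And>(G :: 'b pair_pre_digraph) P R \<rho> \<chi> l0.
      hub_system (pverts G) R \<rho> \<chi> N2 k \<Longrightarrow> (\<forall>x\<in>pverts G. l0 x < K0) \<Longrightarrow>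
      base_labelling G P R \<rho> \<chi> (colours \<psi>) l0 \<Longrightarrow>
      (\<exists>l. (\<forall>x\<in>pverts G. l x < K2) \<and> determined G P R \<rho> \<chi> \<psi> l N2)" using N2(2) by metis
    define \<Lambda> where "\<Lambda> = {..<K1} \<times> {..<K2} \<times> Pow {..<k} \<times> Pow {..<k}"
    have fin: "finite \<Lambda>" by (simp add: \<Lambda>_def)
    obtain e where e: "inj_on e \<Lambda>" "e ` \<Lambda> \<subseteq> {..<card \<Lambda>}" using ex_recode[OF fin] by metis
    show "\<exists>K. \<forall>(G :: 'b pair_pre_digraph) P R \<rho> \<chi> l0.
      hub_system (pverts G) R \<rho> \<chi> N k \<longrightarrow> (\<forall>x\<in>pverts G. l0 x < K0) \<longrightarrow>
      base_labelling G P R \<rho> \<chi> (colours \<theta>) l0 \<longrightarrow>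
      (\<exists>l. (\<forall>x\<in>pverts G. l x < K) \<and> determined G P R \<rho> \<chi> \<theta> l N)"
    proof (intro exI[of _ "card \<Lambda>"] allI impI)
      fix G :: "'b pair_pre_digraph" and P R \<rho> \<chi> l0
      assume hs: "hub_system (pverts G) R \<rho> \<chi> N k" and l0: "\<forall>x\<in>pverts G. l0 x < K0"
        and bl: "base_labelling G P R \<rho> \<chi> (colours \<theta>) l0"
      then interpret hub_system "pverts G" R \<rho> \<chi> N k by simp
      have "base_labelling G P R \<rho> \<chi> (colours \<phi>) l0" "base_labelling G P R \<rho> \<chi> (colours \<psi>) l0"
        using bl unfolding base_labelling_def assms(4) by blast+
      then obtain l1 l2 where l1: "\<forall>x\<in>pverts G. l1 x < K1" "determined G P R \<rho> \<chi> \<phi> l1 N1"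
        and l2: "\<forall>x\<in>pverts G. l2 x < K2" "determined G P R \<rho> \<chi> \<psi> l2 N2"
        using K1[OF hub_system_mono[OF hs NN(1)] l0] K2[OF hub_system_mono[OF hs NN(2)] l0] by blast
      define t where "t x = (l1 x, l2 x, \<chi> ` W N1 x, \<chi> ` W N2 x)" for x
      have t\<Lambda>: "t x \<in> \<Lambda>" if "x \<in> pverts G" for x
        using l1(1) l2(1) that W_V[OF that] \<chi>_less by (fastforce simp: t_def \<Lambda>_def)
      define l where "l = e \<circ> t"
      have tD: "t x = t y" if "x \<in> pverts G" "y \<in> pverts G" "l x = l y" for x y
        using that t\<Lambda> e(1) by (auto simp: l_def dest: inj_onD)
      have "determined G P R \<rho> \<chi> \<theta> l N"
        unfolding determined_def
      proof (intro allI impI)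
        fix \<sigma> \<sigma>' assume V: "\<forall>i\<in>fvars \<theta>. \<sigma> i \<in> pverts G \<and> \<sigma>' i \<in> pverts G" and eq: "eqtype (fvars \<theta>) l N \<sigma> \<sigma>'"
        have "eqtype (fvars \<phi>) l1 N1 \<sigma> \<sigma>'"
        proof (rule eqtype_weaken[OF eq _ NN(1) order_refl])
          show "l1 x = l1 y \<and> \<chi> ` W N1 x = \<chi> ` W N1 y" if "x \<in> pverts G" "y \<in> pverts G" "l x = l y" for x y
            using tD[OF that] by (simp add: t_def)
        qed (use assms(3) V in auto)
        then have 1: "sat G P \<sigma> \<phi> = sat G P \<sigma>' \<phi>"
          using l1(2) V assms(3) unfolding determined_def by blast
        have "eqtype (fvars \<psi>) l2 N2 \<sigma> \<sigma>'"
        proof (rule eqtype_weaken[OF eq _ NN(2) order_refl])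
          show "l2 x = l2 y \<and> \<chi> ` W N2 x = \<chi> ` W N2 y" if "x \<in> pverts G" "y \<in> pverts G" "l x = l y" for x y
            using tD[OF that] by (simp add: t_def)
        qed (use assms(3) V in auto)
        then have 2: "sat G P \<sigma> \<psi> = sat G P \<sigma>' \<psi>"
          using l2(2) V assms(3) unfolding determined_def by blast
        show "sat G P \<sigma> \<theta> = sat G P \<sigma>' \<theta>" unfolding f 1 2 ..
      qed
      moreover have "\<forall>x\<in>pverts G. l x < card \<Lambda>" using t\<Lambda> e(2) by (auto simp: l_def)
      ultimately show "\<exists>l. (\<forall>x\<in>pverts G. l x < card \<Lambda>) \<and> determined G P R \<rho> \<chi> \<theta> l N" by blast
    qed
  qed
qed

lemma eliminable_Ex:
  assumes "eliminable TYPE('b) \<psi>"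
  shows "eliminable TYPE('b) (Ex x0 \<psi>)"
proof -
  obtain r where r: "r \<ge> 1" "\<And>k K0. \<exists>K. \<forall>(G :: 'b pair_pre_digraph) P R \<rho> \<chi> l0.
     hub_system (pverts G) R \<rho> \<chi> r k \<longrightarrow> (\<forall>x\<in>pverts G. l0 x < K0) \<longrightarrow>
     base_labelling G P R \<rho> \<chi> (colours \<psi>) l0 \<longrightarrow>
     (\<exists>l. (\<forall>x\<in>pverts G. l x < K) \<and> determined G P R \<rho> \<chi> \<psi> l r)"
    using assms unfolding eliminable_def by blast
  define X where "X = fvars \<psi> - {x0}"
  define n where "n = card X"
  have X: "finite X" "card X \<le> n" "x0 \<notin> X" "fvars (Ex x0 \<psi>) = X" "fvars \<psi> \<subseteq> insert x0 X"
    by (auto simp: X_def n_def finite_fvars)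
  show ?thesis unfolding eliminable_def
  proof (rule exI[of _ "3 * r"], intro conjI allI)
    show "1 \<le> 3 * r" using r(1) by simp
    fix k K0
    obtain K1 where K1: "\<And>(G :: 'b pair_pre_digraph) P R \<rho> \<chi> l0.
      hub_system (pverts G) R \<rho> \<chi> r k \<Longrightarrow> (\<forall>x\<in>pverts G. l0 x < K0) \<Longrightarrow>
      base_labelling G P R \<rho> \<chi> (colours \<psi>) l0 \<Longrightarrow>
      (\<exists>l. (\<forall>x\<in>pverts G. l x < K1) \<and> determined G P R \<rho> \<chi> \<psi> l r)" using r(2) by metis
    \<comment> \<open>The intermediate label adds the hub colours and their order along
      \<open>\<rho>\<close>, which \<open>shared_below\<close> compares; the final label below adds
      the marks of the hubs.\<close>
    define \<Lambda> where "\<Lambda> = {..<K1} \<times> Pow {..<k} \<times> Pow ({..<k} \<times> {..<k})"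
    have fin: "finite \<Lambda>" by (simp add: \<Lambda>_def)
    obtain e where e: "inj_on e \<Lambda>" "e ` \<Lambda> \<subseteq> {..<card \<Lambda>}" using ex_recode[OF fin] by metis
    define K2 where "K2 = card \<Lambda>"
    \<comment> \<open>The parameters have at most \<open>n * k\<close> hubs altogether, the size of
      the sets that a representative has to avoid.\<close>
    define g where "g = (k + 1) ^ (n * k)"
    define \<Lambda>' where "\<Lambda>' = {..<K2} \<times> Pow ({..<k} \<times> Pow ({..<K2} \<times> {..g}) \<times>
      Pow ({..<K2} \<times> {..<g} \<times> {..<k}) \<times> Pow ({..<K2} \<times> {..<g}))"
    have fin': "finite \<Lambda>'" by (simp add: \<Lambda>'_def)
    obtain e' where e': "inj_on e' \<Lambda>'" "e' ` \<Lambda>' \<subseteq> {..<card \<Lambda>'}" using ex_recode[OF fin'] by metis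
    show "\<exists>K. \<forall>(G :: 'b pair_pre_digraph) P R \<rho> \<chi> l0.
      hub_system (pverts G) R \<rho> \<chi> (3 * r) k \<longrightarrow> (\<forall>x\<in>pverts G. l0 x < K0) \<longrightarrow>
      base_labelling G P R \<rho> \<chi> (colours (Ex x0 \<psi>)) l0 \<longrightarrow>
      (\<exists>l. (\<forall>x\<in>pverts G. l x < K) \<and> determined G P R \<rho> \<chi> (Ex x0 \<psi>) l (3 * r))"
    proof (intro exI[of _ "card \<Lambda>'"] allI impI)
      fix G :: "'b pair_pre_digraph" and P R \<rho> \<chi> l0
      assume hs: "hub_system (pverts G) R \<rho> \<chi> (3 * r) k" and l0: "\<forall>x\<in>pverts G. l0 x < K0"
        and bl: "base_labelling G P R \<rho> \<chi> (colours (Ex x0 \<psi>)) l0"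
      then interpret hub_system "pverts G" R \<rho> \<chi> "3 * r" k by simp
      obtain l1 where l1: "\<forall>x\<in>pverts G. l1 x < K1" "determined G P R \<rho> \<chi> \<psi> l1 r"
        using K1[OF hub_system_mono[OF hs] l0] bl by auto
      define ord where "ord x = {(\<chi> u, \<chi> v) | u v. u \<in> W r x \<and> v \<in> W r x \<and> \<rho> u \<le> \<rho> v}" for x
      define t where "t x = (l1 x, \<chi> ` W r x, ord x)" for x
      have t\<Lambda>: "t x \<in> \<Lambda>" if "x \<in> pverts G" for x
        using l1(1) that W_V[OF that] \<chi>_less by (fastforce simp: t_def \<Lambda>_def ord_def)
      define l where "l = e \<circ> t"
      have tD: "t x = t y" if "x \<in> pverts G" "y \<in> pverts G" "l x = l y" for x y
        using that t\<Lambda> e(1) by (auto simp: l_def dest: inj_onD)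
      have l_less: "l x < K2" if "x \<in> pverts G" for x using t\<Lambda>[OF that] e(2) by (auto simp: l_def K2_def)
      have "finite (above b r z) \<and> card (above b r z) \<le> k" if "z \<in> candidates l r c b" for z c b
      proof -
        have z: "z \<in> pverts G" using that by (simp add: candidates_def)
        have "above b r z \<subseteq> W r z" by (auto simp: above_def split: option.splits)
        moreover have "card (W r z) \<le> k" using card_W[OF z, of r] by simp
        ultimately show ?thesis using finite_W[OF z, of r] by (meson card_mono finite_subset le_trans)
      qed
      note above_bounds = this
      define good where "good c b zs \<longleftrightarrow> length zs \<le> g \<and> set zs \<subseteq> candidates l r c b \<and>
        (\<forall>M. finite M \<and> card M \<le> n * k \<and> (\<exists>z\<in>candidates l r c b. above b r z \<inter> M = {}) \<longrightarrow>
           (\<exists>z\<in>set zs. above b r z \<inter> M = {}))" for c b zs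
      have "\<exists>zs. good c b zs" for c b
        unfolding g_def good_def by (rule representative_family) (rule above_bounds)
      then obtain zs where good: "\<And>c b. good c b (zs c b)" by metis
      have zs: "length (zs c b) \<le> g" "set (zs c b) \<subseteq> candidates l r c b" for c b
        using good[of c b] by (simp_all add: good_def)
      have zs3: "\<exists>z\<in>set (zs c b). above b r z \<inter> M = {}"
        if "finite M" "card M \<le> n * k" "\<exists>z\<in>candidates l r c b. above b r z \<inter> M = {}" for c b M
        using good[of c b] that unfolding good_def by blast
      define t' where "t' x = (l x, {(\<chi> u, local_info zs K2 r u) | u. u \<in> W r x})" for x
      have info: "local_info zs K2 r u \<in> Pow ({..<K2} \<times> {..g}) \<times>
        Pow ({..<K2} \<times> {..<g} \<times> {..<k}) \<times> Pow ({..<K2} \<times> {..<g})" if "u \<in> pverts G" for u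
      proof -
        have "\<chi> b < k" if "b \<in> W (2 * r) u" for b using that W_V[OF \<open>u \<in> pverts G\<close>] \<chi>_less by blast
        moreover have "j < g" if "j < length (zs c b)" for j c b using that zs(1) less_le_trans by blast
        ultimately show ?thesis using zs(1) by (auto simp: local_info_def)
      qed
      have t'\<Lambda>: "t' x \<in> \<Lambda>'" if "x \<in> pverts G" for x
      proof -
        have "u \<in> pverts G" if "u \<in> W r x" for u using that W_V[OF \<open>x \<in> pverts G\<close>] by blast
        then have "{(\<chi> u, local_info zs K2 r u) | u. u \<in> W r x} \<subseteq> {..<k} \<times> Pow ({..<K2} \<times> {..g}) \<times>
          Pow ({..<K2} \<times> {..<g} \<times> {..<k}) \<times> Pow ({..<K2} \<times> {..<g})"
          using \<chi>_less info by blast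
        then show ?thesis using l_less[OF that] by (auto simp: t'_def \<Lambda>'_def)
      qed
      define l' where "l' = e' \<circ> t'"
      have t'D: "t' x = t' y" if "x \<in> pverts G" "y \<in> pverts G" "l' x = l' y" for x y
        using that t'\<Lambda> e'(1) by (auto simp: l'_def dest: inj_onD)
      have transfer: "sat G P \<sigma>' (Ex x0 \<psi>)"
        if V: "\<And>i. i \<in> X \<Longrightarrow> \<sigma> i \<in> pverts G \<and> \<sigma>' i \<in> pverts G" and eq: "eqtype X l' (3 * r) \<sigma> \<sigma>'"
          and s: "sat G P \<sigma> (Ex x0 \<psi>)" for \<sigma> \<sigma>'
      proof -
        obtain z where z: "z \<in> pverts G" "sat G P (\<sigma>(x0 := z)) \<psi>" using s by auto
        have "\<exists>z'\<in>pverts G. eqtype (insert x0 X) l r (\<sigma>(x0 := z)) (\<sigma>'(x0 := z'))"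
        proof (rule exists_transfer[OF X(1-3) order_refl l_less _ _ zs(2) zs3 _ V eq z(1)])
          show "l x = l y \<and> {(\<chi> u, local_info zs K2 r u) | u. u \<in> W r x} = {(\<chi> u, local_info zs K2 r u) | u. u \<in> W r y}"
            if "x \<in> pverts G" "y \<in> pverts G" "l' x = l' y" for x y
            using t'D[OF that] by (simp add: t'_def)
          show "\<chi> ` W r x = \<chi> ` W r y"
            "{(\<chi> u, \<chi> v) | u v. u \<in> W r x \<and> v \<in> W r x \<and> \<rho> u \<le> \<rho> v} =
             {(\<chi> u, \<chi> v) | u v. u \<in> W r y \<and> v \<in> W r y \<and> \<rho> u \<le> \<rho> v}"
            if "x \<in> pverts G" "y \<in> pverts G" "l x = l y" for x y
            using tD[OF that] unfolding t_def ord_def by simp_all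
        qed
        then obtain z' where z': "z' \<in> pverts G" "eqtype (insert x0 X) l r (\<sigma>(x0 := z)) (\<sigma>'(x0 := z'))" by blast
        have V': "(\<sigma>(x0 := z)) i \<in> pverts G \<and> (\<sigma>'(x0 := z')) i \<in> pverts G" if "i \<in> insert x0 X" for i
          using that V z z' by auto
        have "eqtype (fvars \<psi>) l1 r (\<sigma>(x0 := z)) (\<sigma>'(x0 := z'))"
        proof (rule eqtype_weaken[OF z'(2) X(5) order_refl _ _ V'])
          show "l1 x = l1 y \<and> \<chi> ` W r x = \<chi> ` W r y" if "x \<in> pverts G" "y \<in> pverts G" "l x = l y" for x y
            using tD[OF that] by (simp add: t_def)
        qed auto
        then have "sat G P (\<sigma>'(x0 := z')) \<psi>"
          using l1(2) V' X(5) z(2) unfolding determined_def by blast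
        then show ?thesis using z' by auto
      qed
      have "determined G P R \<rho> \<chi> (Ex x0 \<psi>) l' (3 * r)"
        unfolding determined_def X(4)
      proof (intro allI impI)
        fix \<sigma> \<sigma>' assume V: "\<forall>i\<in>X. \<sigma> i \<in> pverts G \<and> \<sigma>' i \<in> pverts G" and eq: "eqtype X l' (3 * r) \<sigma> \<sigma>'"
        show "sat G P \<sigma> (Ex x0 \<psi>) = sat G P \<sigma>' (Ex x0 \<psi>)"
          using transfer[OF _ eq] transfer[OF _ eqtype_sym[OF eq]] V by blast
      qed
      moreover have "\<forall>x\<in>pverts G. l' x < card \<Lambda>'" using t'\<Lambda> e'(2) by (auto simp: l'_def)
      ultimately show "\<exists>l. (\<forall>x\<in>pverts G. l x < card \<Lambda>') \<and> determined G P R \<rho> \<chi> (Ex x0 \<psi>) l (3 * r)" by blast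
    qed
  qed
qed

theorem eliminable: "eliminable TYPE('b) \<phi>"
proof (induction \<phi>)
  case (Neg \<phi>)
  then show ?case by (rule eliminable_cong[where f = Not]) auto
next
  case (Conj \<phi> \<psi>)
  then show ?case by (rule eliminable_binary[where f = "(\<and>)"]) auto
next
  case (Disj \<phi> \<psi>)
  then show ?case by (rule eliminable_binary[where f = "(\<or>)"]) auto
next
  case (All x \<phi>)
  have "eliminable TYPE('b) (Neg \<phi>)" by (rule eliminable_cong[OF All, where f = Not]) auto
  then have "eliminable TYPE('b) (Ex x (Neg \<phi>))" by (rule eliminable_Ex)
  then show ?case by (rule eliminable_cong[where f = Not]) auto
qed (rule eliminable_Eq eliminable_Adj eliminable_Col eliminable_Ex | assumption)+

section \<open>Alternating components of tree-like graphs\<close>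

text \<open>
  \<open>c x y\<close> is the depth of the meet of \<open>x\<close> and \<open>y\<close> in a tree of height \<open>d\<close>, and on the pairs
  \<open>J\<close> of vertices labelled \<open>\<alpha>\<close> and \<open>\<beta>\<close> adjacency is a function \<open>\<Phi>\<close> of that depth. The graph
  \<open>alt j\<close> is obtained by complementing, \<open>j\<close> times, inside the connected components.
\<close>

locale tree_like =
  fixes M :: "'b set" and lab :: "'b \<Rightarrow> nat" and \<alpha> \<beta> :: nat
    and c :: "'b \<Rightarrow> 'b \<Rightarrow> nat" and \<Phi> :: "nat \<Rightarrow> bool" and d :: nat
  assumes finite_M: "finite M"
    and lab_M: "x \<in> M \<Longrightarrow> lab x = \<alpha> \<or> lab x = \<beta>"
    and c_sym: "x \<in> M \<Longrightarrow> y \<in> M \<Longrightarrow> c x y = c y x"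
    and c_ultra: "x \<in> M \<Longrightarrow> y \<in> M \<Longrightarrow> z \<in> M \<Longrightarrow> min (c x y) (c y z) \<le> c x z"
    and c_le: "x \<in> M \<Longrightarrow> y \<in> M \<Longrightarrow> c x y \<le> d"
begin

text \<open>For equal labels this is the complete graph on \<open>M\<close>, otherwise the complete
  bipartite graph between the classes. Complements are taken inside it.\<close>

definition J :: "('b \<times> 'b) set" where
  "J = {(x, y). x \<in> M \<and> y \<in> M \<and> x \<noteq> y \<and> (lab x = \<alpha> \<and> lab y = \<beta> \<or> lab x = \<beta> \<and> lab y = \<alpha>)}"

primrec alt :: "nat \<Rightarrow> ('b \<times> 'b) set" where
  "alt 0 = {(x, y) \<in> J. \<Phi> (c x y)}"
| "alt (Suc j) = (J \<inter> (alt j)\<^sup>*) - alt j"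

lemma sym_J: "sym J"
  by (auto simp: J_def sym_def)

lemma alt_J: "alt j \<subseteq> J"
  by (cases j) auto

lemma sym_alt: "sym (alt j)"
proof (induction j)
  case 0
  have "\<Phi> (c y x)" if "(x, y) \<in> J" "\<Phi> (c x y)" for x y
    using that c_sym[of x y] by (auto simp: J_def)
  then show ?case using sym_J unfolding sym_def by auto
next
  case (Suc j)
  then show ?case using sym_J sym_rtrancl[OF Suc] by (auto simp: sym_def)
qed

lemma equiv_alt: "(x, y) \<in> (alt j)\<^sup>* \<Longrightarrow> (y, x) \<in> (alt j)\<^sup>*"
  using sym_rtrancl[OF sym_alt] by (meson symD)

lemma alt_rtrancl_M: "(x, y) \<in> (alt j)\<^sup>* \<Longrightarrow> x \<noteq> y \<Longrightarrow> x \<in> M \<and> y \<in> M"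
proof -
  assume a: "(x, y) \<in> (alt j)\<^sup>*" "x \<noteq> y"
  then obtain u v where "(x, u) \<in> alt j" "(v, y) \<in> alt j" by (meson converse_rtranclE rtranclE)
  then show ?thesis using alt_J[of j] by (auto simp: J_def)
qed

lemma alt_Suc_rtrancl: "(alt (Suc j))\<^sup>* \<subseteq> (alt j)\<^sup>*"
  using rtrancl_mono[of "alt (Suc j)" "(alt j)\<^sup>*"] by auto

text \<open>Each complement negates \<open>\<Phi>\<close> on the pairs that remain, and only pairs
  inside a component remain. So parity and the components of the earlier rounds describe a round
  completely.\<close>

lemma alt_iff:
  "(x, y) \<in> alt j \<longleftrightarrow>
     (x, y) \<in> J \<and> (\<forall>i<j. (x, y) \<in> (alt i)\<^sup>*) \<and> (\<Phi> (c x y) \<longleftrightarrow> even j)"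
proof (induction j)
  case (Suc j)
  have "(x, y) \<in> (alt i)\<^sup>*" if "(x, y) \<in> (alt j)\<^sup>*" "i \<le> j" for i
    using that(2,1)
    by (induction rule: inc_induct) (use alt_Suc_rtrancl in blast)+
  then show ?case using Suc by (auto simp: less_Suc_eq_le)
qed auto

lemma c_trans: "x \<in> M \<Longrightarrow> y \<in> M \<Longrightarrow> z \<in> M \<Longrightarrow> i \<le> c x y \<Longrightarrow> i \<le> c y z \<Longrightarrow> i \<le> c x z"
  using c_ultra[of x y z] by linarith

text \<open>The depth of the node where the component branches. The minimum runs over edges, so that
  an edge attaining it reveals the value of \<open>\<Phi>\<close> at this depth;
  \<open>level_le\<close> extends the bound to all pairs of the component.\<close>

definition level :: "nat \<Rightarrow> 'b \<Rightarrow> nat" where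
  "level j x = Min {c y z | y z. (x, y) \<in> (alt j)\<^sup>* \<and> (x, z) \<in> (alt j)\<^sup>* \<and> (y, z) \<in> alt j}"

definition nontriv :: "nat \<Rightarrow> 'b set" where
  "nontriv j = Domain (alt j)"

lemma nontriv_M: "nontriv j \<subseteq> M"
  using alt_J[of j] by (auto simp: nontriv_def J_def)

lemma nontriv_rtrancl: "(x, y) \<in> (alt j)\<^sup>* \<Longrightarrow> x \<in> nontriv j \<Longrightarrow> y \<in> nontriv j"
  unfolding nontriv_def using equiv_alt[of x y j] by (auto elim: converse_rtranclE)

lemma nontriv_if_J: "(x, y) \<in> J \<Longrightarrow> (x, y) \<in> (alt j)\<^sup>* \<Longrightarrow> x \<in> nontriv j"
proof -
  assume a: "(x, y) \<in> J" "(x, y) \<in> (alt j)\<^sup>*"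
  then have "x \<noteq> y" by (auto simp: J_def)
  then show ?thesis using a(2) by (auto simp: nontriv_def elim: converse_rtranclE)
qed

lemma finite_level_set:
  "finite {c y z | y z. (x, y) \<in> (alt j)\<^sup>* \<and> (x, z) \<in> (alt j)\<^sup>* \<and> (y, z) \<in> alt j}"
proof (rule finite_subset)
  show "finite {..d}" by simp
  have "c y z \<le> d" if "(y, z) \<in> alt j" for y z
    using that alt_J[of j] c_le[of y z] by (auto simp: J_def)
  then show "{c y z | y z. (x, y) \<in> (alt j)\<^sup>* \<and> (x, z) \<in> (alt j)\<^sup>* \<and> (y, z) \<in> alt j} \<subseteq> {..d}"
    by auto
qed

lemma level_attained:
  assumes "x \<in> nontriv j"
  obtains y z where "(x, y) \<in> (alt j)\<^sup>*" "(x, z) \<in> (alt j)\<^sup>*" "(y, z) \<in> alt j" "c y z = level j x"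
proof -
  obtain y where "(x, y) \<in> alt j" using assms by (auto simp: nontriv_def)
  then have "{c y z | y z. (x, y) \<in> (alt j)\<^sup>* \<and> (x, z) \<in> (alt j)\<^sup>* \<and> (y, z) \<in> alt j} \<noteq> {}"
    by blast
  from Min_in[OF finite_level_set this]
  have "\<exists>y z. level j x = c y z \<and> (x, y) \<in> (alt j)\<^sup>* \<and> (x, z) \<in> (alt j)\<^sup>* \<and> (y, z) \<in> alt j"
    unfolding level_def by (rule CollectD)
  then show ?thesis using that by metis
qed

lemma level_edge:
  assumes "(x, y) \<in> (alt j)\<^sup>*" "(y, z) \<in> alt j"
  shows "level j x \<le> c y z"
  unfolding level_def using assms by (intro Min_le[OF finite_level_set]) (auto intro: rtrancl_into_rtrancl)

lemma level_le:
  assumes "x \<in> nontriv j" "(x, y) \<in> (alt j)\<^sup>*" "(x, z) \<in> (alt j)\<^sup>*"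
  shows "level j x \<le> c y z"
proof -
  have xM: "x \<in> M" using assms(1) nontriv_M by blast
  have inM: "y \<in> M" if "(x, y) \<in> (alt j)\<^sup>*" for y
    using alt_rtrancl_M[OF that] xM by (cases "x = y") auto
  have refl: "level j x \<le> c x x"
  proof -
    obtain y where y: "(x, y) \<in> alt j" using assms(1) by (auto simp: nontriv_def)
    then have "level j x \<le> c x y" by (intro level_edge) auto
    then show ?thesis using c_trans[of x y x] c_sym[of x y] xM inM y by (metis r_into_rtrancl)
  qed
  have *: "level j x \<le> c x y" if "(x, y) \<in> (alt j)\<^sup>*" for y
    using that
  proof (induction rule: rtrancl_induct)
    case (step y z)
    have "level j x \<le> c y z" using level_edge step by blast
    then show ?case using step c_trans xM inM by (meson rtrancl_into_rtrancl)
  qed (rule refl)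
  have "y \<in> M" "z \<in> M" using inM assms by auto
  then show ?thesis using *[OF assms(2)] *[OF assms(3)] c_trans[of y x z] c_sym xM by metis
qed

lemma level_cong: "(x, y) \<in> (alt j)\<^sup>* \<Longrightarrow> level j x = level j y"
proof -
  assume a: "(x, y) \<in> (alt j)\<^sup>*"
  then have "(x, z) \<in> (alt j)\<^sup>* \<longleftrightarrow> (y, z) \<in> (alt j)\<^sup>*" for z
    using equiv_alt by (meson rtrancl_trans)
  then show ?thesis by (simp add: level_def)
qed

text \<open>Some edge attains the level, which fixes the value of \<open>\<Phi>\<close> there. Every
  other pair of \<open>J\<close> at this depth has the same value and the same history, hence is an
  edge too.\<close>

lemma cross_pairs:
  assumes "x \<in> nontriv j" "(x, y) \<in> (alt j)\<^sup>*" "(x, z) \<in> (alt j)\<^sup>*" "(y, z) \<in> J" "c y z = level j x"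
  shows "(y, z) \<in> alt j"
proof -
  obtain u v where "(u, v) \<in> alt j" "c u v = level j x"
    using level_attained[OF assms(1)] by metis
  then have "\<Phi> (c y z) \<longleftrightarrow> even j" using assms(5) alt_iff by metis
  moreover have "(y, z) \<in> (alt i)\<^sup>*" if "i < j" for i
  proof -
    have "(alt j)\<^sup>* \<subseteq> (alt i)\<^sup>*"
      using that by (intro rtrancl_subset_rtrancl) (auto simp: alt_iff)
    then show ?thesis using assms equiv_alt by (meson rtrancl_trans subsetD)
  qed
  ultimately show ?thesis using assms(4) alt_iff by blast
qed

text \<open>An edge of round \<open>Suc j\<close> is a non-edge inside a component of round
  \<open>j\<close>. By \<open>cross_pairs\<close> its ends cannot meet at the level of that
  component, so they meet strictly deeper.\<close>

lemma level_ge: "x \<in> nontriv j \<Longrightarrow> j \<le> level j x"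
proof (induction j arbitrary: x)
  case (Suc j)
  obtain y z where yz: "(x, y) \<in> (alt (Suc j))\<^sup>*" "(y, z) \<in> alt (Suc j)" "c y z = level (Suc j) x"
    using level_attained[OF Suc.prems] by metis
  then have "(y, z) \<in> (alt j)\<^sup>*" "(y, z) \<notin> alt j" "(y, z) \<in> J" by auto
  moreover from this have y: "y \<in> nontriv j"
    using nontriv_if_J by blast
  ultimately have "level j y < c y z"
    using cross_pairs[of y j y z] level_le[of y j y z] by (metis le_neq_implies_less rtrancl.rtrancl_refl)
  then show ?case using Suc.IH[OF y] yz(3) by linarith
qed simp

lemma alt_empty: "alt (Suc d) = {}"
proof (rule ccontr)
  assume "alt (Suc d) \<noteq> {}"
  then obtain x y where xy: "(x, y) \<in> alt (Suc d)" by fastforce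
  then have "x \<in> nontriv (Suc d)" by (auto simp: nontriv_def)
  then have "Suc d \<le> level (Suc d) x" by (rule level_ge)
  also have "\<dots> \<le> c x y" by (rule level_edge[OF _ xy]) simp
  also have "\<dots> \<le> d" using xy alt_J[of "Suc d"] c_le[of x y] by (auto simp: J_def simp del: alt.simps)
  finally show False by simp
qed

text \<open>The recursion of \<open>alt\<close> read backwards. Started from the empty round
  \<open>Suc d\<close>, it recovers round 0 from the components of all rounds; this is what the
  decoding formula evaluates.\<close>

lemma alt_unfold: "(x, y) \<in> alt j \<longleftrightarrow> (x, y) \<in> J \<and> (x, y) \<in> (alt j)\<^sup>* \<and> (x, y) \<notin> alt (Suc j)"
  using alt_J by auto

text \<open>If the labels differ, they alternate along a walk in \<open>J\<close>; if they coincide,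
  any two distinct vertices of \<open>M\<close> are related.\<close>

lemma J_parity:
  assumes "\<And>a b. a < m \<Longrightarrow> (v a, v (Suc a)) \<in> J" "a \<le> m" "b \<le> m" "odd (a + b)" "v a \<noteq> v b"
  shows "(v a, v b) \<in> J"
proof (cases "\<alpha> = \<beta>")
  case True
  have "v i \<in> M" if "i \<le> m" "0 < m" for i
    using assms(1)[of i] assms(1)[of "i - 1"] that by (cases "i < m") (auto simp: J_def)
  moreover have "0 < m" using assms by (cases m) auto
  ultimately have "v a \<in> M" "v b \<in> M" using assms by blast+
  then show ?thesis using assms(5) True lab_M[of "v a"] lab_M[of "v b"] unfolding J_def by auto
next
  case False
  have v0: "v 0 \<in> M" "0 < m" using assms(1)[of 0] assms by (cases m; auto simp: J_def)+
  have *: "v i \<in> M \<and> (lab (v i) = lab (v 0) \<longleftrightarrow> even i)" if "i \<le> m" for i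
    using that
  proof (induction i)
    case (Suc i)
    then show ?case using assms(1)[of i] lab_M[of "v 0"] v0 False by (auto simp: J_def)
  qed (use v0 in auto)
  have "lab (v a) \<noteq> lab (v b)"
    using *[OF assms(2)] *[OF assms(3)] assms(4) by (cases "even a") auto
  moreover have "v a \<in> M" "v b \<in> M" using * assms(2,3) by blast+
  ultimately show ?thesis using lab_M[of "v a"] lab_M[of "v b"] assms(5) unfolding J_def by auto
qed

text \<open>
  On a shortest walk with at least six edges all vertices lie in one child of the meet of the
  component, so a vertex of the component in another child provides a shortcut.
\<close>

lemma alt_diameter:
  assumes "(x, y) \<in> (alt j)\<^sup>*"
  shows "(x, y) \<in> near (alt j) 5"
proof (cases "x = y")
  case False
  define n where "n = (LEAST n. (x, y) \<in> alt j ^^ n)"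
  have n: "(x, y) \<in> alt j ^^ n" and n_min: "\<And>m. (x, y) \<in> alt j ^^ m \<Longrightarrow> n \<le> m"
    using assms unfolding n_def by (auto simp: rtrancl_power intro: LeastI Least_le)
  have "n \<le> 5"
  proof (rule ccontr)
    assume "\<not> n \<le> 5"
    then have n6: "6 \<le> n" by simp
    obtain v where v0: "v 0 = x" and vn: "v n = y" and vs: "\<And>i. i < n \<Longrightarrow> (v i, v (Suc i)) \<in> alt j"
      using n unfolding relpow_fun_conv by blast
    have seg: "(v a, v (a + m)) \<in> alt j ^^ m" if "a + m \<le> n" for a m
      unfolding relpow_fun_conv using that vs by (intro exI[of _ "\<lambda>i. v (a + i)"]) auto
    have short: "b - a \<le> m" if "(v a, v b) \<in> alt j ^^ m" "a \<le> b" "b \<le> n" for a b m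
    proof -
      have "(x, v a) \<in> alt j ^^ a" "(v b, y) \<in> alt j ^^ (n - b)"
        using seg[of 0 a] seg[of b "n - b"] that v0 vn by auto
      then have "(x, y) \<in> alt j ^^ (a + m + (n - b))"
        using that(1) by (auto simp: relpow_add)
      then show ?thesis using n_min that by fastforce
    qed
    have xn: "x \<in> nontriv j" using vs[of 0] v0 n6 by (auto simp: nontriv_def)
    have rv: "(x, v a) \<in> (alt j)\<^sup>*" if "a \<le> n" for a
      using seg[of 0 a] that v0 relpow_imp_rtrancl by fastforce
    have vM: "v a \<in> M" if "a \<le> n" for a
      using nontriv_rtrancl[OF rv[OF that] xn] nontriv_M by blast
    let ?i = "level j x"
    \<comment> \<open>On a shortest walk such a pair of \<open>J\<close> is no edge, so by
      \<open>cross_pairs\<close> it meets strictly below the branching node: both ends lie in one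
      child.\<close>
    have far: "Suc ?i \<le> c (v a) (v b)" if "a \<le> n" "b \<le> n" "odd (a + b)" "a + 3 \<le> b" for a b
    proof -
      have ne: "(v a, v b) \<notin> alt j" using short[of a b 1] that by auto
      have "v a \<noteq> v b" using short[of a b 0] that by auto
      then have "(v a, v b) \<in> J" using J_parity[of n v a b] vs alt_J that by blast
      then have "c (v a) (v b) \<noteq> ?i" using ne cross_pairs[OF xn rv rv] that by blast
      then show ?thesis using level_le[OF xn rv rv] that by (metis le_neq_implies_less Suc_leI)
    qed
    have vM6: "v a \<in> M" if "a \<le> 6" for a using that vM n6 by auto
    have ct: "Suc ?i \<le> c (v a) (v e)" if "Suc ?i \<le> c (v a) (v b)" "Suc ?i \<le> c (v b) (v e)"
      "a \<le> 6" "b \<le> 6" "e \<le> 6" for a b e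
      using c_trans[OF vM6 vM6 vM6] that by blast
    have cs: "Suc ?i \<le> c (v a) (v b)" if "Suc ?i \<le> c (v b) (v a)" "a \<le> 6" "b \<le> 6" for a b
      using c_sym[OF vM6 vM6] that by metis
    \<comment> \<open>Here six edges are needed: the links 0-3, 3-6, 6-1, 1-4 and 0-5 put the
      vertices 0, 1, 4 and 5 into one child.\<close>
    have f: "Suc ?i \<le> c (v 0) (v 3)" "Suc ?i \<le> c (v 3) (v 6)" "Suc ?i \<le> c (v 1) (v 6)"
      "Suc ?i \<le> c (v 1) (v 4)" "Suc ?i \<le> c (v 0) (v 5)" "Suc ?i \<le> c (v 2) (v 5)"
      using n6 by (auto intro!: far)
    have h6: "Suc ?i \<le> c (v 0) (v 6)" using ct[OF f(1,2)] by simp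
    have h1: "Suc ?i \<le> c (v 0) (v 1)" using ct[OF h6 cs[OF f(3)]] by simp
    have h4: "Suc ?i \<le> c (v 0) (v 4)" using ct[OF h1 f(4)] by simp
    have h0: "Suc ?i \<le> c (v 0) (v 0)" using ct[OF h1 cs[OF h1]] by simp
    note h5 = f(5)
    obtain p q where pq: "(x, p) \<in> (alt j)\<^sup>*" "(x, q) \<in> (alt j)\<^sup>*" "c p q = ?i"
      using level_attained[OF xn] by metis
    have pqM: "p \<in> M" "q \<in> M" using nontriv_rtrancl[OF _ xn] nontriv_M pq by blast+
    have "\<not> (Suc ?i \<le> c p (v 0) \<and> Suc ?i \<le> c (v 0) q)"
      using c_trans[OF pqM(1) vM6[of 0] pqM(2), of "Suc ?i"] pq(3) by auto
    then obtain w where w: "(x, w) \<in> (alt j)\<^sup>*" "w \<in> M" "\<not> Suc ?i \<le> c (v 0) w"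
      using pq pqM c_sym[OF pqM(1) vM6[of 0]] by auto
    \<comment> \<open>\<open>w\<close> lies in another child, so it meets these vertices exactly at
      the branching node and is adjacent to each of them that \<open>J\<close> allows.\<close>
    have wv: "c w (v t) = ?i \<and> w \<noteq> v t" if "Suc ?i \<le> c (v 0) (v t)" "t \<le> 6" for t
    proof -
      have "\<not> Suc ?i \<le> c w (v t)"
      proof
        assume "Suc ?i \<le> c w (v t)"
        then have "Suc ?i \<le> c (v t) w" using c_sym[OF w(2) vM6[OF that(2)]] by simp
        then show False using c_trans[OF vM6[of 0] vM6[OF that(2)] w(2) that(1)] w(3) by blast
      qed
      moreover have "?i \<le> c w (v t)" using level_le[OF xn w(1) rv] that n6 by simp
      ultimately show ?thesis using that(1) w(3) by auto
    qed
    have "(w, v t) \<in> alt j" if "Suc ?i \<le> c (v 0) (v t)" "t \<le> 6" "(w, v t) \<in> J" for t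
      using cross_pairs[OF xn w(1) rv that(3)] wv that n6 by auto
    then have edge: "(v t, w) \<in> alt j \<and> (w, v t) \<in> alt j"
      if "Suc ?i \<le> c (v 0) (v t)" "t \<le> 6" "(w, v t) \<in> J" for t
      using that sym_alt by (meson symD)
    have J01: "(v 0, v 1) \<in> J" "(v 0, v 5) \<in> J" "(v 1, v 4) \<in> J"
    proof -
      show "(v 0, v 1) \<in> J" using vs[of 0] alt_J n6 by auto
      show "(v 0, v 5) \<in> J" "(v 1, v 4) \<in> J"
        using J_parity[of n v 0 5] J_parity[of n v 1 4] vs alt_J n6 short[of 0 5 0] short[of 1 4 0] by auto
    qed
    \<comment> \<open>By its label \<open>w\<close> is a common neighbour of vertices 0 and 4 or of
      1 and 5, which are four steps apart on the shortest walk.\<close>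
    have "((w, v 0) \<in> J \<and> (w, v 4) \<in> J) \<or> ((w, v 1) \<in> J \<and> (w, v 5) \<in> J)"
    proof -
      have J_iff: "(w, v t) \<in> J \<longleftrightarrow> lab w = \<alpha> \<and> lab (v t) = \<beta> \<or> lab w = \<beta> \<and> lab (v t) = \<alpha>"
        if "Suc ?i \<le> c (v 0) (v t)" "t \<le> 6" for t
        using wv[OF that] vM6[OF that(2)] w(2) by (simp add: J_def)
      have L: "lab a = \<alpha> \<and> lab b = \<beta> \<or> lab a = \<beta> \<and> lab b = \<alpha>" if "(a, b) \<in> J" for a b
        using that by (simp add: J_def)
      have "(w, v 0) \<in> J \<longleftrightarrow> lab w = \<alpha> \<and> lab (v 0) = \<beta> \<or> lab w = \<beta> \<and> lab (v 0) = \<alpha>"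
        "(w, v 1) \<in> J \<longleftrightarrow> lab w = \<alpha> \<and> lab (v 1) = \<beta> \<or> lab w = \<beta> \<and> lab (v 1) = \<alpha>"
        "(w, v 4) \<in> J \<longleftrightarrow> lab w = \<alpha> \<and> lab (v 4) = \<beta> \<or> lab w = \<beta> \<and> lab (v 4) = \<alpha>"
        "(w, v 5) \<in> J \<longleftrightarrow> lab w = \<alpha> \<and> lab (v 5) = \<beta> \<or> lab w = \<beta> \<and> lab (v 5) = \<alpha>"
        using J_iff h0 h1 h4 h5 by simp_all
      then show ?thesis
        using L[OF J01(1)] L[OF J01(2)] L[OF J01(3)] lab_M[OF w(2)] by (elim disjE conjE) simp_all
    qed
    then have "(v 0, v 4) \<in> alt j ^^ 2 \<or> (v 1, v 5) \<in> alt j ^^ 2"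
      using edge[of 0] edge[of 1] edge[of 4] edge[of 5] h0 h1 h4 h5
      by (auto simp: numeral_2_eq_2)
    then show False using short[of 0 4 2] short[of 1 5 2] n6 by auto
  qed
  then show ?thesis using n by (auto simp: near_iff)
qed simp

section \<open>The nontrivial components of all rounds and their number\<close>

definition comps :: "nat \<Rightarrow> 'b set set" where
  "comps j = (\<lambda>x. (alt j)\<^sup>* `` {x}) ` nontriv j"

lemma finite_comps: "finite (comps j)"
  unfolding comps_def using finite_M nontriv_M finite_subset by blast

lemma comps_eq: "Q \<in> comps j \<Longrightarrow> x \<in> Q \<Longrightarrow> Q = (alt j)\<^sup>* `` {x} \<and> x \<in> nontriv j"
  unfolding comps_def using equiv_alt nontriv_rtrancl by (auto intro: rtrancl_trans)

lemma comps_M: "Q \<in> comps j \<Longrightarrow> Q \<subseteq> M"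
  using comps_eq nontriv_M by blast

lemma comps_nonempty: "Q \<in> comps j \<Longrightarrow> Q \<noteq> {}"
  by (auto simp: comps_def)

lemma comps_same: "Q \<in> comps j \<Longrightarrow> x \<in> Q \<Longrightarrow> y \<in> Q \<Longrightarrow> (x, y) \<in> (alt j)\<^sup>*"
  using comps_eq by blast

lemma in_comps_iff:
  "(x, y) \<in> J \<Longrightarrow> (x, y) \<in> (alt j)\<^sup>* \<longleftrightarrow> (\<exists>Q\<in>comps j. x \<in> Q \<and> y \<in> Q)"
proof
  assume "(x, y) \<in> J" "(x, y) \<in> (alt j)\<^sup>*"
  then have "x \<in> nontriv j"
    by (rule nontriv_if_J)
  then show "\<exists>Q\<in>comps j. x \<in> Q \<and> y \<in> Q" using \<open>(x, y) \<in> (alt j)\<^sup>*\<close> by (auto simp: comps_def)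
qed (auto intro: comps_same)

lemma comps_disjoint: "Q \<in> comps j \<Longrightarrow> Q' \<in> comps j \<Longrightarrow> x \<in> Q \<Longrightarrow> x \<in> Q' \<Longrightarrow> Q = Q'"
  using comps_eq by metis

lemma comps_parent:
  assumes "Q \<in> comps (Suc j)"
  shows "\<exists>R\<in>comps j. Q \<subseteq> R"
proof -
  obtain x where x: "x \<in> nontriv (Suc j)" "Q = (alt (Suc j))\<^sup>* `` {x}" using assms by (auto simp: comps_def)
  then obtain y where "(x, y) \<in> J" "(x, y) \<in> (alt j)\<^sup>*" by (auto simp: nontriv_def)
  then obtain R where R: "R \<in> comps j" "x \<in> R" using in_comps_iff by blast
  have "Q \<subseteq> R" using x(2) alt_Suc_rtrancl comps_eq[OF R] by auto
  with R show ?thesis by blast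
qed

definition comp_level :: "nat \<Rightarrow> 'b set \<Rightarrow> nat" where
  "comp_level j Q = level j (SOME x. x \<in> Q)"

lemma comp_level_eq: "Q \<in> comps j \<Longrightarrow> x \<in> Q \<Longrightarrow> comp_level j Q = level j x"
proof -
  assume Q: "Q \<in> comps j" "x \<in> Q"
  have "(SOME x. x \<in> Q) \<in> Q" using Q(2) by (rule someI)
  then show ?thesis unfolding comp_level_def using comps_same[OF Q(1) _ Q(2)] by (intro level_cong)
qed

lemma comp_level_le: "Q \<in> comps j \<Longrightarrow> x \<in> Q \<Longrightarrow> y \<in> Q \<Longrightarrow> comp_level j Q \<le> c x y"
proof -
  assume Q: "Q \<in> comps j" "x \<in> Q" "y \<in> Q"
  have "level j x \<le> c x y"
    using comps_eq[OF Q(1,2)] comps_same[OF Q] by (intro level_le) auto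
  then show ?thesis using comp_level_eq[OF Q(1,2)] by simp
qed

lemma comp_cross:
  assumes "Q \<in> comps j"
  obtains x y where "x \<in> Q" "y \<in> Q" "(x, y) \<in> alt j" "lab x = \<alpha>" "lab y = \<beta>" "c x y = comp_level j Q"
proof -
  obtain z where z: "z \<in> Q" using comps_nonempty[OF assms] by blast
  then obtain x y where "(z, x) \<in> (alt j)\<^sup>*" "(z, y) \<in> (alt j)\<^sup>*" "(x, y) \<in> alt j" "c x y = level j z"
    using level_attained comps_eq[OF assms] by metis
  moreover from this have "(y, x) \<in> alt j" "c y x = level j z" "x \<in> Q" "y \<in> Q"
    using symD[OF sym_alt] alt_J[of j] c_sym[of x y] comps_eq[OF assms z] by (auto simp: J_def)
  moreover have "lab x = \<alpha> \<and> lab y = \<beta> \<or> lab x = \<beta> \<and> lab y = \<alpha>"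
    using \<open>(x, y) \<in> alt j\<close> alt_J by (auto simp: J_def)
  ultimately show ?thesis using that comp_level_eq[OF assms z] by metis
qed

text \<open>Pairs of \<open>J\<close> across two of these components are non-edges with the same
  history as the edges attaining the level, so they cannot meet at depth \<open>i\<close> and meet
  deeper. For three components with edges \<open>x1 y1\<close>, \<open>x2 y2\<close>,
  \<open>x3 y3\<close> at depth \<open>i\<close>, this puts \<open>x2\<close>, \<open>y3\<close>,
  \<open>x1\<close>, \<open>y2\<close> into one child, although \<open>x2\<close> and
  \<open>y2\<close> meet at depth \<open>i\<close>.\<close>

lemma card_comps_same_node:
  assumes X: "X \<subseteq> M" "\<And>i x y. i < j \<Longrightarrow> x \<in> X \<Longrightarrow> y \<in> X \<Longrightarrow> (x, y) \<in> (alt i)\<^sup>*"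
    and x0: "x0 \<in> M"
  shows "card {Q \<in> comps j. Q \<subseteq> X \<and> comp_level j Q = i \<and> (\<forall>y\<in>Q. i \<le> c x0 y)} \<le> 2"
proof (rule ccontr)
  let ?F = "{Q \<in> comps j. Q \<subseteq> X \<and> comp_level j Q = i \<and> (\<forall>y\<in>Q. i \<le> c x0 y)}"
  assume "\<not> ?thesis"
  then have "3 \<le> card ?F" by simp
  then obtain F where F: "F \<subseteq> ?F" "card F = 3" by (rule obtain_subset_with_card_n)
  obtain P Q R where "F = {P, Q, R}" and ne: "P \<noteq> Q" "P \<noteq> R" "Q \<noteq> R"
    using F(2) unfolding card_3_iff by metis
  then have "P \<in> F" "Q \<in> F" "R \<in> F" by simp_all
  note PQR = this[THEN subsetD[OF F(1)]] ne
  have cross: "Suc i \<le> c x y'"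
    if QQ: "Q \<in> ?F" "Q' \<in> ?F" "Q \<noteq> Q'" and "x \<in> Q" "y' \<in> Q'" "lab x = \<alpha>" "lab y' = \<beta>" for Q Q' x y'
  proof -
    have inX: "x \<in> X" "y' \<in> X" using that by auto
    then have M: "x \<in> M" "y' \<in> M" using X(1) by auto
    have ne: "x \<noteq> y'" using that comps_disjoint by blast
    have J: "(x, y') \<in> J" using M ne that by (auto simp: J_def)
    have "i \<le> c x x0" "i \<le> c x0 y'" using that c_sym[OF M(1) x0] by auto
    then have "i \<le> c x y'" using c_trans[OF M(1) x0 M(2)] by blast
    moreover have "c x y' \<noteq> i"
    proof
      assume "c x y' = i"
      have Qj: "Q \<in> comps j" "comp_level j Q = i" using QQ(1) by auto
      obtain u v where uv: "(u, v) \<in> alt j" "c u v = i"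
        using comp_cross[OF Qj(1)] Qj(2) by metis
      have "(x, y') \<in> alt j"
        using J uv X(2)[of _ x y'] inX \<open>c x y' = i\<close> alt_iff[of u v j] alt_iff[of x y' j] by simp
      then have "y' \<in> Q" using comps_eq[of Q j x] that by auto
      then show False using comps_disjoint[of Q j Q' y'] that by auto
    qed
    ultimately show ?thesis by simp
  qed
  have F: "P \<in> comps j" "comp_level j P = i" "Q \<in> comps j" "comp_level j Q = i"
      "R \<in> comps j" "comp_level j R = i"
    using PQR(1-3) by auto
  obtain x1 y1 where 1: "x1 \<in> P" "y1 \<in> P" "lab x1 = \<alpha>" "lab y1 = \<beta>" "c x1 y1 = i"
    using comp_cross[OF F(1)] F(2) by metis
  obtain x2 y2 where 2: "x2 \<in> Q" "y2 \<in> Q" "lab x2 = \<alpha>" "lab y2 = \<beta>" "c x2 y2 = i"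
    using comp_cross[OF F(3)] F(4) by metis
  obtain x3 y3 where 3: "x3 \<in> R" "y3 \<in> R" "lab x3 = \<alpha>" "lab y3 = \<beta>" "c x3 y3 = i"
    using comp_cross[OF F(5)] F(6) by metis
  have M: "x1 \<in> M" "y1 \<in> M" "x2 \<in> M" "y2 \<in> M" "x3 \<in> M" "y3 \<in> M"
    using 1 2 3 PQR comps_M by blast+
  have a: "Suc i \<le> c x1 y2" "Suc i \<le> c x1 y3" "Suc i \<le> c x2 y3"
    using cross[OF PQR(1,2,4) 1(1) 2(2)] cross[OF PQR(1,3,5) 1(1) 3(2)] cross[OF PQR(2,3,6) 2(1) 3(2)]
      1 2 3 by auto
  have "Suc i \<le> c y3 y2" using c_trans[OF M(6,1,4)] a c_sym[OF M(1,6)] by simp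
  then have "Suc i \<le> c x2 y2" using c_trans[OF M(3,6,4)] a by blast
  then show False using 2 by simp
qed

text \<open>The component of round \<open>j\<close> around such a component branches at the same
  node or at an ancestor of it. This leaves \<open>d + 1\<close> levels for the induction
  hypothesis, and \<open>card_comps_same_node\<close> allows two components per parent.\<close>

lemma card_comps_node:
  assumes x0: "x0 \<in> M"
  shows "card {Q \<in> comps j. comp_level j Q = i \<and> (\<forall>y\<in>Q. i \<le> c x0 y)} \<le> (2 * (d + 1)) ^ (j + 1)"
proof (induction j arbitrary: i)
  case 0
  have "{Q \<in> comps 0. comp_level 0 Q = i \<and> (\<forall>y\<in>Q. i \<le> c x0 y)}
    = {Q \<in> comps 0. Q \<subseteq> M \<and> comp_level 0 Q = i \<and> (\<forall>y\<in>Q. i \<le> c x0 y)}"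
    using comps_M by (intro Collect_cong) blast
  also have "card \<dots> \<le> 2" by (rule card_comps_same_node[OF order_refl _ x0]) simp
  finally show ?case by simp
next
  case (Suc j)
  let ?F = "{Q \<in> comps (Suc j). comp_level (Suc j) Q = i \<and> (\<forall>y\<in>Q. i \<le> c x0 y)}"
  let ?G = "\<Union>i'\<le>d. {Q \<in> comps j. comp_level j Q = i' \<and> (\<forall>y\<in>Q. i' \<le> c x0 y)}"
  define par where "par Q = (SOME R. R \<in> comps j \<and> Q \<subseteq> R)" for Q
  have par: "par Q \<in> comps j" "Q \<subseteq> par Q" if "Q \<in> comps (Suc j)" for Q
    using someI_ex[of "\<lambda>R. R \<in> comps j \<and> Q \<subseteq> R"] comps_parent[OF that] unfolding par_def by blast+
  have "par ` ?F \<subseteq> ?G"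
  proof
    fix R assume "R \<in> par ` ?F"
    then obtain Q where Q: "Q \<in> ?F" "R = par Q" by auto
    have R: "R \<in> comps j" "Q \<subseteq> R" using par Q by auto
    have Qj: "Q \<in> comps (Suc j)" "comp_level (Suc j) Q = i" using Q(1) by auto
    obtain x y where xy: "x \<in> Q" "y \<in> Q" "c x y = i" using comp_cross[OF Qj(1)] Qj(2) by metis
    have lv: "comp_level j R \<le> i" using comp_level_le[OF R(1), of x y] xy R by auto
    have "comp_level j R \<le> c x0 z" if "z \<in> R" for z
    proof -
      have "comp_level j R \<le> c x z" using comp_level_le[OF R(1)] xy R that by blast
      moreover have "comp_level j R \<le> c x0 x" using Q xy lv by auto
      ultimately show ?thesis using c_trans[OF x0 _ _, of x z] comps_M[OF R(1)] R xy that by blast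
    qed
    moreover have "i \<le> d" using xy c_le comps_M[OF R(1)] R by blast
    ultimately show "R \<in> ?G" using R lv by auto
  qed
  moreover have "card {Q \<in> ?F. par Q = R} \<le> 2" if "R \<in> ?G" for R
  proof -
    have R: "R \<in> comps j" using that by auto
    have "(x, y) \<in> (alt i)\<^sup>*" if "i < Suc j" "x \<in> R" "y \<in> R" for i x y
    proof -
      have "alt j \<subseteq> (alt i)\<^sup>*" using that(1) by (cases "i = j") (auto simp: alt_iff[of _ _ j])
      then have "(alt j)\<^sup>* \<subseteq> (alt i)\<^sup>*" by (intro rtrancl_subset_rtrancl)
      then show ?thesis using comps_same[OF R] that by blast
    qed
    then have "card {Q \<in> comps (Suc j). Q \<subseteq> R \<and> comp_level (Suc j) Q = i \<and> (\<forall>y\<in>Q. i \<le> c x0 y)} \<le> 2"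
      by (intro card_comps_same_node[OF comps_M[OF R] _ x0])
    moreover have "{Q \<in> ?F. par Q = R} \<subseteq>
        {Q \<in> comps (Suc j). Q \<subseteq> R \<and> comp_level (Suc j) Q = i \<and> (\<forall>y\<in>Q. i \<le> c x0 y)}"
      using par by auto
    moreover have "finite {Q \<in> comps (Suc j). Q \<subseteq> R \<and> comp_level (Suc j) Q = i \<and> (\<forall>y\<in>Q. i \<le> c x0 y)}"
      using finite_comps by auto
    ultimately show ?thesis by (meson card_mono le_trans)
  qed
  ultimately have "card ?F \<le> 2 * card ?G"
    using finite_comps by (intro card_le_if_fibres_le[of ?F par]) auto
  also have "card ?G \<le> (\<Sum>i'\<le>d. (2 * (d + 1)) ^ (j + 1))"
    by (rule order_trans[OF card_UN_le[OF finite_atMost] sum_mono]) (rule Suc.IH)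
  finally show ?case by simp
qed

text \<open>
  Let \<open>D\<close> arise from the graph by flipping pairs of classes of \<open>cl\<close>. If three components have
  an edge between the same two flipped classes, then after the flip the ends of each of these
  edges are joined by a walk of length three through the other two components.
\<close>

lemma ex_special_comps:
  assumes cl: "\<And>x. x \<in> M \<Longrightarrow> cl x \<in> P" "finite P" "card P \<le> p"
    and cl_lab: "\<And>x y. x \<in> M \<Longrightarrow> y \<in> M \<Longrightarrow> cl x = cl y \<Longrightarrow> lab x = lab y"
    and D: "\<And>x y. (x, y) \<in> J \<Longrightarrow> (x, y) \<in> D \<longleftrightarrow> ((x, y) \<in> alt 0 \<longleftrightarrow> \<not> fl (cl x) (cl y))"
    and D_sym: "sym D"
  shows "\<exists>Sp. Sp \<subseteq> comps j \<and> card Sp \<le> (2 * p\<^sup>2) ^ (j + 1) \<and>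
    (\<forall>Q\<in>comps j - Sp. \<forall>x\<in>Q. \<forall>y\<in>Q. (x, y) \<in> near D 15)"
proof -
  \<comment> \<open>Three is the length of the detour through two further components.\<close>
  define bad where "bad j Q \<longleftrightarrow> (\<exists>x\<in>Q. \<exists>y\<in>Q. (x, y) \<in> alt j \<and> (x, y) \<notin> near D 3)" for j Q
  have card_bad: "card {Q \<in> comps j. Q \<subseteq> X \<and> bad j Q} \<le> 2 * p\<^sup>2"
    if X: "X \<subseteq> M" "\<And>i x y. i < j \<Longrightarrow> x \<in> X \<Longrightarrow> y \<in> X \<Longrightarrow> (x, y) \<in> (alt i)\<^sup>*" for X j
  proof -
    let ?F = "{Q \<in> comps j. Q \<subseteq> X \<and> bad j Q}"
    define e where "e Q = (SOME xy. fst xy \<in> Q \<and> snd xy \<in> Q \<and> xy \<in> alt j \<and> xy \<notin> near D 3)" for Q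
    have e: "fst (e Q) \<in> Q" "snd (e Q) \<in> Q" "e Q \<in> alt j" "e Q \<notin> near D 3" if "Q \<in> ?F" for Q
    proof -
      have "\<exists>xy. fst xy \<in> Q \<and> snd xy \<in> Q \<and> xy \<in> alt j \<and> xy \<notin> near D 3"
        using that unfolding bad_def by force
      from someI_ex[OF this]
      show "fst (e Q) \<in> Q" "snd (e Q) \<in> Q" "e Q \<in> alt j" "e Q \<notin> near D 3" by (auto simp: e_def)
    qed
    define g where "g Q = (cl (fst (e Q)), cl (snd (e Q)))" for Q
    have QM: "Q \<subseteq> M" if "Q \<in> ?F" for Q using that X(1) by blast
    have "g ` ?F \<subseteq> P \<times> P" using e QM cl(1) by (fastforce simp: g_def)
    moreover have "card {Q \<in> ?F. g Q = t} \<le> 2" for t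
    proof (rule ccontr)
      assume "\<not> card {Q \<in> ?F. g Q = t} \<le> 2"
      then have "3 \<le> card {Q \<in> ?F. g Q = t}" by simp
      then obtain F where F: "F \<subseteq> {Q \<in> ?F. g Q = t}" "card F = 3" by (rule obtain_subset_with_card_n)
      obtain Q1 Q2 Q3 where "F = {Q1, Q2, Q3}" and ne: "Q1 \<noteq> Q2" "Q1 \<noteq> Q3" "Q2 \<noteq> Q3"
        using F(2) unfolding card_3_iff by metis
      then have "Q1 \<in> F" "Q2 \<in> F" "Q3 \<in> F" by simp_all
      note inF = this[THEN subsetD[OF F(1)]]
      have gQ: "g Q1 = t" "g Q2 = t" "g Q3 = t" using inF by simp_all
      have "Q1 \<in> ?F" "Q2 \<in> ?F" "Q3 \<in> ?F" using inF by simp_all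
      note Q = this ne
      obtain x1 y1 x2 y2 x3 y3 where xy: "e Q1 = (x1, y1)" "e Q2 = (x2, y2)" "e Q3 = (x3, y3)"
        by (meson surj_pair)
      note e1 = e[OF Q(1), unfolded xy fst_conv snd_conv]
      note e2 = e[OF Q(2), unfolded xy fst_conv snd_conv]
      note e3 = e[OF Q(3), unfolded xy fst_conv snd_conv]
      have cls: "cl x1 = fst t" "cl x2 = fst t" "cl x3 = fst t" "cl y1 = snd t" "cl y2 = snd t" "cl y3 = snd t"
        using gQ xy by (auto simp: g_def)
      have par: "(x, y) \<in> alt j \<longleftrightarrow> ((x, y) \<in> alt 0 \<longleftrightarrow> even j)" if "(x, y) \<in> J" "x \<in> X" "y \<in> X" for x y
        using that X(2) by (auto simp: alt_iff[of _ _ j])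
      have D': "(x, y) \<in> D \<longleftrightarrow> (((x, y) \<in> alt j \<longleftrightarrow> even j) \<longleftrightarrow> \<not> fl (cl x) (cl y))"
        if "(x, y) \<in> J" "x \<in> X" "y \<in> X" for x y
        using par[OF that] D[OF that(1)] by blast
      have inX: "x1 \<in> X" "y1 \<in> X" "x2 \<in> X" "y2 \<in> X" "x3 \<in> X" "y3 \<in> X"
        using e1 e2 e3 Q by auto
      have J1: "(x1, y1) \<in> J" using e1 alt_J by auto
      have "(x1, y1) \<notin> D" using e1(4) near_1[of x1 y1 D 3] by auto
      then have fl: "even j \<longleftrightarrow> fl (fst t) (snd t)" using D'[OF J1] e1(3) inX cls by auto
      have adj: "(x, y) \<in> D" if "Q \<in> ?F" "Q' \<in> ?F" "Q \<noteq> Q'" "x \<in> Q" "y \<in> Q'"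
        "cl x = fst t" "cl y = snd t" for x y Q Q'
      proof -
        have M: "x \<in> M" "y \<in> M" and inX': "x \<in> X" "y \<in> X" using that QM by blast+
        have Q': "Q \<in> comps j" "Q' \<in> comps j" using that(1,2) by auto
        have yQ: "y \<notin> Q" using comps_disjoint[OF Q'] that(3,5) by blast
        then have xy: "x \<noteq> y" "(x, y) \<notin> (alt j)\<^sup>*"
          using that(4) comps_eq[OF Q'(1) that(4)] by auto
        have "x1 \<in> M" "y1 \<in> M" using inX X(1) by auto
        then have "lab x = lab x1" "lab y = lab y1" using that cls M cl_lab by metis+
        then have "(x, y) \<in> J" using J1 M xy by (auto simp: J_def)
        moreover have "(x, y) \<notin> alt j" using xy by blast
        ultimately show ?thesis using D'[OF _ inX'] fl that(6,7) by simp
      qed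
      have "(x1, y2) \<in> D" using adj[OF Q(1,2,4) e1(1) e2(2)] cls by simp
      moreover have "(y2, x3) \<in> D"
        using adj[OF Q(3,2) _ e3(1) e2(2)] cls Q(6) D_sym by (metis symD)
      moreover have "(x3, y1) \<in> D" using adj[OF Q(3,1) _ e3(1) e1(2)] cls Q(5) by metis
      ultimately have "(x1, y1) \<in> near D 3"
        using near_trans[OF near_trans[OF near_1[of x1 y2 D 1] near_1[of y2 x3 D 1]] near_1[of x3 y1 D 1]]
        by (simp add: numeral_3_eq_3)
      then show False using e1 by simp
    qed
    ultimately have "card ?F \<le> 2 * card (P \<times> P)"
      using finite_comps cl(2) by (intro card_le_if_fibres_le[of ?F g]) auto
    also have "card (P \<times> P) \<le> p\<^sup>2" using cl(3) by (simp add: card_cartesian_product power2_eq_square mult_mono)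
    finally show ?thesis by simp
  qed
  \<comment> \<open>At most five edges of the round by \<open>alt_diameter\<close>, each replaced by
    a walk of length at most three in \<open>D\<close>.\<close>
  have near15: "(x, y) \<in> near D 15" if "Q \<in> comps j" "\<not> bad j Q" "x \<in> Q" "y \<in> Q" for Q x y j
  proof -
    have "(x, y) \<in> near (restr (alt j) Q) 5"
    proof -
      have "(x, y) \<in> near (restr (alt j) Q) n" if "(x, y) \<in> near (alt j) n" "x \<in> Q" for n x
        using that
      proof (induction n arbitrary: x)
        case (Suc n)
        then show ?case using comps_eq[OF \<open>Q \<in> comps j\<close>] by (fastforce simp: near_Suc_iff)
      qed simp
      then show ?thesis using alt_diameter comps_same that by blast
    qed
    moreover have "(a, b) \<in> near D 3" if "(a, b) \<in> restr (alt j) Q" for a b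
      using that \<open>\<not> bad j Q\<close> by (auto simp: bad_def)
    ultimately have "(x, y) \<in> near D (5 * 3)" by (rule near_le_mult)
    then show ?thesis by simp
  qed
  show ?thesis
  proof (induction j)
    case 0
    let ?S = "{Q \<in> comps 0. Q \<subseteq> M \<and> bad 0 Q}"
    have "\<not> bad 0 Q" if "Q \<in> comps 0 - ?S" for Q using that comps_M[of Q 0] by blast
    then show ?case
      using card_bad[of M 0] near15[of _ 0] by (intro exI[of _ ?S]) auto
  next
    case (Suc j)
    then obtain Sp where Sp: "Sp \<subseteq> comps j" "card Sp \<le> (2 * p\<^sup>2) ^ (j + 1)"
      "\<forall>Q\<in>comps j - Sp. \<forall>x\<in>Q. \<forall>y\<in>Q. (x, y) \<in> near D 15" by blast
    have fSp: "finite Sp" using Sp(1) finite_comps finite_subset by blast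
    \<comment> \<open>A component inside a non-special one of the previous round inherits its bound,
      so only the children of special components are inspected.\<close>
    let ?S = "\<Union>R\<in>Sp. {Q \<in> comps (Suc j). Q \<subseteq> R \<and> bad (Suc j) Q}"
    have "card ?S \<le> (\<Sum>R\<in>Sp. 2 * p\<^sup>2)"
    proof (rule order_trans[OF card_UN_le[OF fSp]], rule sum_mono)
      fix R assume "R \<in> Sp"
      then have R: "R \<in> comps j" using Sp by blast
      have "(x, y) \<in> (alt i)\<^sup>*" if "i < Suc j" "x \<in> R" "y \<in> R" for i x y
      proof -
        have "alt j \<subseteq> (alt i)\<^sup>*" using that(1) by (cases "i = j") (auto simp: alt_iff[of _ _ j])
        then have "(alt j)\<^sup>* \<subseteq> (alt i)\<^sup>*" by (intro rtrancl_subset_rtrancl)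
        then show ?thesis using comps_same[OF R] that by blast
      qed
      then show "card {Q \<in> comps (Suc j). Q \<subseteq> R \<and> bad (Suc j) Q} \<le> 2 * p\<^sup>2"
        by (intro card_bad[OF comps_M[OF R]])
    qed
    also have "\<dots> = card Sp * (2 * p\<^sup>2)" by simp
    also have "\<dots> \<le> (2 * p\<^sup>2) ^ (j + 1) * (2 * p\<^sup>2)" by (rule mult_le_mono1[OF Sp(2)])
    finally have "card ?S \<le> (2 * p\<^sup>2) ^ (Suc j + 1)" by (simp add: mult.commute)
    moreover have "(x, y) \<in> near D 15" if Q: "Q \<in> comps (Suc j) - ?S" "x \<in> Q" "y \<in> Q" for Q x y
    proof -
      have "\<exists>R\<in>comps j. Q \<subseteq> R" using Q(1) by (intro comps_parent) simp
      then obtain R where R: "R \<in> comps j" "Q \<subseteq> R" by blast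
      show ?thesis
      proof (cases "R \<in> Sp")
        case True
        then have "\<not> bad (Suc j) Q" using R Q(1) by auto
        then show ?thesis using near15[of Q "Suc j"] Q by simp
      next
        case False
        then show ?thesis using Sp(3) R Q by blast
      qed
    qed
    ultimately show ?case by (intro exI[of _ ?S]) blast
  qed
qed

end

section \<open>Chains of ancestors\<close>

lemma rtrancl_last_step:
  assumes "(x, u) \<in> (restr A K)\<^sup>*" "x \<noteq> u"
  shows "\<exists>y. (x, y) \<in> (restr A (K - {u}))\<^sup>* \<and> (y, u) \<in> restr A K \<and> y \<noteq> u"
  using assms
proof (induction rule: converse_rtrancl_induct)
  case (step x z)
  show ?case
  proof (cases "z = u")
    case False
    then obtain y where y: "(z, y) \<in> (restr A (K - {u}))\<^sup>*" "(y, u) \<in> restr A K" "y \<noteq> u" using step by blast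
    have "(x, z) \<in> restr A (K - {u})" using step False by auto
    then show ?thesis using y by (meson converse_rtrancl_into_rtrancl)
  qed (use step in blast)
qed simp

lemma rtrancl_in: "(x, y) \<in> (restr A K)\<^sup>* \<Longrightarrow> x \<in> K \<Longrightarrow> y \<in> K"
  by (induction rule: rtrancl_induct) auto

lemma component_connected:
  assumes "sym A" "K = {w. (x, w) \<in> (restr A N)\<^sup>*}" "a \<in> K" "b \<in> K"
  shows "(a, b) \<in> (restr A K)\<^sup>*"
proof -
  have sub: "(x, w) \<in> (restr A K)\<^sup>*" if "(x, w) \<in> (restr A N)\<^sup>*" for w
    using that
  proof (induction rule: rtrancl_induct)
    case (step y z)
    have "(x, z) \<in> (restr A N)\<^sup>*" using step(1,2) by (rule rtrancl_into_rtrancl)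
    then have "(y, z) \<in> restr A K" using step(1,2) assms(2) by auto
    with step(3) show ?case by (rule rtrancl_into_rtrancl)
  qed simp
  have "(x, a) \<in> (restr A K)\<^sup>*" "(x, b) \<in> (restr A K)\<^sup>*" using sub assms by auto
  then show ?thesis
    using sym_rtrancl[OF sym_restr[OF assms(1)]] by (meson rtrancl_trans symD)
qed

text \<open>
  The colouring is injective on sets of weakly reachable vertices. A connected set with \<open>p\<close>
  colours then has a unique vertex of the colour of its lowest vertex \<open>u\<close>, and removing \<open>u\<close>
  leaves sets with fewer colours.
\<close>

lemma connected_few_colours:
  assumes "sym A" "A \<subseteq> V \<times> V"
    and inj: "\<And>x. x \<in> V \<Longrightarrow> inj_on \<chi> (wreach A \<rho> D x)" and "2 ^ p \<le> D"
    and "K \<subseteq> V" "finite K" "card (\<chi> ` K) \<le> p"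
    and "\<And>x y. x \<in> K \<Longrightarrow> y \<in> K \<Longrightarrow> (x, y) \<in> (restr A K)\<^sup>*"
    and "u \<in> K" "\<And>x. x \<in> K \<Longrightarrow> \<rho> u \<le> \<rho> x" "x \<in> K"
  shows "(x, u) \<in> near (restr A K) (2 ^ p - 1)"
  using assms(4-)
proof (induction p arbitrary: K u x)
  case 0
  then show ?case by auto
next
  case (Suc p)
  have KV: "K \<subseteq> V" and finK: "finite K" and colK: "card (\<chi> ` K) \<le> Suc p"
    and conK: "\<And>x y. x \<in> K \<Longrightarrow> y \<in> K \<Longrightarrow> (x, y) \<in> (restr A K)\<^sup>*"
    and uK: "u \<in> K" and u_min: "\<And>x. x \<in> K \<Longrightarrow> \<rho> u \<le> \<rho> x" and D: "2 ^ Suc p \<le> D"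
    by (fact Suc.prems)+
  define N where "N = {w \<in> K. \<chi> w \<noteq> \<chi> u}"
  \<comment> \<open>A connected part of \<open>N\<close> misses the colour of \<open>u\<close>. By
    induction its vertices are close to its lowest vertex, and two of them are joined within twice
    that distance.\<close>
  have short: "(y, y') \<in> near (restr A K) (2 * (2 ^ p - 1))" if y: "(y, y') \<in> (restr A N)\<^sup>*" "y \<in> N" for y y'
  proof -
    define K' where "K' = {w. (y, w) \<in> (restr A N)\<^sup>*}"
    have K'N: "K' \<subseteq> N" using rtrancl_in[of y _ A N] y(2) by (auto simp: K'_def)
    have NK: "N \<subseteq> K" by (auto simp: N_def)
    have K'V: "K' \<subseteq> V" and finK': "finite K'" using K'N NK KV finK by (auto intro: finite_subset)
    have "\<chi> ` K' \<subseteq> \<chi> ` K - {\<chi> u}" using K'N NK by (auto simp: N_def)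
    then have "card (\<chi> ` K') \<le> card (\<chi> ` K - {\<chi> u})" using finK by (intro card_mono) auto
    also have "\<dots> \<le> p" using colK uK finK by (simp add: card_Diff_singleton)
    finally have col: "card (\<chi> ` K') \<le> p" .
    have con: "(a, b) \<in> (restr A K')\<^sup>*" if "a \<in> K'" "b \<in> K'" for a b
      by (rule component_connected[OF assms(1) K'_def that])
    have yK': "y \<in> K'" "y' \<in> K'" using y by (auto simp: K'_def)
    have "Min (\<rho> ` K') \<in> \<rho> ` K'" using finK' yK' by (intro Min_in) auto
    then obtain u' where u': "u' \<in> K'" "\<rho> u' = Min (\<rho> ` K')" by auto
    then have u'_min: "\<rho> u' \<le> \<rho> x" if "x \<in> K'" for x using finK' that by simp
    have D': "2 ^ p \<le> D" using D by simp
    have "(y, u') \<in> near (restr A K') (2 ^ p - 1)" "(y', u') \<in> near (restr A K') (2 ^ p - 1)"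
      using Suc.IH[OF D' K'V finK' col con u'(1) u'_min] yK' by blast+
    then have "(y, y') \<in> near (restr A K') ((2 ^ p - 1) + (2 ^ p - 1))"
      using near_sym[OF sym_restr[OF assms(1)]] by (blast intro: near_trans)
    then show ?thesis by (rule near_mono) (use K'N NK in auto)
  qed
  \<comment> \<open>Take the last vertex \<open>x'\<close> other than \<open>u\<close> of the colour
    of \<open>u\<close> on a walk to \<open>u\<close>. From there the walk runs through
    \<open>N\<close>, so \<open>u\<close> is a hub of \<open>x'\<close> within range
    \<open>2 ^ Suc p\<close>. Then \<open>x'\<close> has two hubs of one colour, itself and
    \<open>u\<close>.\<close>
  have unique: "x = u" if x: "x \<in> K" "\<chi> x = \<chi> u" for x
  proof (rule ccontr)
    assume "x \<noteq> u"
    define Good where "Good \<longleftrightarrow> (\<exists>x'\<in>K. x' \<noteq> u \<and> \<chi> x' = \<chi> u \<and>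
      ((x', u) \<in> A \<or> (\<exists>y y'. y \<in> N \<and> (x', y) \<in> A \<and> (y, y') \<in> (restr A N)\<^sup>* \<and> (y', u) \<in> A)))"
    have "x = u \<or> (x \<in> N \<and> (\<exists>y'. (x, y') \<in> (restr A N)\<^sup>* \<and> (y', u) \<in> A)) \<or> Good"
      using conK[OF x(1) uK] x(1)
    proof (induction rule: converse_rtrancl_induct)
      case (step w z)
      have w: "w \<in> K" "z \<in> K" "(w, z) \<in> A" using step(1) by auto
      consider "z = u" | "z \<noteq> u" "z \<in> N" "\<exists>y'. (z, y') \<in> (restr A N)\<^sup>* \<and> (y', u) \<in> A" | Good
        using step.IH w(2) by blast
      then show ?case
      proof cases
        case 1
        show ?thesis
        proof (cases "w \<in> N")
          case True
          then show ?thesis using w 1 by blast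
        next
          case False
          then show ?thesis using w 1 by (auto simp: N_def Good_def)
        qed
      next
        case 2
        then obtain y' where y': "(z, y') \<in> (restr A N)\<^sup>*" "(y', u) \<in> A" by blast
        show ?thesis
        proof (cases "w \<in> N")
          case True
          then have "(w, z) \<in> restr A N" using w 2 by auto
          then have "(w, y') \<in> (restr A N)\<^sup>*" using y'(1) by (rule converse_rtrancl_into_rtrancl)
          then show ?thesis using True y'(2) by blast
        next
          case False
          then have "w = u \<or> (w \<noteq> u \<and> \<chi> w = \<chi> u)" using w by (auto simp: N_def)
          then show ?thesis using w 2(2) y' unfolding Good_def by blast
        qed
      qed blast
    qed simp
    then have Good using \<open>x \<noteq> u\<close> x by (auto simp: N_def)
    then obtain x' where x': "x' \<in> K" "x' \<noteq> u" "\<chi> x' = \<chi> u"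
      "(x', u) \<in> A \<or> (\<exists>y y'. y \<in> N \<and> (x', y) \<in> A \<and> (y, y') \<in> (restr A N)\<^sup>* \<and> (y', u) \<in> A)"
      unfolding Good_def by blast
    have "(x', u) \<in> near (restr A K) (2 ^ Suc p)"
      using x'(4)
    proof
      assume "(x', u) \<in> A"
      then show ?thesis using x'(1) uK by (intro near_1) auto
    next
      assume "\<exists>y y'. y \<in> N \<and> (x', y) \<in> A \<and> (y, y') \<in> (restr A N)\<^sup>* \<and> (y', u) \<in> A"
      then obtain y y' where y: "y \<in> N" "(x', y) \<in> A" "(y, y') \<in> (restr A N)\<^sup>*" "(y', u) \<in> A" by blast
      have "y' \<in> N" by (rule rtrancl_in[OF y(3,1)])
      have yK: "y \<in> K" "y' \<in> K" using y(1) \<open>y' \<in> N\<close> by (auto simp: N_def)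
      have "(x', y) \<in> near (restr A K) 1" "(y', u) \<in> near (restr A K) 1"
        using x'(1) uK y yK by (auto intro!: near_1)
      then have "(x', u) \<in> near (restr A K) (1 + (2 * (2 ^ p - 1)) + 1)"
        using short[OF y(3,1)] by (blast intro: near_trans)
      moreover have "1 + (2 * (2 ^ p - 1)) + 1 = (2 :: nat) ^ Suc p"
        by (cases "(2 :: nat) ^ p") simp_all
      ultimately show ?thesis by simp
    qed
    then have "u \<in> wreach A \<rho> D x'"
      unfolding wreach_def using u_min D by (auto elim!: near_mono)
    moreover have "x' \<in> V" using x'(1) KV by blast
    ultimately show False using inj_onD[OF inj[of x'], of u x'] x' by simp
  qed
  show ?case
  proof (cases "x = u")
    case False
    have xK: "x \<in> K" by (rule Suc.prems)
    obtain y where y: "(x, y) \<in> (restr A (K - {u}))\<^sup>*" "(y, u) \<in> restr A K" "y \<noteq> u"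
      using rtrancl_last_step[OF conK[OF xK uK] False] by blast
    have "K - {u} = N" using unique by (auto simp: N_def)
    then have "(x, y) \<in> near (restr A K) (2 * (2 ^ p - 1))" using short[of x y] y(1) xK False by auto
    then have "(x, u) \<in> near (restr A K) (2 * (2 ^ p - 1) + 1)"
      using near_1[OF y(2), of 1] by (blast intro: near_trans)
    moreover have "2 * (2 ^ p - 1) + 1 = 2 ^ Suc p - (1 :: nat)"
      by (cases "(2 :: nat) ^ p") simp_all
    ultimately show ?thesis by simp
  qed simp
qed

text \<open>The ancestors of \<open>v\<close> in the elimination forest of the graph induced on
  \<open>U\<close>, with low ranks near the roots.\<close>

definition anc :: "('b \<times> 'b) set \<Rightarrow> ('b \<Rightarrow> nat) \<Rightarrow> 'b set \<Rightarrow> 'b \<Rightarrow> 'b set" where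
  "anc A \<rho> U v = {u \<in> U. (v, u) \<in> (restr A (U \<inter> {a. \<rho> u \<le> \<rho> a}))\<^sup>*}"

lemma anc_self: "v \<in> U \<Longrightarrow> v \<in> anc A \<rho> U v"
  by (simp add: anc_def)

lemma anc_edge: "(v, u) \<in> A \<Longrightarrow> u \<in> U \<Longrightarrow> v \<in> U \<Longrightarrow> \<rho> u \<le> \<rho> v \<Longrightarrow> u \<in> anc A \<rho> U v"
  by (auto simp: anc_def)

text \<open>\<open>u\<close> and \<open>v\<close> lie in one component of the vertices above
  \<open>u\<close>, hence in one component of the vertices above any lower \<open>w\<close>. This
  yields the tree property of \<open>chains\<close>.\<close>

lemma anc_down:
  assumes "sym A" "u \<in> anc A \<rho> U v" "w \<in> U" "\<rho> w \<le> \<rho> u"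
  shows "w \<in> anc A \<rho> U v \<longleftrightarrow> w \<in> anc A \<rho> U u"
proof -
  let ?Q = "restr A (U \<inter> {a. \<rho> w \<le> \<rho> a})"
  have "(restr A (U \<inter> {a. \<rho> u \<le> \<rho> a}))\<^sup>* \<subseteq> ?Q\<^sup>*" using assms(4) by (intro rtrancl_mono) auto
  then have "(v, u) \<in> ?Q\<^sup>*" using assms(2) by (auto simp: anc_def)
  moreover from this have "(u, v) \<in> ?Q\<^sup>*"
    using sym_rtrancl[OF sym_restr[OF assms(1)]] by (meson symD)
  ultimately show ?thesis using assms(3) by (auto simp: anc_def intro: rtrancl_trans)
qed

text \<open>The component that witnesses an ancestor has few colours, so by
  \<open>connected_few_colours\<close> its lowest vertex is close to \<open>v\<close> inside it.
  Ancestors are therefore hubs, and a colouring that is injective on hubs bounds their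
  number.\<close>

lemma anc_wreach:
  assumes "sym A" "A \<subseteq> V \<times> V" "\<And>x. x \<in> V \<Longrightarrow> inj_on \<chi> (wreach A \<rho> (2 ^ p) x)"
    and U: "U \<subseteq> V" "finite U" "card (\<chi> ` U) \<le> p" and v: "v \<in> U"
  shows "anc A \<rho> U v \<subseteq> wreach A \<rho> (2 ^ p) v"
proof
  fix u assume u: "u \<in> anc A \<rho> U v"
  define K where "K = {w. (v, w) \<in> (restr A (U \<inter> {a. \<rho> u \<le> \<rho> a}))\<^sup>*}"
  have uK: "u \<in> K" and uU: "u \<in> U" using u by (auto simp: K_def anc_def)
  have v_ge: "\<rho> u \<le> \<rho> v"
  proof (cases "u = v")
    case False
    have "(v, u) \<in> (restr A (U \<inter> {a. \<rho> u \<le> \<rho> a}))\<^sup>*" using u by (simp add: anc_def)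
    then show ?thesis using False by (cases rule: converse_rtranclE) auto
  qed simp
  have KU: "K \<subseteq> U \<inter> {a. \<rho> u \<le> \<rho> a}" using rtrancl_in v v_ge by (fastforce simp: K_def)
  have "(v, u) \<in> near (restr A K) (2 ^ p - 1)"
  proof (rule connected_few_colours[OF assms(1-3)])
    show "K \<subseteq> V" "finite K" using KU U by (auto intro: finite_subset)
    have "card (\<chi> ` K) \<le> card (\<chi> ` U)" using KU U by (intro card_mono) auto
    then show "card (\<chi> ` K) \<le> p" using U(3) by simp
    show "(a, b) \<in> (restr A K)\<^sup>*" if "a \<in> K" "b \<in> K" for a b
      by (rule component_connected[OF assms(1) K_def that])
    show "\<rho> u \<le> \<rho> x" if "x \<in> K" for x using that KU by blast
    show "v \<in> K" by (simp add: K_def)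
  qed (use uK in auto)
  then show "u \<in> wreach A \<rho> (2 ^ p) v"
    unfolding wreach_def using KU by (auto elim!: near_mono)
qed

text \<open>\<open>ch x\<close> plays the path from a root to \<open>x\<close> in a forest of height
  \<open>d\<close>: by \<open>tree\<close>, two paths sharing an element share everything of lower
  rank. The forest is never built; its nodes are the elements of the chains, \<open>idx\<close> is
  their depth and \<open>meet\<close> the depth of the last common node.\<close>

locale chains =
  fixes M :: "'b set" and ch :: "'b \<Rightarrow> 'c set" and \<rho> :: "'c \<Rightarrow> nat" and d :: nat
  assumes finite_ch: "x \<in> M \<Longrightarrow> finite (ch x)" and card_ch: "x \<in> M \<Longrightarrow> card (ch x) \<le> d"
    and inj_\<rho>: "x \<in> M \<Longrightarrow> inj_on \<rho> (ch x)"
    and tree: "x \<in> M \<Longrightarrow> y \<in> M \<Longrightarrow> u \<in> ch x \<Longrightarrow> u \<in> ch y \<Longrightarrow> w \<in> ch x \<Longrightarrow> \<rho> w \<le> \<rho> u \<Longrightarrow> w \<in> ch y"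
begin

definition meet :: "'b \<Rightarrow> 'b \<Rightarrow> nat" where
  "meet x y = card (ch x \<inter> ch y)"

definition idx :: "'b \<Rightarrow> 'c \<Rightarrow> nat" where
  "idx x u = card {w \<in> ch x. \<rho> w \<le> \<rho> u}"

lemma meet_sym: "meet x y = meet y x"
  by (simp add: meet_def Int_commute)

lemma meet_le: "x \<in> M \<Longrightarrow> meet x y \<le> d"
  unfolding meet_def using card_mono[OF finite_ch, of x "ch x \<inter> ch y"] card_ch[of x] by fastforce

text \<open>The parts of \<open>ch y\<close> shared with \<open>x\<close> and with \<open>z\<close>
  are initial segments of \<open>ch y\<close>, hence comparable, and the smaller one is shared by
  all three.\<close>

lemma meet_ultra:
  assumes "x \<in> M" "y \<in> M" "z \<in> M"
  shows "min (meet x y) (meet y z) \<le> meet x z"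
proof (cases "ch x \<inter> ch y \<subseteq> ch z")
  case True
  then have "ch x \<inter> ch y \<subseteq> ch x \<inter> ch z" by blast
  then have "meet x y \<le> meet x z" unfolding meet_def using finite_ch assms by (intro card_mono) auto
  then show ?thesis by simp
next
  case False
  then obtain u where u: "u \<in> ch x" "u \<in> ch y" "u \<notin> ch z" by blast
  have "w \<in> ch x" if w: "w \<in> ch y" "w \<in> ch z" for w
  proof (cases "\<rho> w \<le> \<rho> u")
    case True
    then show ?thesis using tree[OF assms(2,1) u(2,1) w(1)] by blast
  next
    case False
    then have "u \<in> ch z" using tree[OF assms(2,3) w(1,2) u(2)] by simp
    then show ?thesis using u by blast
  qed
  then have "ch y \<inter> ch z \<subseteq> ch x \<inter> ch z" by blast
  then have "meet y z \<le> meet x z" unfolding meet_def using finite_ch assms by (intro card_mono) auto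
  then show ?thesis by simp
qed

lemma idx_cong: "x \<in> M \<Longrightarrow> y \<in> M \<Longrightarrow> u \<in> ch x \<Longrightarrow> u \<in> ch y \<Longrightarrow> idx x u = idx y u"
  unfolding idx_def using tree by (intro arg_cong[where f = card]) blast

lemma idx_le_meet:
  assumes "x \<in> M" "y \<in> M" "u \<in> ch x" "u \<in> ch y"
  shows "idx x u \<le> meet x y"
  unfolding idx_def meet_def using tree[OF assms] finite_ch[OF assms(1)] by (intro card_mono) auto

lemma idx_pos: "x \<in> M \<Longrightarrow> u \<in> ch x \<Longrightarrow> 1 \<le> idx x u"
proof -
  assume x: "x \<in> M" "u \<in> ch x"
  then have "0 < idx x u" unfolding idx_def card_gt_0_iff using finite_ch by auto
  then show ?thesis by simp
qed

lemma idx_inj: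
  assumes "x \<in> M" "u \<in> ch x" "v \<in> ch x" "idx x u = idx x v"
  shows "u = v"
proof (rule ccontr)
  have *: "idx x u < idx x v" if "u \<in> ch x" "v \<in> ch x" "\<rho> u < \<rho> v" for u v
  proof -
    have "v \<in> {w \<in> ch x. \<rho> w \<le> \<rho> v} - {w \<in> ch x. \<rho> w \<le> \<rho> u}" using that by simp
    moreover have "{w \<in> ch x. \<rho> w \<le> \<rho> u} \<subseteq> {w \<in> ch x. \<rho> w \<le> \<rho> v}" using that(3) by auto
    ultimately have "{w \<in> ch x. \<rho> w \<le> \<rho> u} \<subset> {w \<in> ch x. \<rho> w \<le> \<rho> v}" by blast
    then show ?thesis unfolding idx_def using finite_ch[OF assms(1)] by (intro psubset_card_mono) auto
  qed
  assume "u \<noteq> v"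
  then have "\<rho> u \<noteq> \<rho> v" using inj_\<rho>[OF assms(1)] assms(2,3) by (auto dest: inj_onD)
  then show False using *[of u v] *[of v u] assms by linarith
qed

text \<open>Otherwise all shared elements lie below \<open>u\<close> in \<open>ch x\<close>, and
  \<open>u\<close> would have a position beyond \<open>meet x y\<close>.\<close>

lemma in_meet:
  assumes "x \<in> M" "y \<in> M" "u \<in> ch x" "idx x u \<le> meet x y"
  shows "u \<in> ch y"
proof (rule ccontr)
  assume u: "u \<notin> ch y"
  have "\<rho> w \<le> \<rho> u" if "w \<in> ch x" "w \<in> ch y" for w
    using tree[OF assms(1,2) that assms(3)] u by (meson linear)
  then have "insert u (ch x \<inter> ch y) \<subseteq> {w \<in> ch x. \<rho> w \<le> \<rho> u}" using assms(3) by auto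
  then have "card (insert u (ch x \<inter> ch y)) \<le> idx x u"
    unfolding idx_def using finite_ch[OF assms(1)] by (intro card_mono) auto
  then show False using u assms(4) finite_ch[OF assms(1)] by (simp add: meet_def)
qed

lemma ex_idx:
  assumes "x \<in> M" "1 \<le> i" "i \<le> card (ch x)"
  shows "\<exists>u\<in>ch x. idx x u = i"
proof -
  have fin: "finite (ch x)" by (rule finite_ch[OF assms(1)])
  have "inj_on (idx x) (ch x)" using idx_inj[OF assms(1)] by (auto simp: inj_on_def)
  then have "card (idx x ` ch x) = card (ch x)" by (rule card_image)
  moreover have "idx x ` ch x \<subseteq> {1..card (ch x)}"
  proof -
    have "idx x u \<le> card (ch x)" for u unfolding idx_def using fin by (intro card_mono) auto
    then show ?thesis using idx_pos[OF assms(1)] by auto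
  qed
  ultimately have "idx x ` ch x = {1..card (ch x)}" by (intro card_subset_eq) auto
  then show ?thesis using assms(2,3) by (metis atLeastAtMost_iff imageE)
qed

definition node :: "nat \<Rightarrow> 'b \<Rightarrow> 'c" where
  "node i x = (SOME u. u \<in> ch x \<and> idx x u = i)"

lemma node:
  assumes "x \<in> M" "1 \<le> i" "i \<le> card (ch x)"
  shows "node i x \<in> ch x" "idx x (node i x) = i"
  using someI_ex[of "\<lambda>u. u \<in> ch x \<and> idx x u = i"] ex_idx[OF assms] unfolding node_def by blast+

lemma meet_le_card: "x \<in> M \<Longrightarrow> meet x y \<le> card (ch x)"
  unfolding meet_def using finite_ch by (intro card_mono) auto

lemma node_in:
  assumes "x \<in> M" "y \<in> M" "1 \<le> i" "i \<le> meet x y"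
  shows "node i x \<in> ch y"
proof -
  have "i \<le> card (ch x)" using meet_le_card[OF assms(1)] assms(4) le_trans by blast
  from node[OF assms(1,3) this] show ?thesis using in_meet[OF assms(1,2)] assms(4) by simp
qed

text \<open>Up to the meet, a position names the same element in both chains. So the shared elements
  can be read off from separate tables for \<open>x\<close> and \<open>y\<close> together with the
  number \<open>meet x y\<close>, which turns adjacency into a function of the meet depth.\<close>

lemma shared_iff:
  assumes xy: "x \<in> M" "y \<in> M" and X: "X \<subseteq> ch x" and Y: "Y \<subseteq> ch y"
  shows "f ` (X \<inter> Y) = {a. \<exists>i\<le>meet x y. (\<exists>u\<in>X. a = f u \<and> i = idx x u) \<and> (\<exists>u\<in>Y. a = f u \<and> i = idx y u)}"
proof (intro equalityI subsetI)
  fix a assume "a \<in> f ` (X \<inter> Y)"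
  then obtain u where u: "u \<in> X" "u \<in> Y" "a = f u" by blast
  then have "u \<in> ch x" "u \<in> ch y" using X Y by auto
  then have "idx x u \<le> meet x y" "idx y u = idx x u" using idx_le_meet idx_cong xy by metis+
  then show "a \<in> {a. \<exists>i\<le>meet x y. (\<exists>u\<in>X. a = f u \<and> i = idx x u) \<and> (\<exists>u\<in>Y. a = f u \<and> i = idx y u)}"
    using u by (auto intro!: exI[of _ "idx x u"])
next
  fix a assume "a \<in> {a. \<exists>i\<le>meet x y. (\<exists>u\<in>X. a = f u \<and> i = idx x u) \<and> (\<exists>u\<in>Y. a = f u \<and> i = idx y u)}"
  then obtain u v where u: "u \<in> X" "v \<in> Y" "a = f u" "idx x u \<le> meet x y" "idx y v = idx x u" by auto
  have ux: "u \<in> ch x" "v \<in> ch y" using u X Y by auto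
  have uy: "u \<in> ch y" using in_meet[OF xy ux(1) u(4)] .
  have "idx y u = idx y v" using idx_cong[OF xy ux(1) uy] u(5) by simp
  then have "u = v" using idx_inj[OF xy(2) uy ux(2)] by blast
  then show "a \<in> f ` (X \<inter> Y)" using u by blast
qed

end

section \<open>Transductions of classes with bounded expansion\<close>

text \<open>The lower end of an edge of \<open>R\<close> is a hub of the higher one at range 1, so
  the edge is recognised by a colour that occurs both in the pattern and in the list
  \<open>adj\<close> of the higher end. Edges at \<open>S\<close> are absent from \<open>R\<close>;
  they are recorded by numbering \<open>S\<close> and storing the numbers of the neighbours in
  \<open>S\<close>.\<close>

lemma ex_base_labelling:
  "\<exists>K0. \<forall>(G :: 'a pair_pre_digraph) P R \<rho> \<chi> N S.
     pair_graph G \<longrightarrow> hub_system (pverts G) R \<rho> \<chi> N k \<longrightarrow> 1 \<le> N \<longrightarrow> R = restr (parcs G) (pverts G - S) \<longrightarrow>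
     S \<subseteq> pverts G \<longrightarrow> card S \<le> s \<longrightarrow>
     (\<exists>l0. (\<forall>x\<in>pverts G. l0 x < K0) \<and> base_labelling G P R \<rho> \<chi> {1..nc} l0)"
proof -
  define \<Lambda> where "\<Lambda> = {..<k} \<times> Pow {1..nc} \<times> Pow {..<k} \<times> Pow {..<s} \<times> Pow {..<s}"
  have fin: "finite \<Lambda>" by (simp add: \<Lambda>_def)
  obtain g where g: "inj_on g \<Lambda>" "g ` \<Lambda> \<subseteq> {..<card \<Lambda>}" using ex_recode[OF fin] by metis
  show ?thesis
  proof (intro exI[of _ "card \<Lambda>"] allI impI)
    fix G :: "'a pair_pre_digraph" and P R \<rho> \<chi> N S
    assume G: "pair_graph G" and hs: "hub_system (pverts G) R \<rho> \<chi> N k" and N: "1 \<le> N"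
      and R: "R = restr (parcs G) (pverts G - S)" and S: "S \<subseteq> pverts G" "card S \<le> s"
    note Gf = G[unfolded pair_graph_iff]
    interpret hub_system "pverts G" R \<rho> \<chi> N k by (rule hs)
    have finS: "finite S" using S(1) finite_V finite_subset by blast
    obtain e :: "'a \<Rightarrow> nat" where e0: "inj_on e S" "e ` S \<subseteq> {..<card S}" using ex_recode[OF finS] by metis
    have e: "inj_on e S" "e t < s" if "t \<in> S" for t using e0 S(2) that by auto
    define adj where "adj x = {\<chi> u | u. u \<in> W 1 x \<and> (x, u) \<in> R}" for x
    define sx where "sx x = e ` ({x} \<inter> S)" for x
    define nx where "nx x = {e t | t. t \<in> S \<and> (t, x) \<in> parcs G}" for x
    define t where "t x = (\<chi> x, {i \<in> {1..nc}. x \<in> P i}, adj x, sx x, nx x)" for x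
    have t\<Lambda>: "t x \<in> \<Lambda>" if x: "x \<in> pverts G" for x
    proof -
      have "adj x \<subseteq> {..<k}" using W_V[OF x] \<chi>_less by (auto simp: adj_def)
      moreover have "sx x \<subseteq> {..<s}" "nx x \<subseteq> {..<s}" using e(2) by (auto simp: sx_def nx_def)
      ultimately show ?thesis using \<chi>_less[OF x] by (auto simp: t_def \<Lambda>_def)
    qed
    define l0 where "l0 = g \<circ> t"
    have tD: "t x = t y" if "x \<in> pverts G" "y \<in> pverts G" "l0 x = l0 y" for x y
      using that t\<Lambda> g(1) by (auto simp: l0_def dest: inj_onD)
    define \<Psi> where "\<Psi> x y q \<longleftrightarrow> (\<chi> y \<in> adj x \<and> \<chi> y \<in> q) \<or> (\<chi> x \<in> adj y \<and> \<chi> x \<in> q) \<or>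
        sx x \<inter> nx y \<noteq> {} \<or> sx y \<inter> nx x \<noteq> {}" for x y q
    have R_edge: "(x, y) \<in> R" if xy: "x \<in> pverts G" "y \<in> pverts G" "\<chi> y \<in> adj x" "\<chi> y \<in> pat 1 x y" for x y
    proof -
      obtain u where u: "u \<in> W 1 x" "(x, u) \<in> R" "\<chi> u = \<chi> y" using xy(3) by (auto simp: adj_def)
      obtain w where w: "w \<in> W 1 x" "w \<in> W 1 y" "\<chi> w = \<chi> y" using xy(4) by (auto simp: pat_def)
      have "w = y" using \<chi>_eqD[OF xy(2) N w(2), of y] w(3) by simp
      moreover have "u = w" using \<chi>_eqD[OF xy(1) N u(1) w(1)] u(3) w(3) by simp
      ultimately show ?thesis using u(2) by simp
    qed
    have edge_R: "\<chi> y \<in> adj x \<and> \<chi> y \<in> pat 1 x y" if "(x, y) \<in> R" "\<rho> y \<le> \<rho> x" for x y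
    proof -
      have "y \<in> W 1 x" using wreach_edge[of x y R \<rho> 1] that by simp
      then show ?thesis using that(1) by (auto simp: adj_def pat_def)
    qed
    have \<Psi>: "(x, y) \<in> parcs G \<longleftrightarrow> \<Psi> x y (pat 1 x y)" if xy: "x \<in> pverts G" "y \<in> pverts G" for x y
    proof
      assume a: "(x, y) \<in> parcs G"
      then have a': "(y, x) \<in> parcs G" using Gf by (meson symD)
      consider "x \<in> S" | "y \<in> S" | "(x, y) \<in> R" using a xy R by auto
      then show "\<Psi> x y (pat 1 x y)"
      proof cases
        case 1
        then have "e x \<in> sx x \<inter> nx y" using a by (auto simp: sx_def nx_def)
        then show ?thesis by (auto simp: \<Psi>_def)
      next
        case 2
        then have "e y \<in> sx y \<inter> nx x" using a' by (auto simp: sx_def nx_def)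
        then show ?thesis by (auto simp: \<Psi>_def)
      next
        case 3
        then have "(y, x) \<in> R" using sym_R by (meson symD)
        then show ?thesis using edge_R[of x y] edge_R[of y x] 3 pat_sym[of 1 x y] unfolding \<Psi>_def
          by (metis linear)
      qed
    next
      assume "\<Psi> x y (pat 1 x y)"
      then consider "\<chi> y \<in> adj x" "\<chi> y \<in> pat 1 x y" | "\<chi> x \<in> adj y" "\<chi> x \<in> pat 1 x y"
        | "sx x \<inter> nx y \<noteq> {}" | "sx y \<inter> nx x \<noteq> {}" unfolding \<Psi>_def by blast
      then show "(x, y) \<in> parcs G"
      proof cases
        case 1
        then show ?thesis using R_edge[OF xy] R by auto
      next
        case 2
        then have "(y, x) \<in> R" using R_edge[OF xy(2,1)] pat_sym by metis
        then show ?thesis using R Gf by (auto dest: symD)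
      next
        case 3
        then obtain t where "x \<in> S" "t \<in> S" "e x = e t" "(t, y) \<in> parcs G" by (auto simp: sx_def nx_def)
        then show ?thesis using e0(1) by (metis inj_onD)
      next
        case 4
        then obtain t where "y \<in> S" "t \<in> S" "e y = e t" "(t, x) \<in> parcs G" by (auto simp: sx_def nx_def)
        then have "(y, x) \<in> parcs G" using e0(1) by (metis inj_onD)
        then show ?thesis using Gf by (auto dest: symD)
      qed
    qed
    have "base_labelling G P R \<rho> \<chi> {1..nc} l0"
      unfolding base_labelling_def
    proof (intro conjI ballI impI)
      fix x x' assume x: "x \<in> pverts G" "x' \<in> pverts G" "l0 x = l0 x'"
      note tx = tD[OF x]
      show "\<chi> x = \<chi> x'" using tx by (simp add: t_def)
      fix i assume i: "i \<in> {1..nc}"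
      have "{i \<in> {1..nc}. x \<in> P i} = {i \<in> {1..nc}. x' \<in> P i}" using tx by (simp add: t_def)
      then show "x \<in> P i \<longleftrightarrow> x' \<in> P i" using i by blast
    next
      fix x y x' y' assume x: "x \<in> pverts G" "y \<in> pverts G" "x' \<in> pverts G" "y' \<in> pverts G"
        and l: "l0 x = l0 x'" "l0 y = l0 y'" "pat 1 x y = pat 1 x' y'"
      have "\<Psi> x y (pat 1 x y) = \<Psi> x' y' (pat 1 x' y')"
        using tD[OF x(1,3) l(1)] tD[OF x(2,4) l(2)] l(3) by (simp add: t_def \<Psi>_def)
      then show "(x, y) \<in> parcs G \<longleftrightarrow> (x', y') \<in> parcs G" using \<Psi> x by simp
    qed
    moreover have "\<forall>x\<in>pverts G. l0 x < card \<Lambda>" using t\<Lambda> g(2) by (auto simp: l0_def)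
    ultimately show "\<exists>l0. (\<forall>x\<in>pverts G. l0 x < card \<Lambda>) \<and> base_labelling G P R \<rho> \<chi> {1..nc} l0" by blast
  qed
qed

text \<open>The hubs are taken in the graph in which the vertices of \<open>S\<close> have been isolated.\<close>

definition edge_labelling ::
  "'a pair_pre_digraph \<Rightarrow> (nat \<Rightarrow> 'a set) \<Rightarrow> fo \<Rightarrow> 'a set \<Rightarrow> nat \<Rightarrow> nat \<Rightarrow> nat \<Rightarrow>
     ('a \<Rightarrow> nat) \<Rightarrow> ('a \<Rightarrow> nat) \<Rightarrow> ('a \<Rightarrow> nat) \<Rightarrow> bool" where
  "edge_labelling G P \<phi> S N k K \<rho> \<chi> l \<longleftrightarrow>
     hub_system (pverts G) (restr (parcs G) (pverts G - S)) \<rho> \<chi> N k \<and> (\<forall>x\<in>pverts G. l x < K) \<and>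
     (\<forall>x\<in>pverts G. \<forall>y\<in>pverts G. \<forall>x'\<in>pverts G. \<forall>y'\<in>pverts G. l x = l x' \<longrightarrow> l y = l y' \<longrightarrow>
        hub_system.pat (restr (parcs G) (pverts G - S)) \<rho> \<chi> N x y =
        hub_system.pat (restr (parcs G) (pverts G - S)) \<rho> \<chi> N x' y' \<longrightarrow>
        (sat2 G P \<phi> x y \<or> sat2 G P \<phi> y x) = (sat2 G P \<phi> x' y' \<or> sat2 G P \<phi> y' x'))"

text \<open>The range \<open>N\<close> comes from the formula alone, so the order can be chosen for
  the range \<open>2 * N\<close> that the colouring requires. Isolating \<open>S\<close> only
  shrinks the sets of hubs, so one order of \<open>G\<close> and one bound \<open>k\<close> serve
  for every \<open>S\<close>.\<close>

lemma ex_edge_labelling: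
  fixes \<D> :: "'a pair_pre_digraph set"
  assumes BE: "bounded_expansion \<D>" "graph_class \<D>"
    and \<phi>: "fvars \<phi> \<subseteq> {0, 1}" "colours \<phi> \<subseteq> {1..nc}"
  shows "\<exists>N k K. \<forall>G\<in>\<D>. \<forall>P. \<forall>S\<subseteq>pverts G. card S \<le> s \<longrightarrow>
    (\<exists>\<rho> \<chi> l. edge_labelling G P \<phi> S N k K \<rho> \<chi> l \<and>
       (\<forall>x\<in>pverts G. card (wreach (parcs G) \<rho> N x) \<le> k))"
proof -
  obtain N where N: "N \<ge> 1" "\<And>k K0. \<exists>K. \<forall>(G :: 'a pair_pre_digraph) P R \<rho> \<chi> l0.
     hub_system (pverts G) R \<rho> \<chi> N k \<longrightarrow> (\<forall>x\<in>pverts G. l0 x < K0) \<longrightarrow>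
     base_labelling G P R \<rho> \<chi> (colours \<phi>) l0 \<longrightarrow>
     (\<exists>l. (\<forall>x\<in>pverts G. l x < K) \<and> determined G P R \<rho> \<chi> \<phi> l N)"
    using eliminable[where 'b = 'a, of \<phi>] unfolding eliminable_def by (elim exE conjE) (rule that, auto)
  obtain k where k: "\<forall>G\<in>\<D>. \<exists>\<rho> :: 'a \<Rightarrow> nat. inj_on \<rho> (pverts G) \<and>
      (\<forall>x\<in>pverts G. card (wreach (parcs G) \<rho> (2 * N) x) \<le> k)"
    using bounded_expansion_order[OF BE, of "2 * N"] by (rule exE)
  obtain K0 where K0: "\<forall>(G :: 'a pair_pre_digraph) P R \<rho> \<chi> N S.
     pair_graph G \<longrightarrow> hub_system (pverts G) R \<rho> \<chi> N k \<longrightarrow> 1 \<le> N \<longrightarrow> R = restr (parcs G) (pverts G - S) \<longrightarrow>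
     S \<subseteq> pverts G \<longrightarrow> card S \<le> s \<longrightarrow>
     (\<exists>l0. (\<forall>x\<in>pverts G. l0 x < K0) \<and> base_labelling G P R \<rho> \<chi> {1..nc} l0)"
    using ex_base_labelling[of k s nc] by (rule exE)
  obtain K1 where K1: "\<forall>(G :: 'a pair_pre_digraph) P R \<rho> \<chi> l0.
     hub_system (pverts G) R \<rho> \<chi> N k \<longrightarrow> (\<forall>x\<in>pverts G. l0 x < K0) \<longrightarrow>
     base_labelling G P R \<rho> \<chi> (colours \<phi>) l0 \<longrightarrow>
     (\<exists>l. (\<forall>x\<in>pverts G. l x < K1) \<and> determined G P R \<rho> \<chi> \<phi> l N)"
    using N(2)[of k K0] by (rule exE)
  define \<Lambda> where "\<Lambda> = {..<K1} \<times> Pow {..<k}"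
  have fin: "finite \<Lambda>" by (simp add: \<Lambda>_def)
  obtain g where g: "inj_on g \<Lambda>" "g ` \<Lambda> \<subseteq> {..<card \<Lambda>}" using ex_recode[OF fin] by metis
  have "\<exists>\<rho> \<chi> l. edge_labelling G P \<phi> S N k (card \<Lambda>) \<rho> \<chi> l \<and>
       (\<forall>x\<in>pverts G. card (wreach (parcs G) \<rho> N x) \<le> k)"
    if GD: "G \<in> \<D>" and S: "S \<subseteq> pverts G" "card S \<le> s" for G P S
  proof -
    have G: "pair_graph G" using GD BE(2) by (auto simp: graph_class_def)
    note Gf = G[unfolded pair_graph_iff]
    define R where "R = restr (parcs G) (pverts G - S)"
    obtain \<rho> :: "'a \<Rightarrow> nat" where \<rho>: "inj_on \<rho> (pverts G)" "\<And>x. x \<in> pverts G \<Longrightarrow> card (wreach (parcs G) \<rho> (2 * N) x) \<le> k"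
      using k GD by blast
    have finW: "finite (wreach (parcs G) \<rho> n x)" if "x \<in> pverts G" for n x
      using wreach_subset[of "parcs G" "pverts G" x \<rho> n] that Gf finite_subset by blast
    have cW: "card (wreach (parcs G) \<rho> N x) \<le> k" if x: "x \<in> pverts G" for x
      using \<rho>(2)[OF x] card_mono[OF finW[OF x] wreach_mono[OF order_refl, of N "2 * N" "parcs G" \<rho> x]] by simp
    have cR: "card (wreach R \<rho> (2 * N) x) \<le> k" if x: "x \<in> pverts G" for x
      using \<rho>(2)[OF x] card_mono[OF finW[OF x] wreach_mono[of R "parcs G" "2 * N" "2 * N" \<rho> x]]
      by (simp add: R_def)
    have RV: "R \<subseteq> pverts G \<times> pverts G" and symR: "sym R" and finV: "finite (pverts G)"
      using Gf by (auto simp: R_def sym_def)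
    obtain \<chi> where \<chi>: "\<forall>x\<in>pverts G. \<chi> x < k" "\<forall>x\<in>pverts G. inj_on \<chi> (wreach R \<rho> N x)"
      using ex_wreach_colouring[OF finV \<rho>(1) RV symR cR] by blast
    have hs: "hub_system (pverts G) R \<rho> \<chi> N k"
      using finV RV symR \<rho>(1) \<chi> by unfold_locales auto
    interpret hub_system "pverts G" R \<rho> \<chi> N k by (rule hs)
    obtain l0 where l0: "\<forall>x\<in>pverts G. l0 x < K0" "base_labelling G P R \<rho> \<chi> {1..nc} l0"
      using K0[rule_format, OF G hs N(1) R_def S] by blast
    have "base_labelling G P R \<rho> \<chi> (colours \<phi>) l0"
      using l0(2) \<phi>(2) unfolding base_labelling_def by blast
    then obtain l1 where l1: "\<forall>x\<in>pverts G. l1 x < K1" "determined G P R \<rho> \<chi> \<phi> l1 N"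
      using K1[rule_format, OF hs] l0(1) by blast
    \<comment> \<open>The hub colours enter the label because \<open>eqtype\<close> compares each
      vertex with itself too.\<close>
    define t where "t x = (l1 x, \<chi> ` W N x)" for x
    have t\<Lambda>: "t x \<in> \<Lambda>" if "x \<in> pverts G" for x
      using l1(1) that W_V[OF that] \<chi>(1) by (auto simp: t_def \<Lambda>_def)
    define l where "l = g \<circ> t"
    have tD: "t x = t y" if "x \<in> pverts G" "y \<in> pverts G" "l x = l y" for x y
      using that t\<Lambda> g(1) by (auto simp: l_def dest: inj_onD)
    have det: "sat2 G P \<phi> x y = sat2 G P \<phi> x' y'"
      if V: "x \<in> pverts G" "y \<in> pverts G" "x' \<in> pverts G" "y' \<in> pverts G"
        and l: "l x = l x'" "l y = l y'" and p: "pat N x y = pat N x' y'" for x y x' y'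
    proof -
      let ?\<sigma> = "(\<lambda>_. y)(0 := x)" and ?\<sigma>' = "(\<lambda>_. y')(0 := x')"
      have t: "t x = t x'" "t y = t y'" using tD V l by blast+
      then have "eqtype {0, 1} l1 N ?\<sigma> ?\<sigma>'"
        using p pat_sym[of N y x] pat_sym[of N y' x'] by (auto simp: eqtype_def t_def pat_self)
      then have "eqtype (fvars \<phi>) l1 N ?\<sigma> ?\<sigma>'" using \<phi>(1) unfolding eqtype_def by blast
      moreover have "\<forall>i\<in>fvars \<phi>. ?\<sigma> i \<in> pverts G \<and> ?\<sigma>' i \<in> pverts G" using V by simp
      ultimately show ?thesis using l1(2) unfolding determined_def sat2_def by blast
    qed
    have "edge_labelling G P \<phi> S N k (card \<Lambda>) \<rho> \<chi> l"
      unfolding edge_labelling_def R_def[symmetric]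
    proof (intro conjI ballI impI hs)
      show "l x < card \<Lambda>" if "x \<in> pverts G" for x using t\<Lambda>[OF that] g(2) by (auto simp: l_def)
      fix x y x' y' assume V: "x \<in> pverts G" "y \<in> pverts G" "x' \<in> pverts G" "y' \<in> pverts G"
        and l: "l x = l x'" "l y = l y'" and p: "pat N x y = pat N x' y'"
      have p': "pat N y x = pat N y' x'" using p pat_sym by metis
      show "(sat2 G P \<phi> x y \<or> sat2 G P \<phi> y x) = (sat2 G P \<phi> x' y' \<or> sat2 G P \<phi> y' x')"
        using det[OF V l p] det[OF V(2,1,4,3) l(2,1) p'] by simp
    qed
    then show ?thesis using cW by blast
  qed
  then show ?thesis by blast
qed

section \<open>Flips\<close>

definition hits :: "'a set \<times> 'a set \<Rightarrow> 'a \<Rightarrow> 'a \<Rightarrow> bool" where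
  "hits F x y \<longleftrightarrow> (x, y) \<in> fst F \<times> snd F \<union> snd F \<times> fst F"

text \<open>Each flip toggles exactly the pairs it hits, so only the parity of the flips hitting a
  pair matters.\<close>

lemma parcs_flips:
  assumes "finite \<F>" "irrefl (parcs H)"
  shows "pverts (flips \<F> H) = pverts H \<and>
    ((x, y) \<in> parcs (flips \<F> H) \<longleftrightarrow>
       x \<noteq> y \<and> ((x, y) \<in> parcs H \<longleftrightarrow> even (card {F \<in> \<F>. hits F x y})))"
  using assms(1)
proof (induction \<F> arbitrary: x y rule: finite_induct)
  case empty
  show ?case using assms(2) by (auto simp: flips_empty irrefl_def)
next
  case (insert F \<F>)
  have "{F' \<in> insert F \<F>. hits F' x y} =
      (if hits F x y then insert F {F \<in> \<F>. hits F x y} else {F \<in> \<F>. hits F x y})" by auto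
  then have c: "card {F' \<in> insert F \<F>. hits F' x y} =
      (if hits F x y then Suc (card {F \<in> \<F>. hits F x y}) else card {F \<in> \<F>. hits F x y})"
    using insert.hyps by simp
  have "(x, y) \<in> parcs (flips (insert F \<F>) H) \<longleftrightarrow>
      x \<noteq> y \<and> ((x, y) \<in> parcs (flips \<F> H) \<longleftrightarrow> \<not> hits F x y)"
    unfolding flips_insert[OF insert.hyps] by (cases F) (auto simp: flip_def hits_def)
  moreover have "pverts (flips (insert F \<F>) H) = pverts H"
    unfolding flips_insert[OF insert.hyps] using insert.IH by (cases F) (simp add: flip_def)
  ultimately show ?case using insert.IH[of x y] c by auto
qed

lemma flips_wf:
  assumes "finite \<F>" "pair_graph H" "\<F> \<subseteq> Pow (pverts H) \<times> Pow (pverts H)"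
  shows "parcs (flips \<F> H) \<subseteq> pverts (flips \<F> H) \<times> pverts (flips \<F> H)" "sym (parcs (flips \<F> H))"
proof -
  note Hf = assms(2)[unfolded pair_graph_iff]
  have irr: "irrefl (parcs H)" using Hf by blast
  note fl = parcs_flips[OF assms(1) irr]
  have pv: "pverts (flips \<F> H) = pverts H" using fl by blast
  have "(x, y) \<in> pverts H \<times> pverts H" if xy: "(x, y) \<in> parcs (flips \<F> H)" for x y
  proof (rule ccontr)
    assume n: "(x, y) \<notin> pverts H \<times> pverts H"
    then have "(x, y) \<notin> parcs H" using Hf by blast
    moreover have "\<not> hits F x y" if "F \<in> \<F>" for F
    proof -
      have "fst F \<subseteq> pverts H" "snd F \<subseteq> pverts H" using subsetD[OF assms(3) that] by auto
      then show ?thesis using n by (auto simp: hits_def)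
    qed
    then have none: "{F \<in> \<F>. hits F x y} = {}" by blast
    have "even (card {F \<in> \<F>. hits F x y})" unfolding none by simp
    ultimately show False using fl[of x y] xy by blast
  qed
  then show "parcs (flips \<F> H) \<subseteq> pverts (flips \<F> H) \<times> pverts (flips \<F> H)" using pv by auto
  have "hits F x y = hits F y x" for F x y by (auto simp: hits_def)
  note hits_sym = this
  have "(x, y) \<in> parcs H \<longleftrightarrow> (y, x) \<in> parcs H" for x y using Hf by (auto dest: symD)
  then have "(y, x) \<in> parcs (flips \<F> H)" if "(x, y) \<in> parcs (flips \<F> H)" for x y
    using that fl[of x y] fl[of y x] hits_sym[of _ x y] by auto
  then show "sym (parcs (flips \<F> H))" by (auto simp: sym_def)
qed

text \<open>The labelling depends on the size \<open>s\<close> of the separators but not on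
  \<open>r\<close>, so \<open>K * K\<close> flips do for all radii. The set is scattered at range
  \<open>r * (2 * N)\<close> in the sparse graph because an edge that survives the flips joins
  vertices with a common hub, \<open>N\<close> steps from either.\<close>

theorem strongly_flip_flat_if_wide:
  fixes \<D> :: "'a pair_pre_digraph set"
  assumes BE: "bounded_expansion \<D>" "graph_class \<D>" and wide: "uniformly_almost_wide \<D>"
    and \<tau>: "is_transduction \<tau>" and \<C>: "\<C> \<subseteq> transduce_class \<tau> \<D>" "graph_class \<C>"
  shows "strongly_flip_flat \<C>"
proof -
  let ?\<phi> = "edge_formula \<tau>"
  obtain s where s: "\<forall>r. \<exists>Nr :: nat \<Rightarrow> nat. \<forall>m. \<forall>G\<in>\<D>. \<forall>A \<subseteq> pverts G. Nr m \<le> card A \<longrightarrow>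
      (\<exists>S B. S \<subseteq> pverts G \<and> card S \<le> s \<and> B \<subseteq> A - S \<and> m < card B \<and>
         r_independent r (with_proj G \<restriction> (pverts G - S)) B)"
    using wide unfolding uniformly_almost_wide_def by (rule exE)
  have \<phi>: "fvars ?\<phi> \<subseteq> {0, 1}" "colours ?\<phi> \<subseteq> {1..ncolours \<tau>}"
    using \<tau> by (auto simp: is_transduction_def)
  obtain N k K where lab: "\<forall>G\<in>\<D>. \<forall>P. \<forall>S\<subseteq>pverts G. card S \<le> s \<longrightarrow>
      (\<exists>\<rho> \<chi> l. edge_labelling G P ?\<phi> S N k K \<rho> \<chi> l \<and> (\<forall>x\<in>pverts G. card (wreach (parcs G) \<rho> N x) \<le> k))"
    using ex_edge_labelling[OF BE \<phi>, of s] by (elim exE) (rule that)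
  have main: "\<exists>\<F> B. \<F> \<subseteq> Pow (pverts H) \<times> Pow (pverts H) \<and> card \<F> \<le> K * K \<and>
      B \<subseteq> A \<and> m \<le> card B \<and> r_independent r (with_proj (flips \<F> H)) B"
    if H: "H \<in> \<C>" and A: "A \<subseteq> pverts H"
      and SB: "\<And>G. G \<in> \<D> \<Longrightarrow> A \<subseteq> pverts G \<Longrightarrow> \<exists>S B. S \<subseteq> pverts G \<and> card S \<le> s \<and> B \<subseteq> A - S \<and> m < card B \<and>
         r_independent (r * (2 * N)) (with_proj G \<restriction> (pverts G - S)) B" for H A m r
  proof -
    have Hg: "pair_graph H" using H \<C>(2) by (auto simp: graph_class_def)
    note Hf = Hg[unfolded pair_graph_iff]
    obtain G P where GP: "G \<in> \<D>" "H = interpreted_graph \<tau> G P"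
      using H \<C>(1) by (auto simp: transduce_class_def transduce_def)
    let ?V = "pverts G"
    have G: "pair_graph G" using GP BE(2) by (auto simp: graph_class_def)
    have HV: "pverts H \<subseteq> ?V" by (auto simp: GP(2) interpreted_graph_def Let_def)
    define E where "E x y \<longleftrightarrow> sat2 G P ?\<phi> x y \<or> sat2 G P ?\<phi> y x" for x y
    have HE: "(x, y) \<in> parcs H \<longleftrightarrow> x \<in> pverts H \<and> y \<in> pverts H \<and> x \<noteq> y \<and> E x y" for x y
      by (auto simp: GP(2) interpreted_graph_def Let_def E_def)
    have E_sym: "E x y = E y x" for x y by (auto simp: E_def)
    obtain S B where S: "S \<subseteq> ?V" "card S \<le> s" and B: "B \<subseteq> A - S" "m < card B"
      and ind: "r_independent (r * (2 * N)) (with_proj G \<restriction> (?V - S)) B"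
      using SB[OF GP(1)] A HV by blast
    define R where "R = restr (parcs G) (?V - S)"
    obtain \<rho> \<chi> l where el: "edge_labelling G P ?\<phi> S N k K \<rho> \<chi> l" using lab GP(1) S by blast
    interpret hub_system ?V R \<rho> \<chi> N k using el by (simp add: edge_labelling_def R_def)
    have l_less: "l x < K" if "x \<in> ?V" for x using el that by (simp add: edge_labelling_def)
    have E_det: "E x y = E x' y'" if "x \<in> ?V" "y \<in> ?V" "x' \<in> ?V" "y' \<in> ?V" "l x = l x'" "l y = l y'"
      "pat N x y = pat N x' y'" for x y x' y'
      using el that unfolding edge_labelling_def R_def[symmetric] E_def by blast
    define L where "L a = {x \<in> pverts H. l x = a}" for a
    define \<Phi> where "\<Phi> a b \<longleftrightarrow> (\<exists>x\<in>?V. \<exists>y\<in>?V. l x = a \<and> l y = b \<and> pat N x y = {} \<and> E x y)" for a b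
    have \<Phi>_iff: "\<Phi> (l x) (l y) \<longleftrightarrow> E x y" if "x \<in> ?V" "y \<in> ?V" "pat N x y = {}" for x y
      using E_det[OF that(1,2)] that unfolding \<Phi>_def by metis
    have \<Phi>_sym: "\<Phi> a b = \<Phi> b a" for a b unfolding \<Phi>_def using E_sym pat_sym by metis
    \<comment> \<open>Every unordered pair of labels is taken once; the flips for both orders would
      cancel.\<close>
    define \<F> where "\<F> = (\<lambda>(a, b). (L a, L b)) ` {(a, b). a \<le> b \<and> b < K \<and> \<Phi> a b}"
    have idxfin: "finite {(a, b). a \<le> b \<and> b < K \<and> \<Phi> a b}" and idxcard: "card {(a, b). a \<le> b \<and> b < K \<and> \<Phi> a b} \<le> K * K"
    proof -
      have sub: "{(a, b). a \<le> b \<and> b < K \<and> \<Phi> a b} \<subseteq> {..<K} \<times> {..<K}" by auto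
      then show "finite {(a, b). a \<le> b \<and> b < K \<and> \<Phi> a b}" by (rule finite_subset) simp
      show "card {(a, b). a \<le> b \<and> b < K \<and> \<Phi> a b} \<le> K * K"
        using card_mono[OF _ sub] by (simp add: card_cartesian_product)
    qed
    have finF: "finite \<F>" and cardF: "card \<F> \<le> K * K"
      using idxfin idxcard card_image_le[OF idxfin, of "\<lambda>(a, b). (L a, L b)"] by (auto simp: \<F>_def)
    have FP: "\<F> \<subseteq> Pow (pverts H) \<times> Pow (pverts H)" by (auto simp: \<F>_def L_def)
    have hits1: "{F \<in> \<F>. hits F x y} = (if \<Phi> (l x) (l y) then {(L (l x), L (l y))} else {})"
      if xy: "x \<in> pverts H" "y \<in> pverts H" "l x \<le> l y" for x y
    proof -
      have "l y < K" using l_less HV xy by blast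
      then have "(L (l x), L (l y)) \<in> \<F>" if "\<Phi> (l x) (l y)" using that xy(3) by (force simp: \<F>_def)
      moreover have "F = (L (l x), L (l y)) \<and> \<Phi> (l x) (l y)" if F: "F \<in> \<F>" "hits F x y" for F
      proof -
        obtain a b where ab: "F = (L a, L b)" "a \<le> b" "\<Phi> a b" using F(1) by (auto simp: \<F>_def)
        have "(l x = a \<and> l y = b) \<or> (l x = b \<and> l y = a)" using F(2) ab(1) by (auto simp: hits_def L_def)
        then show ?thesis using ab xy(3) by (metis le_antisym)
      qed
      moreover have "hits (L (l x), L (l y)) x y" using xy by (auto simp: hits_def L_def)
      ultimately show ?thesis by auto
    qed
    have irr: "irrefl (parcs H)" using Hf by blast
    have edge: "(x, y) \<in> near R (2 * N)" if xy: "(x, y) \<in> parcs (flips \<F> H)" for x y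
    proof (rule ccontr)
      assume nn: "(x, y) \<notin> near R (2 * N)"
      have V: "x \<in> pverts H" "y \<in> pverts H"
        using flips_wf(1)[OF finF Hg FP] xy parcs_flips[OF finF irr, of x y] by auto
      have "W N x \<inter> W N y = {}"
      proof (rule ccontr)
        assume "W N x \<inter> W N y \<noteq> {}"
        then obtain w where "w \<in> W N x" "w \<in> W N y" by blast
        then have "(x, w) \<in> near R N" "(y, w) \<in> near R N" by (auto intro: wreach_near)
        then have "(x, y) \<in> near R (N + N)" using near_sym[OF sym_R] by (blast intro: near_trans)
        then show False using nn by (simp add: mult_2)
      qed
      then have p: "pat N x y = {}" by (simp add: pat_def)
      have xV: "x \<in> ?V" "y \<in> ?V" using V HV by auto
      have "even (card {F \<in> \<F>. hits F x y}) \<longleftrightarrow> \<not> \<Phi> (l x) (l y)"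
      proof (cases "l x \<le> l y")
        case True
        then show ?thesis using hits1[OF V] by simp
      next
        case False
        have "{F \<in> \<F>. hits F x y} = {F \<in> \<F>. hits F y x}" by (auto simp: hits_def)
        then show ?thesis using False hits1[OF V(2,1)] \<Phi>_sym[of "l x" "l y"] by simp
      qed
      moreover have "x \<noteq> y" "((x, y) \<in> parcs H) = even (card {F \<in> \<F>. hits F x y})"
        using parcs_flips[OF finF irr, of x y] xy by auto
      ultimately show False using \<Phi>_iff[OF xV p] HE[of x y] V by simp
    qed
    have "r_independent r (with_proj (flips \<F> H)) B"
      unfolding r_independent_iff[OF flips_wf(1)[OF finF Hg FP]]
    proof (intro conjI ballI impI notI)
      show "B \<subseteq> pverts (flips \<F> H)" using B A parcs_flips[OF finF irr] by blast
      fix u v assume uv: "u \<in> B" "v \<in> B" "u \<noteq> v" "(u, v) \<in> near (parcs (flips \<F> H)) r"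
      have "(u, v) \<in> near R (r * (2 * N))" by (rule near_le_mult[OF uv(4) edge])
      moreover have "(u, v) \<notin> near R (r * (2 * N))"
      proof -
        have "r_independent (r * (2 * N)) (with_proj \<lparr>pverts = ?V - S, parcs = R\<rparr>) B"
          using ind unfolding induce_subgraph_with_proj R_def .
        moreover have "parcs \<lparr>pverts = ?V - S, parcs = R\<rparr> \<subseteq>
            pverts \<lparr>pverts = ?V - S, parcs = R\<rparr> \<times> pverts \<lparr>pverts = ?V - S, parcs = R\<rparr>"
          by (auto simp: R_def)
        ultimately show ?thesis using uv(1-3) by (simp add: r_independent_iff)
      qed
      ultimately show False by blast
    qed
    then show ?thesis using FP cardF B by (intro exI[of _ \<F>] exI[of _ B]) auto
  qed
  show ?thesis
    unfolding strongly_flip_flat_def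
  proof (rule exI[of _ "K * K"], rule allI)
    fix r
    obtain Nr :: "nat \<Rightarrow> nat" where Nr: "\<forall>m. \<forall>G\<in>\<D>. \<forall>A \<subseteq> pverts G. Nr m \<le> card A \<longrightarrow>
      (\<exists>S B. S \<subseteq> pverts G \<and> card S \<le> s \<and> B \<subseteq> A - S \<and> m < card B \<and>
         r_independent (r * (2 * N)) (with_proj G \<restriction> (pverts G - S)) B)"
      using s[rule_format, of "r * (2 * N)"] by (rule exE)
    show "\<exists>Nr :: nat \<Rightarrow> nat. \<forall>m. \<forall>H\<in>\<C>. \<forall>A \<subseteq> pverts H. Nr m \<le> card A \<longrightarrow>
      (\<exists>\<F> B. \<F> \<subseteq> Pow (pverts H) \<times> Pow (pverts H) \<and> card \<F> \<le> K * K \<and>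
         B \<subseteq> A \<and> m \<le> card B \<and> r_independent r (with_proj (flips \<F> H)) B)"
    proof (rule exI[of _ Nr], intro allI ballI impI)
      fix m H A assume H: "H \<in> \<C>" "A \<subseteq> pverts H" "Nr m \<le> card A"
      show "\<exists>\<F> B. \<F> \<subseteq> Pow (pverts H) \<times> Pow (pverts H) \<and> card \<F> \<le> K * K \<and>
         B \<subseteq> A \<and> m \<le> card B \<and> r_independent r (with_proj (flips \<F> H)) B"
        by (rule main[OF H(1,2)]) (use Nr H(3) in blast)
    qed
  qed
qed

section \<open>Tree models\<close>

lemma chains_mono: "chains M ch \<rho> d \<Longrightarrow> M' \<subseteq> M \<Longrightarrow> chains M' ch \<rho> d"
  unfolding chains_def by (meson subsetD)

text \<open>The chains depend on the pair of labels because a forest of bounded height is available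
  only on the boundedly many hub colours of two labels. The vertex \<open>b\<close> has
  \<open>x\<close> and its chain among its hubs, which later provides the clusters of the encoding
  graph.\<close>

definition tree_model ::
  "nat \<Rightarrow> nat \<Rightarrow> nat \<Rightarrow> nat \<Rightarrow> 'a pair_pre_digraph \<Rightarrow> ('a \<Rightarrow> nat) \<Rightarrow> 'a pair_pre_digraph \<Rightarrow>
     ('a \<Rightarrow> nat) \<Rightarrow> (nat \<Rightarrow> nat \<Rightarrow> 'a \<Rightarrow> 'a set) \<Rightarrow> (nat \<Rightarrow> nat \<Rightarrow> nat \<Rightarrow> bool) \<Rightarrow> bool" where
  "tree_model n k d K A \<rho> H lab ch \<Phi> \<longleftrightarrow>
     pverts H \<subseteq> pverts A \<and> (\<forall>w\<in>pverts A. card (wreach (parcs A) \<rho> n w) \<le> k) \<and>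
     (\<forall>x\<in>pverts H. lab x < K) \<and>
     (\<forall>\<alpha> \<beta>. chains {x \<in> pverts H. lab x = \<alpha> \<or> lab x = \<beta>} (ch \<alpha> \<beta>) \<rho> d) \<and>
     (\<forall>\<alpha> \<beta>. \<forall>x\<in>pverts H. lab x = \<alpha> \<or> lab x = \<beta> \<longrightarrow>
        (\<exists>b\<in>pverts A. x \<in> wreach (parcs A) \<rho> n b \<and> ch \<alpha> \<beta> x \<subseteq> wreach (parcs A) \<rho> n b)) \<and>
     (\<forall>\<alpha> \<beta>. \<forall>x\<in>pverts H. \<forall>y\<in>pverts H. x \<noteq> y \<longrightarrow>
        lab x = \<alpha> \<and> lab y = \<beta> \<or> lab x = \<beta> \<and> lab y = \<alpha> \<longrightarrow>
        ((x, y) \<in> parcs H \<longleftrightarrow> \<Phi> \<alpha> \<beta> (chains.meet (ch \<alpha> \<beta>) x y)))"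

text \<open>Making the hubs of each vertex a clique forces them onto one branch of every elimination
  forest that contains them.\<close>

definition hub_graph :: "nat \<Rightarrow> 'a pair_pre_digraph \<Rightarrow> ('a \<Rightarrow> nat) \<Rightarrow> 'a pair_pre_digraph" where
  "hub_graph N G \<rho> = \<lparr>pverts = pverts G,
     parcs = {(u, v). u \<noteq> v \<and> (\<exists>x\<in>pverts G. u \<in> wreach (parcs G) \<rho> N x \<and> v \<in> wreach (parcs G) \<rho> N x)}\<rparr>"

lemma pair_graph_hub_graph: "pair_graph G \<Longrightarrow> pair_graph (hub_graph N G \<rho>)"
proof -
  assume G: "pair_graph G"
  note Gf = G[unfolded pair_graph_iff]
  have "wreach (parcs G) \<rho> N x \<subseteq> pverts G" if "x \<in> pverts G" for x
    using wreach_subset that Gf by metis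
  then show ?thesis using Gf unfolding pair_graph_iff hub_graph_def
    by (auto simp: sym_def irrefl_def)
qed

text \<open>An edge joins two hubs of one vertex, so the clusters of its ends intersect when every
  vertex is its own centre.\<close>

lemma clustered_hub_graph:
  assumes "\<forall>x\<in>pverts G. card (wreach (parcs G) \<rho> N x) \<le> k"
  shows "clustered N k 1 G (hub_graph N G \<rho>)"
proof -
  have "{g \<in> pverts G. g = u} \<subseteq> {u}" for u by auto
  then have "card {g \<in> pverts G. g = u} \<le> 1" for u
    using card_mono[of "{u}" "{g \<in> pverts G. g = u}"] by simp
  then show ?thesis
    unfolding clustered_def hub_graph_def using assms
    by (intro exI[of _ \<rho>] exI[of _ id] exI[of _ "{}"]) auto
qed

text \<open>Two systems of hubs are stacked: those of \<open>G\<close> govern adjacency, and those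
  of the hub graph \<open>A\<close>, with its own order and colouring, govern forests on the former.
  A vertex has at most \<open>k\<close> hubs in \<open>G\<close>, so a pair of labels involves at
  most \<open>p = 2 * k\<close> colours of \<open>A\<close>, and \<open>2 ^ p\<close> is the range
  that \<open>anc_wreach\<close> requires.\<close>

theorem ex_tree_models:
  fixes \<C> :: "'a pair_pre_digraph set"
  assumes sbe: "structurally_bounded_expansion \<C>"
  shows "\<exists>n k d K (\<A> :: 'a pair_pre_digraph set). bounded_expansion \<A> \<and> graph_class \<A> \<and>
    (\<forall>H\<in>\<C>. \<exists>A\<in>\<A>. \<exists>\<rho> lab ch \<Phi>. tree_model n k d K A \<rho> H lab ch \<Phi>)"
proof -
  obtain \<tau> and \<D> :: "'a pair_pre_digraph set" where \<tau>: "is_transduction \<tau>"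
    and BE: "bounded_expansion \<D>" "graph_class \<D>" and \<C>: "\<C> \<subseteq> transduce_class \<tau> \<D>"
    using sbe unfolding structurally_bounded_expansion_def by blast
  let ?\<phi> = "edge_formula \<tau>"
  have \<phi>: "fvars ?\<phi> \<subseteq> {0, 1}" "colours ?\<phi> \<subseteq> {1..ncolours \<tau>}"
    using \<tau> by (auto simp: is_transduction_def)
  obtain N k K1 where lab1: "\<forall>G\<in>\<D>. \<forall>P. \<forall>S\<subseteq>pverts G. card S \<le> 0 \<longrightarrow>
      (\<exists>\<rho> \<chi> l. edge_labelling G P ?\<phi> S N k K1 \<rho> \<chi> l \<and> (\<forall>x\<in>pverts G. card (wreach (parcs G) \<rho> N x) \<le> k))"
    using ex_edge_labelling[OF BE \<phi>, of 0] by (elim exE) (rule that)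
  define \<A> where "\<A> = {hub_graph N G \<rho> | G \<rho>. G \<in> \<D> \<and> (\<forall>x\<in>pverts G. card (wreach (parcs G) \<rho> N x) \<le> k)}"
  have gcA: "graph_class \<A>"
    using BE(2) pair_graph_hub_graph by (auto simp: graph_class_def \<A>_def)
  have beA: "bounded_expansion \<A>"
    by (rule clustered_bounded_expansion[OF BE gcA, where n = N and k = k and T = 1])
      (use clustered_hub_graph in \<open>fastforce simp: \<A>_def\<close>)
  define p where "p = 2 * k"
  define n where "n = (2 :: nat) ^ p"
  obtain k2 where k2: "\<forall>A\<in>\<A>. \<exists>\<rho> :: 'a \<Rightarrow> nat. inj_on \<rho> (pverts A) \<and>
      (\<forall>x\<in>pverts A. card (wreach (parcs A) \<rho> (2 * n) x) \<le> k2)"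
    using bounded_expansion_order[OF beA gcA, of "2 * n"] by (rule exE)
  define \<Lambda> where "\<Lambda> = {..<K1} \<times> Pow {..<k2} \<times> Pow (Pow {..<k2} \<times> {..<k} \<times> {..p})"
  have fin\<Lambda>: "finite \<Lambda>" by (simp add: \<Lambda>_def)
  obtain g where g: "inj_on g \<Lambda>" "g ` \<Lambda> \<subseteq> {..<card \<Lambda>}" using ex_recode[OF fin\<Lambda>] by metis
  have "\<exists>A\<in>\<A>. \<exists>\<rho> lab ch \<Phi>. tree_model n k2 p (card \<Lambda>) A \<rho> H lab ch \<Phi>" if H: "H \<in> \<C>" for H
  proof -
    obtain G P where GP: "G \<in> \<D>" "H = interpreted_graph \<tau> G P"
      using H \<C> unfolding transduce_class_def transduce_def by blast
    let ?V = "pverts G"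
    have G: "pair_graph G" using GP BE(2) by (auto simp: graph_class_def)
    have finV: "finite ?V" using G by (simp add: pair_graph_iff)
    have HV: "pverts H \<subseteq> ?V" by (auto simp: GP(2) interpreted_graph_def Let_def)
    define E where "E x y \<longleftrightarrow> sat2 G P ?\<phi> x y \<or> sat2 G P ?\<phi> y x" for x y
    have HE: "(x, y) \<in> parcs H \<longleftrightarrow> E x y" if "x \<in> pverts H" "y \<in> pverts H" "x \<noteq> y" for x y
      using that by (auto simp: GP(2) interpreted_graph_def Let_def E_def)
    have E_sym: "E x y = E y x" for x y by (auto simp: E_def)
    obtain \<rho>1 \<chi>1 l where el: "edge_labelling G P ?\<phi> {} N k K1 \<rho>1 \<chi>1 l"
      and cW: "\<forall>x\<in>?V. card (wreach (parcs G) \<rho>1 N x) \<le> k"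
      using lab1[rule_format, OF GP(1), of "{}" P] by auto
    have Rid: "restr (parcs G) (?V - {}) = parcs G" using G by (auto simp: pair_graph_iff)
    interpret hs: hub_system ?V "parcs G" \<rho>1 \<chi>1 N k using el Rid by (simp add: edge_labelling_def)
    define W where "W x = wreach (parcs G) \<rho>1 N x" for x
    have l_less: "l x < K1" if "x \<in> ?V" for x using el that by (simp add: edge_labelling_def)
    have E_det: "E x y = E x' y'" if "x \<in> ?V" "y \<in> ?V" "x' \<in> ?V" "y' \<in> ?V" "l x = l x'" "l y = l y'"
      "\<chi>1 ` (W x \<inter> W y) = \<chi>1 ` (W x' \<inter> W y')" for x y x' y'
      using el that unfolding edge_labelling_def Rid E_def W_def hs.pat_def by blast
    define A where "A = hub_graph N G \<rho>1"
    have A\<A>: "A \<in> \<A>" using GP(1) cW by (auto simp: \<A>_def A_def)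
    have VA: "pverts A = ?V" by (simp add: A_def hub_graph_def)
    have Ag: "pair_graph A" using gcA A\<A> by (simp add: graph_class_def)
    then have symA: "sym (parcs A)" and AV: "parcs A \<subseteq> ?V \<times> ?V" using VA by (auto simp: pair_graph_iff)
    obtain \<rho> :: "'a \<Rightarrow> nat" where \<rho>: "inj_on \<rho> ?V" "\<And>x. x \<in> ?V \<Longrightarrow> card (wreach (parcs A) \<rho> (2 * n) x) \<le> k2"
      using k2 A\<A> VA by auto
    obtain \<chi> where \<chi>: "\<forall>x\<in>?V. \<chi> x < k2" "\<forall>x\<in>?V. inj_on \<chi> (wreach (parcs A) \<rho> n x)"
      using ex_wreach_colouring[OF finV \<rho>(1) AV symA \<rho>(2)] by blast
    have WV: "W x \<subseteq> ?V" if "x \<in> ?V" for x using hs.W_V[OF that] by (simp add: W_def)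
    have finW: "finite (W x)" if "x \<in> ?V" for x using WV[OF that] finV finite_subset by blast
    have clique: "(u, v) \<in> parcs A" if "x \<in> ?V" "u \<in> W x" "v \<in> W x" "u \<noteq> v" for x u v
      using that by (auto simp: A_def hub_graph_def W_def)
    have cardW: "card (W x) \<le> k" if "x \<in> ?V" for x using cW that by (simp add: W_def)
    define col where "col x = \<chi> ` W x" for x
    have col: "col x \<subseteq> {..<k2}" "card (col x) \<le> k" if "x \<in> ?V" for x
    proof -
      show "col x \<subseteq> {..<k2}" using WV[OF that] \<chi>(1) by (auto simp: col_def)
      show "card (col x) \<le> k"
        using card_image_le[OF finW[OF that], of \<chi>] cardW[OF that] by (simp add: col_def)
    qed
    have "\<exists>b\<in>W x. \<forall>u\<in>W x. \<rho> u \<le> \<rho> b" if "x \<in> ?V" for x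
    proof -
      have "x \<in> W x" by (simp add: W_def)
      then have "Max (\<rho> ` W x) \<in> \<rho> ` W x" using finW[OF that] by (intro Max_in) auto
      then obtain b where "b \<in> W x" "\<rho> b = Max (\<rho> ` W x)" by auto
      then show ?thesis using finW[OF that] by (intro bexI[of _ b]) auto
    qed
    \<comment> \<open>The highest hub of \<open>x\<close>: all its other hubs are lower and adjacent
      to it in \<open>A\<close>, hence among its ancestors.\<close>
    then obtain bot where bot: "\<And>x. x \<in> ?V \<Longrightarrow> bot x \<in> W x" "\<And>x u. x \<in> ?V \<Longrightarrow> u \<in> W x \<Longrightarrow> \<rho> u \<le> \<rho> (bot x)"
      by metis
    define U where "U C = {v \<in> ?V. \<chi> v \<in> C}" for C
    define an where "an C x = anc (parcs A) \<rho> (U C) (bot x)" for C x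
    have UV: "U C \<subseteq> ?V" "finite (U C)" for C using finV by (auto simp: U_def)
    have colU: "card (\<chi> ` U C) \<le> p" if "finite C" "card C \<le> p" for C
    proof -
      have "\<chi> ` U C \<subseteq> C" by (auto simp: U_def)
      then show ?thesis using card_mono[OF that(1)] that(2) le_trans by blast
    qed
    have WU: "W x \<subseteq> U C" if "x \<in> ?V" "col x \<subseteq> C" for x C using that WV[of x] by (auto simp: U_def col_def)
    have Wan: "W x \<subseteq> an C x" if x: "x \<in> ?V" "col x \<subseteq> C" for x C
    proof
      fix u assume u: "u \<in> W x"
      have U: "u \<in> U C" "bot x \<in> U C" using u WU[OF x] bot(1)[OF x(1)] by auto
      show "u \<in> an C x"
      proof (cases "u = bot x")
        case True
        then show ?thesis using anc_self[OF U(2)] by (simp add: an_def)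
      next
        case False
        then have "(bot x, u) \<in> parcs A" using clique[OF x(1) bot(1)[OF x(1)] u] by simp
        then show ?thesis using anc_edge[OF _ U] bot(2)[OF x(1) u] by (simp add: an_def)
      qed
    qed
    have anW: "an C x \<subseteq> wreach (parcs A) \<rho> n (bot x)" if x: "x \<in> ?V" "col x \<subseteq> C" "finite C" "card C \<le> p" for x C
      unfolding an_def n_def
    proof (rule anc_wreach[OF symA AV _ UV colU[OF x(3,4)]])
      show "inj_on \<chi> (wreach (parcs A) \<rho> (2 ^ p) x)" if "x \<in> ?V" for x using \<chi>(2) that by (simp add: n_def)
      show "bot x \<in> U C" using WU[OF x(1,2)] bot(1)[OF x(1)] by blast
    qed
    have anU: "an C x \<subseteq> U C" for C x by (auto simp: an_def anc_def)
    have chains: "chains {x \<in> pverts H. col x \<subseteq> C} (an C) \<rho> p" if C: "finite C" "card C \<le> p" for C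
    proof
      fix x assume "x \<in> {x \<in> pverts H. col x \<subseteq> C}"
      then have x: "x \<in> ?V" "col x \<subseteq> C" using HV by auto
      have sub: "an C x \<subseteq> wreach (parcs A) \<rho> n (bot x)" by (rule anW[OF x C])
      have bV: "bot x \<in> ?V" using bot(1)[OF x(1)] WV[OF x(1)] by blast
      show fin: "finite (an C x)" using anU[of C x] UV(2)[of C] finite_subset by blast
      have "inj_on \<chi> (an C x)" using \<chi>(2) bV sub inj_on_subset by blast
      then have "card (an C x) = card (\<chi> ` an C x)" by (simp add: card_image)
      also have "\<dots> \<le> card C" using anU[of C x] C(1) by (intro card_mono) (auto simp: U_def)
      finally show "card (an C x) \<le> p" using C(2) by simp
      show "inj_on \<rho> (an C x)" using \<rho>(1) anU[of C x] UV(1)[of C] by (meson inj_on_subset subset_trans)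
      fix y u w assume "u \<in> an C x" "u \<in> an C y" "w \<in> an C x" "\<rho> w \<le> \<rho> u"
      moreover have "w \<in> U C" using \<open>w \<in> an C x\<close> anU by blast
      ultimately show "w \<in> an C y" using anc_down[OF symA] unfolding an_def by metis
    qed
    \<comment> \<open>The table of hub colours and positions used by \<open>shared_iff\<close>. It
      is kept for all admissible colour sets \<open>C\<close>, since the set that applies depends on
      the label of the other vertex as well.\<close>
    define info where "info x = {(C, a, i). C \<subseteq> {..<k2} \<and> col x \<subseteq> C \<and> card C \<le> p \<and>
        (\<exists>u\<in>W x. a = \<chi>1 u \<and> i = chains.idx (an C) \<rho> x u)}" for x
    define t where "t x = (l x, col x, info x)" for x
    have t\<Lambda>: "t x \<in> \<Lambda>" if x: "x \<in> pverts H" for x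
    proof -
      have xV: "x \<in> ?V" using x HV by blast
      have "chains.idx (an C) \<rho> x u \<le> p" if C: "C \<subseteq> {..<k2}" "col x \<subseteq> C" "card C \<le> p" for C u
      proof -
        have "finite C" using C(1) finite_subset by blast
        then interpret chains "{x \<in> pverts H. col x \<subseteq> C}" "an C" \<rho> p by (rule chains[OF _ C(3)])
        have xM: "x \<in> {x \<in> pverts H. col x \<subseteq> C}" using x C(2) by simp
        have "idx x u \<le> card (an C x)" unfolding idx_def using finite_ch[OF xM] by (intro card_mono) auto
        then show ?thesis using card_ch[OF xM] by simp
      qed
      moreover have "\<chi>1 u < k" if "u \<in> W x" for u using that WV[OF xV] hs.\<chi>_less by blast
      ultimately have "info x \<subseteq> Pow {..<k2} \<times> {..<k} \<times> {..p}" by (auto simp: info_def)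
      then show ?thesis using l_less[OF xV] col(1)[OF xV] by (simp add: t_def \<Lambda>_def)
    qed
    define lab where "lab = g \<circ> t"
    have tD: "t x = t y" if "x \<in> pverts H" "y \<in> pverts H" "lab x = lab y" for x y
      using that t\<Lambda> g(1) by (auto simp: lab_def dest: inj_onD)
    \<comment> \<open>A label determines the colours \<open>col x\<close>; \<open>Cof\<close>
      recovers them from the label, so that the chains depend on the pair of labels only.\<close>
    define Cof where "Cof \<alpha> = (\<Union>x\<in>{x \<in> pverts H. lab x = \<alpha>}. col x)" for \<alpha>
    have Cof: "Cof (lab x) = col x" if "x \<in> pverts H" for x
    proof -
      have "col y = col x" if "y \<in> pverts H" "lab y = lab x" for y
        using tD[OF that(1) \<open>x \<in> pverts H\<close> that(2)] by (simp add: t_def)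
      then show ?thesis using that unfolding Cof_def by blast
    qed
    have Cof_bound: "Cof \<alpha> \<subseteq> {..<k2} \<and> card (Cof \<alpha>) \<le> k" for \<alpha>
    proof (cases "\<exists>x\<in>pverts H. lab x = \<alpha>")
      case True
      then obtain x where "x \<in> pverts H" "lab x = \<alpha>" by blast
      then show ?thesis using Cof[of x] col[of x] HV by auto
    next
      case False
      then have "Cof \<alpha> = {}" by (auto simp: Cof_def)
      then show ?thesis by simp
    qed
    define CC where "CC \<alpha> \<beta> = Cof \<alpha> \<union> Cof \<beta>" for \<alpha> \<beta>
    have CC: "CC \<alpha> \<beta> \<subseteq> {..<k2}" "finite (CC \<alpha> \<beta>)" "card (CC \<alpha> \<beta>) \<le> p" for \<alpha> \<beta>
    proof -
      show s: "CC \<alpha> \<beta> \<subseteq> {..<k2}" using Cof_bound by (auto simp: CC_def)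
      then show "finite (CC \<alpha> \<beta>)" using finite_subset by blast
      have "card (CC \<alpha> \<beta>) \<le> card (Cof \<alpha>) + card (Cof \<beta>)" unfolding CC_def by (rule card_Un_le)
      also have "\<dots> \<le> k + k" using Cof_bound by (intro add_mono) auto
      finally show "card (CC \<alpha> \<beta>) \<le> p" by (simp add: p_def)
    qed
    define ch where "ch \<alpha> \<beta> x = an (CC \<alpha> \<beta>) x" for \<alpha> \<beta> x
    have ch_eq: "ch \<alpha> \<beta> = an (CC \<alpha> \<beta>)" for \<alpha> \<beta> by (simp add: ch_def fun_eq_iff)
    have colCC: "col x \<subseteq> CC \<alpha> \<beta>" if "x \<in> pverts H" "lab x = \<alpha> \<or> lab x = \<beta>" for x \<alpha> \<beta>
      using Cof[OF that(1)] that(2) by (auto simp: CC_def)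
    have ch_chains: "chains {x \<in> pverts H. lab x = \<alpha> \<or> lab x = \<beta>} (ch \<alpha> \<beta>) \<rho> p" for \<alpha> \<beta>
      unfolding ch_eq by (rule chains_mono[OF chains[OF CC(2,3)]]) (use colCC in auto)
    define \<Phi> where "\<Phi> \<alpha> \<beta> j \<longleftrightarrow> (\<exists>x\<in>pverts H. \<exists>y\<in>pverts H. lab x = \<alpha> \<and> lab y = \<beta> \<and> x \<noteq> y \<and>
        chains.meet (ch \<alpha> \<beta>) x y = j \<and> E x y)" for \<alpha> \<beta> j
    have shared: "\<chi>1 ` (W x \<inter> W y) = {a. \<exists>i\<le>chains.meet (ch \<alpha> \<beta>) x y. (CC \<alpha> \<beta>, a, i) \<in> info x \<and> (CC \<alpha> \<beta>, a, i) \<in> info y}"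
      if xy: "x \<in> pverts H" "y \<in> pverts H" "lab x = \<alpha>" "lab y = \<beta>" for x y \<alpha> \<beta>
    proof -
      interpret chains "{x \<in> pverts H. lab x = \<alpha> \<or> lab x = \<beta>}" "ch \<alpha> \<beta>" \<rho> p by (rule ch_chains)
      have M: "x \<in> {x \<in> pverts H. lab x = \<alpha> \<or> lab x = \<beta>}" "y \<in> {x \<in> pverts H. lab x = \<alpha> \<or> lab x = \<beta>}"
        using xy by auto
      have cc: "col x \<subseteq> CC \<alpha> \<beta>" "col y \<subseteq> CC \<alpha> \<beta>" using colCC xy by auto
      have "W x \<subseteq> ch \<alpha> \<beta> x" "W y \<subseteq> ch \<alpha> \<beta> y"
        unfolding ch_eq using Wan[OF subsetD[OF HV xy(1)] cc(1)] Wan[OF subsetD[OF HV xy(2)] cc(2)] by simp_all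
      from shared_iff[OF M this, of \<chi>1] show ?thesis
        using CC[of \<alpha> \<beta>] cc by (simp add: info_def ch_eq)
    qed
    have det: "E x y = E x' y'"
      if xy: "x \<in> pverts H" "y \<in> pverts H" "x' \<in> pverts H" "y' \<in> pverts H" "lab x = \<alpha>" "lab y = \<beta>" "lab x' = \<alpha>" "lab y' = \<beta>"
        and m: "chains.meet (ch \<alpha> \<beta>) x y = chains.meet (ch \<alpha> \<beta>) x' y'" for x y x' y' \<alpha> \<beta>
    proof (rule E_det)
      have tt: "t x = t x'" "t y = t y'" using tD[OF xy(1,3)] tD[OF xy(2,4)] xy(5-8) by simp_all
      show "l x = l x'" "l y = l y'" using tt by (simp_all add: t_def)
      have "info x = info x'" "info y = info y'" using tt by (simp_all add: t_def)
      then show "\<chi>1 ` (W x \<inter> W y) = \<chi>1 ` (W x' \<inter> W y')"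
        unfolding shared[OF xy(1,2,5,6)] shared[OF xy(3,4,7,8)] m by simp
    qed (use xy HV in auto)
    have \<Phi>_iff: "(x, y) \<in> parcs H \<longleftrightarrow> \<Phi> \<alpha> \<beta> (chains.meet (ch \<alpha> \<beta>) x y)"
      if xy: "x \<in> pverts H" "y \<in> pverts H" "x \<noteq> y" "lab x = \<alpha>" "lab y = \<beta>" for x y \<alpha> \<beta>
    proof
      assume "(x, y) \<in> parcs H"
      then show "\<Phi> \<alpha> \<beta> (chains.meet (ch \<alpha> \<beta>) x y)" using xy HE[OF xy(1-3)] by (auto simp: \<Phi>_def)
    next
      assume "\<Phi> \<alpha> \<beta> (chains.meet (ch \<alpha> \<beta>) x y)"
      then obtain x' y' where "x' \<in> pverts H" "y' \<in> pverts H" "lab x' = \<alpha>" "lab y' = \<beta>"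
        "chains.meet (ch \<alpha> \<beta>) x' y' = chains.meet (ch \<alpha> \<beta>) x y" "E x' y'" unfolding \<Phi>_def by blast
      then have "E x y" using det[of x y x' y' \<alpha> \<beta>] xy by simp
      then show "(x, y) \<in> parcs H" using HE[OF xy(1-3)] by simp
    qed
    have "tree_model n k2 p (card \<Lambda>) A \<rho> H lab ch \<Phi>"
      unfolding tree_model_def
    proof (intro conjI allI ballI impI)
      show "pverts H \<subseteq> pverts A" using HV VA by simp
      show "card (wreach (parcs A) \<rho> n w) \<le> k2" if "w \<in> pverts A" for w
      proof -
        have wV: "w \<in> ?V" using that VA by simp
        have "finite (wreach (parcs A) \<rho> (2 * n) w)"
          using wreach_subset[OF AV wV] finV finite_subset by blast
        from card_mono[OF this wreach_mono[OF order_refl, of n "2 * n"]] show ?thesis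
          using \<rho>(2)[OF wV] by simp
      qed
      show "lab x < card \<Lambda>" if "x \<in> pverts H" for x using t\<Lambda>[OF that] g(2) by (auto simp: lab_def)
      show "chains {x \<in> pverts H. lab x = \<alpha> \<or> lab x = \<beta>} (ch \<alpha> \<beta>) \<rho> p" for \<alpha> \<beta> by (rule ch_chains)
    next
      fix \<alpha> \<beta> x assume x: "x \<in> pverts H" "lab x = \<alpha> \<or> lab x = \<beta>"
      have xV: "x \<in> ?V" using x(1) HV by blast
      have "x \<in> W x" by (simp add: W_def)
      have "x \<in> wreach (parcs A) \<rho> 1 (bot x)"
      proof (cases "x = bot x")
        case False
        then have "(bot x, x) \<in> parcs A" using clique[OF xV bot(1)[OF xV] \<open>x \<in> W x\<close>] by simp
        then show ?thesis using bot(2)[OF xV \<open>x \<in> W x\<close>] by (intro wreach_edge) auto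
      next
        case True
        then show ?thesis by (metis wreach_self)
      qed
      then have "x \<in> wreach (parcs A) \<rho> n (bot x)"
        using wreach_mono[OF order_refl, of 1 n "parcs A" \<rho> "bot x"] by (auto simp: n_def)
      moreover have "ch \<alpha> \<beta> x \<subseteq> wreach (parcs A) \<rho> n (bot x)"
        unfolding ch_eq by (rule anW[OF xV colCC[OF x] CC(2,3)])
      moreover have "bot x \<in> pverts A" using bot(1)[OF xV] WV[OF xV] VA by blast
      ultimately show "\<exists>b\<in>pverts A. x \<in> wreach (parcs A) \<rho> n b \<and> ch \<alpha> \<beta> x \<subseteq> wreach (parcs A) \<rho> n b" by blast
    next
      fix \<alpha> \<beta> x y assume xy: "x \<in> pverts H" "y \<in> pverts H" "x \<noteq> y"
        and ab: "lab x = \<alpha> \<and> lab y = \<beta> \<or> lab x = \<beta> \<and> lab y = \<alpha>"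
      interpret chains "{x \<in> pverts H. lab x = \<alpha> \<or> lab x = \<beta>}" "ch \<alpha> \<beta>" \<rho> p by (rule ch_chains)
      show "(x, y) \<in> parcs H \<longleftrightarrow> \<Phi> \<alpha> \<beta> (meet x y)"
      proof (cases "lab x = \<alpha> \<and> lab y = \<beta>")
        case True
        then show ?thesis using \<Phi>_iff[OF xy] by blast
      next
        case False
        then have "(y, x) \<in> parcs H \<longleftrightarrow> \<Phi> \<alpha> \<beta> (meet y x)" using \<Phi>_iff[OF xy(2,1)] xy(3) ab by blast
        moreover have "(y, x) \<in> parcs H \<longleftrightarrow> (x, y) \<in> parcs H" using HE xy E_sym by metis
        ultimately show ?thesis using meet_sym[of x y] by simp
      qed
    qed
    then show ?thesis using A\<A> by blast
  qed
  then show ?thesis using beA gcA by blast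
qed

section \<open>The sparse graph of a tree model\<close>

fun disjs :: "fo list \<Rightarrow> fo" where
  "disjs [] = Neg (Eq 0 0)"
| "disjs (f # fs) = Disj f (disjs fs)"

lemma sat_disjs: "sat G P \<sigma> (disjs fs) \<longleftrightarrow> (\<exists>f\<in>set fs. sat G P \<sigma> f)"
  by (induction fs) auto

lemma fvars_disjs: "fvars (disjs fs) = insert 0 (\<Union>f\<in>set fs. fvars f)"
  by (induction fs) auto

lemma colours_disjs: "colours (disjs fs) = (\<Union>f\<in>set fs. colours f)"
  by (induction fs) auto

text \<open>\<open>ty j\<close> is the colour of the hubs of round \<open>j\<close>; \<open>same_hub ty D m\<close> describes round \<open>D - m\<close>.\<close>

primrec same_hub :: "(nat \<Rightarrow> nat) \<Rightarrow> nat \<Rightarrow> nat \<Rightarrow> fo" where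
  "same_hub ty D 0 = Neg (Eq 0 0)"
| "same_hub ty D (Suc m) =
     Ex 2 (Conj (Conj (Adj 2 0) (Adj 2 1)) (Conj (Col (ty (D - Suc m)) 2) (Neg (same_hub ty D m))))"

lemma fvars_same_hub: "fvars (same_hub ty D m) \<subseteq> {0, 1}"
  by (induction m) auto

lemma colours_same_hub: "m \<le> D \<Longrightarrow> colours (same_hub ty D m) \<subseteq> ty ` {..<D}"
  by (induction m) auto

definition hub_types :: "nat \<Rightarrow> nat \<Rightarrow> (nat \<times> nat \<times> nat) set" where
  "hub_types K d = {..<K} \<times> {..<K} \<times> {..d}"

definition ty_code :: "nat \<Rightarrow> nat \<Rightarrow> nat \<times> nat \<times> nat \<Rightarrow> nat" where
  "ty_code K d = (SOME e. inj_on e (hub_types K d) \<and> e ` hub_types K d \<subseteq> {..<card (hub_types K d)})"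

lemma ty_code: "inj_on (ty_code K d) (hub_types K d)" "ty_code K d ` hub_types K d \<subseteq> {..<card (hub_types K d)}"
proof -
  have "finite (hub_types K d)" by (simp add: hub_types_def)
  from someI_ex[OF ex_recode[OF this]]
  show "inj_on (ty_code K d) (hub_types K d)" "ty_code K d ` hub_types K d \<subseteq> {..<card (hub_types K d)}"
    unfolding ty_code_def by blast+
qed

text \<open>The colours 1 to \<open>K\<close> are reserved for the labels; the types of added
  vertices follow.\<close>

definition hub_colour :: "nat \<Rightarrow> nat \<Rightarrow> nat \<Rightarrow> nat \<Rightarrow> nat \<Rightarrow> nat" where
  "hub_colour K d \<alpha> \<beta> j = Suc (K + ty_code K d (\<alpha>, \<beta>, j))"

text \<open>Added vertices carry no label colour, so the vertex formula drops them. Pairs with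
  \<open>\<alpha> \<le> \<beta>\<close> suffice because a transduction symmetrises its edge
  formula.\<close>

definition decoding :: "nat \<Rightarrow> nat \<Rightarrow> transduction" where
  "decoding K d = Transduction (K + card (hub_types K d))
     (disjs (map (\<lambda>\<alpha>. Col (Suc \<alpha>) 0) [0..<K]))
     (disjs (map (\<lambda>(\<alpha>, \<beta>). Conj (Conj (Col (Suc \<alpha>) 0) (Col (Suc \<beta>) 1))
          (same_hub (hub_colour K d \<alpha> \<beta>) (Suc d) (Suc d)))
        (filter (\<lambda>(\<alpha>, \<beta>). \<alpha> \<le> \<beta>) (List.product [0..<K] [0..<K]))))"

lemma is_transduction_decoding: "is_transduction (decoding K d)"
proof -
  have col: "hub_colour K d \<alpha> \<beta> j \<in> {1..K + card (hub_types K d)}" if "\<alpha> < K" "\<beta> < K" "j \<le> d" for \<alpha> \<beta> j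
  proof -
    have "(\<alpha>, \<beta>, j) \<in> hub_types K d" using that by (simp add: hub_types_def)
    then have "ty_code K d (\<alpha>, \<beta>, j) < card (hub_types K d)" using ty_code(2) by blast
    then show ?thesis by (simp add: hub_colour_def)
  qed
  define sh where "sh \<alpha> \<beta> = same_hub (hub_colour K d \<alpha> \<beta>) (Suc d) (Suc d)" for \<alpha> \<beta>
  have c: "Suc 0 \<le> c" "c \<le> K + card (hub_types K d)" if "c \<in> colours (sh \<alpha> \<beta>)" "\<alpha> \<le> \<beta>" "\<beta> < K" for \<alpha> \<beta> c
    using colours_same_hub[of "Suc d" "Suc d" "hub_colour K d \<alpha> \<beta>"] col[OF le_less_trans[OF that(2,3)] that(3)] that(1)
    unfolding sh_def by fastforce+
  have v: "v = Suc 0" if "v \<in> fvars (sh \<alpha> \<beta>)" "0 < v" for \<alpha> \<beta> v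
    using subsetD[OF fvars_same_hub that(1)[unfolded sh_def]] that(2) by simp
  show ?thesis
    unfolding is_transduction_def decoding_def transduction.sel fvars_disjs colours_disjs sh_def[symmetric]
    by (auto intro: c v)
qed

locale sparsify =
  fixes n k d K :: nat and A :: "'a pair_pre_digraph" and \<rho> :: "'a \<Rightarrow> nat" and H :: "'a pair_pre_digraph"
    and lab :: "'a \<Rightarrow> nat" and ch :: "nat \<Rightarrow> nat \<Rightarrow> 'a \<Rightarrow> 'a set" and \<Phi> :: "nat \<Rightarrow> nat \<Rightarrow> nat \<Rightarrow> bool"
  assumes tm: "tree_model n k d K A \<rho> H lab ch \<Phi>" and Hg: "pair_graph H"
begin

abbreviation M :: "nat \<Rightarrow> nat \<Rightarrow> 'a set" where
  "M \<alpha> \<beta> \<equiv> {x \<in> pverts H. lab x = \<alpha> \<or> lab x = \<beta>}"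

abbreviation mt :: "nat \<Rightarrow> nat \<Rightarrow> 'a \<Rightarrow> 'a \<Rightarrow> nat" where
  "mt \<alpha> \<beta> \<equiv> chains.meet (ch \<alpha> \<beta>)"

lemma chains: "chains (M \<alpha> \<beta>) (ch \<alpha> \<beta>) \<rho> d"
  using tm by (simp add: tree_model_def)

lemma finite_H: "finite (pverts H)"
  using Hg by (simp add: pair_graph_iff)

lemma lab_less: "x \<in> pverts H \<Longrightarrow> lab x < K"
  using tm by (simp add: tree_model_def)

lemma tree_like: "tree_like (M \<alpha> \<beta>) lab \<alpha> \<beta> (mt \<alpha> \<beta>) d"
proof -
  interpret chains "M \<alpha> \<beta>" "ch \<alpha> \<beta>" \<rho> d by (rule chains)
  show ?thesis
    by unfold_locales (use finite_H meet_sym meet_ultra meet_le in auto)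
qed

abbreviation al :: "nat \<Rightarrow> nat \<Rightarrow> nat \<Rightarrow> ('a \<times> 'a) set" where
  "al \<alpha> \<beta> \<equiv> tree_like.alt (M \<alpha> \<beta>) lab \<alpha> \<beta> (mt \<alpha> \<beta>) (\<Phi> \<alpha> \<beta>)"

abbreviation cp :: "nat \<Rightarrow> nat \<Rightarrow> nat \<Rightarrow> 'a set set" where
  "cp \<alpha> \<beta> \<equiv> tree_like.comps (M \<alpha> \<beta>) lab \<alpha> \<beta> (mt \<alpha> \<beta>) (\<Phi> \<alpha> \<beta>)"

abbreviation lv :: "nat \<Rightarrow> nat \<Rightarrow> nat \<Rightarrow> 'a set \<Rightarrow> nat" where
  "lv \<alpha> \<beta> \<equiv> tree_like.comp_level (M \<alpha> \<beta>) lab \<alpha> \<beta> (mt \<alpha> \<beta>) (\<Phi> \<alpha> \<beta>)"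

abbreviation JJ :: "nat \<Rightarrow> nat \<Rightarrow> ('a \<times> 'a) set" where
  "JJ \<alpha> \<beta> \<equiv> tree_like.J (M \<alpha> \<beta>) lab \<alpha> \<beta>"

lemma JJ_iff: "(x, y) \<in> JJ \<alpha> \<beta> \<longleftrightarrow> x \<in> pverts H \<and> y \<in> pverts H \<and> x \<noteq> y \<and>
    (lab x = \<alpha> \<and> lab y = \<beta> \<or> lab x = \<beta> \<and> lab y = \<alpha>)"
proof -
  interpret tree_like "M \<alpha> \<beta>" lab \<alpha> \<beta> "mt \<alpha> \<beta>" "\<Phi> \<alpha> \<beta>" d by (rule tree_like)
  show ?thesis by (auto simp: J_def)
qed

lemma alt_0_iff: "(x, y) \<in> JJ \<alpha> \<beta> \<Longrightarrow> (x, y) \<in> al \<alpha> \<beta> 0 \<longleftrightarrow> (x, y) \<in> parcs H"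
proof -
  interpret tree_like "M \<alpha> \<beta>" lab \<alpha> \<beta> "mt \<alpha> \<beta>" "\<Phi> \<alpha> \<beta>" d by (rule tree_like)
  assume J: "(x, y) \<in> J"
  then have "(x, y) \<in> parcs H \<longleftrightarrow> \<Phi> \<alpha> \<beta> (mt \<alpha> \<beta> x y)"
    using tm JJ_iff[of x y \<alpha> \<beta>] unfolding tree_model_def by blast
  then show ?thesis using J by simp
qed

text \<open>Rounds beyond \<open>d\<close> have no edges by \<open>alt_empty\<close>, and
  \<open>\<alpha> \<le> \<beta>\<close> lists every pair of labels once.\<close>

definition hubs :: "(nat \<times> nat \<times> nat \<times> 'a set) set" where
  "hubs = {(\<alpha>, \<beta>, j, Q). \<alpha> \<le> \<beta> \<and> \<beta> < K \<and> j \<le> d \<and> Q \<in> cp \<alpha> \<beta> j}"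

lemma cp_H: "Q \<in> cp \<alpha> \<beta> j \<Longrightarrow> Q \<subseteq> pverts H"
  using tree_like.comps_M[OF tree_like] by blast

lemma cp_M: "Q \<in> cp \<alpha> \<beta> j \<Longrightarrow> Q \<subseteq> M \<alpha> \<beta>"
  by (rule tree_like.comps_M[OF tree_like])

lemma cp_nonempty: "Q \<in> cp \<alpha> \<beta> j \<Longrightarrow> Q \<noteq> {}"
  by (rule tree_like.comps_nonempty[OF tree_like])

lemma finite_cp: "finite (cp \<alpha> \<beta> j)"
  by (rule tree_like.finite_comps[OF tree_like])

lemma finite_hubs: "finite hubs"
proof (rule finite_subset)
  show "hubs \<subseteq> {..<K} \<times> {..<K} \<times> {..d} \<times> Pow (pverts H)" by (auto simp: hubs_def dest: subsetD[OF cp_H])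
qed (use finite_H in simp)

text \<open>There are at most \<open>K * K * (d + 1)\<close> types of hubs, so it is enough to count
  for a single pair of labels and a single round.\<close>

lemma card_hubs_le:
  assumes "\<And>\<alpha> \<beta> j. \<alpha> \<le> \<beta> \<Longrightarrow> \<beta> < K \<Longrightarrow> j \<le> d \<Longrightarrow> card {Q \<in> cp \<alpha> \<beta> j. p (\<alpha>, \<beta>, j, Q)} \<le> b"
  shows "card {q \<in> hubs. p q} \<le> b * (K * K * (d + 1))"
proof -
  let ?f = "\<lambda>(\<alpha>, \<beta>, j, Q). (\<alpha>, \<beta>, j)"
  let ?T = "{(\<alpha>, \<beta>, j). \<alpha> \<le> \<beta> \<and> \<beta> < K \<and> j \<le> d}"
  have sub: "?T \<subseteq> hub_types K d" by (auto simp: hub_types_def)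
  have finT: "finite (hub_types K d)" by (simp add: hub_types_def)
  have "card {q \<in> hubs. p q} \<le> b * card ?T"
  proof (rule card_le_if_fibres_le[where f = ?f])
    show "?f ` {q \<in> hubs. p q} \<subseteq> ?T" by (auto simp: hubs_def)
    show "finite ?T" by (rule finite_subset[OF sub finT])
    fix t assume t: "t \<in> ?T"
    then obtain \<alpha> \<beta> j where t': "t = (\<alpha>, \<beta>, j)" "\<alpha> \<le> \<beta>" "\<beta> < K" "j \<le> d" by auto
    have "{a \<in> {q \<in> hubs. p q}. ?f a = t} \<subseteq> (\<lambda>Q. (\<alpha>, \<beta>, j, Q)) ` {Q \<in> cp \<alpha> \<beta> j. p (\<alpha>, \<beta>, j, Q)}"
      by (auto simp: hubs_def t'(1))
    then have "card {a \<in> {q \<in> hubs. p q}. ?f a = t} \<le> card ((\<lambda>Q. (\<alpha>, \<beta>, j, Q)) ` {Q \<in> cp \<alpha> \<beta> j. p (\<alpha>, \<beta>, j, Q)})"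
      using finite_cp by (intro card_mono) auto
    also have "\<dots> \<le> card {Q \<in> cp \<alpha> \<beta> j. p (\<alpha>, \<beta>, j, Q)}" using finite_cp by (intro card_image_le) auto
    also have "\<dots> \<le> b" by (rule assms[OF t'(2-4)])
    finally show "card {a \<in> {q \<in> hubs. p q}. ?f a = t} \<le> b" .
  qed (use finite_hubs in simp)
  also have "\<dots> \<le> b * card (hub_types K d)" by (intro mult_le_mono2 card_mono[OF finT sub])
  also have "card (hub_types K d) = K * K * (d + 1)" by (simp add: hub_types_def card_cartesian_product algebra_simps)
  finally show ?thesis .
qed

end

text \<open>The encoding graph must have the vertex type of \<open>H\<close>; \<open>h\<close>
  places the added vertices outside \<open>H\<close>, which an infinite type permits.\<close>

locale sparsify_fresh = sparsify n k d K A \<rho> H lab ch \<Phi>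
  for n k d K and A :: "'a pair_pre_digraph" and \<rho> H lab ch \<Phi> +
  fixes h :: "nat \<times> nat \<times> nat \<times> 'a set \<Rightarrow> 'a"
  assumes inj_h: "inj_on h hubs" and fresh: "h ` hubs \<inter> pverts H = {}"
begin

definition SG :: "'a pair_pre_digraph" where
  "SG = \<lparr>pverts = pverts H \<union> h ` hubs,
     parcs = {(x, y). \<exists>(\<alpha>, \<beta>, j, Q)\<in>hubs. (x \<in> Q \<and> y = h (\<alpha>, \<beta>, j, Q)) \<or> (y \<in> Q \<and> x = h (\<alpha>, \<beta>, j, Q))}\<rparr>"

lemma SG_arc_cases:
  assumes "(x, y) \<in> parcs SG"
  obtains \<alpha> \<beta> j Q where "(\<alpha>, \<beta>, j, Q) \<in> hubs" "x \<in> Q" "y = h (\<alpha>, \<beta>, j, Q)"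
  | \<alpha> \<beta> j Q where "(\<alpha>, \<beta>, j, Q) \<in> hubs" "y \<in> Q" "x = h (\<alpha>, \<beta>, j, Q)"
  using assms unfolding SG_def by auto

lemma hubs_cp: "(\<alpha>, \<beta>, j, Q) \<in> hubs \<Longrightarrow> Q \<in> cp \<alpha> \<beta> j"
  by (simp add: hubs_def)

lemma hubs_H: "(\<alpha>, \<beta>, j, Q) \<in> hubs \<Longrightarrow> Q \<subseteq> pverts H"
  by (rule cp_H[OF hubs_cp])

lemma pair_graph_SG: "pair_graph SG"
  unfolding pair_graph_iff
proof (intro conjI)
  show "finite (pverts SG)" using finite_H finite_hubs by (simp add: SG_def)
  show "parcs SG \<subseteq> pverts SG \<times> pverts SG"
    by (auto simp: SG_def dest: subsetD[OF hubs_H])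
  show "sym (parcs SG)" by (auto simp: SG_def sym_def)
  show "irrefl (parcs SG)"
    unfolding irrefl_def
  proof (intro allI notI)
    fix x assume "(x, x) \<in> parcs SG"
    then show False by (cases rule: SG_arc_cases) (use fresh hubs_H in blast)+
  qed
qed

lemma adj_hub_iff:
  assumes "q \<in> hubs" "x \<in> pverts H"
  shows "(h q, x) \<in> parcs SG \<longleftrightarrow> x \<in> snd (snd (snd q))"
proof
  assume "(h q, x) \<in> parcs SG"
  then show "x \<in> snd (snd (snd q))"
  proof (cases rule: SG_arc_cases)
    case (1 \<alpha> \<beta> j Q)
    then show ?thesis using fresh assms(2) by blast
  next
    case (2 \<alpha> \<beta> j Q)
    then have "q = (\<alpha>, \<beta>, j, Q)" using inj_h assms(1) by (auto dest: inj_onD)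
    then show ?thesis using 2 by simp
  qed
next
  assume "x \<in> snd (snd (snd q))"
  then show "(h q, x) \<in> parcs SG"
    using assms(1) by (cases q) (auto simp: SG_def)
qed

definition col :: "nat \<Rightarrow> 'a set" where
  "col c = (if c \<in> {1..K} then {x \<in> pverts H. lab x = c - 1}
     else h ` {(\<alpha>, \<beta>, j, Q) \<in> hubs. hub_colour K d \<alpha> \<beta> j = c})"

lemma hub_col_iff:
  assumes "\<alpha> \<le> \<beta>" "\<beta> < K" "j \<le> d"
  shows "z \<in> col (hub_colour K d \<alpha> \<beta> j) \<longleftrightarrow> (\<exists>Q. (\<alpha>, \<beta>, j, Q) \<in> hubs \<and> z = h (\<alpha>, \<beta>, j, Q))"
proof -
  have ty: "(\<alpha>', \<beta>', j') \<in> hub_types K d" if "(\<alpha>', \<beta>', j', Q) \<in> hubs" for \<alpha>' \<beta>' j' Q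
    using that by (auto simp: hubs_def hub_types_def)
  have "(\<alpha>, \<beta>, j) \<in> hub_types K d" using assms by (simp add: hub_types_def)
  then have "(\<alpha>', \<beta>', j') = (\<alpha>, \<beta>, j)" if "(\<alpha>', \<beta>', j', Q) \<in> hubs" "hub_colour K d \<alpha>' \<beta>' j' = hub_colour K d \<alpha> \<beta> j"
    for \<alpha>' \<beta>' j' Q
    using inj_onD[OF ty_code(1) _ ty[OF that(1)]] that(2) by (simp add: hub_colour_def)
  moreover have "hub_colour K d \<alpha> \<beta> j \<notin> {1..K}" by (simp add: hub_colour_def)
  ultimately show ?thesis unfolding col_def by fastforce
qed

text \<open>A common neighbour of the colour of a round says that \<open>x\<close> and
  \<open>y\<close> lie in one component of it. The induction starts at the empty round
  \<open>Suc d\<close> and descends by \<open>alt_unfold\<close>.\<close>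

lemma sat_same_hub:
  assumes ab: "\<alpha> \<le> \<beta>" "\<beta> < K" and J: "(x, y) \<in> JJ \<alpha> \<beta>" and "m \<le> Suc d" and "\<sigma> 0 = x" "\<sigma> 1 = y"
  shows "sat SG col \<sigma> (same_hub (hub_colour K d \<alpha> \<beta>) (Suc d) m) \<longleftrightarrow> (x, y) \<in> al \<alpha> \<beta> (Suc d - m)"
  using assms(4-)
proof (induction m arbitrary: \<sigma>)
  case 0
  interpret tree_like "M \<alpha> \<beta>" lab \<alpha> \<beta> "mt \<alpha> \<beta>" "\<Phi> \<alpha> \<beta>" d by (rule tree_like)
  show ?case using alt_empty by (simp del: alt.simps)
next
  case (Suc m)
  interpret tree_like "M \<alpha> \<beta>" lab \<alpha> \<beta> "mt \<alpha> \<beta>" "\<Phi> \<alpha> \<beta>" d by (rule tree_like)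
  let ?j = "d - m"
  have j: "Suc d - Suc m = ?j" "Suc d - m = Suc ?j" using Suc.prems(1) by auto
  have xH: "x \<in> pverts H" "y \<in> pverts H" using J by (simp_all add: JJ_iff)
  have IH: "sat SG col (\<sigma>(2 := z)) (same_hub (hub_colour K d \<alpha> \<beta>) (Suc d) m) \<longleftrightarrow> (x, y) \<in> alt (Suc ?j)" for z
    using Suc.IH[of "\<sigma>(2 := z)", unfolded j(2)] Suc.prems by fastforce
  have "sat SG col \<sigma> (same_hub (hub_colour K d \<alpha> \<beta>) (Suc d) (Suc m)) \<longleftrightarrow>
      (\<exists>z\<in>pverts SG. (z, x) \<in> parcs SG \<and> (z, y) \<in> parcs SG \<and> z \<in> col (hub_colour K d \<alpha> \<beta> ?j)) \<and> (x, y) \<notin> alt (Suc ?j)"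
    using IH Suc.prems(2,3) j(1) by (auto simp del: alt.simps)
  also have "(\<exists>z\<in>pverts SG. (z, x) \<in> parcs SG \<and> (z, y) \<in> parcs SG \<and> z \<in> col (hub_colour K d \<alpha> \<beta> ?j)) \<longleftrightarrow>
      (\<exists>Q. (\<alpha>, \<beta>, ?j, Q) \<in> hubs \<and> x \<in> Q \<and> y \<in> Q)"
  proof -
    have "z \<in> pverts SG" if "(\<alpha>, \<beta>, ?j, Q) \<in> hubs" "z = h (\<alpha>, \<beta>, ?j, Q)" for z Q
      using that by (simp add: SG_def)
    then show ?thesis
      using hub_col_iff[OF ab, of ?j] adj_hub_iff[OF _ xH(1)] adj_hub_iff[OF _ xH(2)] by fastforce
  qed
  also have "\<dots> \<longleftrightarrow> (\<exists>Q\<in>comps ?j. x \<in> Q \<and> y \<in> Q)" using ab by (auto simp: hubs_def)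
  also have "\<dots> \<longleftrightarrow> (x, y) \<in> (alt ?j)\<^sup>*" using in_comps_iff[OF J] by simp
  finally show ?case using alt_unfold[of x y ?j] J unfolding j by blast
qed

lemma H_transduced: "H \<in> transduce (decoding K d) SG"
proof -
  have vf: "sat1 SG col (vertex_formula (decoding K d)) v \<longleftrightarrow> v \<in> pverts H" for v
  proof -
    have "sat1 SG col (vertex_formula (decoding K d)) v \<longleftrightarrow> (\<exists>\<alpha><K. v \<in> col (Suc \<alpha>))"
      by (auto simp: sat1_def decoding_def sat_disjs)
    also have "\<dots> \<longleftrightarrow> v \<in> pverts H"
    proof
      assume "v \<in> pverts H"
      then have "lab v < K \<and> v \<in> col (Suc (lab v))" using lab_less[of v] by (auto simp: col_def)
      then show "\<exists>\<alpha><K. v \<in> col (Suc \<alpha>)" by blast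
    qed (auto simp: col_def)
    finally show ?thesis .
  qed
  have ef: "sat2 SG col (edge_formula (decoding K d)) u v \<longleftrightarrow> lab u \<le> lab v \<and> (u, v) \<in> parcs H"
    if uv: "u \<in> pverts H" "v \<in> pverts H" "u \<noteq> v" for u v
  proof -
    let ?\<sigma> = "(\<lambda>_. v)(0 := u)"
    have "sat2 SG col (edge_formula (decoding K d)) u v \<longleftrightarrow>
      (\<exists>\<alpha> \<beta>. \<alpha> < K \<and> \<beta> < K \<and> \<alpha> \<le> \<beta> \<and> u \<in> col (Suc \<alpha>) \<and> v \<in> col (Suc \<beta>) \<and>
         sat SG col ?\<sigma> (same_hub (hub_colour K d \<alpha> \<beta>) (Suc d) (Suc d)))"
      by (auto simp: sat2_def decoding_def sat_disjs simp del: same_hub.simps)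
    also have "\<dots> \<longleftrightarrow> lab u \<le> lab v \<and> sat SG col ?\<sigma> (same_hub (hub_colour K d (lab u) (lab v)) (Suc d) (Suc d))"
    proof -
      have "w \<in> col (Suc \<alpha>) \<longleftrightarrow> lab w = \<alpha>" if "\<alpha> < K" "w \<in> pverts H" for w \<alpha>
        using that by (auto simp: col_def)
      then show ?thesis using lab_less[OF uv(1)] lab_less[OF uv(2)] uv(1,2) by blast
    qed
    also have "\<dots> \<longleftrightarrow> lab u \<le> lab v \<and> (u, v) \<in> parcs H"
    proof -
      have J: "(u, v) \<in> JJ (lab u) (lab v)" using uv by (simp add: JJ_iff)
      then show ?thesis
        using sat_same_hub[OF _ lab_less[OF uv(2)] J order_refl, of ?\<sigma>] alt_0_iff[OF J] by auto
    qed
    finally show ?thesis .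
  qed
  note Hf = Hg[unfolded pair_graph_iff]
  have arcs: "(u, v) \<in> parcs H \<longleftrightarrow> u \<in> pverts H \<and> v \<in> pverts H \<and> u \<noteq> v \<and>
      (sat2 SG col (edge_formula (decoding K d)) u v \<or> sat2 SG col (edge_formula (decoding K d)) v u)" for u v
  proof
    assume a: "(u, v) \<in> parcs H"
    then have "u \<in> pverts H" "v \<in> pverts H" "u \<noteq> v" "(v, u) \<in> parcs H"
      using Hf by (auto simp: irrefl_def dest: symD)
    then show "u \<in> pverts H \<and> v \<in> pverts H \<and> u \<noteq> v \<and>
      (sat2 SG col (edge_formula (decoding K d)) u v \<or> sat2 SG col (edge_formula (decoding K d)) v u)"
      using a ef[of u v] ef[of v u] by (metis linear)
  next
    assume "u \<in> pverts H \<and> v \<in> pverts H \<and> u \<noteq> v \<and>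
      (sat2 SG col (edge_formula (decoding K d)) u v \<or> sat2 SG col (edge_formula (decoding K d)) v u)"
    then show "(u, v) \<in> parcs H" using ef[of u v] ef[of v u] Hf by (auto dest: symD)
  qed
  have V: "{v \<in> pverts SG. sat1 SG col (vertex_formula (decoding K d)) v} = pverts H"
    using vf by (auto simp: SG_def)
  have "H = interpreted_graph (decoding K d) SG col"
    unfolding interpreted_graph_def V Let_def using arcs by (intro pair_pre_digraph.equality) auto
  moreover have "col i \<subseteq> pverts SG" for i by (auto simp: col_def SG_def)
  ultimately show ?thesis unfolding transduce_def by blast
qed

text \<open>A component of positive level branches at a forest node common to the chains of all its
  members; this node represents the added vertex in \<open>A\<close>. At level 0 no such node is
  available, and the added vertex is treated as an apex.\<close>

definition centre :: "'a \<Rightarrow> 'a" where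
  "centre g = (if g \<in> pverts H then g else case inv_into hubs h g of (\<alpha>, \<beta>, j, Q) \<Rightarrow>
     chains.node (ch \<alpha> \<beta>) \<rho> (lv \<alpha> \<beta> j Q) (SOME x. x \<in> Q))"

definition apices :: "'a set" where
  "apices = h ` {(\<alpha>, \<beta>, j, Q) \<in> hubs. lv \<alpha> \<beta> j Q = 0}"

text \<open>All meets within a component are at least as deep as its level, so the node at that
  depth is the same for every member.\<close>

lemma centre_hub:
  assumes q: "(\<alpha>, \<beta>, j, Q) \<in> hubs" "lv \<alpha> \<beta> j Q \<noteq> 0" and x: "x \<in> Q"
  shows "centre (h (\<alpha>, \<beta>, j, Q)) \<in> ch \<alpha> \<beta> x" "chains.idx (ch \<alpha> \<beta>) \<rho> x (centre (h (\<alpha>, \<beta>, j, Q))) = lv \<alpha> \<beta> j Q"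
proof -
  interpret chains "M \<alpha> \<beta>" "ch \<alpha> \<beta>" \<rho> d by (rule chains)
  interpret tl: tree_like "M \<alpha> \<beta>" lab \<alpha> \<beta> "mt \<alpha> \<beta>" "\<Phi> \<alpha> \<beta>" d by (rule tree_like)
  have Q: "Q \<in> tl.comps j" using q by (simp add: hubs_def)
  define y where "y = (SOME x. x \<in> Q)"
  have y: "y \<in> Q" unfolding y_def using x by (rule someI)
  have "h (\<alpha>, \<beta>, j, Q) \<notin> pverts H" using fresh q(1) by blast
  then have c: "centre (h (\<alpha>, \<beta>, j, Q)) = node (lv \<alpha> \<beta> j Q) y"
    using inj_h q(1) by (simp add: centre_def y_def)
  have M: "x \<in> M \<alpha> \<beta>" "y \<in> M \<alpha> \<beta>" using cp_M[OF Q] x y by blast+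
  have le: "lv \<alpha> \<beta> j Q \<le> meet y x" by (rule tl.comp_level_le[OF Q y x])
  have pos: "1 \<le> lv \<alpha> \<beta> j Q" using q(2) by simp
  show in_ch: "centre (h (\<alpha>, \<beta>, j, Q)) \<in> ch \<alpha> \<beta> x" unfolding c by (rule node_in[OF M(2,1) pos le])
  have cy: "lv \<alpha> \<beta> j Q \<le> card (ch \<alpha> \<beta> y)" using le meet_le_card[OF M(2)] le_trans by blast
  show "idx x (centre (h (\<alpha>, \<beta>, j, Q))) = lv \<alpha> \<beta> j Q"
    using idx_cong[OF M node_in[OF M(2,1) pos le] node(1)[OF M(2) pos cy]] node(2)[OF M(2) pos cy] c by simp
qed

text \<open>Components of level 0 all sit at the virtual node above the roots, where
  \<open>card_comps_node\<close> applies with \<open>i = 0\<close> and any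
  \<open>x0\<close>.\<close>

lemma card_apices: "card apices \<le> (2 * (d + 1)) ^ (d + 1) * (K * K * (d + 1))"
proof -
  have "card apices \<le> card {(\<alpha>, \<beta>, j, Q) \<in> hubs. lv \<alpha> \<beta> j Q = 0}"
    unfolding apices_def using finite_hubs by (intro card_image_le) (auto intro: finite_subset)
  also have "\<dots> = card {q \<in> hubs. case q of (\<alpha>, \<beta>, j, Q) \<Rightarrow> lv \<alpha> \<beta> j Q = 0}"
    by (rule arg_cong[where f = card]) auto
  also have "\<dots> \<le> (2 * (d + 1)) ^ (d + 1) * (K * K * (d + 1))"
  proof (rule card_hubs_le)
    fix \<alpha> \<beta> j :: nat assume j: "j \<le> d"
    interpret tl: tree_like "M \<alpha> \<beta>" lab \<alpha> \<beta> "mt \<alpha> \<beta>" "\<Phi> \<alpha> \<beta>" d by (rule tree_like)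
    show "card {Q \<in> cp \<alpha> \<beta> j. case (\<alpha>, \<beta>, j, Q) of (\<alpha>, \<beta>, j, Q) \<Rightarrow> lv \<alpha> \<beta> j Q = 0} \<le> (2 * (d + 1)) ^ (d + 1)"
    proof (cases "M \<alpha> \<beta> = {}")
      case True
      then have "cp \<alpha> \<beta> j = {}" using cp_M cp_nonempty by blast
      then show ?thesis by simp
    next
      case False
      then obtain x0 where "x0 \<in> M \<alpha> \<beta>" by blast
      then have "card {Q \<in> tl.comps j. tl.comp_level j Q = 0 \<and> (\<forall>y\<in>Q. 0 \<le> mt \<alpha> \<beta> x0 y)} \<le> (2 * (d + 1)) ^ (j + 1)"
        by (rule tl.card_comps_node)
      also have "\<dots> \<le> (2 * (d + 1)) ^ (d + 1)" using j by (intro power_increasing) auto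
      finally show ?thesis by simp
    qed
  qed
  finally show ?thesis .
qed

text \<open>For a fixed type, the components with centre \<open>u\<close> have the same level and
  all their members have \<open>u\<close> on their chains, so \<open>card_comps_node\<close> counts
  them at one node. The summand 1 stands for \<open>u\<close> itself as a vertex of
  \<open>H\<close>.\<close>

lemma card_centre_fibre:
  "card {g \<in> pverts SG - apices. centre g = u} \<le> 1 + (2 * (d + 1)) ^ (d + 1) * (K * K * (d + 1))"
proof -
  let ?p = "\<lambda>(\<alpha>, \<beta>, j, Q). lv \<alpha> \<beta> j Q \<noteq> 0 \<and> centre (h (\<alpha>, \<beta>, j, Q)) = u"
  have "{g \<in> pverts SG - apices. centre g = u} \<subseteq> insert u (h ` {q \<in> hubs. ?p q})"
  proof
    fix g assume g: "g \<in> {g \<in> pverts SG - apices. centre g = u}"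
    show "g \<in> insert u (h ` {q \<in> hubs. ?p q})"
    proof (cases "g \<in> pverts H")
      case True
      then show ?thesis using g by (simp add: centre_def)
    next
      case False
      then obtain q where q: "q \<in> hubs" "g = h q" using g by (auto simp: SG_def)
      then show ?thesis using g by (cases q) (auto simp: apices_def)
    qed
  qed
  then have "card {g \<in> pverts SG - apices. centre g = u} \<le> card (insert u (h ` {q \<in> hubs. ?p q}))"
    using finite_hubs by (intro card_mono) auto
  also have "\<dots> \<le> Suc (card (h ` {q \<in> hubs. ?p q}))" by (rule card_insert_le_m1) simp_all
  also have "card (h ` {q \<in> hubs. ?p q}) \<le> card {q \<in> hubs. ?p q}"
    using finite_hubs by (intro card_image_le) auto
  also have "\<dots> \<le> (2 * (d + 1)) ^ (d + 1) * (K * K * (d + 1))"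
  proof (rule card_hubs_le)
    fix \<alpha> \<beta> j :: nat assume ab: "\<alpha> \<le> \<beta>" "\<beta> < K" and j: "j \<le> d"
    interpret chains "M \<alpha> \<beta>" "ch \<alpha> \<beta>" \<rho> d by (rule chains)
    interpret tl: tree_like "M \<alpha> \<beta>" lab \<alpha> \<beta> "mt \<alpha> \<beta>" "\<Phi> \<alpha> \<beta>" d by (rule tree_like)
    let ?F = "{Q \<in> cp \<alpha> \<beta> j. ?p (\<alpha>, \<beta>, j, Q)}"
    have hub: "(\<alpha>, \<beta>, j, Q) \<in> hubs" if "Q \<in> cp \<alpha> \<beta> j" for Q using that ab j by (simp add: hubs_def)
    show "card ?F \<le> (2 * (d + 1)) ^ (d + 1)"
    proof (cases "?F = {}")
      case False
      then obtain Q0 where Q0: "Q0 \<in> ?F" by blast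
      then obtain x0 where x0: "x0 \<in> Q0" using cp_nonempty by blast
      have M0: "x0 \<in> M \<alpha> \<beta>" using Q0 x0 cp_M by blast
      have u0: "u \<in> ch \<alpha> \<beta> x0" "idx x0 u = lv \<alpha> \<beta> j Q0"
        using centre_hub[of \<alpha> \<beta> j Q0 x0] hub[of Q0] Q0 x0 by auto
      have "?F \<subseteq> {Q \<in> tl.comps j. tl.comp_level j Q = idx x0 u \<and> (\<forall>y\<in>Q. idx x0 u \<le> mt \<alpha> \<beta> x0 y)}"
      proof
        fix Q assume Q: "Q \<in> ?F"
        have Qc: "Q \<in> cp \<alpha> \<beta> j" using Q by blast
        have uy: "u \<in> ch \<alpha> \<beta> y" "idx y u = lv \<alpha> \<beta> j Q" "y \<in> M \<alpha> \<beta>" if "y \<in> Q" for y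
          using centre_hub[of \<alpha> \<beta> j Q y] hub[of Q] Q that subsetD[OF cp_M[OF Qc] that] by auto
        obtain y where y: "y \<in> Q" using Q cp_nonempty by blast
        have "lv \<alpha> \<beta> j Q = idx x0 u" using idx_cong[OF uy(3)[OF y] M0 uy(1)[OF y] u0(1)] uy(2)[OF y] by simp
        moreover have "idx x0 u \<le> meet x0 y" if "y \<in> Q" for y
          by (rule idx_le_meet[OF M0 uy(3)[OF that] u0(1) uy(1)[OF that]])
        ultimately show "Q \<in> {Q \<in> tl.comps j. tl.comp_level j Q = idx x0 u \<and> (\<forall>y\<in>Q. idx x0 u \<le> mt \<alpha> \<beta> x0 y)}"
          using Q by simp
      qed
      then have "card ?F \<le> card {Q \<in> tl.comps j. tl.comp_level j Q = idx x0 u \<and> (\<forall>y\<in>Q. idx x0 u \<le> mt \<alpha> \<beta> x0 y)}"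
        using finite_cp by (intro card_mono) auto
      also have "\<dots> \<le> (2 * (d + 1)) ^ (j + 1)" by (rule tl.card_comps_node[OF M0])
      also have "\<dots> \<le> (2 * (d + 1)) ^ (d + 1)" using j by (intro power_increasing) auto
      finally show ?thesis .
    qed (simp only: card.empty)
  qed
  finally show ?thesis by simp
qed

text \<open>An added vertex is adjacent only to members of its component. The chain of a member
  contains the centre, and some \<open>b\<close> has both the member and its chain among its
  hubs.\<close>

lemma clustered_SG:
  assumes "pair_graph A"
  shows "clustered n k (1 + (2 * (d + 1)) ^ (d + 1) * (K * K * (d + 1))) A SG"
proof -
  let ?T = "1 + (2 * (d + 1)) ^ (d + 1) * (K * K * (d + 1))" and ?W = "wreach (parcs A) \<rho> n"
  note tm' = tm[unfolded tree_model_def]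
  have AV: "parcs A \<subseteq> pverts A \<times> pverts A" using assms by (simp add: pair_graph_iff)
  have HA: "pverts H \<subseteq> pverts A" using tm' by blast
  have bot: "\<exists>b\<in>pverts A. x \<in> ?W b \<and> ch \<alpha> \<beta> x \<subseteq> ?W b" if "x \<in> M \<alpha> \<beta>" for x \<alpha> \<beta>
    using tm' that by blast
  have adj: "\<exists>b\<in>pverts A. centre x \<in> ?W b \<and> centre (h (\<alpha>, \<beta>, j, Q)) \<in> ?W b"
    if q: "(\<alpha>, \<beta>, j, Q) \<in> hubs" "h (\<alpha>, \<beta>, j, Q) \<notin> apices" "x \<in> Q" for x \<alpha> \<beta> j Q
  proof -
    have xM: "x \<in> M \<alpha> \<beta>" using cp_M[OF hubs_cp[OF q(1)]] q(3) by blast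
    then have "centre x = x" by (simp add: centre_def)
    moreover have "lv \<alpha> \<beta> j Q \<noteq> 0" using q(1,2) by (force simp: apices_def)
    then have "centre (h (\<alpha>, \<beta>, j, Q)) \<in> ch \<alpha> \<beta> x" using centre_hub(1)[OF q(1) _ q(3)] by blast
    ultimately show ?thesis using bot[OF xM] by auto
  qed
  have cA: "centre g \<in> pverts A" if g: "g \<in> pverts SG - apices" for g
  proof (cases "g \<in> pverts H")
    case True
    then show ?thesis using HA by (auto simp: centre_def)
  next
    case False
    then obtain \<alpha> \<beta> j Q where q: "(\<alpha>, \<beta>, j, Q) \<in> hubs" "g = h (\<alpha>, \<beta>, j, Q)" using g by (auto simp: SG_def)
    obtain x where "x \<in> Q" using cp_nonempty[OF hubs_cp[OF q(1)]] by blast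
    then obtain b where "b \<in> pverts A" "centre g \<in> ?W b" using adj[OF q(1)] q(2) g by blast
    then show ?thesis using wreach_subset[OF AV] by blast
  qed
  have edges: "\<exists>w\<in>pverts A. centre g \<in> ?W w \<and> centre g' \<in> ?W w"
    if gg: "(g, g') \<in> parcs SG" "g \<notin> apices" "g' \<notin> apices" for g g'
    using gg(1)
  proof (cases rule: SG_arc_cases)
    case (1 \<alpha> \<beta> j Q)
    then show ?thesis using adj[OF 1(1) _ 1(2)] gg(3) by simp
  next
    case (2 \<alpha> \<beta> j Q)
    then show ?thesis using adj[OF 2(1) _ 2(2)] gg(2) by blast
  qed
  show ?thesis
    unfolding clustered_def
  proof (rule exI[of _ \<rho>], rule exI[of _ centre], rule exI[of _ apices], intro conjI ballI)
    show "card (?W w) \<le> k" if "w \<in> pverts A" for w using tm' that by blast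
    show "apices \<subseteq> pverts SG" by (auto simp: apices_def SG_def)
    show "card apices \<le> ?T" using card_apices by simp
    show "centre ` (pverts SG - apices) \<subseteq> pverts A" using cA by blast
    show "card {g \<in> pverts SG - apices. centre g = u} \<le> ?T" for u by (rule card_centre_fibre)
    fix a assume "a \<in> parcs SG"
    then show "case a of (g, g') \<Rightarrow> g \<notin> apices \<longrightarrow> g' \<notin> apices \<longrightarrow>
        (\<exists>w\<in>pverts A. centre g \<in> ?W w \<and> centre g' \<in> ?W w)"
      using edges by (cases a) simp
  qed
qed

section \<open>Scattered sets in the encoding graph\<close>

definition members :: "'a \<Rightarrow> 'a set" where
  "members g = (if g \<in> pverts H then {g} else snd (snd (snd (inv_into hubs h g))))"

lemma members_hub: "q \<in> hubs \<Longrightarrow> members (h q) = snd (snd (snd q))"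
  using fresh inj_h by (auto simp: members_def)

definition pick :: "'a \<Rightarrow> 'a" where
  "pick g = (SOME x. x \<in> members g)"

lemma members_nonempty: "g \<in> pverts SG \<Longrightarrow> members g \<noteq> {} \<and> members g \<subseteq> pverts H"
proof -
  assume g: "g \<in> pverts SG"
  show ?thesis
  proof (cases "g \<in> pverts H")
    case False
    then obtain q where q: "q \<in> hubs" "g = h q" using g by (auto simp: SG_def)
    obtain \<alpha> \<beta> j Q where q': "q = (\<alpha>, \<beta>, j, Q)" by (metis prod_cases4)
    then have "Q \<in> cp \<alpha> \<beta> j" using q(1) by (simp add: hubs_def)
    then show ?thesis using cp_nonempty cp_H members_hub[OF q(1)] q(2) q' by auto
  qed (simp add: members_def)
qed

lemma pick_members: "g \<in> pverts SG \<Longrightarrow> pick g \<in> members g"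
  unfolding pick_def using members_nonempty by (meson ex_in_conv someI_ex)

lemma pick_H: "g \<in> pverts SG \<Longrightarrow> pick g \<in> pverts H"
  using pick_members members_nonempty by blast

text \<open>Besides \<open>x\<close>, only vertices added for components containing \<open>x\<close>
  can be mapped to \<open>x\<close>; components of one round are disjoint, so there is at most one
  per type.\<close>

lemma card_pick_fibre: "card {g \<in> pverts SG. pick g = x} \<le> 1 + K * K * (d + 1)"
proof -
  let ?p = "\<lambda>(\<alpha>, \<beta>, j, Q). x \<in> Q"
  have "{g \<in> pverts SG. pick g = x} \<subseteq> insert x (h ` {q \<in> hubs. ?p q})"
  proof
    fix g assume g: "g \<in> {g \<in> pverts SG. pick g = x}"
    then have xm: "x \<in> members g" using pick_members by blast
    show "g \<in> insert x (h ` {q \<in> hubs. ?p q})"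
    proof (cases "g \<in> pverts H")
      case True
      then show ?thesis using xm by (simp add: members_def)
    next
      case False
      then obtain q where q: "q \<in> hubs" "g = h q" using g by (auto simp: SG_def)
      then show ?thesis using xm members_hub[OF q(1)] by (cases q) auto
    qed
  qed
  then have "card {g \<in> pverts SG. pick g = x} \<le> card (insert x (h ` {q \<in> hubs. ?p q}))"
    using finite_hubs by (intro card_mono) auto
  also have "\<dots> \<le> Suc (card (h ` {q \<in> hubs. ?p q}))" by (rule card_insert_le_m1) simp_all
  also have "card (h ` {q \<in> hubs. ?p q}) \<le> card {q \<in> hubs. ?p q}"
    using finite_hubs by (intro card_image_le) auto
  also have "\<dots> \<le> 1 * (K * K * (d + 1))"
  proof (rule card_hubs_le)
    fix \<alpha> \<beta> j :: nat
    define X where "X = {Q \<in> cp \<alpha> \<beta> j. x \<in> Q}"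
    have "Q = Q'" if "Q \<in> X" "Q' \<in> X" for Q Q'
    proof -
      have "Q \<in> cp \<alpha> \<beta> j" "Q' \<in> cp \<alpha> \<beta> j" "x \<in> Q" "x \<in> Q'" using that by (auto simp: X_def)
      then show ?thesis by (rule tree_like.comps_disjoint[OF tree_like])
    qed
    then have "card X \<le> 1" by (simp add: card_le_Suc0_iff_eq X_def finite_cp)
    then show "card {Q \<in> cp \<alpha> \<beta> j. ?p (\<alpha>, \<beta>, j, Q)} \<le> 1" by (simp add: X_def)
  qed
  finally show ?thesis by simp
qed

text \<open>Vertices are classified by their label and the sides of the flips on which they lie,
  which gives at most \<open>p\<close> classes and makes flipping a matter of classes, as
  \<open>ex_special_comps\<close> requires. \<open>S\<close> consists of the vertices added for
  exceptional components; any other component has diameter at most 15 in the flipped graph.\<close>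

lemma ex_separator:
  assumes F: "\<F> \<subseteq> Pow (pverts H) \<times> Pow (pverts H)" "card \<F> \<le> s"
    and p: "p = K * (2 ^ s * 2 ^ s)"
  shows "\<exists>S\<subseteq>pverts SG. card S \<le> (2 * p\<^sup>2 + 1) ^ (d + 1) * (K * K * (d + 1)) \<and>
    (\<forall>r. \<forall>g\<in>pverts SG - S. \<forall>g'\<in>pverts SG - S. (g, g') \<in> near (restr (parcs SG) (pverts SG - S)) r \<longrightarrow>
       (pick g, pick g') \<in> near (parcs (flips \<F> H)) (15 * (r + 1)))"
proof -
  have finF: "finite \<F>" using F(1) finite_H finite_subset by (metis finite_Pow_iff finite_SigmaI)
  let ?D = "parcs (flips \<F> H)"
  have symD: "sym ?D" by (rule flips_wf(2)[OF finF Hg F(1)])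
  have irr: "irrefl (parcs H)" using Hg by (simp add: pair_graph_iff)
  define P where "P = {..<K} \<times> Pow \<F> \<times> Pow \<F>"
  define cl where "cl x = (lab x, {F \<in> \<F>. x \<in> fst F}, {F \<in> \<F>. x \<in> snd F})" for x
  define fl :: "nat \<times> ('a set \<times> 'a set) set \<times> ('a set \<times> 'a set) set \<Rightarrow> nat \<times> ('a set \<times> 'a set) set \<times> ('a set \<times> 'a set) set \<Rightarrow> bool"
    where "fl a b \<longleftrightarrow> odd (card (fst (snd a) \<inter> snd (snd b) \<union> snd (snd a) \<inter> fst (snd b)))" for a b
  have finP: "finite P" using finF by (simp add: P_def)
  have cardP: "card P \<le> p"
  proof -
    have "card P = K * (2 ^ card \<F> * 2 ^ card \<F>)"
      using finF by (simp add: P_def card_cartesian_product card_Pow)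
    also have "\<dots> \<le> K * (2 ^ s * 2 ^ s)" using F(2) by (intro mult_le_mono order_refl power_increasing) auto
    finally show ?thesis by (simp add: p)
  qed
  have fl_iff: "fl (cl x) (cl y) \<longleftrightarrow> odd (card {F \<in> \<F>. hits F x y})" for x y
  proof -
    have "fst (snd (cl x)) \<inter> snd (snd (cl y)) \<union> snd (snd (cl x)) \<inter> fst (snd (cl y)) = {F \<in> \<F>. hits F x y}"
      by (auto simp: cl_def hits_def)
    then show ?thesis by (simp add: fl_def)
  qed
  define special where "special \<alpha> \<beta> j Sp \<longleftrightarrow> Sp \<subseteq> cp \<alpha> \<beta> j \<and> card Sp \<le> (2 * p\<^sup>2) ^ (j + 1) \<and>
      (\<forall>Q\<in>cp \<alpha> \<beta> j - Sp. \<forall>x\<in>Q. \<forall>y\<in>Q. (x, y) \<in> near ?D 15)" for \<alpha> \<beta> j Sp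
  define Sp where "Sp \<alpha> \<beta> j = (SOME X. special \<alpha> \<beta> j X)" for \<alpha> \<beta> j
  have "\<exists>X. special \<alpha> \<beta> j X" for \<alpha> \<beta> j
    unfolding special_def
  proof (rule tree_like.ex_special_comps[OF tree_like _ finP cardP _ _ symD, where cl = cl and fl = fl])
    show "cl x \<in> P" if "x \<in> M \<alpha> \<beta>" for x using that lab_less by (auto simp: cl_def P_def)
    show "lab x = lab y" if "cl x = cl y" for x y using that by (simp add: cl_def)
    show "(x, y) \<in> ?D \<longleftrightarrow> ((x, y) \<in> al \<alpha> \<beta> 0 \<longleftrightarrow> \<not> fl (cl x) (cl y))" if J: "(x, y) \<in> JJ \<alpha> \<beta>" for x y
      using parcs_flips[OF finF irr, of x y] J alt_0_iff[OF J] JJ_iff[of x y \<alpha> \<beta>] fl_iff[of x y] by auto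
  qed
  then have "special \<alpha> \<beta> j (Sp \<alpha> \<beta> j)" for \<alpha> \<beta> j unfolding Sp_def by (rule someI_ex)
  then have Sp: "\<And>\<alpha> \<beta> j. Sp \<alpha> \<beta> j \<subseteq> cp \<alpha> \<beta> j" "\<And>\<alpha> \<beta> j. card (Sp \<alpha> \<beta> j) \<le> (2 * p\<^sup>2) ^ (j + 1)"
    "\<And>\<alpha> \<beta> j Q x y. Q \<in> cp \<alpha> \<beta> j - Sp \<alpha> \<beta> j \<Longrightarrow> x \<in> Q \<Longrightarrow> y \<in> Q \<Longrightarrow> (x, y) \<in> near ?D 15"
    unfolding special_def by blast+
  let ?special = "\<lambda>(\<alpha>, \<beta>, j, Q). Q \<in> Sp \<alpha> \<beta> j"
  define S where "S = h ` {q \<in> hubs. ?special q}"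
  have SV: "S \<subseteq> pverts SG" by (auto simp: S_def SG_def)
  have "card S \<le> card {q \<in> hubs. ?special q}" unfolding S_def using finite_hubs by (intro card_image_le) auto
  also have "\<dots> \<le> (2 * p\<^sup>2 + 1) ^ (d + 1) * (K * K * (d + 1))"
  proof (rule card_hubs_le)
    fix \<alpha> \<beta> j :: nat assume j: "j \<le> d"
    have "{Q \<in> cp \<alpha> \<beta> j. ?special (\<alpha>, \<beta>, j, Q)} = Sp \<alpha> \<beta> j" using Sp(1)[of \<alpha> \<beta> j] by auto
    then have "card {Q \<in> cp \<alpha> \<beta> j. ?special (\<alpha>, \<beta>, j, Q)} \<le> (2 * p\<^sup>2) ^ (j + 1)" using Sp(2)[of \<alpha> \<beta> j] by simp
    \<comment> \<open>Adding 1 keeps the base positive, so that the exponent can be raised even for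
      \<open>p = 0\<close>.\<close>
    also have "\<dots> \<le> (2 * p\<^sup>2 + 1) ^ (j + 1)" by (intro power_mono) auto
    also have "\<dots> \<le> (2 * p\<^sup>2 + 1) ^ (d + 1)" using j by (intro power_increasing) auto
    finally show "card {Q \<in> cp \<alpha> \<beta> j. ?special (\<alpha>, \<beta>, j, Q)} \<le> (2 * p\<^sup>2 + 1) ^ (d + 1)" .
  qed
  finally have cardS: "card S \<le> (2 * p\<^sup>2 + 1) ^ (d + 1) * (K * K * (d + 1))" .
  have hub: "(x, y) \<in> near ?D 15" if q: "(\<alpha>, \<beta>, j, Q) \<in> hubs" "h (\<alpha>, \<beta>, j, Q) \<notin> S" "x \<in> Q" "y \<in> Q" for \<alpha> \<beta> j Q x y
  proof -
    have "Q \<notin> Sp \<alpha> \<beta> j" using q(1,2) by (auto simp: S_def)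
    then show ?thesis using Sp(3)[of Q \<alpha> \<beta> j x y] hubs_cp[OF q(1)] q(3,4) by blast
  qed
  let ?R = "restr (parcs SG) (pverts SG - S)"
  have same: "(x, y) \<in> near ?D 15" if g: "g \<in> pverts SG - S" "x \<in> members g" "y \<in> members g" for g x y
  proof (cases "g \<in> pverts H")
    case True
    then show ?thesis using g by (simp add: members_def)
  next
    case False
    then obtain q where q: "q \<in> hubs" "g = h q" using g(1) by (auto simp: SG_def)
    obtain \<alpha> \<beta> j Q where q': "q = (\<alpha>, \<beta>, j, Q)" by (metis prod_cases4)
    then show ?thesis using hub[of \<alpha> \<beta> j Q x y] q g members_hub[OF q(1)] by simp
  qed
  have step: "(x, y) \<in> near ?D 15" if g: "(g, g') \<in> ?R" "x \<in> members g" "y \<in> members g'" for g g' x y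
  proof -
    have a: "(g, g') \<in> parcs SG" "g \<notin> S" "g' \<notin> S" using g(1) by auto
    from a(1) show ?thesis
    proof (cases rule: SG_arc_cases)
      case (1 \<alpha> \<beta> j Q)
      then have "g \<in> pverts H" using hubs_H by blast
      then have "x \<in> Q" using g(2) 1(2) by (simp add: members_def)
      moreover have "y \<in> Q" using g(3) 1(3) members_hub[OF 1(1)] by simp
      ultimately show ?thesis using hub[OF 1(1)] a(3) 1(3) by blast
    next
      case (2 \<alpha> \<beta> j Q)
      then have "g' \<in> pverts H" using hubs_H by blast
      then have "y \<in> Q" using g(3) 2(2) by (simp add: members_def)
      moreover have "x \<in> Q" using g(2) 2(3) members_hub[OF 2(1)] by simp
      ultimately show ?thesis using hub[OF 2(1)] a(2) 2(3) by blast
    qed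
  qed
  \<comment> \<open>Each of the \<open>r\<close> steps costs 15, and a further 15 pays for moving
    among the members of the starting vertex.\<close>
  have walk: "(x, y) \<in> near ?D (15 * (r + 1))"
    if "(g, g') \<in> near ?R r" "g \<in> pverts SG - S" "x \<in> members g" "y \<in> members g'" for r g g' x y
    using that
  proof (induction r arbitrary: g' y)
    case 0
    then show ?case using same by simp
  next
    case (Suc r)
    show ?case
    proof (cases "g = g'")
      case True
      then have "(x, y) \<in> near ?D 15" using same Suc.prems by blast
      then show ?thesis by (rule near_mono) auto
    next
      case False
      then obtain z where z: "(g, z) \<in> near ?R r" "(z, g') \<in> ?R" using Suc.prems(1) by (auto simp: near_Suc_iff2)
      have "z \<in> pverts SG" using z(2) by auto
      then have "pick z \<in> members z" by (rule pick_members)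
      then have "(x, pick z) \<in> near ?D (15 * (r + 1))" "(pick z, y) \<in> near ?D 15"
        using Suc.IH[OF z(1) Suc.prems(2,3)] step[OF z(2) _ Suc.prems(4)] by blast+
      then have "(x, y) \<in> near ?D (15 * (r + 1) + 15)" by (rule near_trans)
      then show ?thesis by (simp add: algebra_simps)
    qed
  qed
  have "\<forall>r. \<forall>g\<in>pverts SG - S. \<forall>g'\<in>pverts SG - S. (g, g') \<in> near ?R r \<longrightarrow>
       (pick g, pick g') \<in> near ?D (15 * (r + 1))"
    using walk pick_members by simp
  then show ?thesis using SV cardS by blast
qed

end

lemma (in sparsify) ex_fresh:
  assumes "infinite (UNIV :: 'a set)"
  shows "\<exists>h'. sparsify_fresh n k d K A \<rho> H lab ch \<Phi> h'"
proof -
  have "infinite (UNIV - pverts H)" using assms finite_H by simp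
  then obtain B where B: "B \<subseteq> UNIV - pverts H" "finite B" "card B = card hubs"
    by (meson infinite_arbitrarily_large)
  then obtain f where "bij_betw f hubs B" using finite_hubs by (metis bij_betw_iff_card)
  then have "inj_on f hubs" "f ` hubs \<inter> pverts H = {}" using B(1) by (auto simp: bij_betw_def)
  moreover have "sparsify n k d K A \<rho> H lab ch \<Phi>" by unfold_locales
  ultimately show ?thesis by (intro exI[of _ f]) (simp add: sparsify_fresh_def sparsify_fresh_axioms_def)
qed

text \<open>The separator bound \<open>b s\<close> depends on the number of flips but not on the
  radius, as almost-wideness demands. Sets of \<open>\<D>\<close> are moved to \<open>\<C>\<close>
  by \<open>pk\<close>, scattered there at range \<open>15 * (r + 1)\<close>, and pulled
  back.\<close>

theorem ex_wide_class:
  fixes \<C> :: "'a::infinite pair_pre_digraph set"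
  assumes gc: "graph_class \<C>" and sbe: "structurally_bounded_expansion \<C>" and flat: "strongly_flip_flat \<C>"
  shows "\<exists>(\<D> :: 'a pair_pre_digraph set) \<tau>.
       graph_class \<D> \<and> bounded_expansion \<D> \<and> uniformly_almost_wide \<D> \<and>
       is_transduction \<tau> \<and> \<C> \<subseteq> transduce_class \<tau> \<D>"
proof -
  obtain n k d K and \<A> :: "'a pair_pre_digraph set" where \<A>: "bounded_expansion \<A>" "graph_class \<A>"
    and tm: "\<forall>H\<in>\<C>. \<exists>A\<in>\<A>. \<exists>\<rho> lab ch \<Phi>. tree_model n k d K A \<rho> H lab ch \<Phi>"
    using ex_tree_models[OF sbe] by (elim exE conjE) (rule that)
  define T where "T = 1 + (2 * (d + 1)) ^ (d + 1) * (K * K * (d + 1))"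
  define b where "b s = (2 * (K * (2 ^ s * 2 ^ s))\<^sup>2 + 1) ^ (d + 1) * (K * K * (d + 1))" for s :: nat
  \<comment> \<open>Everything that is needed of the construction once tree model and placement are
    forgotten, so that one graph and one map can be chosen for each \<open>H\<close>.\<close>
  define good where "good H G' pk \<longleftrightarrow> pair_graph G' \<and> (\<exists>A\<in>\<A>. clustered n k T A G') \<and> H \<in> transduce (decoding K d) G' \<and>
      (\<forall>g\<in>pverts G'. pk g \<in> pverts H) \<and> (\<forall>x. card {g \<in> pverts G'. pk g = x} \<le> 1 + K * K * (d + 1)) \<and>
      (\<forall>s \<F>. \<F> \<subseteq> Pow (pverts H) \<times> Pow (pverts H) \<longrightarrow> card \<F> \<le> s \<longrightarrow>
        (\<exists>S\<subseteq>pverts G'. card S \<le> b s \<and>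
          (\<forall>r. \<forall>g\<in>pverts G' - S. \<forall>g'\<in>pverts G' - S. (g, g') \<in> near (restr (parcs G') (pverts G' - S)) r \<longrightarrow>
             (pk g, pk g') \<in> near (parcs (flips \<F> H)) (15 * (r + 1)))))" for H G' :: "'a pair_pre_digraph" and pk
  have "\<exists>G' pk. good H G' pk" if H: "H \<in> \<C>" for H
  proof -
    obtain A \<rho> lab ch \<Phi> where A: "A \<in> \<A>" "tree_model n k d K A \<rho> H lab ch \<Phi>" using tm H by blast
    have Hg: "pair_graph H" and Ag: "pair_graph A" using gc \<A>(2) H A(1) by (auto simp: graph_class_def)
    interpret sparsify n k d K A \<rho> H lab ch \<Phi> by (rule sparsify.intro[OF A(2) Hg])
    obtain h where "sparsify_fresh n k d K A \<rho> H lab ch \<Phi> h" using ex_fresh[OF infinite_UNIV] by blast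
    then interpret sf: sparsify_fresh n k d K A \<rho> H lab ch \<Phi> h .
    have "good H (sf.SG) sf.pick"
      unfolding good_def T_def b_def
    proof (intro conjI ballI allI impI)
      show "pair_graph sf.SG" by (rule sf.pair_graph_SG)
      show "\<exists>A\<in>\<A>. clustered n k (1 + (2 * (d + 1)) ^ (d + 1) * (K * K * (d + 1))) A sf.SG"
        by (rule bexI[OF _ A(1)]) (rule sf.clustered_SG[OF Ag])
      show "H \<in> transduce (decoding K d) sf.SG" by (rule sf.H_transduced)
      show "sf.pick g \<in> pverts H" if "g \<in> pverts sf.SG" for g by (rule sf.pick_H[OF that])
      show "card {g \<in> pverts sf.SG. sf.pick g = x} \<le> 1 + K * K * (d + 1)" for x by (rule sf.card_pick_fibre)
    qed (rule sf.ex_separator[OF _ _ refl])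
    then show ?thesis by blast
  qed
  then obtain GG pk where GG: "\<And>H. H \<in> \<C> \<Longrightarrow> good H (GG H) (pk H)" by metis
  define \<D> where "\<D> = GG ` \<C>"
  have gcD: "graph_class \<D>" using GG by (auto simp: graph_class_def \<D>_def good_def)
  have beD: "bounded_expansion \<D>"
    by (rule clustered_bounded_expansion[OF \<A> gcD, where n = n and k = k and T = T])
      (use GG in \<open>auto simp: \<D>_def good_def\<close>)
  have CD: "\<C> \<subseteq> transduce_class (decoding K d) \<D>"
    using GG by (auto simp: transduce_class_def \<D>_def good_def)
  have "uniformly_almost_wide \<D>"
  proof -
    obtain s where s: "\<forall>r. \<exists>N :: nat \<Rightarrow> nat. \<forall>m. \<forall>G\<in>\<C>. \<forall>A \<subseteq> pverts G. N m \<le> card A \<longrightarrow>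
        (\<exists>\<F> B. \<F> \<subseteq> Pow (pverts G) \<times> Pow (pverts G) \<and> card \<F> \<le> s \<and>
           B \<subseteq> A \<and> m \<le> card B \<and> r_independent r (with_proj (flips \<F> G)) B)"
      using flat unfolding strongly_flip_flat_def by (rule exE)
    define c where "c = 1 + K * K * (d + 1)"
    show ?thesis
      unfolding uniformly_almost_wide_def
    proof (rule exI[of _ "b s"], rule allI)
      fix r
      obtain N :: "nat \<Rightarrow> nat" where N: "\<forall>m. \<forall>G\<in>\<C>. \<forall>A \<subseteq> pverts G. N m \<le> card A \<longrightarrow>
        (\<exists>\<F> B. \<F> \<subseteq> Pow (pverts G) \<times> Pow (pverts G) \<and> card \<F> \<le> s \<and>
           B \<subseteq> A \<and> m \<le> card B \<and> r_independent (15 * (r + 1)) (with_proj (flips \<F> G)) B)"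
        using s[rule_format, of "15 * (r + 1)"] by (rule exE)
      have main: "\<exists>S B. S \<subseteq> pverts G \<and> card S \<le> b s \<and> B \<subseteq> A - S \<and> m < card B \<and>
           r_independent r (with_proj G \<restriction> (pverts G - S)) B"
        if G: "G \<in> \<D>" and A: "A \<subseteq> pverts G" "c * N (m + 1 + b s) \<le> card A" for m G A
      proof -
        obtain H where H: "H \<in> \<C>" "G = GG H" using G by (auto simp: \<D>_def)
        define \<pi> where "\<pi> = pk H"
        have gd: "good H G \<pi>" using GG[OF H(1)] H(2) by (simp add: \<pi>_def)
        have Gg: "pair_graph G" using gd by (simp add: good_def)
        have Hg: "pair_graph H" using gc H(1) by (simp add: graph_class_def)
        have \<pi>H: "\<pi> g \<in> pverts H" if "g \<in> pverts G" for g using gd that by (simp add: good_def)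
        have fib: "card {g \<in> pverts G. \<pi> g = x} \<le> c" for x using gd by (simp add: good_def c_def)
        have finG: "finite (pverts G)" and finH: "finite (pverts H)" using Gg Hg by (auto simp: pair_graph_iff)
        have finA: "finite A" using A(1) finG finite_subset by blast
        have "card A \<le> c * card (\<pi> ` A)"
        proof (rule card_le_if_fibres_le[where f = \<pi>])
          fix x
          have "{a \<in> A. \<pi> a = x} \<subseteq> {g \<in> pverts G. \<pi> g = x}" using A(1) by blast
          then have "card {a \<in> A. \<pi> a = x} \<le> card {g \<in> pverts G. \<pi> g = x}" using finG by (intro card_mono) auto
          then show "card {a \<in> A. \<pi> a = x} \<le> c" using fib[of x] by simp
        qed (use finA in auto)
        then have "c * N (m + 1 + b s) \<le> c * card (\<pi> ` A)" using A(2) by linarith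
        then have large: "N (m + 1 + b s) \<le> card (\<pi> ` A)" unfolding mult_le_cancel1 by (simp add: c_def)
        have "\<pi> ` A \<subseteq> pverts H" using \<pi>H A(1) by blast
        from N[rule_format, OF H(1) this large] obtain \<F> B0 where F: "\<F> \<subseteq> Pow (pverts H) \<times> Pow (pverts H)" "card \<F> \<le> s"
          and B0: "B0 \<subseteq> \<pi> ` A" "m + 1 + b s \<le> card B0"
          and ind: "r_independent (15 * (r + 1)) (with_proj (flips \<F> H)) B0"
          by (elim exE conjE) (rule that)
        have finF: "finite \<F>" using F(1) finH by (meson finite_Pow_iff finite_SigmaI finite_subset)
        obtain S where S: "S \<subseteq> pverts G" "card S \<le> b s"
          and far: "\<And>g g'. g \<in> pverts G - S \<Longrightarrow> g' \<in> pverts G - S \<Longrightarrow>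
            (g, g') \<in> near (restr (parcs G) (pverts G - S)) r \<Longrightarrow> (\<pi> g, \<pi> g') \<in> near (parcs (flips \<F> H)) (15 * (r + 1))"
          using gd F unfolding good_def by meson
        define f where "f = inv_into A \<pi>"
        have f: "f x \<in> A" "\<pi> (f x) = x" if "x \<in> B0" for x
          using inv_into_into[of x \<pi> A] f_inv_into_f[of x \<pi> A] B0(1) that by (auto simp: f_def)
        define B where "B = f ` B0 - S"
        have finS: "finite S" using S(1) finG finite_subset by blast
        have "inj_on f B0" using f(2) by (metis inj_onI)
        then have "card (f ` B0) = card B0" by (rule card_image)
        then have "card B0 - card S \<le> card B" unfolding B_def using diff_card_le_card_Diff[OF finS, of "f ` B0"] by simp
        then have cB: "m < card B" using B0(2) S(2) by linarith
        have BA: "B \<subseteq> A - S" using f(1) by (auto simp: B_def)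
        have wfl: "parcs (flips \<F> H) \<subseteq> pverts (flips \<F> H) \<times> pverts (flips \<F> H)"
          by (rule flips_wf(1)[OF finF Hg F(1)])
        have "r_independent r (with_proj \<lparr>pverts = pverts G - S, parcs = restr (parcs G) (pverts G - S)\<rparr>) B"
        proof (subst r_independent_iff)
          show "B \<subseteq> pverts \<lparr>pverts = pverts G - S, parcs = restr (parcs G) (pverts G - S)\<rparr> \<and>
            (\<forall>u\<in>B. \<forall>v\<in>B. u \<noteq> v \<longrightarrow> (u, v) \<notin> near (parcs \<lparr>pverts = pverts G - S, parcs = restr (parcs G) (pverts G - S)\<rparr>) r)"
          proof (intro conjI ballI impI notI)
            show "B \<subseteq> pverts \<lparr>pverts = pverts G - S, parcs = restr (parcs G) (pverts G - S)\<rparr>"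
              using BA A(1) by auto
            fix u v assume uv: "u \<in> B" "v \<in> B" "u \<noteq> v"
              "(u, v) \<in> near (parcs \<lparr>pverts = pverts G - S, parcs = restr (parcs G) (pverts G - S)\<rparr>) r"
            obtain x y where xy: "x \<in> B0" "u = f x" "y \<in> B0" "v = f y" using uv(1,2) by (auto simp: B_def)
            have "(\<pi> u, \<pi> v) \<in> near (parcs (flips \<F> H)) (15 * (r + 1))"
              using far[of u v] uv BA A(1) by auto
            then have "(x, y) \<in> near (parcs (flips \<F> H)) (15 * (r + 1))" using f(2) xy by simp
            moreover have "x \<noteq> y" using uv(3) xy by blast
            ultimately show False using ind xy unfolding r_independent_iff[OF wfl] by blast
          qed
        qed auto
        then have "r_independent r (with_proj G \<restriction> (pverts G - S)) B" unfolding induce_subgraph_with_proj .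
        then show ?thesis using S BA cB by blast
      qed
      show "\<exists>N :: nat \<Rightarrow> nat. \<forall>m. \<forall>G\<in>\<D>. \<forall>A \<subseteq> pverts G. N m \<le> card A \<longrightarrow>
        (\<exists>S B. S \<subseteq> pverts G \<and> card S \<le> b s \<and> B \<subseteq> A - S \<and> m < card B \<and>
           r_independent r (with_proj G \<restriction> (pverts G - S)) B)"
        \<comment> \<open>The factor \<open>c\<close> makes up for the fibres of the map to
          \<open>H\<close>; up to \<open>b s\<close> elements may be lost to \<open>S\<close>, and 1
          makes the final inequality strict.\<close>
        by (rule exI[of _ "\<lambda>m. c * N (m + 1 + b s)"]) (use main in blast)
    qed
  qed
  then show ?thesis using gcD beD CD is_transduction_decoding by blast
qed

theorem mainTheorem4:
  fixes \<C> :: "'a::infinite pair_pre_digraph set"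
  assumes "graph_class \<C>"
    and "structurally_bounded_expansion \<C>"
  shows "strongly_flip_flat \<C> \<longleftrightarrow>
    (\<exists>(\<D> :: 'a pair_pre_digraph set) \<tau>.
       graph_class \<D> \<and> bounded_expansion \<D> \<and> uniformly_almost_wide \<D> \<and>
       is_transduction \<tau> \<and> \<C> \<subseteq> transduce_class \<tau> \<D>)"
  using ex_wide_class[OF assms] strongly_flip_flat_if_wide[OF _ _ _ _ _ assms(1)] by blast

end
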